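(* Let $\eta>0$ and let $n\ge 1$ be an integer. Consider the piecewise polynomial system $$(\dot x,\dot y)=\big(y-2x^2-\eta+\varepsilon f^k(x,y),\ -2xy+\varepsilon g^k(x,y)\big)\quad\text{on } Q_k,\qquad k=1,2,3,4,\quad 0<|\varepsilon|\ll 1,$$ where $Q_1=\{x>0,y>\eta\}$, $Q_2=\{x>0,y<\eta\}$, $Q_3=\{x<0,y<\eta\}$, $Q_4=\{x<0,y>\eta\}$, and $f^k,g^k$ ($k=1,2,3,4$) are real polynomials in $(x,y)$ of degree at most $n$ for which the first order Melnikov function $M$ is not identically zero on $(-\frac1{2\eta},0)$. If $f^1=f^4$, $g^1=g^4$, $f^2=f^3$ and $g^2=g^3$, then the number of limit cycles of this system bifurcating from the period annulus $\{L_h: h\in(-\frac1{2\eta},0)\}$ around the center $(0,\eta)$ of the unperturbed system is not more than $9n-6$ (counting multiplicity).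
   Context: For $\varepsilon=0$ the system is $\dot x=y-2x^2-\eta$, $\dot y=-2xy$. It has the first integral $H(x,y)=y^{-2}\big(x^2-y+\frac{\eta}{2}\big)$ with integrating factor $y^{-3}$, and the unique center $(0,\eta)$ (called a global center), surrounded by the period annulus of clockwise periodic orbits $L_h=\{H(x,y)=h\}$ (in the region $y>0$), $h\in\Sigma=(-\frac1{2\eta},0)$. The orbit $L_h$ tends to the center as $h\to-\frac1{2\eta}$ and to the invariant curve $x^2-y+\frac\eta2=0$ as $h\to0$. Write $L^k_h=L_h\cap Q_k$, oriented clockwise. The first order Melnikov function of the perturbed system is $$M(h)=\sum_{k=1}^4\int_{L_h^k}y^{-3}\big[g^k(x,y)\,dx-f^k(x,y)\,dy\big],\qquad h\in\Sigma.$$ "The number of limit cycles bifurcating from the period annulus is not more than $N$ (counting multiplicity)" is used in the usual first-order Melnikov sense: for every compact $K\subset\Sigma$ there is $\varepsilon_0>0$ such that for all $0<|\varepsilon|<\varepsilon_0$ the perturbed system has at most $N$ limit cycles, counted with multiplicity (as zeros of the displacement map), that are close to the periodic orbits $L_h$, $h\in K$, i.e. that meet the section $\{x=0,\ y>\eta\}$ at a point where $H$ takes a value in $K$. Under the hypothesis of the theorem the only switching line is $y=\eta$. *)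

theory Defs
  imports "HOL-Analysis.Analysis" "HOL-Library.Extended_Nat"
begin

type_synonym plane = "real \<times> real"

definition bivariate_poly_le :: "nat \<Rightarrow> (plane \<Rightarrow> real) \<Rightarrow> bool" where
  "bivariate_poly_le n f \<longleftrightarrow>
     (\<exists>c :: nat \<Rightarrow> nat \<Rightarrow> real. \<forall>x y. f (x, y) = (\<Sum>i\<le>n. \<Sum>j\<le>n - i. c i j * x ^ i * y ^ j))"

definition Q :: "real \<Rightarrow> nat \<Rightarrow> plane set" where
  "Q \<eta> k =
     (if k = 1 then {(x, y). x > 0 \<and> y > \<eta>}
      else if k = 2 then {(x, y). x > 0 \<and> y < \<eta>}
      else if k = 3 then {(x, y). x < 0 \<and> y < \<eta>}
      else if k = 4 then {(x, y). x < 0 \<and> y > \<eta>}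
      else {})"

definition perturbed_field ::
  "real \<Rightarrow> (nat \<Rightarrow> plane \<Rightarrow> real) \<Rightarrow> (nat \<Rightarrow> plane \<Rightarrow> real) \<Rightarrow> real \<Rightarrow> nat \<Rightarrow> plane \<Rightarrow> plane" where
  "perturbed_field \<eta> f g \<epsilon> k = (\<lambda>(x, y).
     (y - 2 * x\<^sup>2 - \<eta> + \<epsilon> * f k (x, y), - 2 * x * y + \<epsilon> * g k (x, y)))"

(* Filippov's convention: on Q k the set below is the singleton given by the k-th field; on the
   boundary lines it is the convex hull of the one-sided limits.  If the fields on both sides of a
   line agree, then it is again a singleton there, and the line is not a switching line. *)
definition filippov_set :: "real \<Rightarrow> (nat \<Rightarrow> plane \<Rightarrow> plane) \<Rightarrow> plane \<Rightarrow> plane set" where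
  "filippov_set \<eta> X p = convex hull {X k p | k. k \<in> {1..4} \<and> p \<in> closure (Q \<eta> k)}"

(* The finite exceptional set accommodates the corners of an orbit at its switching times. *)
definition solution_on :: "real \<Rightarrow> (nat \<Rightarrow> plane \<Rightarrow> plane) \<Rightarrow> real \<Rightarrow> (real \<Rightarrow> plane) \<Rightarrow> bool" where
  "solution_on \<eta> X T \<gamma> \<longleftrightarrow>
     continuous_on {0..T} \<gamma> \<and>
     (\<exists>S. finite S \<and> (\<forall>t\<in>{0..T} - S. \<exists>v\<in>filippov_set \<eta> X (\<gamma> t).
        (\<gamma> has_vector_derivative v) (at t within {0..T})))"

definition closed_orbit :: "real \<Rightarrow> (nat \<Rightarrow> plane \<Rightarrow> plane) \<Rightarrow> plane set \<Rightarrow> bool" where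
  "closed_orbit \<eta> X C \<longleftrightarrow>
     (\<exists>T>0. \<exists>\<gamma>. solution_on \<eta> X T \<gamma> \<and> \<gamma> T = \<gamma> 0 \<and> inj_on \<gamma> {0..<T} \<and> C = \<gamma> ` {0..T})"

definition limit_cycle :: "real \<Rightarrow> (nat \<Rightarrow> plane \<Rightarrow> plane) \<Rightarrow> plane set \<Rightarrow> bool" where
  "limit_cycle \<eta> X C \<longleftrightarrow>
     closed_orbit \<eta> X C \<and>
     (\<exists>U. open U \<and> C \<subseteq> U \<and> (\<forall>C'. closed_orbit \<eta> X C' \<and> C' \<subseteq> U \<longrightarrow> C' = C))"

definition first_return :: "real \<Rightarrow> (nat \<Rightarrow> plane \<Rightarrow> plane) \<Rightarrow> real \<Rightarrow> real \<Rightarrow> bool" where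
  "first_return \<eta> X y y' \<longleftrightarrow>
     y' > \<eta> \<and>
     (\<exists>T>0. \<exists>\<gamma>. solution_on \<eta> X T \<gamma> \<and> \<gamma> 0 = (0, y) \<and> \<gamma> T = (0, y') \<and>
        (\<forall>t\<in>{0<..<T}. \<gamma> t \<notin> {0} \<times> {\<eta><..}))"

(* Displacement map of the section x = 0, y > \<eta>, in the coordinate y; meaningful where the first
   return exists and is unique, which includes a neighbourhood of every y with
   H (0, y) in a given compact subset of (-1/(2\<eta>), 0) once \<epsilon> is small. *)
definition displacement :: "real \<Rightarrow> (nat \<Rightarrow> plane \<Rightarrow> plane) \<Rightarrow> real \<Rightarrow> real" where
  "displacement \<eta> X y = (THE y'. first_return \<eta> X y y') - y"

definition zero_multiplicity :: "(real \<Rightarrow> real) \<Rightarrow> real \<Rightarrow> enat" where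
  "zero_multiplicity d y = Sup {enat m | m. \<forall>j<m. (deriv ^^ j) d y = 0}"

(* A closed orbit close to the period annulus meets the section exactly once. *)
definition cycle_multiplicity :: "real \<Rightarrow> (nat \<Rightarrow> plane \<Rightarrow> plane) \<Rightarrow> plane set \<Rightarrow> enat" where
  "cycle_multiplicity \<eta> X C =
     zero_multiplicity (displacement \<eta> X) (THE y. y > \<eta> \<and> (0, y) \<in> C)"

definition H :: "real \<Rightarrow> plane \<Rightarrow> real" where
  "H \<eta> = (\<lambda>(x, y). (x\<^sup>2 - y + \<eta> / 2) / y\<^sup>2)"

definition bifurcating_limit_cycles_le ::
  "real \<Rightarrow> (nat \<Rightarrow> plane \<Rightarrow> real) \<Rightarrow> (nat \<Rightarrow> plane \<Rightarrow> real) \<Rightarrow> nat \<Rightarrow> bool" where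
  "bifurcating_limit_cycles_le \<eta> f g N \<longleftrightarrow>
     (\<forall>K. compact K \<and> K \<subseteq> {- 1 / (2 * \<eta>)<..<0} \<longrightarrow>
       (\<exists>\<epsilon>\<^sub>0>0. \<forall>\<epsilon>. 0 < \<bar>\<epsilon>\<bar> \<and> \<bar>\<epsilon>\<bar> < \<epsilon>\<^sub>0 \<longrightarrow>
         (let X = perturbed_field \<eta> f g \<epsilon>;
              \<C> = {C. limit_cycle \<eta> X C \<and> (\<exists>y>\<eta>. (0, y) \<in> C \<and> H \<eta> (0, y) \<in> K)}
          in finite \<C> \<and> (\<Sum>C\<in>\<C>. cycle_multiplicity \<eta> X C) \<le> enat N)))"

definition L :: "real \<Rightarrow> real \<Rightarrow> plane set" where
  "L \<eta> h = {(x, y). y > 0 \<and> H \<eta> (x, y) = h}"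

(* For -1/(2\<eta>) < h < 0 the orbit L \<eta> h is the ellipse
   x^2 + (-h) (y + 1/(2h))^2 = -1/(4h) - \<eta>/2, run through clockwise from its top point. *)
definition L_path :: "real \<Rightarrow> real \<Rightarrow> real \<Rightarrow> plane" where
  "L_path \<eta> h \<theta> =
     (let a = sqrt (- 1 / (4 * h) - \<eta> / 2)
      in (a * sin \<theta>, - 1 / (2 * h) + a / sqrt (- h) * cos \<theta>))"

lemma L_path_image:
  assumes "\<eta> > 0" "- 1 / (2 * \<eta>) < h" "h < 0"
  shows "L_path \<eta> h ` {0..2 * pi} = L \<eta> h"
proof -
  define A where "A = - 1 / (4 * h) - \<eta> / 2"
  define a where "a = sqrt A"
  define b where "b = a / sqrt (- h)"
  define c where "c = - 1 / (2 * h)"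
  have hne: "h \<noteq> 0" using assms by simp
  have "- 1 < h * (2 * \<eta>)" using assms(1,2) by (subst (asm) pos_divide_less_eq) auto
  then have A: "A > 0" using assms(3) by (simp add: A_def field_simps)
  have a: "a > 0" "a\<^sup>2 = A" using A by (simp_all add: a_def)
  have b: "b > 0" "b\<^sup>2 = A / (- h)"
    using a assms(3) by (simp_all add: b_def power_divide)
  have c: "c > 0" using assms(3) by (simp add: c_def divide_neg_neg)
  have "c\<^sup>2 - b\<^sup>2 = \<eta> / (2 * (- h))"
    unfolding b c_def A_def using hne by (simp add: field_simps power2_eq_square)
  also have "\<dots> > 0" using assms by (intro divide_pos_pos) auto
  finally have bc: "b < c" using b(1) c by (simp add: power_less_imp_less_base)
  have level: "x\<^sup>2 - y + \<eta> / 2 - h * y\<^sup>2 = x\<^sup>2 - h * (y - c)\<^sup>2 - A" for x y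
    unfolding c_def A_def using hne by (simp add: field_simps power2_eq_square)
  have mem: "(x, y) \<in> L \<eta> h \<longleftrightarrow> y > 0 \<and> x\<^sup>2 - h * (y - c)\<^sup>2 = A" for x y
    using level[of x y] by (auto simp: L_def H_def field_simps)
  have path: "L_path \<eta> h \<theta> = (a * sin \<theta>, c + b * cos \<theta>)" for \<theta>
    by (simp add: L_path_def Let_def a_def b_def c_def A_def)
  have hb: "h * b\<^sup>2 = - A" using b(2) hne by simp
  show ?thesis
  proof (intro subset_antisym subsetI)
    fix p assume "p \<in> L_path \<eta> h ` {0..2 * pi}"
    then obtain \<theta> where p: "p = (a * sin \<theta>, c + b * cos \<theta>)" using path by auto
    have "b * (- 1) \<le> b * cos \<theta>" using b(1) by (intro mult_left_mono) auto
    then have pos: "c + b * cos \<theta> > 0" using bc by simp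
    have "(a * sin \<theta>)\<^sup>2 - h * (b * cos \<theta>)\<^sup>2 = A * (sin \<theta>)\<^sup>2 - h * b\<^sup>2 * (cos \<theta>)\<^sup>2"
      using a(2) by (simp add: power_mult_distrib)
    also have "\<dots> = A * ((sin \<theta>)\<^sup>2 + (cos \<theta>)\<^sup>2)" unfolding hb by (simp only: distrib_left minus_mult_left[symmetric] diff_minus_eq_add)
    also have "\<dots> = A" by simp
    finally show "p \<in> L \<eta> h" unfolding p mem using pos by simp
  next
    fix p assume "p \<in> L \<eta> h"
    then obtain x y where p: "p = (x, y)" and e: "x\<^sup>2 - h * (y - c)\<^sup>2 = A"
      using mem by (cases p) auto
    have "((y - c) / b)\<^sup>2 + (x / a)\<^sup>2 = (x\<^sup>2 - h * (y - c)\<^sup>2) / A"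
      unfolding power_divide a(2) b(2) using A hne by (simp add: field_simps)
    then have "((y - c) / b)\<^sup>2 + (x / a)\<^sup>2 = 1" using e A by simp
    then obtain t where t: "0 \<le> t" "t < 2 * pi" "(y - c) / b = cos t" "x / a = sin t"
      using sincos_total_2pi by metis
    have "p = L_path \<eta> h t" using t(3,4) a(1) b(1) by (simp add: p path field_simps)
    then show "p \<in> L_path \<eta> h ` {0..2 * pi}" using t by auto
  qed
qed

definition line_integral ::
  "(plane \<Rightarrow> real) \<Rightarrow> (plane \<Rightarrow> real) \<Rightarrow> (real \<Rightarrow> plane) \<Rightarrow> real set \<Rightarrow> real" where
  "line_integral P R \<gamma> I = integral I (\<lambda>t.
     P (\<gamma> t) * fst (vector_derivative \<gamma> (at t)) + R (\<gamma> t) * snd (vector_derivative \<gamma> (at t)))"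

definition melnikov ::
  "real \<Rightarrow> (nat \<Rightarrow> plane \<Rightarrow> real) \<Rightarrow> (nat \<Rightarrow> plane \<Rightarrow> real) \<Rightarrow> real \<Rightarrow> real" where
  "melnikov \<eta> f g h = (\<Sum>k=1..4.
     line_integral (\<lambda>(x, y). g k (x, y) / y ^ 3) (\<lambda>(x, y). - f k (x, y) / y ^ 3)
       (L_path \<eta> h) {\<theta> \<in> {0..2 * pi}. L_path \<eta> h \<theta> \<in> Q \<eta> k})"

end

theory Submission
  imports Defs "HOL-Complex_Analysis.Complex_Analysis"
begin

text \<open>
In the coordinate \<open>\<zeta> = (1 - \<eta> / y) + \<i> \<omega> x / y\<close> with \<open>\<omega> = \<surd>(2 \<eta>)\<close> the unperturbed system becomes
the rotation \<open>\<zeta>' = \<i> \<omega> \<zeta>\<close>, and \<open>\<bar>\<zeta>\<bar>\<^sup>2 = 1 + 2 \<eta> H\<close>. So the period annulus is the punctured unit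
disc, the section \<open>x = 0, y > \<eta>\<close> is the angle 0, the switching line \<open>y = \<eta>\<close> is the imaginary axis,
and the perturbed system is a scalar equation \<open>ds/d\<theta> = \<epsilon> a(\<theta>, s) + O(\<epsilon>\<^sup>2)\<close> in polar coordinates
\<open>\<zeta> = s cis \<theta>\<close>, with one analytic right-hand side for \<open>cos \<theta> > 0\<close> and another for \<open>cos \<theta> < 0\<close>.

First order. The integral of the right-hand side over the upper half turn, multiplied by \<open>s\<close>, is a
function \<open>U s\<close>. The half turn \<open>cos \<theta> < 0\<close> contributes \<open>V (- s)\<close> for a function \<open>V\<close> of the same kind,
because \<open>\<theta> \<mapsto> \<theta> + pi\<close> amounts to \<open>s \<mapsto> - s\<close>. Up to a constant factor \<open>U s + V (- s)\<close> is the Melnikov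
function (melnikov_eq_half_int). Integration by parts reduces all integrals to elementary ones, and for
\<open>n \<ge> 2\<close> the sum, multiplied by a function without zeros, takes the form
\<open>p / \<surd>(1 - s\<^sup>2) + q1 + q2 arccos s\<close> with polynomials of degree at most \<open>3 n - 3\<close>, \<open>3 n - 4\<close> and \<open>3 n - 4\<close>.
After \<open>3 n - 3\<close> derivatives only a polynomial of degree \<open>6 n - 6\<close> over a power of \<open>\<surd>(1 - s\<^sup>2)\<close>
remains, so Rolle's theorem allows at most \<open>9 n - 9\<close> zeros; for \<open>n = 1\<close> the sum is a cubic polynomial
(melnikov_space_zeros_le).

From first order to the system. The polar equation makes sense for complex \<open>s\<close> near a compact
interval \<open>{a..b}\<close>, and Picard iteration yields a holomorphic return map \<open>P s = s + \<epsilon> M s + O(\<epsilon>\<^sup>2)\<close>,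
uniformly (holomorphic_flow); here \<open>M\<close> is the Melnikov function times a function without zeros. By Cauchy's estimate the derivatives
converge too, so the number of zeros of \<open>P s - s\<close> in \<open>{a..b}\<close>, with multiplicity, is bounded by that
of \<open>M\<close> once \<open>\<epsilon>\<close> is small (zeros_le_perturbation). The displacement map of the section
is conjugate to \<open>P s - s\<close> up to a factor without zeros, so multiplicities agree
(fixed_point_multiplicity).

Closed orbits. It remains to see that a closed orbit through a point of the section over \<open>{a..b}\<close> is
the orbit of a fixed point of \<open>P\<close> and meets the section only there. The danger is a closed
orbit that misses its starting point after one turn, leaves the region where the analysis applies, and
comes back. If \<open>P s\<^sub>0 \<noteq> s\<^sub>0\<close>, then subtracting the linear drift from the orbit of \<open>s\<^sub>0\<close> gives a closed
curve that all solutions cross in the same direction, and a closed orbit cannot cross such a curve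
(loop_through_section_fixed). Otherwise uniqueness forces the closed orbit to be the polar orbit of
\<open>s\<^sub>0\<close> (closed_orbit_through).
\<close>

section \<open>Vanishing order and Rolle's theorem with multiplicity\<close>

text \<open>The order of a zero is expressed by growth rather than by derivatives, so that it passes through
continuous factors and through changes of variable that are differentiable at the point only.\<close>

definition vanishes_to :: "(real \<Rightarrow> real) \<Rightarrow> real \<Rightarrow> nat \<Rightarrow> bool" where
  "vanishes_to f x m \<longleftrightarrow> (\<exists>C. \<forall>\<^sub>F t in nhds x. \<bar>f t\<bar> \<le> C * \<bar>t - x\<bar> ^ m)"

text \<open>Quantifying over finite sets of points together with lower bounds of the orders makes the statement
include the finiteness of the number of zeros and of their orders.\<close>

definition zeros_le :: "(real \<Rightarrow> real) \<Rightarrow> real set \<Rightarrow> nat \<Rightarrow> bool" where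
  "zeros_le f I N \<longleftrightarrow>
     (\<forall>S m. finite S \<and> S \<subseteq> I \<and> (\<forall>x\<in>S. vanishes_to f x (m x)) \<longrightarrow> sum m S \<le> N)"

text \<open>An infinitely differentiable function together with its derivatives, without appeal to iterated \<open>deriv\<close>.\<close>

definition tower :: "(nat \<Rightarrow> real \<Rightarrow> real) \<Rightarrow> real set \<Rightarrow> bool" where
  "tower D I \<longleftrightarrow> (\<forall>j. \<forall>x\<in>I. (D j has_real_derivative D (Suc j) x) (at x))"

lemma vanishes_to_bounded_factor:
  assumes "vanishes_to f x m"
    and "\<forall>\<^sub>F t in nhds x. \<bar>g t\<bar> \<le> B * \<bar>f t\<bar>" "B \<ge> 0"
  shows "vanishes_to g x m"
proof -
  obtain C where "\<forall>\<^sub>F t in nhds x. \<bar>f t\<bar> \<le> C * \<bar>t - x\<bar> ^ m"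
    using assms(1) by (auto simp: vanishes_to_def)
  with assms(2) have "\<forall>\<^sub>F t in nhds x. \<bar>g t\<bar> \<le> (B * C) * \<bar>t - x\<bar> ^ m"
  proof eventually_elim
    case (elim t)
    have "B * \<bar>f t\<bar> \<le> B * (C * \<bar>t - x\<bar> ^ m)" using elim assms(3) by (intro mult_left_mono)
    then show ?case using elim by (simp add: mult.assoc)
  qed
  then show ?thesis by (auto simp: vanishes_to_def)
qed

lemma vanishes_to_cong:
  assumes "\<forall>\<^sub>F t in nhds x. f t = g t" "vanishes_to f x m"
  shows "vanishes_to g x m"
proof (rule vanishes_to_bounded_factor[OF assms(2), where B = 1])
  show "\<forall>\<^sub>F t in nhds x. \<bar>g t\<bar> \<le> 1 * \<bar>f t\<bar>"
    using assms(1) by eventually_elim simp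
qed simp

lemma vanishes_to_mult_left:
  assumes "vanishes_to f x m" "isCont u x"
  shows "vanishes_to (\<lambda>t. u t * f t) x m"
proof (rule vanishes_to_bounded_factor[OF assms(1), where B = "\<bar>u x\<bar> + 1"])
  have "((\<lambda>t. \<bar>u t\<bar>) \<longlongrightarrow> \<bar>u x\<bar>) (nhds x)" using assms(2)
    by (intro tendsto_rabs) (metis tendsto_nhds_iff isCont_def)
  then have "\<forall>\<^sub>F t in nhds x. \<bar>u t\<bar> < \<bar>u x\<bar> + 1" by (rule order_tendstoD(2)) simp
  then show "\<forall>\<^sub>F t in nhds x. \<bar>u t * f t\<bar> \<le> (\<bar>u x\<bar> + 1) * \<bar>f t\<bar>"
    by eventually_elim (auto simp: abs_mult intro!: mult_right_mono)
qed simp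

lemma vanishes_to_compose:
  assumes "vanishes_to f (\<phi> y) m" "(\<phi> has_real_derivative d) (at y)"
  shows "vanishes_to (\<lambda>t. f (\<phi> t)) y m"
proof -
  obtain C where C: "\<forall>\<^sub>F t in nhds (\<phi> y). \<bar>f t\<bar> \<le> C * \<bar>t - \<phi> y\<bar> ^ m"
    using assms(1) by (auto simp: vanishes_to_def)
  have cont: "filterlim \<phi> (nhds (\<phi> y)) (nhds y)"
    using DERIV_isCont[OF assms(2)] by (metis tendsto_nhds_iff isCont_def)
  have 1: "\<forall>\<^sub>F t in nhds y. \<bar>f (\<phi> t)\<bar> \<le> C * \<bar>\<phi> t - \<phi> y\<bar> ^ m"
    using eventually_compose_filterlim[OF C cont] .
  have "((\<lambda>t. (\<phi> t - \<phi> y) / (t - y)) \<longlongrightarrow> d) (at y)"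
    using assms(2) by (simp add: has_field_derivative_iff)
  then have "((\<lambda>t. \<bar>(\<phi> t - \<phi> y) / (t - y)\<bar>) \<longlongrightarrow> \<bar>d\<bar>) (at y)" by (rule tendsto_rabs)
  then have "\<forall>\<^sub>F t in at y. \<bar>(\<phi> t - \<phi> y) / (t - y)\<bar> < \<bar>d\<bar> + 1"
    by (rule order_tendstoD(2)) simp
  then have "\<forall>\<^sub>F t in nhds y. \<bar>\<phi> t - \<phi> y\<bar> \<le> (\<bar>d\<bar> + 1) * \<bar>t - y\<bar>"
    unfolding eventually_at_filter
    by eventually_elim (auto simp: divide_simps split: if_splits)
  with 1 have "\<forall>\<^sub>F t in nhds y. \<bar>f (\<phi> t)\<bar> \<le> (\<bar>C\<bar> * (\<bar>d\<bar> + 1) ^ m) * \<bar>t - y\<bar> ^ m"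
  proof eventually_elim
    case (elim t)
    have "\<bar>f (\<phi> t)\<bar> \<le> \<bar>C\<bar> * \<bar>\<phi> t - \<phi> y\<bar> ^ m"
      using elim(1) by (smt (verit) mult_right_mono zero_le_power abs_ge_self abs_ge_zero)
    also have "\<dots> \<le> \<bar>C\<bar> * ((\<bar>d\<bar> + 1) * \<bar>t - y\<bar>) ^ m"
      using elim(2) by (intro mult_left_mono power_mono) auto
    finally show ?case by (simp add: power_mult_distrib mult.assoc)
  qed
  then show ?thesis by (auto simp: vanishes_to_def)
qed

lemma vanishes_to_0 [simp]: "isCont f x \<Longrightarrow> vanishes_to f x 0"
proof -
  assume "isCont f x"
  moreover have "vanishes_to (\<lambda>_. 1) x 0" by (auto simp: vanishes_to_def intro!: exI[of _ 1])
  ultimately have "vanishes_to (\<lambda>t. f t * 1) x 0" by (intro vanishes_to_mult_left)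
  then show "vanishes_to f x 0" by simp
qed

lemma tower_shift: "tower D I \<Longrightarrow> tower (\<lambda>j. D (j + k)) I"
  by (auto simp: tower_def)

text \<open>By induction on the order: a bound of order \<open>m\<close> for the derivative integrates to order \<open>m + 1\<close> for the
function, by the mean value theorem.\<close>

lemma tower_vanishes_to:
  assumes "tower D I" "open I" "x \<in> I" "\<forall>j<m. D j x = 0"
  shows "vanishes_to (D 0) x m"
  using assms(1,4)
proof (induction m arbitrary: D)
  case 0
  then show ?case using assms(3) by (auto simp: tower_def intro!: vanishes_to_0 DERIV_isCont)
next
  case (Suc m)
  have "vanishes_to (D (0 + 1)) x m"
    by (rule Suc.IH[where D = "\<lambda>j. D (j + 1)"]) (use Suc.prems tower_shift[of D I 1] in auto)
  then obtain C where "\<forall>\<^sub>F t in nhds x. \<bar>D 1 t\<bar> \<le> C * \<bar>t - x\<bar> ^ m"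
    by (auto simp: vanishes_to_def)
  then have "\<forall>\<^sub>F t in nhds x. \<bar>D 1 t\<bar> \<le> C * \<bar>t - x\<bar> ^ m \<and> t \<in> I"
    using assms(2,3) by (simp add: eventually_conj eventually_nhds_in_open)
  then obtain e where e: "e > 0" "\<And>t. dist t x < e \<Longrightarrow> \<bar>D 1 t\<bar> \<le> C * \<bar>t - x\<bar> ^ m \<and> t \<in> I"
    unfolding eventually_nhds_metric by blast
  have "\<bar>D 0 t\<bar> \<le> \<bar>C\<bar> * \<bar>t - x\<bar> ^ Suc m" if t: "dist t x < e" for t
  proof -
    have "norm (D 0 t - D 0 x) \<le> (\<bar>C\<bar> * \<bar>t - x\<bar> ^ m) * norm (t - x)"
    proof (rule field_differentiable_bound[of "closed_segment x t" "D 0" "D 1"])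
      fix u assume u: "u \<in> closed_segment x t"
      then have le: "\<bar>u - x\<bar> \<le> \<bar>t - x\<bar>"
        using segment_bound(1)[OF u] by (auto simp: dist_real_def abs_minus_commute)
      then have du: "dist u x < e" using t by (simp add: dist_real_def)
      show "(D 0 has_field_derivative D 1 u) (at u within closed_segment x t)"
        using Suc.prems(1) e(2)[OF du] by (auto simp: tower_def intro: has_field_derivative_at_within)
      have "\<bar>D 1 u\<bar> \<le> C * \<bar>u - x\<bar> ^ m" using e(2)[OF du] by simp
      also have "\<dots> \<le> \<bar>C\<bar> * \<bar>t - x\<bar> ^ m"
        using le by (intro mult_mono power_mono) auto
      finally show "norm (D 1 u) \<le> \<bar>C\<bar> * \<bar>t - x\<bar> ^ m" by simp
    qed auto
    then show ?thesis using Suc.prems(2) by (simp add: mult_ac)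
  qed
  then have "\<forall>\<^sub>F t in nhds x. \<bar>D 0 t\<bar> \<le> \<bar>C\<bar> * \<bar>t - x\<bar> ^ Suc m"
    unfolding eventually_nhds_metric using e(1) by blast
  then show ?case by (auto simp: vanishes_to_def)
qed

text \<open>At the first derivative that does not vanish, the function is asymptotic to its leading Taylor term,
which decays more slowly than the assumed order.\<close>

lemma tower_vanishes_to_imp:
  assumes "tower D I" "open I" "x \<in> I" "vanishes_to (D 0) x m" "j < m"
  shows "D j x = 0"
  using assms(5)
proof (induction j rule: less_induct)
  case (less k)
  show ?case
  proof (rule ccontr)
    assume nz: "D k x \<noteq> 0"
    define p where "p t = D k x / fact k * (t - x) ^ k" for t
    \<comment> \<open>The remainder after the leading Taylor term vanishes to order \<open>k + 1\<close> by the previous lemma.\<close>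
    define E where "E j t = D j t - (if j \<le> k then D k x / fact (k - j) * (t - x) ^ (k - j) else 0)" for j t
    have "tower E I"
      unfolding tower_def
    proof (intro allI ballI)
      fix j t assume t: "t \<in> I"
      have D: "(D j has_real_derivative D (Suc j) t) (at t)" using assms(1) t by (auto simp: tower_def)
      show "(E j has_real_derivative E (Suc j) t) (at t)"
      proof (cases "j \<le> k")
        case False
        then show ?thesis using D by (simp add: E_def [abs_def])
      next
        case True
        then obtain i where k: "k = j + i" using le_Suc_ex by blast
        have "((\<lambda>t. D k x / fact i * (t - x) ^ i) has_real_derivative
           (if Suc j \<le> k then D k x / fact (k - Suc j) * (t - x) ^ (k - Suc j) else 0)) (at t)"
        proof (cases i)
          case 0
          then show ?thesis by (simp add: k)
        next
          case (Suc l)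
          have "((\<lambda>t. D k x / fact i * (t - x) ^ i) has_real_derivative
              D k x / fact i * (real (Suc l) * (t - x) ^ l)) (at t)"
            unfolding Suc by (rule derivative_eq_intros refl | simp)+
          moreover have "D k x / fact i * (real (Suc l) * (t - x) ^ l) = D k x / fact l * (t - x) ^ l"
            unfolding Suc fact_Suc by (simp add: divide_simps del: of_nat_Suc)
          ultimately show ?thesis by (simp add: k Suc)
        qed
        from DERIV_diff[OF D this] show ?thesis by (simp add: E_def [abs_def] k)
      qed
    qed
    moreover have "\<forall>j<Suc k. E j x = 0"
      using less by (auto simp: E_def less_Suc_eq_le power_0_left)
    ultimately have "vanishes_to (E 0) x (Suc k)"
      using tower_vanishes_to assms(2,3) by blast
    then obtain C where C: "\<forall>\<^sub>F t in nhds x. \<bar>E 0 t\<bar> \<le> C * \<bar>t - x\<bar> ^ Suc k"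
      by (auto simp: vanishes_to_def)
    obtain C' where C': "\<forall>\<^sub>F t in nhds x. \<bar>D 0 t\<bar> \<le> C' * \<bar>t - x\<bar> ^ m"
      using assms(4) by (auto simp: vanishes_to_def)
    obtain i where m: "m = Suc k + i" using less.prems by (metis Suc_leI le_Suc_ex)
    define c where "c = \<bar>D k x / fact k\<bar>"
    have "\<forall>\<^sub>F t in nhds x. dist t x < 1" by (simp add: eventually_nhds_metric) (metis zero_less_one)
    with C C' have "\<forall>\<^sub>F t in nhds x. c * \<bar>t - x\<bar> ^ k \<le> (\<bar>C\<bar> + \<bar>C'\<bar>) * \<bar>t - x\<bar> ^ Suc k"
    proof eventually_elim
      case (elim t)
      have "\<bar>t - x\<bar> ^ m \<le> \<bar>t - x\<bar> ^ Suc k"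
        using elim(3) by (intro power_decreasing) (auto simp: m dist_real_def)
      then have "C' * \<bar>t - x\<bar> ^ m \<le> \<bar>C'\<bar> * \<bar>t - x\<bar> ^ Suc k" by (intro mult_mono) auto
      moreover have "C * \<bar>t - x\<bar> ^ Suc k \<le> \<bar>C\<bar> * \<bar>t - x\<bar> ^ Suc k" by (intro mult_right_mono) auto
      moreover have "c * \<bar>t - x\<bar> ^ k = \<bar>D 0 t - E 0 t\<bar>"
        by (simp add: E_def c_def abs_mult power_abs)
      moreover have "\<bar>D 0 t - E 0 t\<bar> \<le> \<bar>D 0 t\<bar> + \<bar>E 0 t\<bar>" by simp
      ultimately show ?case using elim(1,2) unfolding distrib_right by linarith
    qed
    then have "\<forall>\<^sub>F t in at x. c \<le> (\<bar>C\<bar> + \<bar>C'\<bar>) * \<bar>t - x\<bar>"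
      unfolding eventually_at_filter
      by eventually_elim (auto simp: mult_ac)
    moreover have "((\<lambda>t. (\<bar>C\<bar> + \<bar>C'\<bar>) * \<bar>t - x\<bar>) \<longlongrightarrow> (\<bar>C\<bar> + \<bar>C'\<bar>) * \<bar>x - x\<bar>) (at x)"
      by (intro tendsto_intros)
    ultimately have "c \<le> (\<bar>C\<bar> + \<bar>C'\<bar>) * \<bar>x - x\<bar>"
      by (intro tendsto_lowerbound[where F = "at x"]) auto
    moreover have "c > 0" using nz by (simp add: c_def)
    ultimately show False by simp
  qed
qed

text \<open>The new zeros are chosen between consecutive given ones, hence apart from them: in the count with
multiplicity, the old points are used a second time.\<close>

lemma Rolle_points:
  fixes f :: "real \<Rightarrow> real"
  assumes "finite S" "S \<noteq> {}" "S \<subseteq> {a<..<b}" "\<And>x. x \<in> {a<..<b} \<Longrightarrow> (f has_real_derivative f' x) (at x)"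
    "\<And>x. x \<in> S \<Longrightarrow> f x = 0"
  shows "\<exists>R. finite R \<and> R \<subseteq> {Min S..Max S} \<and> R \<inter> S = {} \<and> card R + 1 = card S \<and> (\<forall>x\<in>R. f' x = 0)"
  using assms
proof (induction S rule: finite_linorder_max_induct)
  case empty
  then show ?case by simp
next
  case (insert c A)
  show ?case
  proof (cases "A = {}")
    case True
    then show ?thesis by (intro exI[of _ "{}"]) auto
  next
    case False
    then obtain R where R: "finite R" "R \<subseteq> {Min A..Max A}" "R \<inter> A = {}" "card R + 1 = card A" "\<forall>x\<in>R. f' x = 0"
      using insert by auto
    have MA: "Max A \<in> A" "Min A \<in> A" using False insert.hyps by auto
    then have lt: "Max A < c" using insert.hyps by auto
    have in_I: "Max A \<in> {a<..<b}" "c \<in> {a<..<b}" using insert.prems MA by auto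
    have "\<exists>z. Max A < z \<and> z < c \<and> DERIV f z :> 0"
    proof (rule Rolle[OF lt])
      show "f (Max A) = f c" using insert.prems MA by simp
      show "continuous_on {Max A..c} f"
      proof (intro continuous_at_imp_continuous_on ballI)
        fix x assume "x \<in> {Max A..c}"
        then have "x \<in> {a<..<b}" using in_I by auto
        then show "isCont f x" by (rule DERIV_isCont[OF insert.prems(3)])
      qed
      show "\<And>x. Max A < x \<Longrightarrow> x < c \<Longrightarrow> f differentiable at x"
        using in_I insert.prems(3) unfolding real_differentiable_def
        by (meson greaterThanLessThan_iff less_trans)
    qed
    then obtain z where z: "Max A < z" "z < c" "DERIV f z :> 0" by blast
    have fz: "f' z = 0" using z in_I insert.prems(3)[of z] DERIV_unique by fastforce
    have zA: "z \<notin> A" "z \<notin> R" using z(1) R(2) insert.hyps(1) by (auto simp: dest: Max_ge)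
    have ca: "c \<notin> A" using insert.hyps by auto
    show ?thesis
    proof (intro exI[of _ "insert z R"] conjI)
      show "insert z R \<subseteq> {Min (insert c A)..Max (insert c A)}"
        using R(2) z lt False insert.hyps(1) MA by (auto simp: min_def max_def) (use MA in fastforce)+
      show "insert z R \<inter> insert c A = {}" using R z zA lt by auto
    qed (use R fz zA ca insert.hyps(1) in auto)
  qed
qed

text \<open>A zero of order \<open>m\<close> is one of order \<open>m - 1\<close> of the derivative, and Rolle's theorem adds one zero
of the derivative in each gap, so at most one zero is lost altogether.\<close>

lemma tower_zeros_le_Suc:
  assumes "tower D {a<..<b}" "zeros_le (D 1) {a<..<b} N"
  shows "zeros_le (D 0) {a<..<b} (Suc N)"
  unfolding zeros_le_def
proof (intro allI impI)
  fix S and m :: "real \<Rightarrow> nat"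
  assume "finite S \<and> S \<subseteq> {a<..<b} \<and> (\<forall>x\<in>S. vanishes_to (D 0) x (m x))"
  then have S: "finite S" "S \<subseteq> {a<..<b}" and v: "\<And>x. x \<in> S \<Longrightarrow> vanishes_to (D 0) x (m x)" by auto
  define Z where "Z = {x\<in>S. m x > 0}"
  have Z: "finite Z" "Z \<subseteq> {a<..<b}" using S by (auto simp: Z_def)
  have sumZ: "sum m S = sum m Z"
    unfolding Z_def by (intro sum.mono_neutral_right) (use S in auto)
  have D0: "D j x = 0" if "x \<in> Z" "j < m x" for x j
    using tower_vanishes_to_imp[OF assms(1) _ _ v that(2)] that S by (auto simp: Z_def)
  show "sum m S \<le> Suc N"
  proof (cases "Z = {}")
    case True
    then show ?thesis by (simp add: sumZ)
  next
    case False
    have der: "(D 0 has_real_derivative D 1 x) (at x)" if "x \<in> {a<..<b}" for x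
      using assms(1) that by (auto simp: tower_def)
    obtain R where R: "finite R" "R \<subseteq> {Min Z..Max Z}" "R \<inter> Z = {}" "card R + 1 = card Z" "\<forall>x\<in>R. D 1 x = 0"
      using Rolle_points[OF Z(1) False Z(2) der] D0 by (auto simp: Z_def)
    have "Min Z \<in> Z" "Max Z \<in> Z" using Z(1) False by auto
    then have RI: "R \<subseteq> {a<..<b}" using R(2) Z(2) by fastforce
    define m' where "m' x = (if x \<in> Z then m x - 1 else 1)" for x
    have tow1: "tower (\<lambda>j. D (j + 1)) {a<..<b}" by (rule tower_shift[OF assms(1)])
    have "vanishes_to (D 1) x (m' x)" if "x \<in> Z \<union> R" for x
    proof -
      have "\<forall>j<m' x. D (j + 1) x = 0"
        using that R D0 by (auto simp: m'_def)
      from tower_vanishes_to[OF tow1 _ _ this] show ?thesis using that RI Z by auto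
    qed
    then have "sum m' (Z \<union> R) \<le> N"
      using assms(2) Z R(1) RI unfolding zeros_le_def by blast
    moreover have "sum m' (Z \<union> R) = (\<Sum>x\<in>Z. m x - 1) + card R"
    proof -
      have "sum m' (Z \<union> R) = sum m' Z + sum m' R" using Z R by (intro sum.union_disjoint) auto
      moreover have "sum m' R = (\<Sum>x\<in>R. 1)" by (intro sum.cong) (use R in \<open>auto simp: m'_def\<close>)
      ultimately show ?thesis by (simp add: m'_def)
    qed
    moreover have "sum m Z = (\<Sum>x\<in>Z. m x - 1) + card Z"
    proof -
      have "sum m Z = (\<Sum>x\<in>Z. (m x - 1) + 1)" by (intro sum.cong) (auto simp: Z_def)
      then show ?thesis unfolding sum.distrib by simp
    qed
    ultimately show ?thesis using R(4) sumZ by linarith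
  qed
qed

lemma zeros_le_mono: "zeros_le f I N \<Longrightarrow> N \<le> N' \<Longrightarrow> zeros_le f I N'"
  unfolding zeros_le_def by (meson le_trans)

lemma zeros_le_0:
  assumes "\<And>x. x \<in> I \<Longrightarrow> isCont f x \<and> f x \<noteq> 0"
  shows "zeros_le f I 0"
  unfolding zeros_le_def
proof (intro allI impI)
  fix S and m :: "real \<Rightarrow> nat"
  assume S: "finite S \<and> S \<subseteq> I \<and> (\<forall>x\<in>S. vanishes_to f x (m x))"
  have "m x = 0" if "x \<in> S" for x
  proof (rule ccontr)
    assume "m x \<noteq> 0"
    obtain C where "\<forall>\<^sub>F t in nhds x. \<bar>f t\<bar> \<le> C * \<bar>t - x\<bar> ^ m x"
      using S \<open>x \<in> S\<close> by (auto simp: vanishes_to_def)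
    from eventually_nhds_x_imp_x[OF this] have "f x = 0" using \<open>m x \<noteq> 0\<close> by (simp add: power_0_left)
    then show False using assms[of x] S that by auto
  qed
  then show "sum m S \<le> 0" by simp
qed

text \<open>The alternative that a function vanishes identically has to be carried along: a derivative that is
identically zero makes its antiderivative constant, with no zeros or only zeros.\<close>

lemma tower_Rolle:
  assumes "tower D {a<..<b}" "zeros_le (D k) {a<..<b} N \<or> (\<forall>x\<in>{a<..<b}. D k x = 0)"
  shows "zeros_le (D 0) {a<..<b} (N + k) \<or> (\<forall>x\<in>{a<..<b}. D 0 x = 0)"
  using assms
proof (induction k arbitrary: D)
  case 0
  then show ?case by simp
next
  case (Suc k)
  have tow1: "tower (\<lambda>j. D (j + 1)) {a<..<b}" by (rule tower_shift[OF Suc.prems(1)])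
  have "zeros_le (D (0 + 1)) {a<..<b} (N + k) \<or> (\<forall>x\<in>{a<..<b}. D (0 + 1) x = 0)"
    by (rule Suc.IH[OF tow1]) (use Suc.prems in simp)
  then show ?case
  proof
    assume "zeros_le (D (0 + 1)) {a<..<b} (N + k)"
    then show ?thesis using tower_zeros_le_Suc[OF Suc.prems(1)] by simp
  next
    assume z: "\<forall>x\<in>{a<..<b}. D (0 + 1) x = 0"
    have der: "(D 0 has_real_derivative 0) (at x)" if "x \<in> {a<..<b}" for x
    proof -
      have "(D 0 has_real_derivative D (Suc 0) x) (at x)" using Suc.prems(1) that unfolding tower_def by blast
      moreover have "D (Suc 0) x = 0" using z that by simp
      ultimately show ?thesis by simp
    qed
    have const: "D 0 x = D 0 y" if "x \<in> {a<..<b}" "y \<in> {a<..<b}" for x y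
      by (rule has_field_derivative_zero_constant[of "{a<..<b}" "D 0", THEN exE])
         (use der that in \<open>auto intro: has_field_derivative_at_within\<close>)
    show ?thesis
    proof (cases "\<forall>x\<in>{a<..<b}. D 0 x = 0")
      case False
      then obtain y where y: "y \<in> {a<..<b}" "D 0 y \<noteq> 0" by blast
      have "zeros_le (D 0) {a<..<b} 0"
        by (rule zeros_le_0) (use der const y in \<open>metis DERIV_isCont\<close>)
      then show ?thesis using zeros_le_mono by blast
    qed simp
  qed
qed

lemma tower_poly: "tower (\<lambda>j. poly ((pderiv ^^ j) p)) I"
  by (auto simp: tower_def intro: poly_DERIV)

lemma degree_pderiv_iterate: "degree ((pderiv ^^ j) (p :: real poly)) = degree p - j"
  by (induction j) (auto simp: degree_pderiv)

lemma zeros_le_poly: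
  fixes p :: "real poly"
  assumes "degree p \<le> N"
  shows "zeros_le (poly p) {a<..<b} N \<or> (\<forall>x\<in>{a<..<b}. poly p x = 0)"
proof -
  have "degree ((pderiv ^^ N) p) = 0" using assms by (simp add: degree_pderiv_iterate)
  then obtain c where c: "(pderiv ^^ N) p = [:c:]" using degree_eq_zeroE by blast
  have "zeros_le (poly ((pderiv ^^ N) p)) {a<..<b} 0 \<or> (\<forall>x\<in>{a<..<b}. poly ((pderiv ^^ N) p) x = 0)"
    by (cases "c = 0") (auto simp: c intro!: zeros_le_0)
  from tower_Rolle[OF tower_poly this] show ?thesis by simp
qed

lemma zeros_le_factor:
  assumes "zeros_le g I N \<or> (\<forall>x\<in>I. g x = 0)" "open I"
    and "\<And>x. x \<in> I \<Longrightarrow> g x = u x * f x" "\<And>x. x \<in> I \<Longrightarrow> isCont u x \<and> u x \<noteq> 0"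
  shows "zeros_le f I N \<or> (\<forall>x\<in>I. f x = 0)"
  using assms(1)
proof
  assume g: "zeros_le g I N"
  have "vanishes_to g x m" if "vanishes_to f x m" "x \<in> I" for x m
    by (rule vanishes_to_cong[OF _ vanishes_to_mult_left[OF that(1), of u]])
       (use assms that in \<open>auto intro: eventually_mono[OF eventually_nhds_in_open]\<close>)
  then have "zeros_le f I N" using g unfolding zeros_le_def by (meson subsetD)
  then show ?thesis ..
qed (use assms in force)

section \<open>Kepler's anomalies\<close>

text \<open>Kepler's true anomaly as a function of the eccentric anomaly \<open>t\<close> for the eccentricity \<open>s\<close>, in the form
that is smooth on the whole line. The level curves of \<open>H\<close> are ellipses; the parametrization of the
Melnikov integral uses the angle \<open>anomaly s \<theta>\<close>, whereas \<open>\<theta>\<close> is the polar angle of \<open>\<zeta>\<close>.\<close>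

definition anomaly :: "real \<Rightarrow> real \<Rightarrow> real" where
  "anomaly s t = (let \<kappa> = s / (1 + sqrt (1 - s\<^sup>2)) in t + 2 * arctan (\<kappa> * sin t / (1 - \<kappa> * cos t)))"

lemma one_minus_mult_cos_pos:
  assumes "\<bar>s\<bar> < (1::real)"
  shows "1 - s * cos t > 0"
proof -
  have "\<bar>s * cos t\<bar> \<le> \<bar>s\<bar> * 1" unfolding abs_mult by (intro mult_left_mono) auto
  then show ?thesis using assms by linarith
qed

lemma one_minus_square_pos: "\<bar>s\<bar> < (1::real) \<Longrightarrow> 1 - s\<^sup>2 > 0"
  by (simp add: abs_square_less_1)

lemma has_real_derivative_anomaly:
  assumes s: "\<bar>s\<bar> < 1"
  shows "(anomaly s has_real_derivative sqrt (1 - s\<^sup>2) / (1 - s * cos t)) (at t)"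
proof -
  define R where "R = sqrt (1 - s\<^sup>2)"
  define \<kappa> where "\<kappa> = s / (1 + R)"
  have D: "1 - s\<^sup>2 > 0" using s by (rule one_minus_square_pos)
  have R: "R > 0" "R\<^sup>2 = 1 - s\<^sup>2" using D by (auto simp: R_def)
  have "\<bar>\<kappa>\<bar> \<le> \<bar>s\<bar>" using R(1) by (simp add: \<kappa>_def abs_divide divide_le_eq mult_le_cancel_left1)
  then have k: "\<bar>\<kappa>\<bar> < 1" using s by simp
  have s_eq: "\<kappa> * (1 + R) = s" using R(1) by (simp add: \<kappa>_def)
  have "\<kappa>\<^sup>2 * (1 + R)\<^sup>2 = (1 - R) * (1 + R)"
    using s_eq R(2) by (simp add: power_mult_distrib[symmetric]) (simp add: algebra_simps power2_eq_square)
  then have "\<kappa>\<^sup>2 * (1 + R) = 1 - R" using R(1) by (simp add: power2_eq_square)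
  then have k2: "(1 + \<kappa>\<^sup>2) * R = 1 - \<kappa>\<^sup>2" by (simp add: algebra_simps)
  have "(1 + \<kappa>\<^sup>2) * s = \<kappa> * ((1 + \<kappa>\<^sup>2) + (1 + \<kappa>\<^sup>2) * R)" by (simp add: s_eq[symmetric] algebra_simps)
  also have "\<dots> = 2 * \<kappa>" unfolding k2 by simp
  finally have k3: "(1 + \<kappa>\<^sup>2) * s = 2 * \<kappa>" .
  define v where "v = 1 - \<kappa> * cos t"
  define u where "u = \<kappa> * sin t"
  have v: "v > 0" unfolding v_def by (rule one_minus_mult_cos_pos[OF k])
  have uv: "u\<^sup>2 + v\<^sup>2 > 0" using v by (simp add: sum_power2_gt_zero_iff)
  have quot: "1 + 2 * (x / N) = (N + 2 * x) / N" if "N > 0" for x N :: real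
    using that by (simp add: add_divide_distrib)
  have uv_eq: "u\<^sup>2 + v\<^sup>2 = (1 + \<kappa>\<^sup>2) * (1 - s * cos t)"
  proof -
    have "u\<^sup>2 + v\<^sup>2 = \<kappa>\<^sup>2 * ((sin t)\<^sup>2 + (cos t)\<^sup>2) + 1 - 2 * \<kappa> * cos t"
      unfolding u_def v_def power2_eq_square by (simp only: algebra_simps)
    also have "\<dots> = (1 + \<kappa>\<^sup>2) - (1 + \<kappa>\<^sup>2) * s * cos t" unfolding k3 by simp
    finally show ?thesis by (simp add: algebra_simps)
  qed
  have "((\<lambda>t. t + 2 * arctan (\<kappa> * sin t / (1 - \<kappa> * cos t))) has_real_derivative
      1 + 2 * (inverse (1 + (u / v)\<^sup>2) * ((\<kappa> * cos t * v - u * (\<kappa> * sin t)) / (v * v)))) (at t)"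
    unfolding u_def v_def using v[unfolded v_def]
    by (auto intro!: derivative_eq_intros)
  also have "1 + 2 * (inverse (1 + (u / v)\<^sup>2) * ((\<kappa> * cos t * v - u * (\<kappa> * sin t)) / (v * v)))
     = 1 + 2 * ((\<kappa> * cos t * v - u * (\<kappa> * sin t)) / (u\<^sup>2 + v\<^sup>2))"
  proof -
    have "1 + (u / v)\<^sup>2 = (u\<^sup>2 + v\<^sup>2) / (v * v)"
      using v by (simp add: field_simps power2_eq_square)
    then show ?thesis using v uv by simp
  qed
  also have "\<kappa> * cos t * v - u * (\<kappa> * sin t) = \<kappa> * cos t - \<kappa>\<^sup>2 * ((sin t)\<^sup>2 + (cos t)\<^sup>2)"
    unfolding u_def v_def power2_eq_square by (simp only: algebra_simps)
  also have "1 + 2 * ((\<kappa> * cos t - \<kappa>\<^sup>2 * ((sin t)\<^sup>2 + (cos t)\<^sup>2)) / (u\<^sup>2 + v\<^sup>2)) =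
      ((u\<^sup>2 + v\<^sup>2) + 2 * (\<kappa> * cos t - \<kappa>\<^sup>2)) / (u\<^sup>2 + v\<^sup>2)"
    unfolding sin_cos_squared_add mult_1_right by (rule quot[OF uv])
  also have "(u\<^sup>2 + v\<^sup>2) + 2 * (\<kappa> * cos t - \<kappa>\<^sup>2) = (1 + \<kappa>\<^sup>2) * R"
  proof -
    have "(u\<^sup>2 + v\<^sup>2) = 1 + \<kappa>\<^sup>2 - ((1 + \<kappa>\<^sup>2) * s) * cos t" unfolding uv_eq by (simp add: algebra_simps)
    then show ?thesis unfolding k2 k3 by simp
  qed
  also have "(1 + \<kappa>\<^sup>2) * R / (u\<^sup>2 + v\<^sup>2) = R / (1 - s * cos t)"
  proof -
    have "1 + \<kappa>\<^sup>2 > 0" by (simp add: add_pos_nonneg)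
    then show ?thesis unfolding uv_eq by simp
  qed
  finally show ?thesis by (simp add: anomaly_def [abs_def] R_def \<kappa>_def Let_def)
qed

lemma anomaly_0 [simp]: "anomaly s 0 = 0"
  and anomaly_minus: "anomaly s (- t) = - anomaly s t"
  and anomaly_2pi_minus: "anomaly s (2 * pi - t) = 2 * pi - anomaly s t"
  and anomaly_pi: "anomaly s pi = pi"
  by (simp_all add: anomaly_def Let_def sin_diff cos_diff arctan_minus)

lemma cos_sin_anomaly:
  assumes s: "\<bar>s\<bar> < 1"
  shows "cos (anomaly s t) = (cos t - s) / (1 - s * cos t)"
    and "sin (anomaly s t) = sqrt (1 - s\<^sup>2) * sin t / (1 - s * cos t)"
proof -
  define R where "R = sqrt (1 - s\<^sup>2)"
  have R: "R > 0" "R\<^sup>2 = 1 - s\<^sup>2" using one_minus_square_pos[OF s] by (auto simp: R_def)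
  define C where "C t = (cos t - s) / (1 - s * cos t)" for t
  define S where "S t = R * sin t / (1 - s * cos t)" for t
  define p where "p t = R / (1 - s * cos t)" for t
  have w: "1 - s * cos t > 0" for t by (rule one_minus_mult_cos_pos[OF s])
  have C': "(C has_real_derivative - S t * p t) (at t)" for t
  proof -
    have "(C has_real_derivative (- sin t * (1 - s * cos t) - (cos t - s) * (s * sin t)) /
        ((1 - s * cos t) * (1 - s * cos t))) (at t)"
      unfolding C_def [abs_def] using w[of t] by (auto intro!: derivative_eq_intros)
    also have "- sin t * (1 - s * cos t) - (cos t - s) * (s * sin t) = - (R\<^sup>2 * sin t)"
      unfolding R by (simp add: algebra_simps power2_eq_square)
    also have "- (R\<^sup>2 * sin t) / ((1 - s * cos t) * (1 - s * cos t)) = - S t * p t"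
      by (simp add: S_def p_def power2_eq_square)
    finally show ?thesis .
  qed
  have S': "(S has_real_derivative C t * p t) (at t)" for t
  proof -
    have "(S has_real_derivative (R * cos t * (1 - s * cos t) - R * sin t * (s * sin t)) /
        ((1 - s * cos t) * (1 - s * cos t))) (at t)"
      unfolding S_def [abs_def] using w[of t] by (auto intro!: derivative_eq_intros)
    also have "R * cos t * (1 - s * cos t) - R * sin t * (s * sin t)
        = R * (cos t - s * ((sin t)\<^sup>2 + (cos t)\<^sup>2))"
      unfolding power2_eq_square by (simp only: algebra_simps)
    also have "R * (cos t - s * ((sin t)\<^sup>2 + (cos t)\<^sup>2)) / ((1 - s * cos t) * (1 - s * cos t)) = C t * p t"
      by (simp add: C_def p_def)
    finally show ?thesis .
  qed
  have a': "(anomaly s has_real_derivative p t) (at t)" for t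
    using has_real_derivative_anomaly[OF s] by (simp add: p_def R_def)
  note der = C' S' a' DERIV_chain2[OF DERIV_cos a'] DERIV_chain2[OF DERIV_sin a']
  \<comment> \<open>Both \<open>(C, S)\<close> and \<open>(cos, sin)\<close> of the anomaly rotate with speed \<open>p\<close>, so their inner product \<open>P\<close>
and cross product \<open>Q\<close> are constant.\<close>
  define P where "P t = C t * cos (anomaly s t) + S t * sin (anomaly s t)" for t
  define Q where "Q t = S t * cos (anomaly s t) - C t * sin (anomaly s t)" for t
  have "(P has_real_derivative 0) (at t)" for t
    unfolding P_def [abs_def] by (rule derivative_eq_intros der refl)+ (simp add: algebra_simps)
  then have "P t = P 0" by (metis DERIV_isconst_all)
  moreover have "P 0 = 1" using s by (auto simp: P_def C_def S_def)
  ultimately have P1: "P t = 1" by simp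
  have "(Q has_real_derivative 0) (at t)" for t
    unfolding Q_def [abs_def] by (rule derivative_eq_intros der refl)+ (simp add: algebra_simps)
  then have "Q t = Q 0" by (metis DERIV_isconst_all)
  moreover have "Q 0 = 0" by (simp add: Q_def S_def)
  ultimately have Q0: "Q t = 0" by simp
  have one: "(sin (anomaly s t))\<^sup>2 + (cos (anomaly s t))\<^sup>2 = 1" by simp
  have "C t * ((sin (anomaly s t))\<^sup>2 + (cos (anomaly s t))\<^sup>2) = cos (anomaly s t) * P t - sin (anomaly s t) * Q t"
    by (simp only: P_def Q_def) algebra
  then show "cos (anomaly s t) = (cos t - s) / (1 - s * cos t)"
    unfolding P1 Q0 one by (simp add: C_def)
  have "S t * ((sin (anomaly s t))\<^sup>2 + (cos (anomaly s t))\<^sup>2) = sin (anomaly s t) * P t + cos (anomaly s t) * Q t"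
    by (simp only: P_def Q_def) algebra
  then show "sin (anomaly s t) = sqrt (1 - s\<^sup>2) * sin t / (1 - s * cos t)"
    unfolding P1 Q0 one by (simp add: S_def R_def)
qed

lemma anomaly_pi_half:
  assumes s: "\<bar>s\<bar> < 1"
  shows "anomaly s (pi / 2) = arccos (- s)"
proof -
  have D: "1 - s\<^sup>2 > 0" using s by (rule one_minus_square_pos)
  define \<kappa> where "\<kappa> = s / (1 + sqrt (1 - s\<^sup>2))"
  have "sqrt (1 - s\<^sup>2) > 0" using D by simp
  then have "1 + sqrt (1 - s\<^sup>2) > 0" "\<bar>s\<bar> * 1 \<le> \<bar>s\<bar> * (1 + sqrt (1 - s\<^sup>2))"
    by (linarith, intro mult_left_mono) auto
  then have "\<bar>\<kappa>\<bar> \<le> \<bar>s\<bar>" by (simp add: \<kappa>_def abs_divide pos_divide_le_eq)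
  then have k: "-1 < \<kappa>" "\<kappa> < 1" using s by auto
  have "arctan \<kappa> < pi / 4" "- (pi / 4) < arctan \<kappa>"
    using k arctan_less_iff[of \<kappa> 1] arctan_less_iff[of "-1" \<kappa>] by (auto simp: arctan_one arctan_minus)
  then have "0 \<le> anomaly s (pi / 2)" "anomaly s (pi / 2) \<le> pi"
    by (simp_all add: anomaly_def Let_def \<kappa>_def)
  from arccos_cos[OF this] show ?thesis using cos_sin_anomaly(1)[OF s, of "pi / 2"] by simp
qed

section \<open>Trigonometric integrals over a half turn\<close>

text \<open>The exponent \<open>3 - j\<close> of \<open>1 - s cos t\<close> can have either sign; the quotient avoids negative exponents.\<close>

definition trig_int :: "nat \<Rightarrow> nat \<Rightarrow> real \<Rightarrow> real" where
  "trig_int i j s = integral {- (pi / 2)..pi / 2}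
     (\<lambda>t. (s * sin t) ^ i * ((1 - s * cos t) ^ 3 / (1 - s * cos t) ^ j))"

definition neg_int :: "nat \<Rightarrow> real \<Rightarrow> real" where
  "neg_int r s = integral {- (pi / 2)..pi / 2} (\<lambda>t. 1 / (1 - s * cos t) ^ r)"

text \<open>The only transcendental function among the integrals: the integral of \<open>1 / (1 - s cos t)\<close> over the
half turn.\<close>

definition arc_part :: "real \<Rightarrow> real" where
  "arc_part s = 2 * arccos (- s) / sqrt (1 - s\<^sup>2)"

lemma neg_int_1:
  assumes s: "\<bar>s\<bar> < 1"
  shows "neg_int 1 s = arc_part s"
proof -
  have D: "sqrt (1 - s\<^sup>2) > 0" using one_minus_square_pos[OF s] by simp
  have "((\<lambda>t. sqrt (1 - s\<^sup>2) / (1 - s * cos t)) has_integral anomaly s (pi / 2) - anomaly s (- (pi / 2)))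
     {- (pi / 2)..pi / 2}"
    by (intro fundamental_theorem_of_calculus)
       (auto simp: has_real_derivative_iff_has_vector_derivative[symmetric]
         intro: has_field_derivative_at_within has_real_derivative_anomaly[OF s])
  then have "((\<lambda>t. (1 / sqrt (1 - s\<^sup>2)) * (sqrt (1 - s\<^sup>2) / (1 - s * cos t))) has_integral
     (1 / sqrt (1 - s\<^sup>2)) * (anomaly s (pi / 2) - anomaly s (- (pi / 2)))) {- (pi / 2)..pi / 2}"
    by (rule has_integral_mult_right)
  then have "((\<lambda>t. 1 / (1 - s * cos t) ^ 1) has_integral arc_part s) {- (pi / 2)..pi / 2}"
    using D by (simp add: anomaly_minus anomaly_pi_half[OF s] arc_part_def)
  then show ?thesis unfolding neg_int_def by (rule integral_unique)
qed

text \<open>Integrate the derivative of \<open>s sin t / (1 - s cos t) ^ (r + 1)\<close> over the half turn; the boundary terms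
give \<open>2 s\<close>.\<close>

lemma neg_int_rec:
  assumes s: "\<bar>s\<bar> < 1"
  shows "real (Suc r) * (1 - s\<^sup>2) * neg_int (Suc (Suc r)) s
     = 2 * s + (2 * real r + 1) * neg_int (Suc r) s - real r * neg_int r s"
proof -
  let ?I = "{- (pi / 2)..pi / 2}"
  define w where "w t = 1 - s * cos t" for t
  have w: "w t > 0" for t unfolding w_def by (rule one_minus_mult_cos_pos[OF s])
  have wne: "w t \<noteq> 0" for t using w[of t] by simp
  have cont: "continuous_on A w" for A unfolding w_def by (intro continuous_intros)
  have int: "((\<lambda>t. 1 / w t ^ k) has_integral neg_int k s) ?I" for k
    unfolding neg_int_def w_def[symmetric]
    by (intro integrable_integral integrable_continuous_real continuous_intros cont) (use wne in auto)
  have "((\<lambda>t. s * (cos t / w t ^ Suc r - real (Suc r) * s * (sin t)\<^sup>2 / w t ^ Suc (Suc r))) has_integral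
      s * sin (pi / 2) / w (pi / 2) ^ Suc r - s * sin (- (pi / 2)) / w (- (pi / 2)) ^ Suc r) ?I"
  proof (rule fundamental_theorem_of_calculus)
    fix t :: real
    have w': "(w has_real_derivative s * sin t) (at t)"
      unfolding w_def by (auto intro!: derivative_eq_intros)
    have "((\<lambda>t. s * sin t / w t ^ Suc r) has_real_derivative
       (s * cos t * w t ^ Suc r - s * sin t * (real (Suc r) * w t ^ r * (s * sin t))) / (w t ^ Suc r * w t ^ Suc r)) (at t)"
      by (rule derivative_eq_intros w' refl | use wne in simp)+
    also have "(s * cos t * w t ^ Suc r - s * sin t * (real (Suc r) * w t ^ r * (s * sin t))) / (w t ^ Suc r * w t ^ Suc r)
      = s * (cos t / w t ^ Suc r - real (Suc r) * s * (sin t)\<^sup>2 / w t ^ Suc (Suc r))"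
      using wne by (simp add: divide_simps power2_eq_square) (simp add: algebra_simps)
    finally show "((\<lambda>t. s * sin t / w t ^ Suc r) has_vector_derivative
       s * (cos t / w t ^ Suc r - real (Suc r) * s * (sin t)\<^sup>2 / w t ^ Suc (Suc r))) (at t within ?I)"
      by (auto simp: has_real_derivative_iff_has_vector_derivative[symmetric] intro: has_field_derivative_at_within)
  qed simp
  moreover have "s * (cos t / w t ^ Suc r - real (Suc r) * s * (sin t)\<^sup>2 / w t ^ Suc (Suc r))
     = real (Suc r) * (1 - s\<^sup>2) * (1 / w t ^ Suc (Suc r)) - (2 * real r + 1) * (1 / w t ^ Suc r)
       + real r * (1 / w t ^ r)" for t
  proof -
    have sc: "s * cos t = 1 - w t" by (simp add: w_def)
    have "s * s * (sin t)\<^sup>2 = s\<^sup>2 - (s * cos t)\<^sup>2"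
      unfolding sin_squared_eq by (simp add: algebra_simps power2_eq_square)
    then have ss: "s * s * (sin t)\<^sup>2 = s\<^sup>2 - (1 - w t)\<^sup>2" unfolding sc .
    have "s * (cos t / w t ^ Suc r - real (Suc r) * s * (sin t)\<^sup>2 / w t ^ Suc (Suc r))
      = (s * cos t * w t - real (Suc r) * (s * s * (sin t)\<^sup>2)) / w t ^ Suc (Suc r)"
      using wne by (simp add: divide_simps) (simp add: algebra_simps)
    also have "\<dots> = ((1 - w t) * w t - real (Suc r) * (s\<^sup>2 - (1 - w t)\<^sup>2)) / w t ^ Suc (Suc r)"
      unfolding ss sc ..
    also have "\<dots> = (real (Suc r) * (1 - s\<^sup>2) - (2 * real r + 1) * w t + real r * (w t * w t)) / w t ^ Suc (Suc r)"
      by (rule arg_cong[of _ _ "\<lambda>x. x / _"]) (simp add: algebra_simps power2_eq_square)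
    also have "\<dots> = real (Suc r) * (1 - s\<^sup>2) * (1 / w t ^ Suc (Suc r)) - (2 * real r + 1) * (1 / w t ^ Suc r)
       + real r * (1 / w t ^ r)"
      using wne by (simp add: divide_simps)
    finally show ?thesis .
  qed
  ultimately have "((\<lambda>t. real (Suc r) * (1 - s\<^sup>2) * (1 / w t ^ Suc (Suc r)) - (2 * real r + 1) * (1 / w t ^ Suc r)
       + real r * (1 / w t ^ r)) has_integral 2 * s) ?I"
    by (simp add: w_def)
  moreover have "((\<lambda>t. real (Suc r) * (1 - s\<^sup>2) * (1 / w t ^ Suc (Suc r)) - (2 * real r + 1) * (1 / w t ^ Suc r)
       + real r * (1 / w t ^ r)) has_integral real (Suc r) * (1 - s\<^sup>2) * neg_int (Suc (Suc r)) s
         - (2 * real r + 1) * neg_int (Suc r) s + real r * neg_int r s) ?I"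
    by (intro has_integral_add has_integral_diff has_integral_mult_right int)
  ultimately have "2 * s = real (Suc r) * (1 - s\<^sup>2) * neg_int (Suc (Suc r)) s
         - (2 * real r + 1) * neg_int (Suc r) s + real r * neg_int r s"
    by (rule has_integral_unique)
  then show ?thesis by linarith
qed

section \<open>A linear space containing the half-turn integrals\<close>

text \<open>The degree bounds are chosen such that the half-turn integrals of all perturbations of degree \<open>n\<close> belong
to this space. For \<open>n = 1\<close> the powers of \<open>1 - s cos t\<close> in the integrands are nonnegative, so no arc part
occurs, and the polynomial has degree at most 3.\<close>

definition melnikov_space :: "nat \<Rightarrow> (real \<Rightarrow> real) \<Rightarrow> bool" where
  "melnikov_space n U \<longleftrightarrow> (\<exists>p q. degree p \<le> max 3 (3 * n - 3) \<and> degree q \<le> 3 * n - 4 \<and> (n = 1 \<longrightarrow> q = 0) \<and>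
     (\<forall>s. \<bar>s\<bar> < 1 \<longrightarrow> (1 - s\<^sup>2) ^ (n - 2) * U s = poly p s + (1 - s\<^sup>2) * arc_part s * poly q s))"

lemma melnikov_space_0: "melnikov_space n (\<lambda>s. 0)"
  unfolding melnikov_space_def by (intro exI[of _ 0]) auto

lemma melnikov_space_add:
  assumes "melnikov_space n U" "melnikov_space n V"
  shows "melnikov_space n (\<lambda>s. U s + V s)"
proof -
  from assms obtain p q p' q' where
    "degree p \<le> max 3 (3 * n - 3)" "degree q \<le> 3 * n - 4" "n = 1 \<longrightarrow> q = 0"
    "\<And>s. \<bar>s\<bar> < 1 \<Longrightarrow> (1 - s\<^sup>2) ^ (n - 2) * U s = poly p s + (1 - s\<^sup>2) * arc_part s * poly q s"
    "degree p' \<le> max 3 (3 * n - 3)" "degree q' \<le> 3 * n - 4" "n = 1 \<longrightarrow> q' = 0"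
    "\<And>s. \<bar>s\<bar> < 1 \<Longrightarrow> (1 - s\<^sup>2) ^ (n - 2) * V s = poly p' s + (1 - s\<^sup>2) * arc_part s * poly q' s"
    unfolding melnikov_space_def by blast
  note pq = this
  have "(1 - s\<^sup>2) ^ (n - 2) * (U s + V s) = poly (p + p') s + (1 - s\<^sup>2) * arc_part s * poly (q + q') s"
    if "\<bar>s\<bar> < 1" for s
    by (simp only: distrib_left poly_add pq(4,8)[OF that])
  moreover have "degree (p + p') \<le> max 3 (3 * n - 3)" "degree (q + q') \<le> 3 * n - 4" "n = 1 \<longrightarrow> q + q' = 0"
    using pq by (auto intro: degree_add_le)
  ultimately show ?thesis unfolding melnikov_space_def by blast
qed

lemma melnikov_space_cmult:
  assumes "melnikov_space n U"
  shows "melnikov_space n (\<lambda>s. c * U s)"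
proof -
  from assms obtain p q where
    "degree p \<le> max 3 (3 * n - 3)" "degree q \<le> 3 * n - 4" "n = 1 \<longrightarrow> q = 0"
    "\<And>s. \<bar>s\<bar> < 1 \<Longrightarrow> (1 - s\<^sup>2) ^ (n - 2) * U s = poly p s + (1 - s\<^sup>2) * arc_part s * poly q s"
    unfolding melnikov_space_def by blast
  note pq = this
  have "(1 - s\<^sup>2) ^ (n - 2) * (c * U s) = poly (smult c p) s + (1 - s\<^sup>2) * arc_part s * poly (smult c q) s"
    if "\<bar>s\<bar> < 1" for s
    by (simp only: mult.left_commute[of _ c] poly_smult distrib_left pq(4)[OF that])
  moreover have "degree (smult c p) \<le> max 3 (3 * n - 3)" "degree (smult c q) \<le> 3 * n - 4" "n = 1 \<longrightarrow> smult c q = 0"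
    using pq degree_smult_le[of c p] degree_smult_le[of c q] by auto
  ultimately show ?thesis unfolding melnikov_space_def by blast
qed

lemma melnikov_space_sum:
  "(\<And>i. i \<in> A \<Longrightarrow> melnikov_space n (U i)) \<Longrightarrow> melnikov_space n (\<lambda>s. \<Sum>i\<in>A. U i s)"
  by (induction A rule: infinite_finite_induct) (auto intro: melnikov_space_0 melnikov_space_add)

lemma melnikov_space_cong:
  assumes "melnikov_space n U" "\<And>s. \<bar>s\<bar> < 1 \<Longrightarrow> U s = V s"
  shows "melnikov_space n V"
  using assms unfolding melnikov_space_def by simp

definition one_minus_sq :: "real poly" where "one_minus_sq = [:1, 0, - 1:]"

lemma poly_one_minus_sq [simp]: "poly one_minus_sq s = 1 - s\<^sup>2"
  by (simp add: one_minus_sq_def power2_eq_square)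

lemma degree_one_minus_sq_power: "degree (one_minus_sq ^ k) \<le> 2 * k"
  using degree_power_le[of one_minus_sq k] by (simp add: one_minus_sq_def mult.commute)

lemma degree_one_minus_sq_power_mult: "degree (one_minus_sq ^ k * p) \<le> 2 * k + degree p"
  using degree_mult_le[of "one_minus_sq ^ k" p] degree_one_minus_sq_power[of k] by linarith

text \<open>The recursion multiplies by \<open>1 - s\<^sup>2\<close> at each step. The bound on \<open>A\<close> cannot hold for the zero
polynomial at \<open>r = 0\<close>, hence the alternative.\<close>

lemma neg_int_closed_form:
  "\<exists>A B. (A = 0 \<or> degree A + 3 \<le> 2 * Suc r) \<and> degree B \<le> 2 * r \<and>
     (\<forall>s. \<bar>s\<bar> < 1 \<longrightarrow> (1 - s\<^sup>2) ^ r * neg_int (Suc r) s = poly A s + poly B s * arc_part s)"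
proof (induction r rule: less_induct)
  case (less r)
  consider "r = 0" | "r = 1" | k where "r = Suc (Suc k)" by (metis One_nat_def not0_implies_Suc)
  then show ?case
  proof cases
    case 1
    then show ?thesis using neg_int_1 by (intro exI[of _ 0] exI[of _ 1]) auto
  next
    case 2
    have "(1 - s\<^sup>2) * neg_int 2 s = 2 * s + arc_part s" if "\<bar>s\<bar> < 1" for s
      using neg_int_rec[OF that, of 0] neg_int_1[OF that] by (simp add: numeral_2_eq_2)
    then show ?thesis using 2
      by (intro exI[of _ "[:0, 2:]"] exI[of _ 1]) (auto simp: numeral_2_eq_2)
  next
    case (3 k)
    obtain A1 B1 where 1: "A1 = 0 \<or> degree A1 + 3 \<le> 2 * Suc (Suc k)" "degree B1 \<le> 2 * Suc k"
     "\<And>s. \<bar>s\<bar> < 1 \<Longrightarrow> (1 - s\<^sup>2) ^ Suc k * neg_int (Suc (Suc k)) s = poly A1 s + poly B1 s * arc_part s"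
      using less[of "Suc k"] 3 by auto
    obtain A0 B0 where 0: "A0 = 0 \<or> degree A0 + 3 \<le> 2 * Suc k" "degree B0 \<le> 2 * k"
     "\<And>s. \<bar>s\<bar> < 1 \<Longrightarrow> (1 - s\<^sup>2) ^ k * neg_int (Suc k) s = poly A0 s + poly B0 s * arc_part s"
      using less[of k] 3 by auto
    define c where "c = 1 / real (Suc (Suc k))"
    define A where "A = smult c (one_minus_sq ^ Suc k * [:0, 2:] + smult (2 * real (Suc k) + 1) A1
       - smult (real (Suc k)) (one_minus_sq ^ 1 * A0))"
    define B where "B = smult c (smult (2 * real (Suc k) + 1) B1 - smult (real (Suc k)) (one_minus_sq ^ 1 * B0))"
    have "(1 - s\<^sup>2) ^ Suc (Suc k) * neg_int (Suc (Suc (Suc k))) s = poly A s + poly B s * arc_part s"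
      if s: "\<bar>s\<bar> < 1" for s
    proof -
      have "(1 - s\<^sup>2) ^ Suc (Suc k) * neg_int (Suc (Suc (Suc k))) s
        = c * ((1 - s\<^sup>2) ^ Suc k * (real (Suc (Suc k)) * (1 - s\<^sup>2) * neg_int (Suc (Suc (Suc k))) s))"
        by (simp add: c_def)
      also have "\<dots> = c * ((1 - s\<^sup>2) ^ Suc k * (2 * s) + (2 * real (Suc k) + 1) * ((1 - s\<^sup>2) ^ Suc k * neg_int (Suc (Suc k)) s)
         - real (Suc k) * (1 - s\<^sup>2) * ((1 - s\<^sup>2) ^ k * neg_int (Suc k) s))"
        unfolding neg_int_rec[OF s] by (simp add: algebra_simps)
      also have "\<dots> = poly A s + poly B s * arc_part s"
        unfolding 1(3)[OF s] 0(3)[OF s] by (simp add: A_def B_def algebra_simps)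
      finally show ?thesis .
    qed
    moreover have "degree A + 3 \<le> 2 * Suc r"
    proof -
      have "degree (one_minus_sq ^ Suc k * [:0, 2:]) \<le> 2 * k + 3"
        using degree_one_minus_sq_power_mult[of "Suc k" "[:0, 2:]"] by simp
      moreover have "degree (smult (2 * real (Suc k) + 1) A1) \<le> 2 * k + 3"
        using 1(1) degree_smult_le[of "2 * real (Suc k) + 1" A1] by auto
      moreover have "degree (smult (real (Suc k)) (one_minus_sq ^ 1 * A0)) \<le> 2 * k + 3"
        using 0(1) degree_smult_le[of "real (Suc k)" "one_minus_sq ^ 1 * A0"] degree_one_minus_sq_power_mult[of 1 A0]
        by auto
      ultimately have "degree A \<le> 2 * k + 3"
        unfolding A_def by (rule order_trans[OF degree_smult_le degree_diff_le[OF degree_add_le]])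
      then show ?thesis using 3 by simp
    qed
    moreover have "degree B \<le> 2 * r"
    proof -
      have "degree (smult (2 * real (Suc k) + 1) B1) \<le> 2 * r"
        using 1(2) degree_smult_le[of "2 * real (Suc k) + 1" B1] 3 by simp
      moreover have "degree (smult (real (Suc k)) (one_minus_sq ^ 1 * B0)) \<le> 2 * r"
        using 0(2) degree_smult_le[of "real (Suc k)" "one_minus_sq ^ 1 * B0"] degree_one_minus_sq_power_mult[of 1 B0] 3
        by simp
      ultimately show ?thesis
        unfolding B_def by (rule order_trans[OF degree_smult_le degree_diff_le])
    qed
    ultimately show ?thesis using 3 by blast
  qed
qed

lemma pos_int_poly:
  "\<exists>p. degree p \<le> i \<and> (\<forall>s. integral {- (pi / 2)..pi / 2} (\<lambda>t. (1 - s * cos t) ^ i) = poly p s)"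
proof -
  define c where "c l = real (i choose l) * integral {- (pi / 2)..pi / 2} (\<lambda>t. (- cos t) ^ l)" for l
  have "integral {- (pi / 2)..pi / 2} (\<lambda>t. (1 - s * cos t) ^ i) = (\<Sum>l\<le>i. c l * s ^ l)" for s
  proof -
    have "(1 - s * cos t) ^ i = (\<Sum>l\<le>i. (real (i choose l) * s ^ l) * (- cos t) ^ l)" for t
      using binomial_ring[of "- (s * cos t)" 1 i]
      by (simp add: power_mult_distrib power_minus[of "s * _"] power_minus[of "cos _"] mult_ac)
    then have "integral {- (pi / 2)..pi / 2} (\<lambda>t. (1 - s * cos t) ^ i)
      = integral {- (pi / 2)..pi / 2} (\<lambda>t. \<Sum>l\<le>i. (real (i choose l) * s ^ l) * (- cos t) ^ l)"
      by presburger
    also have "\<dots> = (\<Sum>l\<le>i. integral {- (pi / 2)..pi / 2} (\<lambda>t. (real (i choose l) * s ^ l) * (- cos t) ^ l))"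
      by (intro integral_sum integrable_continuous_real continuous_intros) auto
    finally have "integral {- (pi / 2)..pi / 2} (\<lambda>t. (1 - s * cos t) ^ i) = \<dots>" .
    then show ?thesis by (simp add: c_def mult_ac)
  qed
  then show ?thesis
    by (intro exI[of _ "\<Sum>l\<le>i. monom (c l) l"])
       (auto simp: poly_sum poly_monom intro!: degree_sum_le order_trans[OF degree_monom_le])
qed

text \<open>For \<open>j \<le> 3\<close> the integrand is a polynomial in \<open>s\<close>; for \<open>j \<ge> 4\<close> the closed form with \<open>r = j - 4\<close> applies.
The inequalities between \<open>a\<close>, \<open>j\<close> and \<open>n\<close> say that the factor \<open>(s\<^sup>2 - 1) ^ a\<close> compensates the powers of
\<open>1 - s\<^sup>2\<close> in the denominator beyond \<open>n - 2\<close>.\<close>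

lemma melnikov_space_base:
  assumes n: "n \<ge> 1" and "2 * a \<le> j" "j \<le> n + 2" "j \<le> n + 1 + a"
  shows "melnikov_space n (\<lambda>s. (s\<^sup>2 - 1) ^ a * trig_int 0 j s)"
proof (cases "j \<le> 3")
  case True
  obtain p where p: "degree p \<le> 3 - j"
    "\<And>s. integral {- (pi / 2)..pi / 2} (\<lambda>t. (1 - s * cos t) ^ (3 - j)) = poly p s"
    using pos_int_poly[of "3 - j"] by blast
  have eq: "trig_int 0 j s = poly p s" if s: "\<bar>s\<bar> < 1" for s
  proof -
    have "(1 - s * cos t) ^ 3 / (1 - s * cos t) ^ j = (1 - s * cos t) ^ (3 - j)" for t
      using one_minus_mult_cos_pos[OF s, of t] True by (simp add: power_diff)
    then show ?thesis unfolding trig_int_def p(2)[symmetric] by simp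
  qed
  define P where "P = smult ((-1) ^ a) (one_minus_sq ^ (n - 2 + a) * p)"
  have "degree P \<le> 2 * (n - 2 + a) + (3 - j)"
    unfolding P_def using degree_smult_le[of "(-1) ^ a" "one_minus_sq ^ (n - 2 + a) * p"]
      degree_one_minus_sq_power_mult[of "n - 2 + a" p] p(1) by linarith
  also have "\<dots> \<le> max 3 (3 * n - 3)" using assms True by simp
  finally have deg: "degree P \<le> max 3 (3 * n - 3)" .
  have "(1 - s\<^sup>2) ^ (n - 2) * ((s\<^sup>2 - 1) ^ a * trig_int 0 j s) = poly P s" if "\<bar>s\<bar> < 1" for s
  proof -
    have "(s\<^sup>2 - 1) ^ a = (-1) ^ a * (1 - s\<^sup>2) ^ a" by (simp add: power_mult_distrib[symmetric])
    then show ?thesis by (simp add: eq[OF that] P_def power_add mult_ac)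
  qed
  then show ?thesis unfolding melnikov_space_def
    by (intro exI[of _ P] exI[of _ 0]) (auto simp: deg)
next
  case False
  define r where "r = j - 4"
  have j: "j = r + 4" using False by (simp add: r_def)
  obtain A B where AB: "A = 0 \<or> degree A + 3 \<le> 2 * Suc r" "degree B \<le> 2 * r"
     "\<And>s. \<bar>s\<bar> < 1 \<Longrightarrow> (1 - s\<^sup>2) ^ r * neg_int (Suc r) s = poly A s + poly B s * arc_part s"
    using neg_int_closed_form[of r] by blast
  have eq: "trig_int 0 j s = neg_int (Suc r) s" if s: "\<bar>s\<bar> < 1" for s
  proof -
    have "(1 - s * cos t) ^ 3 / (1 - s * cos t) ^ j = 1 / (1 - s * cos t) ^ Suc r" for t
    proof -
      have "(1 - s * cos t) ^ j = (1 - s * cos t) ^ 3 * (1 - s * cos t) ^ Suc r"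
        unfolding j power_add[symmetric] by (rule arg_cong) simp
      then show ?thesis using one_minus_mult_cos_pos[OF s, of t] by simp
    qed
    then show ?thesis unfolding trig_int_def neg_int_def by simp
  qed
  have n2: "n \<ge> 2" using j assms by simp
  define k where "k = n + a - 3 - r"
  have k: "n - 2 + a = r + Suc k" using j assms n2 by (simp add: k_def)
  define P where "P = smult ((-1) ^ a) (one_minus_sq ^ Suc k * A)"
  define Q where "Q = smult ((-1) ^ a) (one_minus_sq ^ k * B)"
  have "degree P \<le> 3 * n - 3"
  proof (cases "A = 0")
    case False
    then have "degree P \<le> 2 * Suc k + degree A" unfolding P_def
      using degree_smult_le[of "(-1) ^ a" "one_minus_sq ^ Suc k * A"]
      degree_one_minus_sq_power_mult[of "Suc k" A] by linarith
    then show ?thesis using False AB(1) k assms n2 by simp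
  qed (simp add: P_def)
  moreover have "degree Q \<le> 3 * n - 4"
  proof -
    have "degree Q \<le> 2 * k + degree B" unfolding Q_def
      using degree_smult_le[of "(-1) ^ a" "one_minus_sq ^ k * B"]
      degree_one_minus_sq_power_mult[of k B] by linarith
    then show ?thesis using AB(2) k assms n2 by simp
  qed
  moreover have "(1 - s\<^sup>2) ^ (n - 2) * ((s\<^sup>2 - 1) ^ a * trig_int 0 j s)
     = poly P s + (1 - s\<^sup>2) * arc_part s * poly Q s" if s: "\<bar>s\<bar> < 1" for s
  proof -
    have "(s\<^sup>2 - 1) ^ a = (-1) ^ a * (1 - s\<^sup>2) ^ a" by (simp add: power_mult_distrib[symmetric])
    then have "(1 - s\<^sup>2) ^ (n - 2) * ((s\<^sup>2 - 1) ^ a * trig_int 0 j s)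
      = (-1) ^ a * ((1 - s\<^sup>2) ^ (n - 2 + a) * neg_int (Suc r) s)"
      by (simp add: eq[OF s] power_add mult_ac)
    also have "\<dots> = (-1) ^ a * ((1 - s\<^sup>2) ^ Suc k * ((1 - s\<^sup>2) ^ r * neg_int (Suc r) s))"
      unfolding k power_add by (simp add: mult_ac)
    also have "\<dots> = poly P s + (1 - s\<^sup>2) * arc_part s * poly Q s"
      unfolding AB(3)[OF s] by (simp add: P_def Q_def algebra_simps)
    finally show ?thesis .
  qed
  ultimately show ?thesis unfolding melnikov_space_def using n2
    by (intro exI[of _ P] exI[of _ Q]) auto
qed

lemma continuous_on_trig_integrand:
  assumes "\<bar>s\<bar> < (1::real)"
  shows "continuous_on A (\<lambda>t. (s * sin t) ^ i * ((1 - s * cos t) ^ k / (1 - s * cos t) ^ j))"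
  using one_minus_mult_cos_pos[OF assms] by (intro continuous_intros) (auto simp: less_imp_neq[symmetric])

lemma trig_int_odd:
  assumes "odd i"
  shows "trig_int i j s = 0"
proof -
  let ?f = "\<lambda>t. (s * sin t) ^ i * ((1 - s * cos t) ^ 3 / (1 - s * cos t) ^ j)"
  have "integral {- (pi / 2)..- (- (pi / 2))} (\<lambda>t. ?f (- t)) = integral {- (pi / 2)..pi / 2} ?f"
    using Henstock_Kurzweil_Integration.integral_reflect_real[of "pi / 2" "- (pi / 2)" ?f] by simp
  moreover have "?f (- t) = - ?f t" for t using assms by (simp add: power_minus_odd)
  ultimately show ?thesis by (simp add: trig_int_def)
qed

text \<open>With \<open>w = 1 - s cos t\<close> one has \<open>(s sin t)\<^sup>2 = (s\<^sup>2 - 1) + 2 w - w\<^sup>2\<close>, which trades two powers of the sine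
for powers of \<open>w\<close>.\<close>

lemma trig_int_step:
  assumes s: "\<bar>s\<bar> < 1" and j: "j \<ge> 2"
  shows "trig_int (i + 2) j s = (s\<^sup>2 - 1) * trig_int i j s + 2 * trig_int i (j - 1) s - trig_int i (j - 2) s"
proof -
  let ?I = "{- (pi / 2)..pi / 2}"
  let ?f = "\<lambda>j t. (s * sin t) ^ i * ((1 - s * cos t) ^ 3 / (1 - s * cos t) ^ j)"
  have int: "(?f j has_integral trig_int i j s) ?I" for j
    unfolding trig_int_def
    by (intro integrable_integral integrable_continuous_real continuous_on_trig_integrand s)
  have "((\<lambda>t. (s\<^sup>2 - 1) * ?f j t + 2 * ?f (j - 1) t - ?f (j - 2) t) has_integral
     (s\<^sup>2 - 1) * trig_int i j s + 2 * trig_int i (j - 1) s - trig_int i (j - 2) s) ?I"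
    by (intro has_integral_add has_integral_diff has_integral_mult_right int)
  moreover have "(s\<^sup>2 - 1) * ?f j t + 2 * ?f (j - 1) t - ?f (j - 2) t =
      (s * sin t) ^ (i + 2) * ((1 - s * cos t) ^ 3 / (1 - s * cos t) ^ j)" for t
  proof -
    define w where "w = 1 - s * cos t"
    have w: "w \<noteq> 0" using one_minus_mult_cos_pos[OF s, of t] by (simp add: w_def)
    have "(s * sin t)\<^sup>2 = s\<^sup>2 - (s * cos t)\<^sup>2" unfolding power_mult_distrib sin_squared_eq by (simp add: algebra_simps)
    also have "s * cos t = 1 - w" by (simp add: w_def)
    finally have ss: "(s * sin t)\<^sup>2 = (s\<^sup>2 - 1) + 2 * w - w\<^sup>2" by (simp add: power2_eq_square algebra_simps)
    obtain m where m: "j = Suc (Suc m)" using j by (metis Suc_le_D numeral_2_eq_2 Suc_le_mono)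
    have "w ^ 3 / w ^ (j - 1) = w * (w ^ 3 / w ^ j)" "w ^ 3 / w ^ (j - 2) = w\<^sup>2 * (w ^ 3 / w ^ j)"
      using w by (simp_all add: m power2_eq_square)
    note X = this
    define X where "X = w ^ 3 / w ^ j"
    define S where "S = (s * sin t) ^ i"
    have "(s * sin t) ^ (i + 2) = S * ((s\<^sup>2 - 1) + 2 * w - w\<^sup>2)" unfolding power_add ss S_def ..
    moreover have "(s\<^sup>2 - 1) * (S * X) + 2 * (S * (w * X)) - S * (w\<^sup>2 * X) = S * ((s\<^sup>2 - 1) + 2 * w - w\<^sup>2) * X"
      by (simp only: algebra_simps)
    ultimately show ?thesis unfolding w_def[symmetric] X X_def[symmetric] S_def[symmetric] by simp
  qed
  ultimately show ?thesis unfolding trig_int_def by (simp add: integral_unique)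
qed

text \<open>Each pair of sine factors either contributes a factor \<open>s\<^sup>2 - 1\<close> or lowers \<open>j\<close>; the exponent \<open>a\<close>
accumulates these factors during the induction.\<close>

lemma melnikov_space_trig_int_even:
  assumes n: "n \<ge> 1"
  shows "2 * a + 2 * k \<le> j \<Longrightarrow> j \<le> n + 2 \<Longrightarrow> j \<le> n + 1 + a + k \<Longrightarrow>
     melnikov_space n (\<lambda>s. (s\<^sup>2 - 1) ^ a * trig_int (2 * k) j s)"
proof (induction k arbitrary: a j)
  case 0
  then show ?case using melnikov_space_base[OF n, of a j] by simp
next
  case (Suc k)
  have 1: "melnikov_space n (\<lambda>s. (s\<^sup>2 - 1) ^ Suc a * trig_int (2 * k) j s)"
    by (rule Suc.IH) (use Suc.prems in auto)
  have 2: "melnikov_space n (\<lambda>s. (s\<^sup>2 - 1) ^ a * trig_int (2 * k) (j - 1) s)"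
    by (rule Suc.IH) (use Suc.prems in auto)
  have 3: "melnikov_space n (\<lambda>s. (s\<^sup>2 - 1) ^ a * trig_int (2 * k) (j - 2) s)"
    by (rule Suc.IH) (use Suc.prems in auto)
  have "melnikov_space n (\<lambda>s. ((s\<^sup>2 - 1) ^ Suc a * trig_int (2 * k) j s
      + 2 * ((s\<^sup>2 - 1) ^ a * trig_int (2 * k) (j - 1) s)) + (- 1) * ((s\<^sup>2 - 1) ^ a * trig_int (2 * k) (j - 2) s))"
    by (intro melnikov_space_add melnikov_space_cmult 1 2 3)
  then show ?case
  proof (rule melnikov_space_cong)
    fix s :: real assume s: "\<bar>s\<bar> < 1"
    have "j \<ge> 2" using Suc.prems by simp
    note step = trig_int_step[OF s this, of "2 * k"]
    have k2: "2 * Suc k = 2 * k + 2" by simp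
    show "((s\<^sup>2 - 1) ^ Suc a * trig_int (2 * k) j s
      + 2 * ((s\<^sup>2 - 1) ^ a * trig_int (2 * k) (j - 1) s)) + (- 1) * ((s\<^sup>2 - 1) ^ a * trig_int (2 * k) (j - 2) s)
      = (s\<^sup>2 - 1) ^ a * trig_int (2 * Suc k) j s"
      unfolding k2 step by (simp add: algebra_simps)
  qed
qed

lemma melnikov_space_trig_int:
  assumes "n \<ge> 1" "i \<le> j" "j \<le> n + 2" "j \<le> n + 1 \<or> i \<ge> 1"
  shows "melnikov_space n (trig_int i j)"
proof (cases "even i")
  case True
  then obtain k where i: "i = 2 * k" by blast
  have "melnikov_space n (\<lambda>s. (s\<^sup>2 - 1) ^ 0 * trig_int (2 * k) j s)"
    by (rule melnikov_space_trig_int_even) (use assms i in auto)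
  then show ?thesis by (simp add: i)
next
  case False
  then have "trig_int i j = (\<lambda>s. 0)" using trig_int_odd by blast
  then show ?thesis by (simp add: melnikov_space_0)
qed

section \<open>Zeros of functions in that space\<close>

lemma pderiv_iterate_eq_0: "degree (p :: real poly) < k \<Longrightarrow> (pderiv ^^ k) p = 0"
proof (induction k)
  case (Suc k)
  show ?case
  proof (cases "degree p < k")
    case False
    then have "degree ((pderiv ^^ k) p) = 0" using degree_pderiv_iterate[of k p] Suc.prems by simp
    then show ?thesis by (auto elim: degree_eq_zeroE simp: pderiv_pCons)
  qed (use Suc.IH in simp)
qed simp

text \<open>This is the derivative of \<open>(1 - s\<^sup>2) powr (k + 1 / 2)\<close>, by induction on \<open>k\<close>.\<close>

lemma has_real_derivative_sqrt_mult_power: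
  assumes "1 - s\<^sup>2 > 0"
  shows "((\<lambda>s. sqrt (1 - s\<^sup>2) * (1 - s\<^sup>2) ^ k) has_real_derivative
      - ((2 * real k + 1) * s * (sqrt (1 - s\<^sup>2) * (1 - s\<^sup>2) ^ k) / (1 - s\<^sup>2))) (at s)"
proof (induction k)
  case 0
  have "((\<lambda>s. sqrt (1 - s\<^sup>2)) has_real_derivative - (s * inverse (sqrt (1 - s\<^sup>2)))) (at s)"
    using assms by (auto intro!: derivative_eq_intros)
  moreover have "inverse (sqrt (1 - s\<^sup>2)) = sqrt (1 - s\<^sup>2) / (1 - s\<^sup>2)"
    using assms by (simp add: real_sqrt_divide field_simps)
  ultimately show ?case by simp
next
  case (Suc k)
  have "((\<lambda>s. (1 - s\<^sup>2) * (sqrt (1 - s\<^sup>2) * (1 - s\<^sup>2) ^ k)) has_real_derivative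
      (- (2 * s)) * (sqrt (1 - s\<^sup>2) * (1 - s\<^sup>2) ^ k)
      + - ((2 * real k + 1) * s * (sqrt (1 - s\<^sup>2) * (1 - s\<^sup>2) ^ k) / (1 - s\<^sup>2)) * (1 - s\<^sup>2)) (at s)"
    by (rule DERIV_mult[OF _ Suc.IH]) (auto intro!: derivative_eq_intros)
  moreover have "(- (2 * s)) * (sqrt (1 - s\<^sup>2) * (1 - s\<^sup>2) ^ k)
      + - ((2 * real k + 1) * s * (sqrt (1 - s\<^sup>2) * (1 - s\<^sup>2) ^ k) / (1 - s\<^sup>2)) * (1 - s\<^sup>2)
     = - ((2 * real (Suc k) + 1) * s * (sqrt (1 - s\<^sup>2) * (1 - s\<^sup>2) ^ Suc k) / (1 - s\<^sup>2))"
  proof -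
    have "(- (2 * s)) * X + - ((2 * real k + 1) * s * X / d) * d = - ((2 * real (Suc k) + 1) * s * (d * X) / d)"
      if "d > 0" for X d :: real
    proof -
      have "- (c * s * X / d) * d = - (c * s * X)" "- (c * s * (d * X) / d) = - (c * s * X)" for c
        using that by simp_all
      then show ?thesis by (simp only:) (simp add: algebra_simps)
    qed
    from this[OF assms, of "sqrt (1 - s\<^sup>2) * (1 - s\<^sup>2) ^ k"] show ?thesis
      by (simp only: power_Suc mult.left_commute[of "sqrt (1 - s\<^sup>2)" "1 - s\<^sup>2"])
  qed
  ultimately show ?case by (simp add: mult_ac)
qed

text \<open>Each derivative lowers the degrees of \<open>q1\<close> and \<open>q2\<close> and moves the derivative of the arccosine into the
algebraic part, whose numerator \<open>P k\<close> gains one degree. After \<open>N + 1\<close> derivatives only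
\<open>P (N + 1) / (1 - s\<^sup>2) powr (N + 3 / 2)\<close> is left, with a numerator of degree at most \<open>2 (N + 1)\<close>; Rolle's
theorem adds \<open>N + 1\<close> zeros.\<close>

lemma zeros_le_sqrt_poly_arccos:
  fixes p q1 q2 :: "real poly"
  assumes "degree p \<le> Suc N" "degree q1 \<le> N" "degree q2 \<le> N"
  defines "E \<equiv> \<lambda>s. poly p s / sqrt (1 - s\<^sup>2) + poly q1 s + poly q2 s * arccos s"
  shows "zeros_le E {0<..<1} (3 * Suc N) \<or> (\<forall>s\<in>{0<..<1}. E s = 0)"
proof -
  define P where "P = rec_nat p (\<lambda>k r. one_minus_sq ^ 1 * pderiv r + smult (2 * real k + 1) ([:0, 1:] * r)
     - one_minus_sq ^ Suc k * (pderiv ^^ k) q2)"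
  have P0: "P 0 = p" and PS: "P (Suc k) = one_minus_sq ^ 1 * pderiv (P k) + smult (2 * real k + 1) ([:0, 1:] * P k)
     - one_minus_sq ^ Suc k * (pderiv ^^ k) q2" for k
    by (simp_all add: P_def)
  have degP: "degree (P k) \<le> Suc N + k" for k
  proof (induction k)
    case 0
    then show ?case using assms(1) by (simp add: P0)
  next
    case (Suc k)
    have 1: "degree (one_minus_sq ^ 1 * pderiv (P k)) \<le> Suc N + Suc k"
    proof (cases "degree (P k) = 0")
      case True
      then have "pderiv (P k) = 0" by (simp add: pderiv_eq_0_iff)
      then show ?thesis by simp
    next
      case False
      then show ?thesis using degree_one_minus_sq_power_mult[of 1 "pderiv (P k)"] Suc.IH
        by (simp add: degree_pderiv)
    qed
    have 2: "degree (smult (2 * real k + 1) ([:0, 1:] * P k)) \<le> Suc N + Suc k"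
      using Suc.IH degree_smult_le[of "2 * real k + 1" "[:0, 1:] * P k"] degree_mult_le[of "[:0, 1:]" "P k"]
      by simp
    have 3: "degree (one_minus_sq ^ Suc k * (pderiv ^^ k) q2) \<le> Suc N + Suc k"
    proof (cases "degree q2 < k")
      case True
      then show ?thesis by (simp add: pderiv_iterate_eq_0)
    next
      case False
      then show ?thesis
        using degree_one_minus_sq_power_mult[of "Suc k" "(pderiv ^^ k) q2"] assms(3)
        by (simp add: degree_pderiv_iterate)
    qed
    show ?case unfolding PS by (intro degree_diff_le degree_add_le 1 2 3)
  qed
  define G where "G k s = sqrt (1 - s\<^sup>2) * (1 - s\<^sup>2) ^ k" for k and s :: real
  define D where "D k s = poly (P k) s / G k s + poly ((pderiv ^^ k) q1) s + poly ((pderiv ^^ k) q2) s * arccos s" for k s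
  have pos: "1 - s\<^sup>2 > 0" if "s \<in> {0<..<1}" for s :: real
    using that by (intro one_minus_square_pos) auto
  have G: "G k s > 0" if "s \<in> {0<..<1}" for k s using pos[OF that] by (simp add: G_def)
  have tow: "tower D {0<..<1}"
    unfolding tower_def
  proof (intro allI ballI)
    fix k and s :: real assume s: "s \<in> {0<..<1}"
    let ?d = "1 - s\<^sup>2"
    have G': "(G k has_real_derivative - ((2 * real k + 1) * s * G k s / ?d)) (at s)"
      unfolding G_def [abs_def] using has_real_derivative_sqrt_mult_power[OF pos[OF s]] .
    have acos: "(arccos has_real_derivative inverse (- sqrt ?d)) (at s)"
      using s by (intro DERIV_arccos) auto
    have d1: "(D k has_real_derivative
       (poly (pderiv (P k)) s * G k s - poly (P k) s * (- ((2 * real k + 1) * s * G k s / ?d))) / (G k s * G k s)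
       + poly (pderiv ((pderiv ^^ k) q1)) s
       + (poly (pderiv ((pderiv ^^ k) q2)) s * arccos s + inverse (- sqrt ?d) * poly ((pderiv ^^ k) q2) s)) (at s)"
      unfolding D_def [abs_def]
      by (intro DERIV_add DERIV_mult DERIV_divide poly_DERIV G' acos) (use G[OF s, of k] in simp)
    have d2: "(poly (pderiv (P k)) s * G k s - poly (P k) s * (- ((2 * real k + 1) * s * G k s / ?d))) / (G k s * G k s)
       + inverse (- sqrt ?d) * poly ((pderiv ^^ k) q2) s = poly (P (Suc k)) s / G (Suc k) s"
    proof -
      have "inverse (- sqrt ?d) = - (?d ^ k / G k s)" using pos[OF s] by (simp add: G_def field_simps)
      moreover have "(poly (pderiv (P k)) s * G k s - poly (P k) s * (- ((2 * real k + 1) * s * G k s / ?d))) / (G k s * G k s)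
        = (poly (pderiv (P k)) s + (2 * real k + 1) * s * poly (P k) s / ?d) / G k s"
      proof -
        have "poly (pderiv (P k)) s * G k s - poly (P k) s * (- ((2 * real k + 1) * s * G k s / ?d))
          = (poly (pderiv (P k)) s + (2 * real k + 1) * s * poly (P k) s / ?d) * G k s"
          by (simp add: algebra_simps)
        then show ?thesis using G[OF s, of k] by simp
      qed
      moreover have "poly (P (Suc k)) s / G (Suc k) s
        = (poly (P (Suc k)) s / ?d) / G k s"
        by (simp add: G_def mult_ac)
      moreover have "poly (P (Suc k)) s / ?d
        = poly (pderiv (P k)) s + (2 * real k + 1) * s * poly (P k) s / ?d - ?d ^ k * poly ((pderiv ^^ k) q2) s"
        unfolding PS using pos[OF s] by (simp add: diff_divide_distrib add_divide_distrib mult_ac)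
      ultimately show ?thesis by (simp add: add_divide_distrib diff_divide_distrib)
    qed
    have "D (Suc k) s = poly (P (Suc k)) s / G (Suc k) s + poly (pderiv ((pderiv ^^ k) q1)) s
       + poly (pderiv ((pderiv ^^ k) q2)) s * arccos s" by (simp add: D_def)
    then show "(D k has_real_derivative D (Suc k) s) (at s)"
      using d2 by (intro DERIV_cong[OF d1]) linarith
  qed
  let ?K = "Suc N"
  have DK: "D ?K s = poly (P ?K) s / G ?K s" for s
    using assms(2,3) by (simp add: D_def pderiv_iterate_eq_0 del: funpow.simps)
  have "zeros_le (D ?K) {0<..<1} (2 * ?K) \<or> (\<forall>s\<in>{0<..<1}. D ?K s = 0)"
  proof (rule zeros_le_factor)
    show "zeros_le (poly (P ?K)) {0<..<1} (2 * ?K) \<or> (\<forall>s\<in>{0<..<1}. poly (P ?K) s = 0)"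
      by (rule zeros_le_poly) (use degP[of ?K] in simp)
    fix s :: real assume s: "s \<in> {0<..<1}"
    show "poly (P ?K) s = G ?K s * D ?K s" using G[OF s, of ?K] by (simp add: DK)
    show "isCont (G ?K) s \<and> G ?K s \<noteq> 0" using G[OF s, of ?K]
      by (auto simp: G_def [abs_def] intro!: continuous_intros)
  qed simp
  from tower_Rolle[OF tow this]
  have "zeros_le (D 0) {0<..<1} (2 * ?K + ?K) \<or> (\<forall>s\<in>{0<..<1}. D 0 s = 0)" .
  moreover have "2 * ?K + ?K = 3 * ?K" by simp
  moreover have "D 0 = E" by (simp add: D_def E_def G_def P0 fun_eq_iff)
  ultimately show ?thesis by metis
qed

text \<open>The reflection turns \<open>arccos (- s)\<close> in the arc part of \<open>V\<close> into \<open>arccos s = pi - arccos (- s)\<close>, so that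
both functions together involve a single arccosine.\<close>

lemma melnikov_space_zeros_le:
  assumes n: "n \<ge> 1" and U: "melnikov_space n U" and V: "melnikov_space n V"
  defines "F \<equiv> \<lambda>s. U s + V (- s)"
  shows "zeros_le F {0<..<1} (9 * n - 6) \<or> (\<forall>s\<in>{0<..<1}. F s = 0)"
proof -
  from U V obtain p q p' q' where
    pq: "degree p \<le> max 3 (3 * n - 3)" "degree q \<le> 3 * n - 4" "n = 1 \<longrightarrow> q = 0"
    "\<And>s. \<bar>s\<bar> < 1 \<Longrightarrow> (1 - s\<^sup>2) ^ (n - 2) * U s = poly p s + (1 - s\<^sup>2) * arc_part s * poly q s"
    "degree p' \<le> max 3 (3 * n - 3)" "degree q' \<le> 3 * n - 4" "n = 1 \<longrightarrow> q' = 0"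
    "\<And>s. \<bar>s\<bar> < 1 \<Longrightarrow> (1 - s\<^sup>2) ^ (n - 2) * V s = poly p' s + (1 - s\<^sup>2) * arc_part s * poly q' s"
    unfolding melnikov_space_def by blast
  define m where "m = [:0, -1 :: real:]"
  define P where "P = p + pcompose p' m"
  have degm: "degree (pcompose r m) = degree r" for r by (simp add: degree_pcompose m_def)
  have degP: "degree P \<le> max 3 (3 * n - 3)" unfolding P_def using pq by (intro degree_add_le) (auto simp: degm)
  show ?thesis
  proof (cases "n = 1")
    case True
    have FP: "F s = poly P s" if "s \<in> {0<..<1}" for s
    proof -
      have "q = 0" "q' = 0" using pq(3,7) True by auto
      then show ?thesis using pq(4)[of s] pq(8)[of "- s"] that
        by (simp add: F_def P_def poly_pcompose m_def True)
    qed
    have zP: "zeros_le (poly P) {0<..<1} 3 \<or> (\<forall>s\<in>{0<..<1}. poly P s = 0)"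
      by (rule zeros_le_poly) (use degP True in simp)
    have "zeros_le F {0<..<1} 3 \<or> (\<forall>s\<in>{0<..<1}. F s = 0)"
      by (rule zeros_le_factor[OF zP, where u = "\<lambda>_. 1"]) (simp_all add: FP)
    then show ?thesis using True by simp
  next
    case False
    then have n2: "n \<ge> 2" using n by simp
    define q1 where "q1 = smult (2 * pi) q"
    define q2 where "q2 = smult 2 (pcompose q' m) - smult 2 q"
    define E where "E s = poly P s / sqrt (1 - s\<^sup>2) + poly q1 s + poly q2 s * arccos s" for s
    have EF: "E s = ((1 - s\<^sup>2) ^ (n - 2) / sqrt (1 - s\<^sup>2)) * F s" and pos: "1 - s\<^sup>2 > 0" if s: "s \<in> {0<..<1}" for s
    proof -
      show d: "1 - s\<^sup>2 > 0" using s by (intro one_minus_square_pos) auto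
      define R where "R = sqrt (1 - s\<^sup>2)"
      have R: "R > 0" "1 - s\<^sup>2 = R * R" using d by (simp_all add: R_def)
      have acos: "arccos (- s) = pi - arccos s" using s by (intro arccos_minus) auto
      have "(1 - s\<^sup>2) ^ (n - 2) * F s = (poly p s + (1 - s\<^sup>2) * arc_part s * poly q s)
        + (poly p' (- s) + (1 - s\<^sup>2) * arc_part (- s) * poly q' (- s))"
        using pq(4)[of s] pq(8)[of "- s"] s by (simp add: F_def distrib_left)
      also have "\<dots> = poly P s + (R * R) * (2 * (pi - arccos s) / R) * poly q s
        + (R * R) * (2 * arccos s / R) * poly q' (- s)"
        unfolding arc_part_def power2_minus R_def[symmetric] acos minus_minus
        unfolding R(2) by (simp add: P_def poly_pcompose m_def)
      also have "\<dots> = R * E s"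
      proof -
        have RR: "R * R * (c / R) = R * c" for c using R(1) by simp
        have "R * E s = poly P s + R * (2 * pi * poly q s + (2 * poly q' (- s) - 2 * poly q s) * arccos s)"
          using R(1) by (simp add: E_def q1_def q2_def poly_pcompose m_def R_def[symmetric] distrib_left)
        then show ?thesis unfolding RR by (simp add: algebra_simps)
      qed
      finally show "E s = ((1 - s\<^sup>2) ^ (n - 2) / sqrt (1 - s\<^sup>2)) * F s"
        unfolding R_def[symmetric] using R(1) by (simp add: nonzero_eq_divide_eq mult.commute)
    qed
    have "zeros_le E {0<..<1} (3 * Suc (3 * n - 4)) \<or> (\<forall>s\<in>{0<..<1}. E s = 0)"
      unfolding E_def [abs_def]
    proof (rule zeros_le_sqrt_poly_arccos)
      show "degree P \<le> Suc (3 * n - 4)" using degP n2 by simp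
      show "degree q1 \<le> 3 * n - 4" unfolding q1_def using pq(2) degree_smult_le order_trans by blast
      show "degree q2 \<le> 3 * n - 4" unfolding q2_def
        using pq(2,6) degree_smult_le[of 2 q] degree_smult_le[of 2 "pcompose q' m"]
        by (intro degree_diff_le) (auto simp: degm)
    qed
    then have "zeros_le F {0<..<1} (3 * Suc (3 * n - 4)) \<or> (\<forall>s\<in>{0<..<1}. F s = 0)"
    proof (rule zeros_le_factor)
      fix s :: real assume s: "s \<in> {0<..<1}"
      show "E s = ((1 - s\<^sup>2) ^ (n - 2) / sqrt (1 - s\<^sup>2)) * F s" by (rule EF[OF s])
      show "isCont (\<lambda>s. (1 - s\<^sup>2) ^ (n - 2) / sqrt (1 - s\<^sup>2)) s \<and> (1 - s\<^sup>2) ^ (n - 2) / sqrt (1 - s\<^sup>2) \<noteq> 0"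
        using pos[OF s] by (auto intro!: continuous_intros)
    qed simp
    moreover have "3 * Suc (3 * n - 4) \<le> 9 * n - 6" using n2 by simp
    ultimately show ?thesis using zeros_le_mono by blast
  qed
qed

section \<open>Polar components of a polynomial perturbation\<close>

text \<open>The type of the values is left open because the same formulas are used with real
and with complex radius.\<close>

definition bipoly :: "nat \<Rightarrow> (nat \<Rightarrow> nat \<Rightarrow> real) \<Rightarrow> 'a \<Rightarrow> 'a \<Rightarrow> 'a::real_normed_field" where
  "bipoly n c x y = (\<Sum>i\<le>n. \<Sum>j\<le>n - i. of_real (c i j) * x ^ i * y ^ j)"

text \<open>The velocity \<open>(f, g)\<close> at the point with \<open>\<zeta> = C + \<i> S\<close> changes \<open>\<zeta>\<close> with the velocity
\<open>(\<eta> g + \<i> \<omega> (f y - x g)) / y\<^sup>2\<close>. Its inner products with the radial and the rotated radial vector, for \<open>f\<close> and \<open>g\<close>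
with the coefficients \<open>c\<close> and \<open>d\<close>, are the radial and the angular rate; if \<open>\<zeta> = s cis \<theta>\<close>, they contribute
\<open>radial_rate / s\<close> to \<open>s'\<close> and \<open>angular_rate / s\<^sup>2\<close> to \<open>\<theta>'\<close>.\<close>

definition radial_rate ::
  "real \<Rightarrow> nat \<Rightarrow> (nat \<Rightarrow> nat \<Rightarrow> real) \<Rightarrow> (nat \<Rightarrow> nat \<Rightarrow> real) \<Rightarrow> 'a \<Rightarrow> 'a \<Rightarrow> 'a::real_normed_field" where
  "radial_rate \<eta> n c d C S =
     (let x = of_real (\<eta> / sqrt (2 * \<eta>)) * S / (1 - C); y = of_real \<eta> / (1 - C)
      in (of_real \<eta> * bipoly n d x y * C + of_real (sqrt (2 * \<eta>)) * (bipoly n c x y * y - x * bipoly n d x y) * S) / y\<^sup>2)"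

definition angular_rate ::
  "real \<Rightarrow> nat \<Rightarrow> (nat \<Rightarrow> nat \<Rightarrow> real) \<Rightarrow> (nat \<Rightarrow> nat \<Rightarrow> real) \<Rightarrow> 'a \<Rightarrow> 'a \<Rightarrow> 'a::real_normed_field" where
  "angular_rate \<eta> n c d C S =
     (let x = of_real (\<eta> / sqrt (2 * \<eta>)) * S / (1 - C); y = of_real \<eta> / (1 - C)
      in (of_real (sqrt (2 * \<eta>)) * (bipoly n c x y * y - x * bipoly n d x y) * C - of_real \<eta> * bipoly n d x y * S) / y\<^sup>2)"

lemma radial_rate_expand:
  fixes S C :: real
  assumes \<eta>: "\<eta> > 0" and w: "1 - C \<noteq> 0"
  defines "T \<equiv> \<lambda>i j. S ^ i * ((1 - C) ^ 3 / (1 - C) ^ j)"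
  shows "radial_rate \<eta> n c d C S = (\<Sum>i\<le>n. \<Sum>j\<le>n - i. ((\<eta> / sqrt (2 * \<eta>)) ^ i * \<eta> ^ j / \<eta>) *
     (sqrt (2 * \<eta>) * c i j * T (i + 1) (i + j + 2)
       + d i j * (T i (i + j + 1) - T i (i + j) - T (i + 2) (i + j + 2))))"
proof -
  define \<omega> where "\<omega> = sqrt (2 * \<eta>)"
  have \<omega>: "\<omega> \<noteq> 0" using \<eta> by (simp add: \<omega>_def)
  define W where "W = 1 - C"
  have W: "W \<noteq> 0" and C: "C = 1 - W" using w by (simp_all add: W_def)
  define x where "x = \<eta> / \<omega> * S / W"
  define y where "y = \<eta> / W"
  have y: "y \<noteq> 0" using \<eta> W by (simp add: y_def)
  have "radial_rate \<eta> n c d C S =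
     (\<eta> * bipoly n d x y * C + \<omega> * (bipoly n c x y * y - x * bipoly n d x y) * S) / y\<^sup>2"
    by (simp add: radial_rate_def Let_def x_def y_def \<omega>_def W_def)
  also have "\<dots> = bipoly n c x y * (\<omega> * S / y) + bipoly n d x y * ((\<eta> * C - \<omega> * x * S) / y\<^sup>2)"
    using y by (simp add: field_simps power2_eq_square)
  also have "\<dots> = (\<Sum>i\<le>n. \<Sum>j\<le>n - i. c i j * x ^ i * y ^ j * (\<omega> * S / y) + d i j * x ^ i * y ^ j * ((\<eta> * C - \<omega> * x * S) / y\<^sup>2))"
    by (simp add: bipoly_def sum_distrib_right sum.distrib del: times_divide_eq_right)
  also have "\<dots> = (\<Sum>i\<le>n. \<Sum>j\<le>n - i. ((\<eta> / \<omega>) ^ i * \<eta> ^ j / \<eta>) *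
     (\<omega> * c i j * T (i + 1) (i + j + 2)
       + d i j * (T i (i + j + 1) - T i (i + j) - T (i + 2) (i + j + 2))))"
  proof (intro sum.cong refl)
    fix i j
    define k where "k = (\<eta> / \<omega>) ^ i * \<eta> ^ j / \<eta>"
    define v where "v = 1 / W ^ (i + j)"
    have xy: "x ^ i * y ^ j = k * \<eta> * S ^ i * v"
      using \<eta> by (simp add: x_def y_def k_def v_def power_mult_distrib power_divide power_add mult_ac)
    have T: "T (i + 1) (i + j + 2) = S * S ^ i * (W * v)" "T i (i + j + 1) = S ^ i * (W\<^sup>2 * v)"
       "T i (i + j) = S ^ i * (W ^ 3 * v)" "T (i + 2) (i + j + 2) = S\<^sup>2 * S ^ i * (W * v)"
      using W by (simp_all add: T_def W_def[symmetric] v_def power_add power2_eq_square power3_eq_cube)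
    have "\<omega> * S / y = \<omega> * S * W / \<eta>" by (simp add: y_def)
    then have 1: "x ^ i * y ^ j * (\<omega> * S / y) = k * (\<omega> * T (i + 1) (i + j + 2))"
      unfolding xy T using \<eta> by simp
    have "(\<eta> * C - \<omega> * x * S) / y\<^sup>2 = (C * W\<^sup>2 - S\<^sup>2 * W) / \<eta>"
    proof -
      have "\<eta> * C - \<omega> * x * S = \<eta> * (C - S\<^sup>2 / W)"
        using \<omega> by (simp add: x_def power2_eq_square algebra_simps)
      then have "(\<eta> * C - \<omega> * x * S) / y\<^sup>2 = (C - S\<^sup>2 / W) * W\<^sup>2 / \<eta>"
        using \<eta> by (simp add: y_def power_divide power2_eq_square[of \<eta>])
      also have "(C - S\<^sup>2 / W) * W\<^sup>2 = C * W\<^sup>2 - S\<^sup>2 * W"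
        using W by (simp add: left_diff_distrib power2_eq_square)
      finally show ?thesis .
    qed
    then have "x ^ i * y ^ j * ((\<eta> * C - \<omega> * x * S) / y\<^sup>2) = k * (S ^ i * v * (C * W\<^sup>2 - S\<^sup>2 * W))"
      unfolding xy using \<eta> by simp
    also have "\<dots> = k * (T i (i + j + 1) - T i (i + j) - T (i + 2) (i + j + 2))"
      unfolding T C by (simp add: algebra_simps power2_eq_square power3_eq_cube)
    finally have 2: "x ^ i * y ^ j * ((\<eta> * C - \<omega> * x * S) / y\<^sup>2) = \<dots>" .
    show "c i j * x ^ i * y ^ j * (\<omega> * S / y) + d i j * x ^ i * y ^ j * ((\<eta> * C - \<omega> * x * S) / y\<^sup>2)
      = ((\<eta> / \<omega>) ^ i * \<eta> ^ j / \<eta>) * (\<omega> * c i j * T (i + 1) (i + j + 2)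
       + d i j * (T i (i + j + 1) - T i (i + j) - T (i + 2) (i + j + 2)))"
    proof -
      have "c i j * x ^ i * y ^ j * (\<omega> * S / y) + d i j * x ^ i * y ^ j * ((\<eta> * C - \<omega> * x * S) / y\<^sup>2)
        = c i j * (x ^ i * y ^ j * (\<omega> * S / y)) + d i j * (x ^ i * y ^ j * ((\<eta> * C - \<omega> * x * S) / y\<^sup>2))"
        by (simp only: mult.assoc)
      then show ?thesis unfolding 1 2 k_def[symmetric] by (simp add: algebra_simps)
    qed
  qed
  finally show ?thesis by (simp add: \<omega>_def)
qed

lemma melnikov_space_radial_rate:
  assumes \<eta>: "\<eta> > 0" and n: "n \<ge> 1"
  shows "melnikov_space n (\<lambda>s. integral {- (pi / 2)..pi / 2} (\<lambda>t. radial_rate \<eta> n c d (s * cos t) (s * sin t)))"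
proof -
  define k where "k i j = (\<eta> / sqrt (2 * \<eta>)) ^ i * \<eta> ^ j / \<eta>" for i j
  define V where "V s = (\<Sum>i\<le>n. \<Sum>j\<le>n - i. k i j * (sqrt (2 * \<eta>) * c i j * trig_int (i + 1) (i + j + 2) s
       + d i j * (trig_int i (i + j + 1) s - trig_int i (i + j) s - trig_int (i + 2) (i + j + 2) s)))" for s
  have T: "melnikov_space n (\<lambda>s. k i j * (sqrt (2 * \<eta>) * c i j * trig_int (i + 1) (i + j + 2) s
       + d i j * (trig_int i (i + j + 1) s - trig_int i (i + j) s - trig_int (i + 2) (i + j + 2) s)))"
    if ij: "i \<le> n" "j \<le> n - i" for i j
  proof -
    have t: "melnikov_space n (trig_int (i + 1) (i + j + 2))" "melnikov_space n (trig_int i (i + j + 1))"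
      "melnikov_space n (trig_int i (i + j))" "melnikov_space n (trig_int (i + 2) (i + j + 2))"
      by (rule melnikov_space_trig_int[OF n]; use ij in linarith)+
    have "melnikov_space n (\<lambda>s. trig_int i (i + j + 1) s + (- 1) * trig_int i (i + j) s + (- 1) * trig_int (i + 2) (i + j + 2) s)"
      by (rule melnikov_space_add[OF melnikov_space_add[OF t(2) melnikov_space_cmult[OF t(3)]] melnikov_space_cmult[OF t(4)]])
    from melnikov_space_cmult[OF melnikov_space_add[OF melnikov_space_cmult[OF t(1), of "sqrt (2 * \<eta>) * c i j"]
        melnikov_space_cmult[OF this, of "d i j"]], of "k i j"]
    show ?thesis by simp
  qed
  have "melnikov_space n V"
    unfolding V_def [abs_def] by (rule melnikov_space_sum, rule melnikov_space_sum, rule T) simp_all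
  then show ?thesis
  proof (rule melnikov_space_cong)
    fix s :: real assume s: "\<bar>s\<bar> < 1"
    let ?T = "\<lambda>i j t. (s * sin t) ^ i * ((1 - s * cos t) ^ 3 / (1 - s * cos t) ^ j)"
    have int: "(?T i j has_integral trig_int i j s) {- (pi / 2)..pi / 2}" for i j
      unfolding trig_int_def
      by (intro integrable_integral integrable_continuous_real continuous_on_trig_integrand s)
    have "((\<lambda>t. \<Sum>i\<le>n. \<Sum>j\<le>n - i. k i j * (sqrt (2 * \<eta>) * c i j * ?T (i + 1) (i + j + 2) t
       + d i j * (?T i (i + j + 1) t - ?T i (i + j) t - ?T (i + 2) (i + j + 2) t))) has_integral V s) {- (pi / 2)..pi / 2}"
      unfolding V_def
      by (intro has_integral_sum has_integral_mult_right has_integral_add has_integral_diff int) auto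
    moreover have "radial_rate \<eta> n c d (s * cos t) (s * sin t) =
       (\<Sum>i\<le>n. \<Sum>j\<le>n - i. k i j * (sqrt (2 * \<eta>) * c i j * ?T (i + 1) (i + j + 2) t
       + d i j * (?T i (i + j + 1) t - ?T i (i + j) t - ?T (i + 2) (i + j + 2) t)))" for t
      unfolding k_def using one_minus_mult_cos_pos[OF s, of t]
      by (intro radial_rate_expand \<eta>) simp
    ultimately have "((\<lambda>t. radial_rate \<eta> n c d (s * cos t) (s * sin t)) has_integral V s) {- (pi / 2)..pi / 2}"
      by presburger
    then show "V s = integral {- (pi / 2)..pi / 2} (\<lambda>t. radial_rate \<eta> n c d (s * cos t) (s * sin t))"
      by (simp add: integral_unique)
  qed
qed

section \<open>The Melnikov function as a sum of two half-turn integrals\<close>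

definition half_int ::
  "real \<Rightarrow> nat \<Rightarrow> (nat \<Rightarrow> nat \<Rightarrow> real) \<Rightarrow> (nat \<Rightarrow> nat \<Rightarrow> real) \<Rightarrow> real \<Rightarrow> real" where
  "half_int \<eta> n c d s = integral {- (pi / 2)..pi / 2} (\<lambda>t. radial_rate \<eta> n c d (s * cos t) (s * sin t))"

lemma continuous_on_radial_rate [continuous_intros]:
  fixes C S :: "'b::topological_space \<Rightarrow> 'a::real_normed_field"
  assumes "continuous_on A C" "continuous_on A S" "\<And>t. t \<in> A \<Longrightarrow> C t \<noteq> 1" "\<eta> \<noteq> 0"
  shows "continuous_on A (\<lambda>t. radial_rate \<eta> n c d (C t) (S t))"
proof -
  have "1 - C t \<noteq> 0" if "t \<in> A" for t using assms(3)[OF that] by simp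
  then show ?thesis
    unfolding radial_rate_def Let_def bipoly_def
    by (intro continuous_intros assms(1,2)) (simp_all add: assms(4))
qed

lemma continuous_on_radial_rate_polar:
  assumes "\<bar>s\<bar> < (1::real)" "\<eta> > 0"
  shows "continuous_on A (\<lambda>t. radial_rate \<eta> n c d (s * cos t) (s * sin t))"
proof -
  have "s * cos t \<noteq> 1" for t using one_minus_mult_cos_pos[OF assms(1), of t] by simp
  then show ?thesis using assms(2) by (intro continuous_on_radial_rate continuous_intros) simp_all
qed

lemma half_int_upper:
  fixes n :: nat and c d :: "nat \<Rightarrow> nat \<Rightarrow> real" and s \<eta> :: real
  assumes "\<bar>s\<bar> < 1" "\<eta> > 0"
  defines "R \<equiv> \<lambda>t. radial_rate \<eta> n c d (s * cos t) (s * sin t)"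
  shows "half_int \<eta> n c d s = integral {0..pi / 2} R + integral {3 * pi / 2..2 * pi} R"
proof -
  have int: "R integrable_on {a..b}" for a b
    unfolding R_def by (intro integrable_continuous_real continuous_on_radial_rate_polar assms)
  have "integral {- (pi / 2)..0} R = integral {- (pi / 2) + 2 * pi..0 + 2 * pi} R"
  proof -
    have "R \<circ> (+) (2 * pi) = R" by (simp add: R_def fun_eq_iff sin_add cos_add)
    then show ?thesis
      using Henstock_Kurzweil_Integration.integral_shift_Icc_real[of "- (pi / 2)" 0 R "2 * pi"] by simp
  qed
  moreover have "integral {- (pi / 2)..0} R + integral {0..pi / 2} R = integral {- (pi / 2)..pi / 2} R"
    by (intro Henstock_Kurzweil_Integration.integral_combine int) auto
  moreover have "- (pi / 2) + 2 * pi = 3 * pi / 2" by simp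
  ultimately show ?thesis by (simp add: half_int_def R_def)
qed

lemma half_int_lower:
  fixes n :: nat and c d :: "nat \<Rightarrow> nat \<Rightarrow> real" and s \<eta> :: real
  assumes "\<bar>s\<bar> < 1" "\<eta> > 0"
  defines "R \<equiv> \<lambda>t. radial_rate \<eta> n c d (s * cos t) (s * sin t)"
  shows "half_int \<eta> n c d (- s) = integral {pi / 2..3 * pi / 2} R"
proof -
  have "R \<circ> (+) pi = (\<lambda>t. radial_rate \<eta> n c d (- s * cos t) (- s * sin t))"
    by (simp add: R_def fun_eq_iff sin_add cos_add)
  then show ?thesis
    using Henstock_Kurzweil_Integration.integral_shift_Icc_real[of "- (pi / 2)" "pi / 2" R pi]
    by (simp add: half_int_def)
qed

lemma L_path_anomaly:
  assumes \<eta>: "\<eta> > 0" and s: "0 < s" "s < 1" and h: "h = (s\<^sup>2 - 1) / (2 * \<eta>)"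
  shows "L_path \<eta> h \<phi> = (\<eta> / sqrt (2 * \<eta>) * s / sqrt (1 - s\<^sup>2) * sin \<phi>, \<eta> / (1 - s\<^sup>2) * (1 + s * cos \<phi>))"
proof -
  have D: "1 - s\<^sup>2 > 0" using s by (intro one_minus_square_pos) auto
  define a where "a = sqrt (- 1 / (4 * h) - \<eta> / 2)"
  have 1: "- 1 / (2 * h) = \<eta> / (1 - s\<^sup>2)" using \<eta> D by (simp add: h field_simps)
  have 2: "- 1 / (4 * h) - \<eta> / 2 = \<eta> / 2 * (s\<^sup>2 / (1 - s\<^sup>2))" using \<eta> D by (simp add: h field_simps)
  have a: "a = sqrt (\<eta> / 2) * (s / sqrt (1 - s\<^sup>2))" unfolding a_def 2
    unfolding real_sqrt_mult real_sqrt_divide[of "s\<^sup>2"] real_sqrt_abs using s by simp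
  have \<eta>2: "sqrt (\<eta> / 2) = \<eta> / sqrt (2 * \<eta>)"
  proof -
    have "sqrt (\<eta> / 2) * sqrt (2 * \<eta>) = sqrt (\<eta> * \<eta>)" unfolding real_sqrt_mult[symmetric] by simp
    then show ?thesis using \<eta> by (simp add: field_simps)
  qed
  have "sqrt (- h) = sqrt (1 - s\<^sup>2) / sqrt (2 * \<eta>)"
    unfolding real_sqrt_divide[symmetric] by (simp add: h minus_divide_left)
  note sh = this
  have "a / sqrt (- h) = \<eta> * s / (sqrt (1 - s\<^sup>2) * sqrt (1 - s\<^sup>2))"
  proof -
    have "(\<eta> / \<Omega> * (s / R)) / (R / \<Omega>) = \<eta> * s / (R * R)" if "\<Omega> > 0" "R > 0" for R \<Omega> :: real
      using that by simp
    then have "(\<eta> / sqrt (2 * \<eta>) * (s / sqrt (1 - s\<^sup>2))) / (sqrt (1 - s\<^sup>2) / sqrt (2 * \<eta>))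
      = \<eta> * s / (sqrt (1 - s\<^sup>2) * sqrt (1 - s\<^sup>2))"
      using \<eta> D by (metis mult_pos_pos real_sqrt_gt_zero zero_less_numeral)
    then show ?thesis unfolding a \<eta>2 sh .
  qed
  also have "\<dots> = \<eta> * s / (1 - s\<^sup>2)" using D by simp
  finally have b: "a / sqrt (- h) = \<eta> / (1 - s\<^sup>2) * s" by simp
  have "L_path \<eta> h \<phi> = (a * sin \<phi>, - 1 / (2 * h) + a / sqrt (- h) * cos \<phi>)"
    by (simp add: L_path_def Let_def a_def)
  then show ?thesis unfolding 1 b unfolding a \<eta>2 by (simp add: algebra_simps add_divide_distrib)
qed

text \<open>The parameter sets of the four arcs of an orbit, where \<open>\<alpha>\<close> is the first angle at which it crosses the
switching line.\<close>

lemma Collect_cos_greater: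
  assumes "0 < \<alpha>" "\<alpha> < pi"
  shows "{t \<in> {0..2 * pi}. sin t > 0 \<and> cos t > cos \<alpha>} = {0<..<\<alpha>}"
    and "{t \<in> {0..2 * pi}. sin t > 0 \<and> cos t < cos \<alpha>} = {\<alpha><..<pi}"
    and "{t \<in> {0..2 * pi}. sin t < 0 \<and> cos t < cos \<alpha>} = {pi<..<2 * pi - \<alpha>}"
    and "{t \<in> {0..2 * pi}. sin t < 0 \<and> cos t > cos \<alpha>} = {2 * pi - \<alpha><..<2 * pi}"
proof -
  have sp: "sin t > 0 \<longleftrightarrow> 0 < t \<and> t < pi" if "0 \<le> t" "t \<le> 2 * pi" for t
    using that sin_gt_zero[of t] sin_le_zero[of t] by (cases "t = 2 * pi"; cases "t = 0"; cases "t < pi") force+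
  have sn: "sin t < 0 \<longleftrightarrow> pi < t \<and> t < 2 * pi" if "0 \<le> t" "t \<le> 2 * pi" for t
    using that sin_lt_zero[of t] sin_ge_zero[of t] by (cases "t = 2 * pi"; cases "t > pi") force+
  have c1: "cos t > cos \<alpha> \<longleftrightarrow> t < \<alpha>" "cos t < cos \<alpha> \<longleftrightarrow> \<alpha> < t" if "0 < t" "t < pi" for t
    using that assms by (simp_all add: cos_mono_less_eq)
  have c2: "cos t > cos \<alpha> \<longleftrightarrow> 2 * pi - \<alpha> < t" "cos t < cos \<alpha> \<longleftrightarrow> t < 2 * pi - \<alpha>" if "pi < t" "t < 2 * pi" for t
    using c1[of "2 * pi - t"] that by (auto simp: cos_diff)
  show "{t \<in> {0..2 * pi}. sin t > 0 \<and> cos t > cos \<alpha>} = {0<..<\<alpha>}"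
    using sp c1 assms by auto
  show "{t \<in> {0..2 * pi}. sin t > 0 \<and> cos t < cos \<alpha>} = {\<alpha><..<pi}"
    using sp c1 assms by auto
  show "{t \<in> {0..2 * pi}. sin t < 0 \<and> cos t < cos \<alpha>} = {pi<..<2 * pi - \<alpha>}"
    using sn c2 assms by auto
  show "{t \<in> {0..2 * pi}. sin t < 0 \<and> cos t > cos \<alpha>} = {2 * pi - \<alpha><..<2 * pi}"
    using sn c2 assms by auto
qed

text \<open>Substituting \<open>\<phi> = anomaly s \<theta>\<close> in the line integrals turns the integrand into the radial rate. The
switching points \<open>cos \<phi> = - s\<close> become \<open>\<theta> = pi / 2\<close> and \<open>\<theta> = 3 pi / 2\<close>, so that the arcs in the
four quadrants combine to the two half turns.\<close>

lemma melnikov_eq_half_int: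
  assumes \<eta>: "\<eta> > 0" and s: "0 < s" "s < 1" and h: "h = (s\<^sup>2 - 1) / (2 * \<eta>)"
    and f: "\<And>x y. f 1 (x, y) = bipoly n c x y" "\<And>x y. f 2 (x, y) = bipoly n c' x y"
    and g: "\<And>x y. g 1 (x, y) = bipoly n d x y" "\<And>x y. g 2 (x, y) = bipoly n d' x y"
    and sym: "f 1 = f 4" "g 1 = g 4" "f 2 = f 3" "g 2 = g 3"
  shows "melnikov \<eta> f g h = (half_int \<eta> n c d s + half_int \<eta> n c' d' (- s)) / (\<eta> * sqrt (2 * \<eta>))"
proof -
  define \<omega> where "\<omega> = sqrt (2 * \<eta>)"
  have \<omega>: "\<omega> > 0" "\<omega> * \<omega> = 2 * \<eta>" using \<eta> by (simp_all add: \<omega>_def)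
  have s1: "\<bar>s\<bar> < 1" using s by simp
  define D where "D = 1 - s\<^sup>2"
  have D: "D > 0" unfolding D_def using s1 by (rule one_minus_square_pos)
  define \<gamma> where "\<gamma> = L_path \<eta> h"
  have \<gamma>: "\<gamma> \<phi> = (\<eta> / \<omega> * s / sqrt D * sin \<phi>, \<eta> / D * (1 + s * cos \<phi>))" for \<phi>
    unfolding \<gamma>_def \<omega>_def D_def by (rule L_path_anomaly[OF \<eta> s h])
  have \<gamma>': "vector_derivative \<gamma> (at \<phi>) = (\<eta> / \<omega> * s / sqrt D * cos \<phi>, \<eta> / D * (s * - sin \<phi>))" for \<phi>
  proof (rule vector_derivative_at)
    show "(\<gamma> has_vector_derivative (\<eta> / \<omega> * s / sqrt D * cos \<phi>, \<eta> / D * (s * - sin \<phi>))) (at \<phi>)"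
      unfolding \<gamma> [abs_def]
      by (intro has_vector_derivative_Pair; unfold has_real_derivative_iff_has_vector_derivative[symmetric])
         (use \<omega> D in \<open>auto intro!: derivative_eq_intros\<close>)
  qed
  define \<alpha> where "\<alpha> = anomaly s (pi / 2)"
  have cos\<alpha>: "cos \<alpha> = - s" using cos_sin_anomaly(1)[OF s1, of "pi / 2"] by (simp add: \<alpha>_def)
  have \<alpha>: "0 < \<alpha>" "\<alpha> < pi"
    using s arccos_less_mono[of 1 "- s"] arccos_less_mono[of "- s" "- 1"]
    by (auto simp: \<alpha>_def anomaly_pi_half[OF s1])
  have a32: "anomaly s (3 * pi / 2) = 2 * pi - \<alpha>" using anomaly_2pi_minus[of s "pi / 2"] by (simp add: \<alpha>_def)
  have a2: "anomaly s (2 * pi) = 2 * pi" using anomaly_2pi_minus[of s 0] by simp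
  have snd_gt: "\<eta> / D * (1 + s * cos \<phi>) > \<eta> \<longleftrightarrow> cos \<phi> > cos \<alpha>"
    and snd_lt: "\<eta> / D * (1 + s * cos \<phi>) < \<eta> \<longleftrightarrow> cos \<phi> < cos \<alpha>" for \<phi>
  proof -
    have e: "\<eta> / D * (1 + s * cos \<phi>) - \<eta> = (\<eta> * s / D) * (cos \<phi> - cos \<alpha>)"
      unfolding cos\<alpha> using D by (simp add: field_simps) (simp add: D_def power2_eq_square algebra_simps)
    have p: "\<eta> * s / D > 0" using \<eta> s D by simp
    show "\<eta> / D * (1 + s * cos \<phi>) > \<eta> \<longleftrightarrow> cos \<phi> > cos \<alpha>"
      using e p by (metis diff_gt_0_iff_gt zero_less_mult_pos mult_pos_pos)
    show "\<eta> / D * (1 + s * cos \<phi>) < \<eta> \<longleftrightarrow> cos \<phi> < cos \<alpha>"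
      using e p by (metis diff_less_0_iff_less mult_less_0_iff less_asym)
  qed
  have p: "\<eta> / \<omega> * s / sqrt D > 0" using \<eta> \<omega> s D by simp
  have fst_sgn: "\<eta> / \<omega> * s / sqrt D * sin \<phi> > 0 \<longleftrightarrow> sin \<phi> > 0"
    "\<eta> / \<omega> * s / sqrt D * sin \<phi> < 0 \<longleftrightarrow> sin \<phi> < 0" for \<phi>
    using p by (metis zero_less_mult_pos mult_pos_pos, metis mult_less_0_iff less_asym)
  have Qk: "\<gamma> \<phi> \<in> Q \<eta> 1 \<longleftrightarrow> sin \<phi> > 0 \<and> cos \<phi> > cos \<alpha>"
    "\<gamma> \<phi> \<in> Q \<eta> 2 \<longleftrightarrow> sin \<phi> > 0 \<and> cos \<phi> < cos \<alpha>"
    "\<gamma> \<phi> \<in> Q \<eta> 3 \<longleftrightarrow> sin \<phi> < 0 \<and> cos \<phi> < cos \<alpha>"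
    "\<gamma> \<phi> \<in> Q \<eta> 4 \<longleftrightarrow> sin \<phi> < 0 \<and> cos \<phi> > cos \<alpha>" for \<phi>
  proof -
    have "(X, Y) \<in> Q \<eta> 1 \<longleftrightarrow> X > 0 \<and> Y > \<eta>" "(X, Y) \<in> Q \<eta> 2 \<longleftrightarrow> X > 0 \<and> Y < \<eta>"
      "(X, Y) \<in> Q \<eta> 3 \<longleftrightarrow> X < 0 \<and> Y < \<eta>" "(X, Y) \<in> Q \<eta> 4 \<longleftrightarrow> X < 0 \<and> Y > \<eta>" for X Y
      by (simp_all add: Q_def)
    note Q = this
    show "\<gamma> \<phi> \<in> Q \<eta> 1 \<longleftrightarrow> sin \<phi> > 0 \<and> cos \<phi> > cos \<alpha>"
      "\<gamma> \<phi> \<in> Q \<eta> 2 \<longleftrightarrow> sin \<phi> > 0 \<and> cos \<phi> < cos \<alpha>"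
      "\<gamma> \<phi> \<in> Q \<eta> 3 \<longleftrightarrow> sin \<phi> < 0 \<and> cos \<phi> < cos \<alpha>"
      "\<gamma> \<phi> \<in> Q \<eta> 4 \<longleftrightarrow> sin \<phi> < 0 \<and> cos \<phi> > cos \<alpha>"
      unfolding \<gamma> Q fst_sgn snd_gt snd_lt by (rule refl)+
  qed
  define I where "I k \<phi> = g k (\<gamma> \<phi>) / snd (\<gamma> \<phi>) ^ 3 * fst (vector_derivative \<gamma> (at \<phi>))
     + - f k (\<gamma> \<phi>) / snd (\<gamma> \<phi>) ^ 3 * snd (vector_derivative \<gamma> (at \<phi>))" for k \<phi>
  have li: "line_integral (\<lambda>(x, y). g k (x, y) / y ^ 3) (\<lambda>(x, y). - f k (x, y) / y ^ 3)
       (L_path \<eta> h) A = integral A (I k)" for k A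
    unfolding line_integral_def I_def [abs_def] \<gamma>_def by (simp add: case_prod_unfold)
  have "melnikov \<eta> f g h = (\<Sum>k=1..4. integral {\<theta> \<in> {0..2 * pi}. \<gamma> \<theta> \<in> Q \<eta> k} (I k))"
    unfolding melnikov_def li \<gamma>_def ..
  also have "\<dots> = integral {0<..<\<alpha>} (I 1) + integral {\<alpha><..<pi} (I 2) + integral {pi<..<2 * pi - \<alpha>} (I 3)
     + integral {2 * pi - \<alpha><..<2 * pi} (I 4)"
  proof -
    have "{\<theta> \<in> {0..2 * pi}. \<gamma> \<theta> \<in> Q \<eta> 1} = {0<..<\<alpha>}"
      "{\<theta> \<in> {0..2 * pi}. \<gamma> \<theta> \<in> Q \<eta> 2} = {\<alpha><..<pi}"
      "{\<theta> \<in> {0..2 * pi}. \<gamma> \<theta> \<in> Q \<eta> 3} = {pi<..<2 * pi - \<alpha>}"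
      "{\<theta> \<in> {0..2 * pi}. \<gamma> \<theta> \<in> Q \<eta> 4} = {2 * pi - \<alpha><..<2 * pi}"
      unfolding Qk by (rule Collect_cos_greater[OF \<alpha>])+
    note sets = this
    have "{1..4::nat} = {1, 2, 3, 4}" by auto
    then have "(\<Sum>k=1..4. integral {\<theta> \<in> {0..2 * pi}. \<gamma> \<theta> \<in> Q \<eta> k} (I k))
      = (\<Sum>k\<in>{1, 2, 3, 4}. integral {\<theta> \<in> {0..2 * pi}. \<gamma> \<theta> \<in> Q \<eta> k} (I k))" by (simp only:)
    also have "\<dots> = integral {\<theta> \<in> {0..2 * pi}. \<gamma> \<theta> \<in> Q \<eta> 1} (I 1) + integral {\<theta> \<in> {0..2 * pi}. \<gamma> \<theta> \<in> Q \<eta> 2} (I 2)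
      + integral {\<theta> \<in> {0..2 * pi}. \<gamma> \<theta> \<in> Q \<eta> 3} (I 3) + integral {\<theta> \<in> {0..2 * pi}. \<gamma> \<theta> \<in> Q \<eta> 4} (I 4)"
      by simp
    finally show ?thesis unfolding sets .
  qed
  also have "\<dots> = integral {0..\<alpha>} (I 1) + integral {\<alpha>..pi} (I 2) + integral {pi..2 * pi - \<alpha>} (I 2)
     + integral {2 * pi - \<alpha>..2 * pi} (I 1)"
  proof -
    have "I 3 = I 2" "I 4 = I 1" unfolding I_def [abs_def] sym by auto
    then show ?thesis by (simp add: integral_open_interval_real)
  qed
  finally have M: "melnikov \<eta> f g h = integral {0..\<alpha>} (I 1) + integral {\<alpha>..pi} (I 2) + integral {pi..2 * pi - \<alpha>} (I 2)
     + integral {2 * pi - \<alpha>..2 * pi} (I 1)" .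
  define w where "w t = 1 - s * cos t" for t
  have w: "w t > 0" for t unfolding w_def by (rule one_minus_mult_cos_pos[OF s1])
  have mono: "anomaly s a \<le> anomaly s b" if "a \<le> b" for a b
    by (rule DERIV_nonneg_imp_nondecreasing[OF that])
       (use has_real_derivative_anomaly[OF s1] w D in \<open>auto intro!: exI simp: w_def[symmetric] D_def[symmetric] less_imp_le\<close>)
  have subst: "integral {anomaly s a..anomaly s b} (I k)
      = integral {a..b} (\<lambda>t. radial_rate \<eta> n cc dd (s * cos t) (s * sin t)) / (\<eta> * \<omega>)"
    if ab: "a \<le> b" and k: "\<And>x y. f k (x, y) = bipoly n cc x y" "\<And>x y. g k (x, y) = bipoly n dd x y" for a b k cc dd
  proof -
    have pt: "sqrt D / w t * I k (anomaly s t) = radial_rate \<eta> n cc dd (s * cos t) (s * sin t) / (\<eta> * \<omega>)" for t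
    proof -
      define C where "C = s * cos t"
      define S where "S = s * sin t"
      define W where "W = 1 - C"
      have W: "W = w t" "W > 0" using w by (simp_all add: W_def C_def w_def)
      define x where "x = \<eta> / \<omega> * S / W"
      define y where "y = \<eta> / W"
      have ca: "cos (anomaly s t) = (cos t - s) / W" and sa: "sin (anomaly s t) = sqrt D * sin t / W"
        using cos_sin_anomaly[OF s1, of t] by (simp_all add: W w_def D_def)
      have RD: "sqrt D * sqrt D = D" using D by simp
      have "1 + s * cos (anomaly s t) = D / W"
        unfolding ca using W(2) by (simp add: field_simps) (simp add: W_def C_def D_def power2_eq_square)
      then have gt: "\<gamma> (anomaly s t) = (x, y)"
        unfolding \<gamma> sa x_def y_def S_def using D by simp
      have CS: "C * C + S * S = s * s"
      proof -
        have "C * C + S * S = s * s * ((sin t)\<^sup>2 + (cos t)\<^sup>2)"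
          unfolding C_def S_def power2_eq_square by (simp only: algebra_simps)
        then show ?thesis by simp
      qed
      have d1: "sqrt D / W * (\<eta> / \<omega> * s / sqrt D * cos (anomaly s t)) = \<eta> / \<omega> * (C * W - S * S) / (W * W)"
      proof -
        have "s * (cos t - s) = C * W - S * S" using CS by (simp add: W_def C_def algebra_simps)
        moreover have "sqrt D / W * (\<eta> / \<omega> * s / sqrt D * cos (anomaly s t)) = \<eta> / \<omega> * (s * (cos t - s)) / (W * W)"
          unfolding ca using D by simp
        ultimately show ?thesis by simp
      qed
      have d2: "sqrt D / W * (\<eta> / D * (s * - sin (anomaly s t))) = - (\<eta> * S / (W * W))"
      proof -
        have "sqrt D / W * (\<eta> / D * (s * - sin (anomaly s t))) = - ((sqrt D * sqrt D) / D * (\<eta> * S / (W * W)))"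
        proof -
          have "r / W * (\<eta> / D * (s * - (r * \<sigma> / W))) = - ((r * r) / D * (\<eta> * (s * \<sigma>) / (W * W)))" for r \<sigma>
            by (simp add: mult_ac)
          then show ?thesis unfolding sa S_def .
        qed
        then show ?thesis unfolding RD using D by simp
      qed
      have "sqrt D / W * I k (anomaly s t) = g k (x, y) / y ^ 3 * (sqrt D / W * (\<eta> / \<omega> * s / sqrt D * cos (anomaly s t)))
          + - f k (x, y) / y ^ 3 * (sqrt D / W * (\<eta> / D * (s * - sin (anomaly s t))))"
        unfolding I_def gt \<gamma>' fst_conv snd_conv by (simp only: distrib_left mult.left_commute)
      also have "\<dots> = g k (x, y) / y ^ 3 * (\<eta> / \<omega> * (C * W - S * S) / (W * W)) + f k (x, y) / y ^ 3 * (\<eta> * S / (W * W))"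
        unfolding d1 d2 by simp
      also have "\<dots> = (g k (x, y) * (C * W - S * S) / \<omega> + f k (x, y) * S) * W / (\<eta> * \<eta>)"
        using \<eta> W(2) by (simp add: y_def power3_eq_cube add_divide_distrib distrib_left distrib_right mult_ac)
      also have "\<dots> = (\<eta> * g k (x, y) * C + \<omega> * (f k (x, y) * y - x * g k (x, y)) * S) / y\<^sup>2 / (\<eta> * \<omega>)"
      proof -
        have "(\<eta> * g k (x, y) * C + \<omega> * (f k (x, y) * y - x * g k (x, y)) * S) / y\<^sup>2
          = (\<eta> * g k (x, y) * C + \<omega> * (f k (x, y) * y - x * g k (x, y)) * S) * (W * W) / (\<eta> * \<eta>)"
          by (simp add: y_def power2_eq_square)
        also have "(\<eta> * g k (x, y) * C + \<omega> * (f k (x, y) * y - x * g k (x, y)) * S) * (W * W)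
           = \<eta> * \<omega> * ((g k (x, y) * (C * W - S * S) / \<omega> + f k (x, y) * S) * W)"
        proof -
          have yW: "y * W = \<eta>" "\<omega> * x * W = \<eta> * S" using W \<omega> by (simp_all add: x_def y_def)
          have "(f k (x, y) * y - x * g k (x, y)) * \<omega> * W = f k (x, y) * \<omega> * (y * W) - (\<omega> * x * W) * g k (x, y)"
            by (simp add: algebra_simps)
          then have fg: "(f k (x, y) * y - x * g k (x, y)) * \<omega> * W = f k (x, y) * \<omega> * \<eta> - \<eta> * S * g k (x, y)"
            unfolding yW .
          have "(\<eta> * g k (x, y) * C + \<omega> * (f k (x, y) * y - x * g k (x, y)) * S) * (W * W)
            = (\<eta> * g k (x, y) * C * W + ((f k (x, y) * y - x * g k (x, y)) * \<omega> * W) * S) * W"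
            by (simp add: algebra_simps)
          also have "\<dots> = (\<eta> * g k (x, y) * C * W + (f k (x, y) * \<omega> * \<eta> - \<eta> * S * g k (x, y)) * S) * W"
            unfolding fg ..
          also have "\<dots> = \<eta> * \<omega> * ((g k (x, y) * (C * W - S * S) / \<omega> + f k (x, y) * S) * W)"
            using \<omega> by (simp add: field_simps)
          finally show ?thesis .
        qed
        finally show ?thesis using \<eta> \<omega> by simp
      qed
      also have "\<dots> = radial_rate \<eta> n cc dd C S / (\<eta> * \<omega>)"
        unfolding k radial_rate_def Let_def x_def y_def W_def \<omega>_def by simp
      finally show ?thesis unfolding W C_def S_def .
    qed
    have "((\<lambda>t. (sqrt D / w t) *\<^sub>R I k (anomaly s t)) has_integral integral {anomaly s a..anomaly s b} (I k)) {a..b}"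
    proof (rule has_integral_substitution[OF ab mono[OF ab], where c = "anomaly s a" and d = "anomaly s b"])
      show "anomaly s ` {a..b} \<subseteq> {anomaly s a..anomaly s b}" using mono by auto
      show "continuous_on {anomaly s a..anomaly s b} (I k)"
      proof -
        have c\<gamma>: "continuous_on X \<gamma>" for X unfolding \<gamma> [abs_def] by (intro continuous_intros)
        have "continuous_on X (I k)" for X
        proof -
          have "snd (\<gamma> \<phi>) \<noteq> 0" for \<phi>
          proof -
            have "\<bar>s * cos \<phi>\<bar> \<le> \<bar>s\<bar> * 1" unfolding abs_mult by (intro mult_left_mono) auto
            then have "1 + s * cos \<phi> > 0" using s1 by linarith
            then show ?thesis using \<eta> D by (simp add: \<gamma>)
          qed
          moreover have "I k = (\<lambda>\<phi>. bipoly n dd (fst (\<gamma> \<phi>)) (snd (\<gamma> \<phi>)) / snd (\<gamma> \<phi>) ^ 3 * (\<eta> / \<omega> * s / sqrt D * cos \<phi>)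
             + - bipoly n cc (fst (\<gamma> \<phi>)) (snd (\<gamma> \<phi>)) / snd (\<gamma> \<phi>) ^ 3 * (\<eta> / D * (s * - sin \<phi>)))"
            unfolding I_def [abs_def] \<gamma>' k[symmetric] by simp
          ultimately show ?thesis
            by (simp only: bipoly_def) (intro continuous_intros c\<gamma>, auto)
        qed
        then show ?thesis .
      qed
      show "(anomaly s has_real_derivative sqrt D / w x) (at x within {a..b})" for x
        unfolding D_def w_def by (rule has_field_derivative_at_within[OF has_real_derivative_anomaly[OF s1]])
    qed
    from integral_unique[OF this[unfolded real_scaleR_def pt]] show ?thesis by simp
  qed
  let ?R = "\<lambda>t. radial_rate \<eta> n c d (s * cos t) (s * sin t)" and ?R' = "\<lambda>t. radial_rate \<eta> n c' d' (s * cos t) (s * sin t)"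
  have "melnikov \<eta> f g h = (integral {0..pi / 2} ?R + integral {pi / 2..pi} ?R' + integral {pi..3 * pi / 2} ?R'
     + integral {3 * pi / 2..2 * pi} ?R) / (\<eta> * \<omega>)"
    unfolding M using subst[OF _ f(1) g(1), of 0 "pi / 2"] subst[OF _ f(2) g(2), of "pi / 2" pi]
      subst[OF _ f(2) g(2), of pi "3 * pi / 2"] subst[OF _ f(1) g(1), of "3 * pi / 2" "2 * pi"]
    by (simp add: anomaly_pi a32 a2 \<alpha>_def[symmetric] add_divide_distrib)
  moreover have "integral {pi / 2..pi} ?R' + integral {pi..3 * pi / 2} ?R' = integral {pi / 2..3 * pi / 2} ?R'"
    by (intro Henstock_Kurzweil_Integration.integral_combine integrable_continuous_real continuous_on_radial_rate_polar \<eta> s1) auto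
  ultimately show ?thesis
    unfolding half_int_upper[OF s1 \<eta>] half_int_lower[OF s1 \<eta>] \<omega>_def by simp
qed

section \<open>Flows depending holomorphically on the initial value\<close>

lemma continuous_on_slice:
  assumes "continuous_on (A \<times> B) (\<lambda>(t, z). g t z)" "z \<in> B" "A' \<subseteq> A"
  shows "continuous_on A' (\<lambda>t. g t z)"
proof -
  have "continuous_on A' (\<lambda>t. (t, z))" "(\<lambda>t. (t, z)) ` A' \<subseteq> A \<times> B"
    using assms(2,3) by (auto intro!: continuous_intros)
  from continuous_on_compose2[OF assms(1) this] show ?thesis by simp
qed

text \<open>By Cauchy's estimate applied to differences, joint continuity of \<open>f\<close> implies joint continuity of the
derivative in \<open>z\<close>, so one may differentiate under the integral.\<close>

lemma holomorphic_integral_param: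
  fixes f :: "real \<Rightarrow> complex \<Rightarrow> complex"
  assumes S: "open S" "convex S" and cont: "continuous_on ({a..b} \<times> S) (\<lambda>(t, z). f t z)"
    and holo: "\<And>t. t \<in> {a..b} \<Longrightarrow> f t holomorphic_on S"
  shows "(\<lambda>z. integral {a..b} (\<lambda>t. f t z)) holomorphic_on S"
proof -
  have conts: "continuous_on (S \<times> {a..b}) (\<lambda>(z, t). f t z)"
  proof -
    have "continuous_on (S \<times> {a..b}) ((\<lambda>(t, z). f t z) \<circ> prod.swap)"
      by (intro continuous_on_compose continuous_intros continuous_on_subset[OF cont]) auto
    then show ?thesis by (simp add: o_def case_prod_unfold)
  qed
  have "continuous_on (S \<times> {a..b}) (\<lambda>(z, t). deriv (f t) z)"
    unfolding continuous_on_iff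
  proof (intro ballI allI impI)
    fix p and e :: real assume p: "p \<in> S \<times> {a..b}" and e: "e > 0"
    obtain z0 t0 where p_eq: "p = (z0, t0)" and z0: "z0 \<in> S" and t0: "t0 \<in> {a..b}" using p by auto
    obtain r0 where r0: "r0 > 0" "cball z0 r0 \<subseteq> S" using S(1) z0 open_contains_cball by metis
    define r where "r = r0 / 2"
    have r: "r > 0" using r0 by (simp add: r_def)
    have sub: "cball z r \<subseteq> cball z0 r0" if "dist z z0 < r" for z
    proof
      fix w assume "w \<in> cball z r"
      then show "w \<in> cball z0 r0" using that dist_triangle[of z0 w z] by (simp add: r_def dist_commute)
    qed
    have "compact ({a..b} \<times> cball z0 r0)" by (intro compact_Times) auto
    moreover have "continuous_on ({a..b} \<times> cball z0 r0) (\<lambda>(t, z). f t z)"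
      by (rule continuous_on_subset[OF cont]) (use r0 in auto)
    ultimately have "uniformly_continuous_on ({a..b} \<times> cball z0 r0) (\<lambda>(t, z). f t z)"
      by (rule compact_uniformly_continuous[rotated])
    moreover have "e * r / 2 > 0" using e r by simp
    ultimately obtain d1 where d1: "d1 > 0" "\<And>x x'. \<lbrakk>x \<in> {a..b} \<times> cball z0 r0; x' \<in> {a..b} \<times> cball z0 r0; dist x' x < d1\<rbrakk>
        \<Longrightarrow> dist (case x' of (t, z) \<Rightarrow> f t z) (case x of (t, z) \<Rightarrow> f t z) < e * r / 2"
      unfolding uniformly_continuous_on_def by blast
    have "continuous_on S (deriv (f t0))"
      by (intro holomorphic_on_imp_continuous_on holomorphic_deriv holo S t0)
    then obtain d2 where d2: "d2 > 0" "\<And>z. z \<in> S \<Longrightarrow> dist z z0 < d2 \<Longrightarrow> dist (deriv (f t0) z) (deriv (f t0) z0) < e / 2"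
      unfolding continuous_on_iff using z0 e by (meson half_gt_zero)
    show "\<exists>d>0. \<forall>x'\<in>S \<times> {a..b}. dist x' p < d \<longrightarrow>
        dist (case x' of (z, t) \<Rightarrow> deriv (f t) z) (case p of (z, t) \<Rightarrow> deriv (f t) z) < e"
    proof (intro exI[of _ "min (min d1 d2) r"] conjI ballI impI)
      show "0 < min (min d1 d2) r" using d1 d2 r by simp
      fix x' assume x': "x' \<in> S \<times> {a..b}" "dist x' p < min (min d1 d2) r"
      obtain z t where x_eq: "x' = (z, t)" and z: "z \<in> S" and t: "t \<in> {a..b}" using x'(1) by auto
      have dz: "dist z z0 < min (min d1 d2) r"
        using x'(2) dist_fst_le[of x' p] by (simp add: x_eq p_eq)
      have dt: "dist t t0 < d1" using x'(2) dist_snd_le[of x' p] by (simp add: x_eq p_eq)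
      have subz: "cball z r \<subseteq> cball z0 r0" using sub dz by simp
      define g where "g w = f t w - f t0 w" for w
      have g: "g holomorphic_on cball z r"
        unfolding g_def 
        by (intro holomorphic_intros holomorphic_on_subset[OF holo[OF t]] holomorphic_on_subset[OF holo[OF t0]])
           (use subz r0 in auto)
      have "norm ((deriv ^^ 1) g z) \<le> fact 1 * (e * r / 2) / r ^ 1"
      proof (rule Cauchy_inequality)
        show "g holomorphic_on ball z r" using g by (rule holomorphic_on_subset) auto
        show "continuous_on (cball z r) g" using g by (rule holomorphic_on_imp_continuous_on)
        fix w assume w: "norm (z - w) = r"
        then have "w \<in> cball z0 r0" using subz by (auto simp: dist_norm)
        then show "norm (g w) \<le> e * r / 2"
          using d1(2)[of "(t0, w)" "(t, w)"] t t0 dt by (simp add: g_def dist_norm dist_Pair_Pair less_imp_le)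
      qed (use r in auto)
      then have "norm (deriv g z) \<le> e / 2" using r by simp
      moreover have "deriv g z = deriv (f t) z - deriv (f t0) z"
        unfolding g_def using holo[OF t] holo[OF t0] S(1) z
        by (intro deriv_diff) (auto simp: holomorphic_on_imp_differentiable_at)
      moreover have "dist (deriv (f t0) z) (deriv (f t0) z0) < e / 2" using d2(2)[OF z] dz by simp
      moreover have "dist (deriv (f t) z) (deriv (f t0) z0)
         \<le> dist (deriv (f t) z) (deriv (f t0) z) + dist (deriv (f t0) z) (deriv (f t0) z0)" by (rule dist_triangle)
      ultimately show "dist (case x' of (z, t) \<Rightarrow> deriv (f t) z) (case p of (z, t) \<Rightarrow> deriv (f t) z) < e"
        unfolding x_eq p_eq by (simp add: dist_norm)
    qed
  qed
  then have "(\<lambda>z. integral (cbox a b) ((\<lambda>z t. f t z) z)) holomorphic_on S"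
  proof (intro leibniz_rule_holomorphic[where fx = "\<lambda>z t. deriv (f t) z"] S(2))
    fix z t assume "z \<in> S" "t \<in> cbox a b"
    then show "((\<lambda>z. f t z) has_field_derivative deriv (f t) z) (at z within S)"
      using holo[of t] S(1) by (auto intro: holomorphic_derivI)
  next
    fix z assume z: "z \<in> S"
    have "continuous_on {a..b} (\<lambda>t. f t z)"
      by (rule continuous_on_slice[OF cont z order_refl])
    then show "(\<lambda>t. f t z) integrable_on cbox a b" by (simp add: integrable_continuous_real)
  qed auto
  then show ?thesis by simp
qed

text \<open>Rescaling to the fixed interval \<open>{0..1}\<close> reduces the variable upper limit to an integral with
parameters.\<close>

lemma continuous_on_integral_upper:
  fixes g :: "real \<Rightarrow> 'a::euclidean_space \<Rightarrow> 'b::euclidean_space"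
  assumes cont: "continuous_on ({0..T} \<times> U) (\<lambda>(t, z). g t z)"
  shows "continuous_on ({0..T} \<times> U) (\<lambda>(t, z). integral {0..t} (\<lambda>u. g u z))"
proof -
  have "continuous_on (({0..T} \<times> U) \<times> cbox 0 1) (\<lambda>(p, \<sigma>). fst p *\<^sub>R g (fst p * \<sigma>) (snd p))"
  proof -
    have "continuous_on (({0..T} \<times> U) \<times> cbox (0::real) 1) (\<lambda>q. (\<lambda>(t, z). g t z) (fst (fst q) * snd q, snd (fst q)))"
    proof (rule continuous_on_compose2[OF cont])
      show "(\<lambda>q. (fst (fst q) * snd q, snd (fst q))) ` (({0..T} \<times> U) \<times> cbox (0::real) 1) \<subseteq> {0..T} \<times> U"
      proof (clarsimp)
        fix t \<sigma> :: real assume "0 \<le> t" "t \<le> T" "0 \<le> \<sigma>" "\<sigma> \<le> 1"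
        then show "t * \<sigma> \<le> T" using mult_left_le[of \<sigma> t] by linarith
      qed
    qed (intro continuous_intros)
    then show ?thesis by (auto simp: case_prod_unfold intro!: continuous_intros)
  qed
  then have c: "continuous_on ({0..T} \<times> U) (\<lambda>p. integral (cbox 0 1) (\<lambda>\<sigma>. fst p *\<^sub>R g (fst p * \<sigma>) (snd p)))"
    by (rule integral_continuous_on_param)
  have "integral (cbox 0 1) (\<lambda>\<sigma>. fst p *\<^sub>R g (fst p * \<sigma>) (snd p)) = (case p of (t, z) \<Rightarrow> integral {0..t} (\<lambda>u. g u z))"
    if p: "p \<in> {0..T} \<times> U" for p
  proof -
    obtain t z where pe: "p = (t, z)" and t: "0 \<le> t" "t \<le> T" and z: "z \<in> U" using p by auto
    have "((\<lambda>\<sigma>. t *\<^sub>R g (t * \<sigma>) z) has_integral integral {t * 0..t * 1} (\<lambda>u. g u z)) {0..1}"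
    proof (rule has_integral_substitution[where c = 0 and d = t])
      show "(\<lambda>\<sigma>. t * \<sigma>) ` {0..1} \<subseteq> {0..t}" using t by (auto intro: mult_left_le)
      show "continuous_on {0..t} (\<lambda>u. g u z)"
        by (rule continuous_on_slice[OF cont z]) (use t in auto)
    qed (use t in \<open>auto intro!: derivative_eq_intros\<close>)
    from integral_unique[OF this] show ?thesis
      by (simp only: pe fst_conv snd_conv prod.case box_real mult_zero_right mult_1_right)
  qed
  with c show ?thesis by (rule continuous_on_eq)
qed

text \<open>Picard iteration, with all iterates holomorphic in \<open>z\<close>. Cauchy's estimate on discs of radius \<open>\<rho>\<close> gives the
Lipschitz constant \<open>m / \<rho>\<close>, so the smallness of \<open>m T / \<rho>\<close> alone makes the iteration a contraction, and
the distance of the flow from the first iterate is of second order in \<open>m\<close>.\<close>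

lemma holomorphic_flow:
  fixes G :: "real \<Rightarrow> complex \<Rightarrow> complex"
  assumes T: "T \<ge> 0" and U: "open U" "convex U" and \<rho>: "\<rho> > 0"
    and cont: "continuous_on ({0..T} \<times> V) (\<lambda>(t, z). G t z)"
    and holo: "\<And>t. t \<in> {0..T} \<Longrightarrow> G t holomorphic_on V"
    and bound: "\<And>t z. t \<in> {0..T} \<Longrightarrow> z \<in> V \<Longrightarrow> norm (G t z) \<le> m"
    and real: "\<And>t z. t \<in> {0..T} \<Longrightarrow> z \<in> V \<Longrightarrow> z \<in> \<real> \<Longrightarrow> G t z \<in> \<real>"
    and margin: "\<And>z. z \<in> U \<Longrightarrow> cball z (2 * \<rho>) \<subseteq> V"
    and m: "m \<ge> 0" "2 * m * T \<le> \<rho>"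
  obtains \<Gamma> where
    "\<And>t z. t \<in> {0..T} \<Longrightarrow> z \<in> U \<Longrightarrow> norm (\<Gamma> t z - z) \<le> m * T"
    "\<And>z. z \<in> U \<Longrightarrow> \<Gamma> 0 z = z"
    "\<And>t z. t \<in> {0..T} \<Longrightarrow> z \<in> U \<Longrightarrow> ((\<lambda>t. \<Gamma> t z) has_vector_derivative G t (\<Gamma> t z)) (at t within {0..T})"
    "\<Gamma> T holomorphic_on U"
    "\<And>t z. t \<in> {0..T} \<Longrightarrow> z \<in> U \<Longrightarrow> z \<in> \<real> \<Longrightarrow> \<Gamma> t z \<in> \<real>"
    "\<And>z. z \<in> U \<Longrightarrow> norm (\<Gamma> T z - z - integral {0..T} (\<lambda>t. G t z)) \<le> T * (m / \<rho>) * (m * T)"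
proof -
  let ?I = "{0..T}"
  have lip: "norm (G t w - G t w') \<le> m / \<rho> * norm (w - w')"
    if z: "z \<in> U" and t: "t \<in> ?I" and w: "w \<in> cball z \<rho>" "w' \<in> cball z \<rho>" for z w w' t
  proof (rule field_differentiable_bound[OF convex_cball _ _ w])
    fix v assume v: "v \<in> cball z \<rho>"
    have sub: "cball v \<rho> \<subseteq> V"
    proof -
      have "cball v \<rho> \<subseteq> cball z (2 * \<rho>)" 
      proof
        fix u assume "u \<in> cball v \<rho>"
        then show "u \<in> cball z (2 * \<rho>)" using v dist_triangle[of z u v] by simp
      qed
      then show ?thesis using margin[OF z] by blast
    qed
    have h: "G t holomorphic_on cball v \<rho>" using holo[OF t] sub by (rule holomorphic_on_subset)
    have hb: "G t holomorphic_on ball v \<rho>" using h by (rule holomorphic_on_subset) auto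
    show "(G t has_field_derivative deriv (G t) v) (at v within cball z \<rho>)"
      by (rule holomorphic_derivI[OF hb]) (use \<rho> in auto)
    have "norm ((deriv ^^ 1) (G t) v) \<le> fact 1 * m / \<rho> ^ 1"
      by (rule Cauchy_inequality[OF hb holomorphic_on_imp_continuous_on[OF h] \<rho>])
         (use sub bound[OF t] in \<open>auto simp: dist_norm subset_eq\<close>)
    then show "norm (deriv (G t) v) \<le> m / \<rho>" by simp
  qed
  define \<Gamma> where "\<Gamma> = rec_nat (\<lambda>t z. z) (\<lambda>k \<gamma> t z. z + integral {0..t} (\<lambda>u. G u (\<gamma> u z)))"
  have \<Gamma>0: "\<Gamma> 0 t z = z" and \<Gamma>S: "\<Gamma> (Suc k) t z = z + integral {0..t} (\<lambda>u. G u (\<Gamma> k u z))" for k t z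
    by (simp_all add: \<Gamma>_def)
  \<comment> \<open>The properties that Picard iteration and uniform limits preserve.\<close>
  define good where "good \<gamma> \<longleftrightarrow> continuous_on (?I \<times> U) (\<lambda>(t, z). \<gamma> t z) \<and> (\<forall>t\<in>?I. \<gamma> t holomorphic_on U) \<and>
      (\<forall>t\<in>?I. \<forall>z\<in>U. norm (\<gamma> t z - z) \<le> m * T \<and> (z \<in> \<real> \<longrightarrow> \<gamma> t z \<in> \<real>))" for \<gamma>
  have mT: "m * T \<le> \<rho>" using m \<rho> mult_nonneg_nonneg[OF m(1) T] by linarith
  have in_cball: "\<gamma> t z \<in> cball z \<rho>" if "good \<gamma>" "t \<in> ?I" "z \<in> U" for \<gamma> t z
  proof -
    have "norm (\<gamma> t z - z) \<le> m * T" using that unfolding good_def by blast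
    then show ?thesis using mT by (simp add: dist_norm norm_minus_commute)
  qed
  have in_V: "w \<in> V" if "w \<in> cball z \<rho>" "z \<in> U" for w z
    using margin[OF that(2)] that(1) \<rho> by (auto simp: subset_eq)
  have contG: "continuous_on (?I \<times> U) (\<lambda>(t, z). G t (\<gamma> t z))" if g: "good \<gamma>" for \<gamma>
  proof -
    have "continuous_on (?I \<times> U) (\<lambda>p. (\<lambda>(t, z). G t z) (fst p, (\<lambda>(t, z). \<gamma> t z) p))"
      by (rule continuous_on_compose2[OF cont])
         (use g in_V[OF in_cball[OF g]] in \<open>auto simp: good_def intro!: continuous_intros\<close>)
    then show ?thesis by (simp add: case_prod_unfold)
  qed
  have contG1: "continuous_on ?I (\<lambda>u. G u (\<gamma> u z))" if g: "good \<gamma>" and z: "z \<in> U" for \<gamma> z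
    by (rule continuous_on_slice[OF contG[OF g] z order_refl])
  have int: "(\<lambda>u. G u (\<gamma> u z)) integrable_on {0..t}" if "good \<gamma>" "z \<in> U" "t \<in> ?I" for \<gamma> z t
    using that by (intro integrable_continuous_real continuous_on_subset[OF contG1]) auto
  have int_bound: "norm (integral {0..t} F) \<le> B * T"
    if "t \<in> ?I" "continuous_on {0..t} F" "\<And>u. u \<in> {0..t} \<Longrightarrow> norm (F u) \<le> B" "B \<ge> 0" for t and F :: "real \<Rightarrow> complex" and B :: real
  proof -
    have "norm (integral {0..t} F) \<le> B * (t - 0)"
      using that by (intro integral_bound) auto
    also have "\<dots> \<le> B * T" using that by (intro mult_left_mono) auto
    finally show ?thesis .
  qed
  have good: "good (\<Gamma> k)" for k
  proof (induction k)
    case 0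
    have "continuous_on (?I \<times> U) (\<lambda>p. snd p)" by (intro continuous_intros)
    then show ?case using m T by (auto simp: good_def \<Gamma>0 case_prod_unfold)
  next
    case (Suc k)
    have "continuous_on (?I \<times> U) (\<lambda>(t, z). \<Gamma> (Suc k) t z)"
    proof -
      have "continuous_on (?I \<times> U) (\<lambda>p. snd p + (\<lambda>(t, z). integral {0..t} (\<lambda>u. G u (\<Gamma> k u z))) p)"
        by (intro continuous_intros continuous_on_integral_upper[OF contG[OF Suc]])
      then show ?thesis by (simp add: \<Gamma>S case_prod_unfold)
    qed
    moreover have "\<Gamma> (Suc k) t holomorphic_on U" if t: "t \<in> ?I" for t
      unfolding \<Gamma>S
    proof (intro holomorphic_intros holomorphic_integral_param U)
      show "continuous_on ({0..t} \<times> U) (\<lambda>(u, z). G u (\<Gamma> k u z))"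
        by (rule continuous_on_subset[OF contG[OF Suc]]) (use t in auto)
      fix u assume u: "u \<in> {0..t}"
      then have u: "u \<in> ?I" using t by auto
      have "(G u \<circ> \<Gamma> k u) holomorphic_on U"
        by (rule holomorphic_on_compose_gen[OF _ holo[OF u]])
           (use Suc u in_V in_cball[OF Suc u] in \<open>auto simp: good_def\<close>)
      then show "(\<lambda>z. G u (\<Gamma> k u z)) holomorphic_on U" by (simp add: o_def)
    qed
    moreover have "norm (\<Gamma> (Suc k) t z - z) \<le> m * T" if "t \<in> ?I" "z \<in> U" for t z
      unfolding \<Gamma>S add_diff_cancel_left' using that m
      by (intro int_bound continuous_on_subset[OF contG1[OF Suc]])
         (auto intro!: bound in_V[OF in_cball[OF Suc]])
    moreover have "\<Gamma> (Suc k) t z \<in> \<real>" if t: "t \<in> ?I" and z: "z \<in> U" "z \<in> \<real>" for t z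
    proof -
      have "Im (integral {0..t} (\<lambda>u. G u (\<Gamma> k u z))) = integral {0..t} (\<lambda>u. Im (G u (\<Gamma> k u z)))"
        using integral_linear[OF int[OF Suc z(1) t] bounded_linear_Im] by (simp add: o_def)
      also have "\<dots> = integral {0..t} (\<lambda>u. 0)"
      proof (rule integral_cong)
        fix u assume "u \<in> {0..t}"
        then have u: "u \<in> ?I" using t by auto
        have "G u (\<Gamma> k u z) \<in> \<real>"
          by (rule real[OF u in_V[OF in_cball[OF Suc u z(1)] z(1)]]) (use Suc u z in \<open>auto simp: good_def\<close>)
        then show "Im (G u (\<Gamma> k u z)) = 0" by (simp add: complex_is_Real_iff)
      qed
      finally show ?thesis using z by (simp add: \<Gamma>S complex_is_Real_iff)
    qed
    ultimately show ?case unfolding good_def by blast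
  qed
  have half: "T * (m / \<rho>) \<le> 1 / 2" using m \<rho> by (simp add: field_simps)
  have diff: "norm (integral {0..t} (\<lambda>u. G u (\<gamma> u z)) - integral {0..t} (\<lambda>u. G u (\<gamma>' u z))) \<le> m / \<rho> * B * T"
    if g: "good \<gamma>" "good \<gamma>'" and t: "t \<in> ?I" and z: "z \<in> U" and B: "\<And>u. u \<in> ?I \<Longrightarrow> norm (\<gamma> u z - \<gamma>' u z) \<le> B"
    for \<gamma> \<gamma>' t z B
  proof -
    have B0: "B \<ge> 0" using B[OF t] norm_ge_zero order_trans by blast
    have "integral {0..t} (\<lambda>u. G u (\<gamma> u z)) - integral {0..t} (\<lambda>u. G u (\<gamma>' u z))
      = integral {0..t} (\<lambda>u. G u (\<gamma> u z) - G u (\<gamma>' u z))"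
      using int[OF g(1) z t] int[OF g(2) z t] by (simp add: Henstock_Kurzweil_Integration.integral_diff)
    also have "norm \<dots> \<le> m / \<rho> * B * T"
    proof (rule int_bound[OF t])
      show "continuous_on {0..t} (\<lambda>u. G u (\<gamma> u z) - G u (\<gamma>' u z))"
        by (intro continuous_intros continuous_on_subset[OF contG1[OF g(1) z]] continuous_on_subset[OF contG1[OF g(2) z]])
           (use t in auto)
      fix u assume "u \<in> {0..t}"
      then have u: "u \<in> ?I" using t by auto
      have "norm (G u (\<gamma> u z) - G u (\<gamma>' u z)) \<le> m / \<rho> * norm (\<gamma> u z - \<gamma>' u z)"
        by (rule lip[OF z u in_cball[OF g(1) u z] in_cball[OF g(2) u z]])
      also have "\<dots> \<le> m / \<rho> * B" using B[OF u] m \<rho> by (intro mult_left_mono) auto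
      finally show "norm (G u (\<gamma> u z) - G u (\<gamma>' u z)) \<le> m / \<rho> * B" .
    qed (use m \<rho> B0 in auto)
    finally show ?thesis .
  qed
  have step: "norm (\<Gamma> (Suc k) t z - \<Gamma> k t z) \<le> m * T * (1 / 2) ^ k" if "t \<in> ?I" "z \<in> U" for k t z
    using that
  proof (induction k arbitrary: t)
    case 0
    then show ?case using good[of "Suc 0"] by (simp add: \<Gamma>0 good_def)
  next
    case (Suc k)
    have "norm (\<Gamma> (Suc (Suc k)) t z - \<Gamma> (Suc k) t z)
      = norm (integral {0..t} (\<lambda>u. G u (\<Gamma> (Suc k) u z)) - integral {0..t} (\<lambda>u. G u (\<Gamma> k u z)))"
      by (simp add: \<Gamma>S[of "Suc k"] \<Gamma>S[of k])
    also have "\<dots> \<le> m / \<rho> * (m * T * (1 / 2) ^ k) * T"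
      by (rule diff[OF good good Suc.prems]) (use Suc in auto)
    also have "\<dots> = (T * (m / \<rho>)) * (m * T * (1 / 2) ^ k)" by simp
    also have "\<dots> \<le> 1 / 2 * (m * T * (1 / 2) ^ k)" using half m T by (intro mult_right_mono) auto
    finally show ?case by simp
  qed
  define F where "F p = (\<Sum>k. \<Gamma> (Suc k) (fst p) (snd p) - \<Gamma> k (fst p) (snd p))" for p
  define \<Gamma>' where "\<Gamma>' t z = z + F (t, z)" for t z
  have "uniform_limit (?I \<times> U) (\<lambda>n p. \<Sum>k<n. \<Gamma> (Suc k) (fst p) (snd p) - \<Gamma> k (fst p) (snd p)) F sequentially"
    unfolding F_def
  proof (rule Weierstrass_m_test[where M = "\<lambda>k. m * T * (1 / 2) ^ k"])
    show "summable (\<lambda>k. m * T * (1 / 2) ^ k)" by (intro summable_mult summable_geometric) auto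
  qed (use step in auto)
  moreover have "(\<Sum>k<n. \<Gamma> (Suc k) t z - \<Gamma> k t z) = \<Gamma> n t z - z" for n t z
    using sum_lessThan_telescope[of "\<lambda>k. \<Gamma> k t z" n] by (simp add: \<Gamma>0)
  ultimately have "uniform_limit (?I \<times> U) (\<lambda>n p. \<Gamma> n (fst p) (snd p) - snd p) F sequentially" by simp
  then have "uniform_limit (?I \<times> U) (\<lambda>n p. snd p + (\<Gamma> n (fst p) (snd p) - snd p)) (\<lambda>p. snd p + F p) sequentially"
    by (intro uniform_limit_add uniform_limit_const)
  then have ul: "uniform_limit (?I \<times> U) (\<lambda>n p. \<Gamma> n (fst p) (snd p)) (\<lambda>p. \<Gamma>' (fst p) (snd p)) sequentially"
    by (simp add: \<Gamma>'_def)
  have lim: "(\<lambda>n. \<Gamma> n t z) \<longlonglongrightarrow> \<Gamma>' t z" if "t \<in> ?I" "z \<in> U" for t z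
    using tendsto_uniform_limitI[OF ul, of "(t, z)"] that by simp
  have good': "good \<Gamma>'"
    unfolding good_def
  proof (intro conjI ballI impI)
    have "continuous_on (?I \<times> U) (\<lambda>p. \<Gamma>' (fst p) (snd p))"
      by (rule uniform_limit_theorem[OF _ ul]) (use good in \<open>auto simp: good_def case_prod_unfold\<close>)
    then show "continuous_on (?I \<times> U) (\<lambda>(t, z). \<Gamma>' t z)" by (simp add: case_prod_unfold)
  next
    fix t assume t: "t \<in> ?I"
    show "\<Gamma>' t holomorphic_on U"
    proof (rule holomorphic_uniform_sequence[OF U(1)])
      show "\<Gamma> n t holomorphic_on U" for n using good[of n] t by (simp add: good_def)
      fix z assume "z \<in> U"
      then obtain d where d: "d > 0" "cball z d \<subseteq> U" using U(1) open_contains_cball by metis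
      have "uniform_limit (cball z d) (\<lambda>n x. \<Gamma> n (fst (t, x)) (snd (t, x))) (\<lambda>x. \<Gamma>' (fst (t, x)) (snd (t, x))) sequentially"
        by (rule uniform_limit_compose'[OF ul]) (use d t in auto)
      then show "\<exists>d>0. cball z d \<subseteq> U \<and> uniform_limit (cball z d) (\<lambda>n. \<Gamma> n t) (\<Gamma>' t) sequentially"
        using d by auto
    qed
  next
    fix t z assume t: "t \<in> ?I" and z: "z \<in> U"
    have "(\<lambda>n. norm (\<Gamma> n t z - z)) \<longlonglongrightarrow> norm (\<Gamma>' t z - z)" by (intro tendsto_intros lim t z)
    then show "norm (\<Gamma>' t z - z) \<le> m * T"
      by (rule LIMSEQ_le_const2) (use good t z in \<open>auto simp: good_def\<close>)
    assume "z \<in> \<real>"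
    then show "\<Gamma>' t z \<in> \<real>"
      using good t z by (intro closed_sequentially[OF closed_complex_Reals _ lim[OF t z]]) (auto simp: good_def)
  qed
  have eq: "\<Gamma>' t z = z + integral {0..t} (\<lambda>u. G u (\<Gamma>' u z))" if t: "t \<in> ?I" and z: "z \<in> U" for t z
  proof -
    have "(\<lambda>n. integral {0..t} (\<lambda>u. G u (\<Gamma> n u z))) \<longlonglongrightarrow> integral {0..t} (\<lambda>u. G u (\<Gamma>' u z))"
    proof (rule LIMSEQ_I)
      fix e :: real assume e: "e > 0"
      have "\<forall>\<^sub>F n in sequentially. \<forall>p\<in>?I \<times> U. dist (\<Gamma> n (fst p) (snd p)) (\<Gamma>' (fst p) (snd p)) < e"
        using ul e unfolding uniform_limit_iff by blast
      then obtain N where N: "\<And>n u. n \<ge> N \<Longrightarrow> u \<in> ?I \<Longrightarrow> norm (\<Gamma> n u z - \<Gamma>' u z) < e"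
        unfolding eventually_sequentially dist_norm using z by fastforce
      have "norm (integral {0..t} (\<lambda>u. G u (\<Gamma> n u z)) - integral {0..t} (\<lambda>u. G u (\<Gamma>' u z))) < e" if n: "n \<ge> N" for n
      proof -
        have "norm (integral {0..t} (\<lambda>u. G u (\<Gamma> n u z)) - integral {0..t} (\<lambda>u. G u (\<Gamma>' u z))) \<le> m / \<rho> * e * T"
          by (rule diff[OF good good' t z]) (use N n in \<open>auto intro: less_imp_le\<close>)
        also have "\<dots> = (T * (m / \<rho>)) * e" by simp
        also have "\<dots> \<le> 1 / 2 * e" using half e by (intro mult_right_mono) auto
        finally show ?thesis using e by simp
      qed
      then show "\<exists>N. \<forall>n\<ge>N. norm (integral {0..t} (\<lambda>u. G u (\<Gamma> n u z)) - integral {0..t} (\<lambda>u. G u (\<Gamma>' u z))) < e" by blast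
    qed
    then have "(\<lambda>n. \<Gamma> (Suc n) t z) \<longlonglongrightarrow> z + integral {0..t} (\<lambda>u. G u (\<Gamma>' u z))"
      unfolding \<Gamma>S by (intro tendsto_intros)
    moreover have "(\<lambda>n. \<Gamma> (Suc n) t z) \<longlonglongrightarrow> \<Gamma>' t z" using lim[OF t z] by (rule LIMSEQ_Suc)
    ultimately show ?thesis using LIMSEQ_unique by blast
  qed
  show thesis
  proof (rule that[of \<Gamma>'])
    fix t z assume t: "t \<in> ?I" and z: "z \<in> U"
    show "norm (\<Gamma>' t z - z) \<le> m * T" using good' t z by (auto simp: good_def)
    have "((\<lambda>t. z + integral {0..t} (\<lambda>u. G u (\<Gamma>' u z))) has_vector_derivative 0 + G t (\<Gamma>' t z)) (at t within ?I)"
      by (intro has_vector_derivative_add has_vector_derivative_const integral_has_vector_derivative contG1 good' t z)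
    then have d: "((\<lambda>t. z + integral {0..t} (\<lambda>u. G u (\<Gamma>' u z))) has_vector_derivative G t (\<Gamma>' t z)) (at t within ?I)"
      by simp
    show "((\<lambda>t. \<Gamma>' t z) has_vector_derivative G t (\<Gamma>' t z)) (at t within ?I)"
      by (rule has_vector_derivative_transform[OF t _ d]) (rule eq[OF _ z])
    assume "z \<in> \<real>"
    then show "\<Gamma>' t z \<in> \<real>" using good' t z by (auto simp: good_def)
  next
    fix z assume z: "z \<in> U"
    show "\<Gamma>' 0 z = z" using eq[of 0 z] z T by simp
    have TT: "T \<in> ?I" using T by simp
    have "\<Gamma>' T z - z - integral {0..T} (\<lambda>t. G t z)
      = integral {0..T} (\<lambda>u. G u (\<Gamma>' u z)) - integral {0..T} (\<lambda>u. G u (\<Gamma> 0 u z))"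
      using eq[OF TT z] by (simp add: \<Gamma>0)
    also have "norm \<dots> \<le> m / \<rho> * (m * T) * T"
      by (rule diff[OF good' good TT z]) (use good' z in \<open>auto simp: good_def \<Gamma>0\<close>)
    finally show "norm (\<Gamma>' T z - z - integral {0..T} (\<lambda>t. G t z)) \<le> T * (m / \<rho>) * (m * T)" by (simp add: mult_ac)
  next
    show "\<Gamma>' T holomorphic_on U" using good' T by (auto simp: good_def)
  qed
qed

section \<open>The orbit equation in polar coordinates\<close>

text \<open>A change of the angle whose derivative \<open>2 cos\<^sup>2 \<tau>\<close> vanishes at the switching angles. In the new angle the
right-hand side of the orbit equation is continuous although it jumps in the old one, so an existence
theorem for continuous fields suffices.\<close>

definition stretch :: "real \<Rightarrow> real" where "stretch \<tau> = \<tau> + sin \<tau> * cos \<tau>"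

lemma has_real_derivative_stretch: "(stretch has_real_derivative 2 * (cos \<tau>)\<^sup>2) (at \<tau>)"
proof -
  have "(stretch has_real_derivative 1 + (cos \<tau> * cos \<tau> + sin \<tau> * - sin \<tau>)) (at \<tau>)"
    unfolding stretch_def [abs_def] by (auto intro!: derivative_eq_intros)
  moreover have "1 + (cos \<tau> * cos \<tau> + sin \<tau> * - sin \<tau>) = 2 * (cos \<tau>)\<^sup>2"
    using sin_cos_squared_add[of \<tau>] by (simp add: power2_eq_square algebra_simps)
  ultimately show ?thesis by simp
qed

lemma continuous_on_stretch [continuous_intros]:
  fixes f :: "'a::t2_space \<Rightarrow> real"
  shows "continuous_on A f \<Longrightarrow> continuous_on A (\<lambda>x. stretch (f x))"
  unfolding stretch_def by (intro continuous_intros)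

text \<open>The increment of \<open>sin cos\<close> between \<open>a\<close> and \<open>b\<close> is \<open>cos (a + b) sin (b - a)\<close>, of absolute value less than
\<open>b - a\<close>.\<close>

lemma stretch_strict_mono: "a < b \<Longrightarrow> stretch a < stretch b"
proof -
  assume ab: "a < b"
  have "sin b * cos b - sin a * cos a = cos (a + b) * sin (b - a)"
  proof -
    have "cos (a + b) * sin (b - a) = sin b * cos b * ((sin a)\<^sup>2 + (cos a)\<^sup>2) - sin a * cos a * ((sin b)\<^sup>2 + (cos b)\<^sup>2)"
      unfolding cos_add sin_diff power2_eq_square by algebra
    then show ?thesis by simp
  qed
  moreover have "\<bar>cos (a + b) * sin (b - a)\<bar> \<le> 1 * \<bar>sin (b - a)\<bar>"
    unfolding abs_mult by (intro mult_right_mono) auto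
  moreover have "\<bar>sin (b - a)\<bar> < b - a"
  proof -
    have "sin (b - a) < b - a"
    proof (cases "b - a < pi")
      case True
      have "0 - sin 0 < (b - a) - sin (b - a)"
      proof (rule DERIV_pos_imp_increasing_open[of 0 "b - a" "\<lambda>t. t - sin t"])
        fix t assume t: "0 < t" "t < b - a"
        then have "cos t < cos 0" using True by (intro cos_monotone_0_pi) auto
        moreover have "((\<lambda>t. t - sin t) has_real_derivative 1 - cos t) (at t)" by (auto intro!: derivative_eq_intros)
        ultimately show "\<exists>y. ((\<lambda>t. t - sin t) has_real_derivative y) (at t) \<and> y > 0" by force
      qed (use ab in \<open>auto intro!: continuous_intros\<close>)
      then show ?thesis by simp
    next
      case False
      then show ?thesis using sin_le_one[of "b - a"] pi_gt3 by linarith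
    qed
    moreover have "- sin (b - a) < b - a"
    proof (cases "b - a < pi")
      case True
      then show ?thesis using ab sin_gt_zero[of "b - a"] by linarith
    next
      case False
      have "- 1 \<le> sin (b - a)" by (rule sin_ge_minus_one)
      then show ?thesis using False pi_gt3 by linarith
    qed
    ultimately show ?thesis by linarith
  qed
  ultimately show ?thesis by (simp add: stretch_def abs_less_iff) linarith
qed

lemma stretch_0 [simp]: "stretch 0 = 0" and stretch_pi_half [simp]: "stretch (pi / 2) = pi / 2"
  and stretch_3pi_half [simp]: "stretch (3 * pi / 2) = 3 * pi / 2" and stretch_2pi [simp]: "stretch (2 * pi) = 2 * pi"
proof -
  have "cos (3 * pi / 2) = 0" using cos_pi_half cos_minus_pi[of "3 * pi / 2"] by (simp add: cos_3over2_pi)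
  then show "stretch (3 * pi / 2) = 3 * pi / 2" by (simp add: stretch_def)
qed (simp_all add: stretch_def)

text \<open>The coefficients \<open>c\<close>, \<open>d\<close> belong to the perturbation above the switching line, \<open>c'\<close>, \<open>d'\<close> to that below.\<close>

locale two_zone_system =
  fixes \<eta> :: real and n :: nat and c d c' d' :: "nat \<Rightarrow> nat \<Rightarrow> real"
  assumes eta_pos: "\<eta> > 0"
begin

definition \<omega> :: real where "\<omega> = sqrt (2 * \<eta>)"

lemma omega_pos: "\<omega> > 0" and omega_sq: "\<omega> * \<omega> = 2 * \<eta>"
  using eta_pos by (simp_all add: \<omega>_def)

definition rad :: "bool \<Rightarrow> real \<Rightarrow> 'a \<Rightarrow> 'a::real_normed_field" where
  "rad u \<theta> z = radial_rate \<eta> n (if u then c else c') (if u then d else d') (z * of_real (cos \<theta>)) (z * of_real (sin \<theta>))"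

definition ang :: "bool \<Rightarrow> real \<Rightarrow> 'a \<Rightarrow> 'a::real_normed_field" where
  "ang u \<theta> z = angular_rate \<eta> n (if u then c else c') (if u then d else d') (z * of_real (cos \<theta>)) (z * of_real (sin \<theta>))"

text \<open>The quotient of the radial and the angular velocity in the linearizing coordinates, multiplied out to
avoid \<open>1 / z\<^sup>2\<close>. The radius \<open>z\<close> may be complex.\<close>

definition slope :: "bool \<Rightarrow> real \<Rightarrow> real \<Rightarrow> 'a \<Rightarrow> 'a::real_normed_field" where
  "slope u \<epsilon> \<theta> z = of_real \<epsilon> * rad u \<theta> z * z / (of_real \<omega> * z\<^sup>2 + of_real \<epsilon> * ang u \<theta> z)"

definition stretched_slope :: "real \<Rightarrow> real \<Rightarrow> 'a \<Rightarrow> 'a::real_normed_field" where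
  "stretched_slope \<epsilon> \<tau> z = of_real (2 * (cos \<tau>)\<^sup>2) * slope (cos \<tau> \<ge> 0) \<epsilon> (stretch \<tau>) z"

text \<open>The coefficient of \<open>\<epsilon>\<close> in the stretched slope.\<close>

definition linear_slope :: "real \<Rightarrow> 'a \<Rightarrow> 'a::real_normed_field" where
  "linear_slope \<tau> z = of_real (2 * (cos \<tau>)\<^sup>2) * (rad (cos \<tau> \<ge> 0) (stretch \<tau>) z / (of_real \<omega> * z))"

lemma of_real_rad [simp]: "rad u \<theta> (of_real s) = of_real (rad u \<theta> s)"
  by (simp add: rad_def radial_rate_def Let_def bipoly_def)

lemma of_real_ang [simp]: "ang u \<theta> (of_real s) = of_real (ang u \<theta> s)"
  by (simp add: ang_def angular_rate_def Let_def bipoly_def)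

lemma of_real_slope [simp]: "slope u \<epsilon> \<theta> (of_real s) = of_real (slope u \<epsilon> \<theta> s)"
  by (simp add: slope_def)

lemma of_real_stretched_slope [simp]: "stretched_slope \<epsilon> \<tau> (of_real s) = of_real (stretched_slope \<epsilon> \<tau> s)"
  by (simp add: stretched_slope_def)

lemma of_real_linear_slope [simp]: "linear_slope \<tau> (of_real s) = of_real (linear_slope \<tau> s)"
  by (simp add: linear_slope_def)

lemma mult_cos_neq_1: "norm z < 1 \<Longrightarrow> z * of_real (cos \<theta>) \<noteq> (1::'a::real_normed_field)"
proof
  assume z: "norm z < 1" and "z * of_real (cos \<theta>) = 1"
  then have "norm z * \<bar>cos \<theta>\<bar> = 1" by (metis norm_mult norm_of_real norm_one)
  moreover have "norm z * \<bar>cos \<theta>\<bar> \<le> norm z * 1" by (intro mult_left_mono) auto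
  ultimately show False using z by linarith
qed

lemma continuous_on_rad [continuous_intros]:
  fixes z :: "'b::t2_space \<Rightarrow> 'a::real_normed_field"
  assumes "continuous_on A \<theta>" "continuous_on A z" "\<And>x. x \<in> A \<Longrightarrow> norm (z x) < 1"
  shows "continuous_on A (\<lambda>x. rad u (\<theta> x) (z x))"
  unfolding rad_def
  by (intro continuous_on_radial_rate continuous_intros assms mult_cos_neq_1) (use eta_pos assms in auto)

lemma continuous_on_angular_rate:
  fixes C S :: "'b::topological_space \<Rightarrow> 'a::real_normed_field"
  assumes "continuous_on A C" "continuous_on A S" "\<And>t. t \<in> A \<Longrightarrow> C t \<noteq> 1"
  shows "continuous_on A (\<lambda>t. angular_rate \<eta> n cc dd (C t) (S t))"
proof -
  have "1 - C t \<noteq> 0" if "t \<in> A" for t using assms(3)[OF that] by simp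
  then show ?thesis
    unfolding angular_rate_def Let_def bipoly_def
    by (intro continuous_intros assms(1,2)) (use eta_pos in simp_all)
qed

lemma continuous_on_ang [continuous_intros]:
  fixes z :: "'b::t2_space \<Rightarrow> 'a::real_normed_field"
  assumes "continuous_on A \<theta>" "continuous_on A z" "\<And>x. x \<in> A \<Longrightarrow> norm (z x) < 1"
  shows "continuous_on A (\<lambda>x. ang u (\<theta> x) (z x))"
  unfolding ang_def
  by (intro continuous_on_angular_rate continuous_intros assms mult_cos_neq_1) (use assms in auto)

lemma holomorphic_rad: "rad u \<theta> holomorphic_on {z. norm z < 1}"
  and holomorphic_ang: "ang u \<theta> holomorphic_on {z. norm z < 1}"
proof -
  have ne: "1 - z * complex_of_real (cos \<theta>) \<noteq> 0" if "norm z < 1" for z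
    using mult_cos_neq_1[OF that, of \<theta>] by simp
  show "rad u \<theta> holomorphic_on {z. norm z < 1}"
    unfolding rad_def [abs_def] radial_rate_def Let_def bipoly_def
    by (intro holomorphic_intros) (use ne eta_pos in \<open>simp_all\<close>)
  show "ang u \<theta> holomorphic_on {z. norm z < 1}"
    unfolding ang_def [abs_def] angular_rate_def Let_def bipoly_def
    by (intro holomorphic_intros) (use ne eta_pos in \<open>simp_all\<close>)
qed

end

locale annulus = two_zone_system +
  fixes a b :: real
  assumes ab: "0 < a" "a \<le> b" "b < 1"
begin

text \<open>The radii of interest lie in \<open>{a..b}\<close>; \<open>\<rho>\<close> is the unit in which neighbourhoods of this interval are
measured. All estimates take place within distance \<open>4 \<rho>\<close>, well inside the punctured unit disc.\<close>

definition \<rho> :: real where "\<rho> = min a (1 - b) / 16"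

lemma rho: "\<rho> > 0" "16 * \<rho> \<le> a" "16 * \<rho> \<le> 1 - b"
  using ab by (auto simp: \<rho>_def)

definition rect :: "real \<Rightarrow> complex set" where
  "rect r = cbox (Complex (a - r) (- r)) (Complex (b + r) r)"

definition open_rect :: "complex set" where
  "open_rect = box (Complex (a - \<rho>) (- \<rho>)) (Complex (b + \<rho>) \<rho>)"

lemma mem_rect: "z \<in> rect r \<longleftrightarrow> a - r \<le> Re z \<and> Re z \<le> b + r \<and> \<bar>Im z\<bar> \<le> r"
  by (auto simp: rect_def in_cbox_complex_iff)

lemma mem_open_rect: "z \<in> open_rect \<longleftrightarrow> a - \<rho> < Re z \<and> Re z < b + \<rho> \<and> \<bar>Im z\<bar> < \<rho>"
  by (auto simp: open_rect_def in_box_complex_iff)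

lemma open_open_rect: "open open_rect" and convex_open_rect: "convex open_rect"
  by (simp_all add: open_rect_def open_box convex_box)

lemma cball_rect: "z \<in> rect r \<Longrightarrow> cball z r' \<subseteq> rect (r + r')"
proof
  fix w assume z: "z \<in> rect r" and "w \<in> cball z r'"
  then have "norm (z - w) \<le> r'" by (simp add: dist_norm)
  then have "\<bar>Re z - Re w\<bar> \<le> r'" "\<bar>Im z - Im w\<bar> \<le> r'"
    using abs_Re_le_cmod[of "z - w"] abs_Im_le_cmod[of "z - w"] by auto
  then show "w \<in> rect (r + r')" using z unfolding mem_rect by linarith
qed

lemma open_rect_subset: "open_rect \<subseteq> rect \<rho>"
  by (auto simp: mem_rect mem_open_rect)

lemma rect_norm:
  assumes "z \<in> rect (4 * \<rho>)"
  shows "norm z < 1" "3 / 4 * a \<le> norm z" "z \<noteq> 0"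
proof -
  have "norm z \<le> \<bar>Re z\<bar> + \<bar>Im z\<bar>" by (rule cmod_le)
  then show "norm z < 1" using assms rho ab unfolding mem_rect by linarith
  have "\<bar>Re z\<bar> \<le> norm z" by (rule abs_Re_le_cmod)
  then show "3 / 4 * a \<le> norm z" using assms rho ab unfolding mem_rect by linarith
  then show "z \<noteq> 0" using ab by auto
qed

text \<open>The angle enters only through its sine and cosine, so it suffices to take it from one period, and
continuity on a compact set gives the bound.\<close>

lemma rates_bounded: "\<exists>B>0. \<forall>u \<theta>. \<forall>z\<in>rect (4 * \<rho>). norm (rad u \<theta> z) \<le> B \<and> norm (ang u \<theta> z) \<le> B"
proof -
  let ?K = "{0..2 * pi} \<times> rect (4 * \<rho>)"
  have cK: "compact ?K" by (simp add: rect_def compact_Times)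
  have "\<exists>B. \<forall>p\<in>?K. norm (rad u (fst p) (snd p)) + norm (ang u (fst p) (snd p)) \<le> B" for u
  proof -
    have "continuous_on ?K (\<lambda>p. norm (rad u (fst p) (snd p)) + norm (ang u (fst p) (snd p)))"
      by (intro continuous_intros) (use rect_norm in auto)
    then have "compact ((\<lambda>p. norm (rad u (fst p) (snd p)) + norm (ang u (fst p) (snd p))) ` ?K)"
      using cK by (rule compact_continuous_image)
    then have "bounded ((\<lambda>p. norm (rad u (fst p) (snd p)) + norm (ang u (fst p) (snd p))) ` ?K)"
      by (rule compact_imp_bounded)
    then obtain B where "\<forall>x\<in>(\<lambda>p. norm (rad u (fst p) (snd p)) + norm (ang u (fst p) (snd p))) ` ?K. norm x \<le> B"
      unfolding bounded_iff by blast
    then show ?thesis by (intro exI[of _ B] ballI) (smt (verit, best) image_eqI real_norm_def)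
  qed
  then obtain B where B: "\<And>u p. p \<in> ?K \<Longrightarrow> norm (rad u (fst p) (snd p)) + norm (ang u (fst p) (snd p)) \<le> B u"
    by metis
  define B' where "B' = max 1 (max (B True) (B False))"
  have "norm (rad u \<theta> z) \<le> B' \<and> norm (ang u \<theta> z) \<le> B'" if z: "z \<in> rect (4 * \<rho>)" for u \<theta> z
  proof -
    obtain t where t: "0 \<le> t" "t < 2 * pi" "cos \<theta> = cos t" "sin \<theta> = sin t"
      using sincos_total_2pi[of "cos \<theta>" "sin \<theta>"] by auto
    have "rad u \<theta> z = rad u t z" "ang u \<theta> z = ang u t z" by (simp_all add: rad_def ang_def t)
    moreover have "norm (rad u t z) + norm (ang u t z) \<le> B u" using B[of "(t, z)" u] t z by auto
    moreover have "B u \<le> B'" by (cases u) (auto simp: B'_def)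
    ultimately show ?thesis by (smt (verit) norm_ge_zero)
  qed
  then show ?thesis by (intro exI[of _ B']) (auto simp: B'_def)
qed

definition B :: real where
  "B = (SOME B. B > 0 \<and> (\<forall>u \<theta>. \<forall>z\<in>rect (4 * \<rho>). norm (rad u \<theta> z) \<le> B \<and> norm (ang u \<theta> z) \<le> B))"

lemma B: "B > 0" "z \<in> rect (4 * \<rho>) \<Longrightarrow> norm (rad u \<theta> z) \<le> B" "z \<in> rect (4 * \<rho>) \<Longrightarrow> norm (ang u \<theta> z) \<le> B"
  using someI_ex[OF rates_bounded] unfolding B_def[symmetric] by auto

definition K :: real where "K = 4 * B / (\<omega> * a\<^sup>2)"

text \<open>The first term keeps the angular velocity away from zero, the second keeps the change of the radius
during one turn below \<open>\<rho>\<close>.\<close>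

definition \<epsilon>\<^sub>0 :: real where "\<epsilon>\<^sub>0 = min (\<omega> * a\<^sup>2 / (4 * B)) (\<rho> / (8 * pi * K))"

lemma K_pos: "K > 0" using B(1) omega_pos ab by (simp add: K_def)

lemma eps0_pos: "\<epsilon>\<^sub>0 > 0"
  using B(1) omega_pos ab K_pos rho by (simp add: \<epsilon>\<^sub>0_def)

text \<open>The first order coefficient of the return map, for complex radius.\<close>

definition melnikov_fun :: "complex \<Rightarrow> complex" where
  "melnikov_fun z = integral {0..2 * pi} (\<lambda>\<tau>. linear_slope \<tau> z)"

text \<open>The factor \<open>cos\<^sup>2\<close> vanishes where the case distinction jumps.\<close>

lemma continuous_on_two_sided:
  fixes h :: "bool \<Rightarrow> 'b::t2_space \<Rightarrow> 'a::real_normed_field"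
  assumes T: "continuous_on A T" and h: "\<And>u. continuous_on A (h u)"
  shows "continuous_on A (\<lambda>x. of_real (2 * (cos (T x))\<^sup>2) * h (cos (T x) \<ge> 0) x)"
proof -
  have "continuous_on A (\<lambda>x. if cos (T x) \<le> 0 then of_real (2 * (cos (T x))\<^sup>2) * h False x
      else of_real (2 * (cos (T x))\<^sup>2) * h True x)"
    by (rule continuous_on_cases_le)
       (auto intro!: continuous_intros continuous_on_subset[OF h] continuous_on_subset[OF T])
  moreover have "(if cos (T x) \<le> 0 then of_real (2 * (cos (T x))\<^sup>2) * h False x
      else of_real (2 * (cos (T x))\<^sup>2) * h True x) = of_real (2 * (cos (T x))\<^sup>2) * h (cos (T x) \<ge> 0) x" for x
    by (cases "cos (T x)" "0::real" rule: linorder_cases) auto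
  ultimately show ?thesis by simp
qed

lemma continuous_on_linear_slope:
  "continuous_on (X \<times> rect (4 * \<rho>)) (\<lambda>(\<tau>, z). linear_slope \<tau> z)"
proof -
  have "continuous_on (X \<times> rect (4 * \<rho>)) (\<lambda>p. rad u (stretch (fst p)) (snd p) / (of_real \<omega> * snd p))" for u
    by (intro continuous_intros) (use rect_norm omega_pos in auto)
  from continuous_on_two_sided[OF continuous_on_fst[OF continuous_on_id] this]
  show ?thesis unfolding linear_slope_def by (simp add: case_prod_unfold)
qed

lemma holomorphic_melnikov_fun: "melnikov_fun holomorphic_on open_rect"
  unfolding melnikov_fun_def [abs_def]
proof (rule holomorphic_integral_param[OF open_open_rect convex_open_rect])
  have sub: "open_rect \<subseteq> rect (4 * \<rho>)" using rho by (auto simp: mem_rect mem_open_rect)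
  show "continuous_on ({0..2 * pi} \<times> open_rect) (\<lambda>(\<tau>, z). linear_slope \<tau> z)"
    by (rule continuous_on_subset[OF continuous_on_linear_slope]) (use sub in auto)
  fix \<tau> :: real
  show "linear_slope \<tau> holomorphic_on open_rect"
    unfolding linear_slope_def [abs_def]
    by (intro holomorphic_intros holomorphic_on_subset[OF holomorphic_rad]) (use sub rect_norm omega_pos in auto)
qed

end

locale small_perturbation = annulus +
  fixes \<epsilon> :: real
  assumes eps: "\<bar>\<epsilon>\<bar> < \<epsilon>\<^sub>0"
begin

lemma eps_bound_rate: "\<bar>\<epsilon>\<bar> * B \<le> \<omega> * a\<^sup>2 / 4"
  using eps B(1) by (simp add: \<epsilon>\<^sub>0_def pos_less_divide_eq mult.commute mult.left_commute)

lemma eps_bound_slope: "8 * pi * (\<bar>\<epsilon>\<bar> * K) \<le> \<rho>"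
  using eps K_pos by (simp add: \<epsilon>\<^sub>0_def pos_less_divide_eq mult_ac)

lemma denominator_bound:
  assumes z: "z \<in> rect (4 * \<rho>)"
  shows "norm (of_real \<omega> * z\<^sup>2 + of_real \<epsilon> * ang u \<theta> z) \<ge> \<omega> * a\<^sup>2 / 4"
proof -
  have "(3 / 4 * a)\<^sup>2 \<le> (norm z)\<^sup>2" using rect_norm(2)[OF z] ab by (intro power_mono) auto
  moreover have "(3 / 4 * a)\<^sup>2 = 9 / 16 * a\<^sup>2" by (simp add: power2_eq_square)
  ultimately have "a\<^sup>2 / 2 \<le> (norm z)\<^sup>2" using zero_le_power2[of a] by linarith
  then have "\<omega> * (a\<^sup>2 / 2) \<le> \<omega> * (norm z)\<^sup>2" using omega_pos by (intro mult_left_mono) auto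
  moreover have "norm (of_real \<epsilon> * ang u \<theta> z) \<le> \<bar>\<epsilon>\<bar> * B"
    using B(3)[OF z] by (simp add: norm_mult mult_left_mono)
  moreover have "norm (of_real \<omega> * z\<^sup>2) = \<omega> * (norm z)\<^sup>2" using omega_pos by (simp add: norm_mult norm_power)
  moreover have "norm (of_real \<omega> * z\<^sup>2) - norm (of_real \<epsilon> * ang u \<theta> z) \<le> norm (of_real \<omega> * z\<^sup>2 + of_real \<epsilon> * ang u \<theta> z)"
    by (rule norm_diff_ineq)
  ultimately show ?thesis using eps_bound_rate by simp
qed

lemma denominator_nonzero: "z \<in> rect (4 * \<rho>) \<Longrightarrow> of_real \<omega> * z\<^sup>2 + of_real \<epsilon> * ang u \<theta> z \<noteq> 0"
proof
  assume "z \<in> rect (4 * \<rho>)" and "of_real \<omega> * z\<^sup>2 + of_real \<epsilon> * ang u \<theta> z = 0"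
  with denominator_bound[of z u \<theta>] have "\<omega> * a\<^sup>2 / 4 \<le> 0" by simp
  then show False using omega_pos ab by (simp add: mult_le_0_iff)
qed

lemma slope_bound:
  assumes z: "z \<in> rect (4 * \<rho>)"
  shows "norm (slope u \<epsilon> \<theta> z) \<le> \<bar>\<epsilon>\<bar> * K"
proof -
  have "norm (slope u \<epsilon> \<theta> z) = \<bar>\<epsilon>\<bar> * norm (rad u \<theta> z) * norm z / norm (of_real \<omega> * z\<^sup>2 + of_real \<epsilon> * ang u \<theta> z)"
    by (simp add: slope_def norm_mult norm_divide)
  also have "\<dots> \<le> \<bar>\<epsilon>\<bar> * B * 1 / (\<omega> * a\<^sup>2 / 4)"
    using denominator_bound[OF z] B(1) B(2)[OF z] rect_norm(1)[OF z] omega_pos ab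
    by (intro frac_le mult_mono) auto
  also have "\<dots> = \<bar>\<epsilon>\<bar> * K" by (simp add: K_def)
  finally show ?thesis .
qed

lemma holomorphic_slope: "slope u \<epsilon> \<theta> holomorphic_on rect (4 * \<rho>)"
  unfolding slope_def [abs_def]
  by (intro holomorphic_intros holomorphic_on_subset[OF holomorphic_rad] holomorphic_on_subset[OF holomorphic_ang])
     (use rect_norm denominator_nonzero in auto)

lemma slope_lipschitz:
  assumes "z \<in> rect (3 * \<rho>)" "w \<in> rect (3 * \<rho>)"
  shows "norm (slope u \<epsilon> \<theta> z - slope u \<epsilon> \<theta> w) \<le> \<bar>\<epsilon>\<bar> * K / \<rho> * norm (z - w)"
proof (rule field_differentiable_bound[of "rect (3 * \<rho>)"])
  show "convex (rect (3 * \<rho>))" by (simp add: rect_def)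
  fix v assume v: "v \<in> rect (3 * \<rho>)"
  have sub: "cball v \<rho> \<subseteq> rect (4 * \<rho>)" using cball_rect[OF v, of \<rho>] by simp
  have h: "slope u \<epsilon> \<theta> holomorphic_on cball v \<rho>" using holomorphic_slope sub by (rule holomorphic_on_subset)
  have hb: "slope u \<epsilon> \<theta> holomorphic_on ball v \<rho>" using h by (rule holomorphic_on_subset) auto
  show "(slope u \<epsilon> \<theta> has_field_derivative deriv (slope u \<epsilon> \<theta>) v) (at v within rect (3 * \<rho>))"
    by (rule holomorphic_derivI[OF hb]) (use rho in auto)
  have "norm ((deriv ^^ 1) (slope u \<epsilon> \<theta>) v) \<le> fact 1 * (\<bar>\<epsilon>\<bar> * K) / \<rho> ^ 1"
    by (rule Cauchy_inequality[OF hb holomorphic_on_imp_continuous_on[OF h] rho(1)])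
       (use sub slope_bound in \<open>auto simp: dist_norm subset_eq\<close>)
  then show "norm (deriv (slope u \<epsilon> \<theta>) v) \<le> \<bar>\<epsilon>\<bar> * K / \<rho>" by simp
qed (use assms in auto)

lemma real_slope_lipschitz:
  assumes "s \<in> {a - 3 * \<rho>..b + 3 * \<rho>}" "t \<in> {a - 3 * \<rho>..b + 3 * \<rho>}"
  shows "\<bar>slope u \<epsilon> \<theta> s - slope u \<epsilon> \<theta> t\<bar> \<le> \<bar>\<epsilon>\<bar> * K / \<rho> * \<bar>s - t\<bar>"
  using slope_lipschitz[of "of_real s" "of_real t" u \<theta>] assms rho
  by (simp add: mem_rect flip: of_real_diff)

lemma continuous_on_stretched_slope:
  "continuous_on (X \<times> rect (4 * \<rho>)) (\<lambda>(\<tau>, z). stretched_slope \<epsilon> \<tau> z)"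
proof -
  have "continuous_on (X \<times> rect (4 * \<rho>)) (\<lambda>p. slope u \<epsilon> (stretch (fst p)) (snd p))" for u
    unfolding slope_def by (intro continuous_intros) (use rect_norm denominator_nonzero in auto)
  from continuous_on_two_sided[OF continuous_on_fst[OF continuous_on_id] this]
  show ?thesis unfolding stretched_slope_def by (simp add: case_prod_unfold)
qed

lemma two_cos_square_le: "norm (of_real (2 * (cos \<tau>)\<^sup>2) :: 'a::real_normed_field) \<le> 2"
  by (simp add: norm_mult abs_square_le_1 norm_power power_le_one)

lemma holomorphic_flow_stretched:
  obtains \<Gamma> where
    "\<And>t z. t \<in> {0..2 * pi} \<Longrightarrow> z \<in> open_rect \<Longrightarrow> norm (\<Gamma> t z - z) \<le> \<rho>"
    "\<And>z. z \<in> open_rect \<Longrightarrow> \<Gamma> 0 z = z"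
    "\<And>t z. t \<in> {0..2 * pi} \<Longrightarrow> z \<in> open_rect \<Longrightarrow>
       ((\<lambda>t. \<Gamma> t z) has_vector_derivative stretched_slope \<epsilon> t (\<Gamma> t z)) (at t within {0..2 * pi})"
    "\<Gamma> (2 * pi) holomorphic_on open_rect"
    "\<And>t z. t \<in> {0..2 * pi} \<Longrightarrow> z \<in> open_rect \<Longrightarrow> z \<in> \<real> \<Longrightarrow> \<Gamma> t z \<in> \<real>"
    "\<And>z. z \<in> open_rect \<Longrightarrow> norm (\<Gamma> (2 * pi) z - z - of_real \<epsilon> * melnikov_fun z) \<le>
        (16 * pi\<^sup>2 * K\<^sup>2 / \<rho> + 4 * pi * B * K / (\<omega> * (a\<^sup>2 / 2))) * \<epsilon>\<^sup>2"
proof -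
  define m where "m = 2 * (\<bar>\<epsilon>\<bar> * K)"
  have sub4: "open_rect \<subseteq> rect (4 * \<rho>)" using rho by (auto simp: mem_rect mem_open_rect)
  have m0: "m \<ge> 0" using K_pos by (simp add: m_def)
  have bnd: "norm (stretched_slope \<epsilon> t z) \<le> m" if "z \<in> rect (4 * \<rho>)" for t z
    unfolding stretched_slope_def norm_mult m_def
    by (intro mult_mono two_cos_square_le slope_bound that) auto
  have m1: "2 * m * (2 * pi) \<le> \<rho>" using eps_bound_slope by (simp add: m_def mult_ac)
  obtain \<Gamma> where \<Gamma>:
    "\<And>t z. t \<in> {0..2 * pi} \<Longrightarrow> z \<in> open_rect \<Longrightarrow> norm (\<Gamma> t z - z) \<le> m * (2 * pi)"
    "\<And>z. z \<in> open_rect \<Longrightarrow> \<Gamma> 0 z = z"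
    "\<And>t z. t \<in> {0..2 * pi} \<Longrightarrow> z \<in> open_rect \<Longrightarrow>
       ((\<lambda>t. \<Gamma> t z) has_vector_derivative stretched_slope \<epsilon> t (\<Gamma> t z)) (at t within {0..2 * pi})"
    "\<Gamma> (2 * pi) holomorphic_on open_rect"
    "\<And>t z. t \<in> {0..2 * pi} \<Longrightarrow> z \<in> open_rect \<Longrightarrow> z \<in> \<real> \<Longrightarrow> \<Gamma> t z \<in> \<real>"
    "\<And>z. z \<in> open_rect \<Longrightarrow> norm (\<Gamma> (2 * pi) z - z - integral {0..2 * pi} (\<lambda>t. stretched_slope \<epsilon> t z))
        \<le> 2 * pi * (m / \<rho>) * (m * (2 * pi))"
  proof (rule holomorphic_flow[of "2 * pi" open_rect \<rho> "rect (4 * \<rho>)" "stretched_slope \<epsilon>" m])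
    show "continuous_on ({0..2 * pi} \<times> rect (4 * \<rho>)) (\<lambda>(t, z). stretched_slope \<epsilon> t z)"
      by (rule continuous_on_stretched_slope)
    show "stretched_slope \<epsilon> t holomorphic_on rect (4 * \<rho>)" for t
      unfolding stretched_slope_def [abs_def] by (intro holomorphic_intros holomorphic_slope)
    show "stretched_slope \<epsilon> t z \<in> \<real>" if "z \<in> \<real>" for t and z :: complex
      using that by (auto elim!: Reals_cases)
    show "cball z (2 * \<rho>) \<subseteq> rect (4 * \<rho>)" if "z \<in> open_rect" for z
    proof -
      have "cball z (2 * \<rho>) \<subseteq> rect (\<rho> + 2 * \<rho>)" using open_rect_subset that by (intro cball_rect) auto
      also have "\<dots> \<subseteq> rect (4 * \<rho>)" using rho by (auto simp: mem_rect)
      finally show ?thesis .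
    qed
  qed (use open_open_rect convex_open_rect rho bnd m0 m1 in auto)
  show thesis
  proof (rule that[of \<Gamma>])
    fix t z assume tz: "t \<in> {0..2 * pi}" "z \<in> open_rect"
    have "0 \<le> m * (2 * pi)" using m0 by simp
    moreover have "2 * m * (2 * pi) = 2 * (m * (2 * pi))" by simp
    ultimately have "m * (2 * pi) \<le> \<rho>" using m1 by linarith
    then show "norm (\<Gamma> t z - z) \<le> \<rho>" using \<Gamma>(1)[OF tz] by simp
  next
    fix z assume z: "z \<in> open_rect"
    then have z4: "z \<in> rect (4 * \<rho>)" using sub4 by auto
    have c1: "continuous_on {0..2 * pi} (\<lambda>t. stretched_slope \<epsilon> t z)"
      by (rule continuous_on_slice[OF continuous_on_stretched_slope z4 order_refl])
    have c2: "continuous_on {0..2 * pi} (\<lambda>t. linear_slope t z)"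
      by (rule continuous_on_slice[OF continuous_on_linear_slope z4 order_refl])
    have pt: "norm (stretched_slope \<epsilon> t z - of_real \<epsilon> * linear_slope t z) \<le> 2 * (B * K / (\<omega> * (a\<^sup>2 / 2)) * \<epsilon>\<^sup>2)" for t
    proof -
      let ?u = "cos t \<ge> 0" and ?th = "stretch t"
      let ?A = "ang ?u ?th z" and ?R = "rad ?u ?th z"
      let ?N = "of_real \<omega> * z\<^sup>2 + of_real \<epsilon> * ?A"
      have N: "?N \<noteq> 0" by (rule denominator_nonzero[OF z4])
      have z0: "z \<noteq> 0" "of_real \<omega> * z\<^sup>2 \<noteq> 0" using rect_norm(3)[OF z4] omega_pos by auto
      have "slope ?u \<epsilon> ?th z - of_real \<epsilon> * (?R / (of_real \<omega> * z))
        = - (slope ?u \<epsilon> ?th z * (of_real \<epsilon> * ?A / (of_real \<omega> * z\<^sup>2)))"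
      proof -
        have "of_real \<epsilon> * (?R / (of_real \<omega> * z)) = slope ?u \<epsilon> ?th z * (?N / (of_real \<omega> * z\<^sup>2))"
          unfolding slope_def using N z0 by (simp add: power2_eq_square)
        also have "?N / (of_real \<omega> * z\<^sup>2) = 1 + of_real \<epsilon> * ?A / (of_real \<omega> * z\<^sup>2)"
          using z0 by (simp add: add_divide_distrib)
        finally show ?thesis by (simp add: algebra_simps)
      qed
      moreover have "norm (slope ?u \<epsilon> ?th z * (of_real \<epsilon> * ?A / (of_real \<omega> * z\<^sup>2)))
        \<le> (\<bar>\<epsilon>\<bar> * K) * ((\<bar>\<epsilon>\<bar> * B) / (\<omega> * (a\<^sup>2 / 2)))"
        unfolding norm_mult norm_divide
      proof (intro mult_mono frac_le slope_bound z4)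
        have "(3 / 4 * a)\<^sup>2 \<le> (norm z)\<^sup>2" using rect_norm(2)[OF z4] ab by (intro power_mono) auto
        moreover have "(3 / 4 * a)\<^sup>2 = 9 / 16 * a\<^sup>2" by (simp add: power2_eq_square)
  ultimately have "a\<^sup>2 / 2 \<le> (norm z)\<^sup>2" using zero_le_power2[of a] by linarith
        then show "a\<^sup>2 / 2 \<le> norm (z\<^sup>2)" by (simp add: norm_power)
      qed (use B(1) B(3)[OF z4] omega_pos ab K_pos in auto)
      ultimately have "norm (slope ?u \<epsilon> ?th z - of_real \<epsilon> * (?R / (of_real \<omega> * z))) \<le> B * K / (\<omega> * (a\<^sup>2 / 2)) * \<epsilon>\<^sup>2"
        by (simp add: power2_eq_square[of \<epsilon>] abs_mult_self_eq mult_ac flip: abs_mult)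
      then have "norm (of_real (2 * (cos t)\<^sup>2) * (slope ?u \<epsilon> ?th z - of_real \<epsilon> * (?R / (of_real \<omega> * z))))
         \<le> 2 * (B * K / (\<omega> * (a\<^sup>2 / 2)) * \<epsilon>\<^sup>2)"
        unfolding norm_mult by (intro mult_mono two_cos_square_le) auto
      moreover have "stretched_slope \<epsilon> t z - of_real \<epsilon> * linear_slope t z
         = of_real (2 * (cos t)\<^sup>2) * (slope ?u \<epsilon> ?th z - of_real \<epsilon> * (?R / (of_real \<omega> * z)))"
        by (simp add: stretched_slope_def linear_slope_def algebra_simps)
      ultimately show ?thesis by simp
    qed
    have int_eq: "integral {0..2 * pi} (\<lambda>t. stretched_slope \<epsilon> t z) - of_real \<epsilon> * melnikov_fun z
      = integral {0..2 * pi} (\<lambda>t. stretched_slope \<epsilon> t z - of_real \<epsilon> * linear_slope t z)"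
      unfolding melnikov_fun_def
      by (subst Henstock_Kurzweil_Integration.integral_diff)
         (auto intro!: integrable_continuous_real continuous_intros c1 c2)
    have 1: "norm (integral {0..2 * pi} (\<lambda>t. stretched_slope \<epsilon> t z) - of_real \<epsilon> * melnikov_fun z)
       \<le> 2 * (B * K / (\<omega> * (a\<^sup>2 / 2)) * \<epsilon>\<^sup>2) * (2 * pi - 0)"
      unfolding int_eq
    proof (rule integral_bound)
      show "continuous_on {0..2 * pi} (\<lambda>t. stretched_slope \<epsilon> t z - of_real \<epsilon> * linear_slope t z)"
        by (intro continuous_on_diff continuous_on_mult continuous_on_const c1 c2)
      show "norm (stretched_slope \<epsilon> t z - of_real \<epsilon> * linear_slope t z)
         \<le> 2 * (B * K / (\<omega> * (a\<^sup>2 / 2)) * \<epsilon>\<^sup>2)" for t by (rule pt)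
    qed simp
    have "norm (\<Gamma> (2 * pi) z - z - of_real \<epsilon> * melnikov_fun z)
      \<le> norm (\<Gamma> (2 * pi) z - z - integral {0..2 * pi} (\<lambda>t. stretched_slope \<epsilon> t z))
        + norm (integral {0..2 * pi} (\<lambda>t. stretched_slope \<epsilon> t z) - of_real \<epsilon> * melnikov_fun z)"
      using norm_triangle_ineq[of "\<Gamma> (2 * pi) z - z - integral {0..2 * pi} (\<lambda>t. stretched_slope \<epsilon> t z)"
        "integral {0..2 * pi} (\<lambda>t. stretched_slope \<epsilon> t z) - of_real \<epsilon> * melnikov_fun z"]
      by (simp add: algebra_simps)
    also have "\<dots> \<le> 2 * pi * (m / \<rho>) * (m * (2 * pi)) + 2 * (B * K / (\<omega> * (a\<^sup>2 / 2)) * \<epsilon>\<^sup>2) * (2 * pi - 0)"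
      by (intro add_mono 1 \<Gamma>(6) z)
    also have "\<dots> = (16 * pi\<^sup>2 * K\<^sup>2 / \<rho> + 4 * pi * B * K / (\<omega> * (a\<^sup>2 / 2))) * \<epsilon>\<^sup>2"
    proof -
      have "m * m = 4 * K\<^sup>2 * (\<bar>\<epsilon>\<bar> * \<bar>\<epsilon>\<bar>)" by (simp add: m_def power2_eq_square)
      then have mm: "m * m = 4 * K\<^sup>2 * \<epsilon>\<^sup>2" by (simp add: power2_eq_square)
      have e1: "2 * pi * (m / \<rho>) * (m * (2 * pi)) = 4 * pi\<^sup>2 * (m * m) / \<rho>" by (simp add: power2_eq_square)
      show ?thesis unfolding e1 mm by (simp add: algebra_simps)
    qed
    finally show "norm (\<Gamma> (2 * pi) z - z - of_real \<epsilon> * melnikov_fun z)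
      \<le> (16 * pi\<^sup>2 * K\<^sup>2 / \<rho> + 4 * pi * B * K / (\<omega> * (a\<^sup>2 / 2))) * \<epsilon>\<^sup>2" .
  qed (use \<Gamma> in auto)
qed

end

section \<open>Orbits and the return map in polar coordinates\<close>

lemma increment_ge_off_finite:
  fixes f :: "real \<Rightarrow> real"
  assumes "a \<le> b" "continuous_on {a..b} f" "finite S"
    and "\<And>t. t \<in> {a<..<b} - S \<Longrightarrow> \<exists>v\<ge>r. (f has_real_derivative v) (at t)"
  shows "r * (b - a) \<le> f b - f a"
proof -
  obtain f' where f': "\<And>t. t \<in> {a<..<b} - S \<Longrightarrow> f' t \<ge> r \<and> (f has_real_derivative f' t) (at t)"
    using assms(4) by metis
  define g where "g t = (if t \<in> {a<..<b} - S then f' t else r)" for t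
  have g: "(g has_integral f b - f a) {a..b}"
    by (rule fundamental_theorem_of_calculus_interior_strong[OF assms(3,1) _ assms(2)])
       (use f' in \<open>auto simp: g_def has_real_derivative_iff_has_vector_derivative[symmetric]\<close>)
  have c: "((\<lambda>t. r) has_integral r * (b - a)) {a..b}"
    using has_integral_const_real[of r a b] assms(1) by (simp add: mult.commute)
  show ?thesis
    by (rule has_integral_le[OF c g]) (use f' in \<open>auto simp: g_def\<close>)
qed

text \<open>Strictness: if the nondecreasing function did not increase, it would be constant and its derivative zero
at all points.\<close>

lemma increment_pos_off_finite:
  fixes f :: "real \<Rightarrow> real"
  assumes "a < b" "continuous_on {a..b} f" "finite S"
    and der: "\<And>t. t \<in> {a<..<b} - S \<Longrightarrow> \<exists>v>0. (f has_real_derivative v) (at t)"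
  shows "f a < f b"
proof -
  have mono: "f x \<le> f y" if "a \<le> x" "x \<le> y" "y \<le> b" for x y
  proof -
    have "\<exists>v\<ge>0. (f has_real_derivative v) (at t)" if "t \<in> {x<..<y} - S" for t
      using der[of t] that \<open>a \<le> x\<close> \<open>y \<le> b\<close> by (auto intro: less_imp_le)
    then have "0 * (y - x) \<le> f y - f x"
      using that by (intro increment_ge_off_finite[OF _ continuous_on_subset[OF assms(2)] assms(3)]) auto
    then show ?thesis by simp
  qed
  show ?thesis
  proof (rule ccontr)
    assume "\<not> f a < f b"
    then have const: "f x = f a" if "a \<le> x" "x \<le> b" for x
      using mono[of a x] mono[of x b] that by force
    have "infinite ({a<..<b} - S)" using assms(1,3) by (simp add: infinite_Ioo)
    then obtain t where t: "t \<in> {a<..<b} - S" by (metis finite.emptyI ex_in_conv)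
    obtain v where v: "v > 0" "(f has_real_derivative v) (at t)" using der[OF t] by blast
    have "((\<lambda>_. f a) has_real_derivative v) (at t)"
    proof (rule has_field_derivative_transform_within_open[OF v(2), of "{a<..<b}"])
      show "f x = f a" if "x \<in> {a<..<b}" for x using that by (intro const) auto
    qed (use t in auto)
    then have "v = 0" using DERIV_unique[OF _ DERIV_const] by blast
    then show False using v(1) by simp
  qed
qed

text \<open>A function that is strictly increasing because of its positive derivative off a finite set is inverted
with the same kind of regularity.\<close>

lemma inverse_off_finite:
  fixes f :: "real \<Rightarrow> real"
  assumes ab: "a < b" and cont: "continuous_on {a..b} f" and fin: "finite E"
    and der: "\<And>t. t \<in> {a<..<b} - E \<Longrightarrow> (f has_real_derivative f' t) (at t)"
    and pos: "\<And>t. t \<in> {a<..<b} - E \<Longrightarrow> f' t > 0"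
  obtains g where "continuous_on {f a..f b} g" "f a < f b"
    "\<And>y. y \<in> {f a..f b} \<Longrightarrow> g y \<in> {a..b} \<and> f (g y) = y"
    "\<And>x. x \<in> {a..b} \<Longrightarrow> f x \<in> {f a..f b} \<and> g (f x) = x"
    "\<And>y. y \<in> {f a<..<f b} - f ` E \<Longrightarrow> (g has_real_derivative 1 / f' (g y)) (at y)"
    "\<And>y. y \<in> {f a<..<f b} \<Longrightarrow> g y \<in> {a<..<b}"
proof -
  have strict: "f x < f y" if "a \<le> x" "x < y" "y \<le> b" for x y
  proof -
    have "\<exists>v>0. (f has_real_derivative v) (at t)" if "t \<in> {x<..<y} - E" for t
      using der[of t] pos[of t] that \<open>a \<le> x\<close> \<open>y \<le> b\<close> by auto
    then show ?thesis
      using that by (intro increment_pos_off_finite[OF _ continuous_on_subset[OF cont] fin]) auto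
  qed
  then have inj: "inj_on f {a..b}"
    by (intro linorder_inj_onI) (auto simp: less_imp_neq)
  define g where "g = the_inv_into {a..b} f"
  have gf: "g (f x) = x" if "x \<in> {a..b}" for x
    unfolding g_def by (rule the_inv_into_f_f[OF inj that])
  have mono: "f x \<le> f y" if "a \<le> x" "x \<le> y" "y \<le> b" for x y
    using strict[of x y] that by (cases "x = y") auto
  have img: "f ` {a..b} = {f a..f b}"
  proof
    show "f ` {a..b} \<subseteq> {f a..f b}" using mono by auto
    show "{f a..f b} \<subseteq> f ` {a..b}"
      using IVT'[of f a _ b] cont ab by fastforce
  qed
  have cg: "continuous_on {f a..f b} g"
    using continuous_on_inv[OF cont compact_Icc, of g] gf img by simp
  have fg: "g y \<in> {a..b} \<and> f (g y) = y" if "y \<in> {f a..f b}" for y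
    using that img gf by (metis imageE)
  have gi: "g y \<in> {a<..<b}" if y: "y \<in> {f a<..<f b}" for y
  proof -
    have "g y \<in> {a..b}" "f (g y) = y" using fg[of y] y by auto
    moreover from this have "g y \<noteq> a" "g y \<noteq> b" using y by auto
    ultimately show ?thesis by auto
  qed
  show thesis
  proof (rule that[of g])
    fix y assume y: "y \<in> {f a<..<f b} - f ` E"
    have "g y \<in> {a<..<b}" using gi[of y] y by simp
    moreover have "f (g y) = y" using fg[of y] y by simp
    then have "g y \<notin> E" using y by (metis DiffD2 image_eqI)
    ultimately have gy: "g y \<in> {a<..<b} - E" by simp
    have "(g has_real_derivative inverse (f' (g y))) (at y)"
    proof (rule DERIV_inverse_function)
      show "(f has_real_derivative f' (g y)) (at (g y))" by (rule der[OF gy])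
      show "f' (g y) \<noteq> 0" using pos[OF gy] by simp
      show "f a < y" "y < f b" using y by auto
      show "f (g x) = x" if "f a < x" "x < f b" for x using fg[of x] that by auto
      have "continuous_on {f a<..<f b} g" by (rule continuous_on_subset[OF cg]) auto
      then show "isCont g y" using y by (simp add: continuous_on_eq_continuous_at)
    qed
    then show "(g has_real_derivative 1 / f' (g y)) (at y)" by (simp add: inverse_eq_divide)
  qed (use cg strict ab fg gf mono gi in auto)
qed

text \<open>Gronwall's argument: \<open>e\<^sup>2 exp (- 2 M t)\<close> cannot increase.\<close>

lemma gronwall_zero:
  fixes e :: "real \<Rightarrow> real"
  assumes "continuous_on {a..b} e" "finite S" "e a = 0"
    and der: "\<And>t. t \<in> {a<..<b} - S \<Longrightarrow> \<exists>v. (e has_real_derivative v) (at t) \<and> \<bar>v\<bar> \<le> M * \<bar>e t\<bar>"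
    and t: "t \<in> {a..b}"
  shows "e t = 0"
proof -
  define \<phi> where "\<phi> t = - ((e t)\<^sup>2 * exp (- 2 * M * t))" for t
  have "0 * (t - a) \<le> \<phi> t - \<phi> a"
  proof (rule increment_ge_off_finite[OF _ _ assms(2)])
    show "a \<le> t" using t by simp
    show "continuous_on {a..t} \<phi>" unfolding \<phi>_def
      by (intro continuous_intros continuous_on_subset[OF assms(1)]) (use t in auto)
    fix u assume u: "u \<in> {a<..<t} - S"
    then obtain v where v: "(e has_real_derivative v) (at u)" "\<bar>v\<bar> \<le> M * \<bar>e u\<bar>" using der[of u] t by auto
    have "(\<phi> has_real_derivative - (2 * e u * v * exp (- 2 * M * u) + (exp (- 2 * M * u) * (- 2 * M)) * (e u)\<^sup>2)) (at u)"
      unfolding \<phi>_def [abs_def] using v(1) by (auto intro!: derivative_eq_intros)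
    moreover have "- (2 * e u * v * exp (- 2 * M * u) + (exp (- 2 * M * u) * (- 2 * M)) * (e u)\<^sup>2)
       = 2 * exp (- 2 * M * u) * (M * (e u)\<^sup>2 - e u * v)" by (simp add: algebra_simps)
    moreover have "e u * v \<le> M * (e u)\<^sup>2"
    proof -
      have "e u * v \<le> \<bar>e u\<bar> * \<bar>v\<bar>" by (metis abs_ge_self abs_mult)
      also have "\<dots> \<le> \<bar>e u\<bar> * (M * \<bar>e u\<bar>)" using v(2) by (intro mult_left_mono) auto
      also have "\<dots> = M * (e u)\<^sup>2" by (simp add: power2_eq_square)
      finally show ?thesis .
    qed
    ultimately show "\<exists>v\<ge>0. (\<phi> has_real_derivative v) (at u)"
      by (intro exI[of _ "2 * exp (- 2 * M * u) * (M * (e u)\<^sup>2 - e u * v)"]) simp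
  qed
  then have "(e t)\<^sup>2 * exp (- 2 * M * t) \<le> 0" using assms(3) by (simp add: \<phi>_def)
  then have "(e t)\<^sup>2 \<le> 0" by (simp add: mult_le_0_iff)
  then show ?thesis by simp
qed

lemma cos_sign:
  assumes "0 \<le> x" "x \<le> 2 * pi"
  shows "cos x > 0 \<longleftrightarrow> x < pi / 2 \<or> x > 3 * pi / 2" "cos x = 0 \<longleftrightarrow> x = pi / 2 \<or> x = 3 * pi / 2"
proof -
  have 1: "cos x > 0" if "x < pi / 2 \<or> x > 3 * pi / 2"
    using cos_gt_zero_pi[of x] cos_gt_zero_pi[of "x - 2 * pi"] that assms by (auto simp: cos_diff)
  have 2: "cos x < 0" if "pi / 2 < x" "x < 3 * pi / 2"
    using cos_gt_zero_pi[of "x - pi"] that by (auto simp: cos_diff)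
  have 3: "cos (3 * pi / 2) = 0" using cos_3over2_pi by (simp add: mult.commute)
  show "cos x > 0 \<longleftrightarrow> x < pi / 2 \<or> x > 3 * pi / 2" using 1 2 3
    by (smt (verit) cos_pi_half)
  show "cos x = 0 \<longleftrightarrow> x = pi / 2 \<or> x = 3 * pi / 2" using 1 2 3
    by (smt (verit) cos_pi_half)
qed

context small_perturbation begin

text \<open>One solution operator is fixed, so that the return map becomes a function of the radius.\<close>

definition flow :: "real \<Rightarrow> complex \<Rightarrow> complex" where
  "flow = (SOME \<Gamma>.
    (\<forall>t z. t \<in> {0..2 * pi} \<longrightarrow> z \<in> open_rect \<longrightarrow> norm (\<Gamma> t z - z) \<le> \<rho>) \<and>
    (\<forall>z. z \<in> open_rect \<longrightarrow> \<Gamma> 0 z = z) \<and>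
    (\<forall>t z. t \<in> {0..2 * pi} \<longrightarrow> z \<in> open_rect \<longrightarrow>
       ((\<lambda>t. \<Gamma> t z) has_vector_derivative stretched_slope \<epsilon> t (\<Gamma> t z)) (at t within {0..2 * pi})) \<and>
    \<Gamma> (2 * pi) holomorphic_on open_rect \<and>
    (\<forall>t z. t \<in> {0..2 * pi} \<longrightarrow> z \<in> open_rect \<longrightarrow> z \<in> \<real> \<longrightarrow> \<Gamma> t z \<in> \<real>) \<and>
    (\<forall>z. z \<in> open_rect \<longrightarrow> norm (\<Gamma> (2 * pi) z - z - of_real \<epsilon> * melnikov_fun z) \<le>
        (16 * pi\<^sup>2 * K\<^sup>2 / \<rho> + 4 * pi * B * K / (\<omega> * (a\<^sup>2 / 2))) * \<epsilon>\<^sup>2))"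

lemma flow:
  "t \<in> {0..2 * pi} \<Longrightarrow> z \<in> open_rect \<Longrightarrow> norm (flow t z - z) \<le> \<rho>"
  "z \<in> open_rect \<Longrightarrow> flow 0 z = z"
  "t \<in> {0..2 * pi} \<Longrightarrow> z \<in> open_rect \<Longrightarrow>
     ((\<lambda>t. flow t z) has_vector_derivative stretched_slope \<epsilon> t (flow t z)) (at t within {0..2 * pi})"
  "flow (2 * pi) holomorphic_on open_rect"
  "t \<in> {0..2 * pi} \<Longrightarrow> z \<in> open_rect \<Longrightarrow> z \<in> \<real> \<Longrightarrow> flow t z \<in> \<real>"
  "z \<in> open_rect \<Longrightarrow> norm (flow (2 * pi) z - z - of_real \<epsilon> * melnikov_fun z) \<le>
      (16 * pi\<^sup>2 * K\<^sup>2 / \<rho> + 4 * pi * B * K / (\<omega> * (a\<^sup>2 / 2))) * \<epsilon>\<^sup>2"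
proof -
  have "\<exists>\<Gamma>.
    (\<forall>t z. t \<in> {0..2 * pi} \<longrightarrow> z \<in> open_rect \<longrightarrow> norm (\<Gamma> t z - z) \<le> \<rho>) \<and>
    (\<forall>z. z \<in> open_rect \<longrightarrow> \<Gamma> 0 z = z) \<and>
    (\<forall>t z. t \<in> {0..2 * pi} \<longrightarrow> z \<in> open_rect \<longrightarrow>
       ((\<lambda>t. \<Gamma> t z) has_vector_derivative stretched_slope \<epsilon> t (\<Gamma> t z)) (at t within {0..2 * pi})) \<and>
    \<Gamma> (2 * pi) holomorphic_on open_rect \<and>
    (\<forall>t z. t \<in> {0..2 * pi} \<longrightarrow> z \<in> open_rect \<longrightarrow> z \<in> \<real> \<longrightarrow> \<Gamma> t z \<in> \<real>) \<and>
    (\<forall>z. z \<in> open_rect \<longrightarrow> norm (\<Gamma> (2 * pi) z - z - of_real \<epsilon> * melnikov_fun z) \<le>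
        (16 * pi\<^sup>2 * K\<^sup>2 / \<rho> + 4 * pi * B * K / (\<omega> * (a\<^sup>2 / 2))) * \<epsilon>\<^sup>2)"
    by (rule holomorphic_flow_stretched) blast
  from someI_ex[OF this, folded flow_def] show
  "t \<in> {0..2 * pi} \<Longrightarrow> z \<in> open_rect \<Longrightarrow> norm (flow t z - z) \<le> \<rho>"
  "z \<in> open_rect \<Longrightarrow> flow 0 z = z"
  "t \<in> {0..2 * pi} \<Longrightarrow> z \<in> open_rect \<Longrightarrow>
     ((\<lambda>t. flow t z) has_vector_derivative stretched_slope \<epsilon> t (flow t z)) (at t within {0..2 * pi})"
  "flow (2 * pi) holomorphic_on open_rect"
  "t \<in> {0..2 * pi} \<Longrightarrow> z \<in> open_rect \<Longrightarrow> z \<in> \<real> \<Longrightarrow> flow t z \<in> \<real>"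
  "z \<in> open_rect \<Longrightarrow> norm (flow (2 * pi) z - z - of_real \<epsilon> * melnikov_fun z) \<le>
      (16 * pi\<^sup>2 * K\<^sup>2 / \<rho> + 4 * pi * B * K / (\<omega> * (a\<^sup>2 / 2))) * \<epsilon>\<^sup>2"
    by blast+
qed

definition poincare :: "real \<Rightarrow> real" where
  "poincare s = Re (flow (2 * pi) (of_real s))"

definition speed :: "bool \<Rightarrow> real \<Rightarrow> real \<Rightarrow> real" where
  "speed u \<theta> s = \<omega> + \<epsilon> * ang u \<theta> s / s\<^sup>2"

lemma real_bounds:
  assumes s: "s \<in> {a - 4 * \<rho>..b + 4 * \<rho>}"
  shows "s > 0" "s < 1"
  using s rho ab by auto

lemma speed_bounds:
  assumes s: "s \<in> {a - 4 * \<rho>..b + 4 * \<rho>}"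
  shows "\<omega> / 2 \<le> speed u \<theta> s" "speed u \<theta> s \<le> 2 * \<omega>"
proof -
  have m: "of_real s \<in> rect (4 * \<rho>)" using s rho by (simp add: mem_rect)
  have "\<bar>ang u \<theta> s\<bar> \<le> B" using B(3)[OF m, of u \<theta>] by simp
  then have "\<bar>\<epsilon> * ang u \<theta> s\<bar> \<le> \<omega> * a\<^sup>2 / 4"
    using eps_bound_rate unfolding abs_mult by (meson abs_ge_zero mult_left_mono order_trans)
  moreover have "(3 / 4 * a)\<^sup>2 \<le> s\<^sup>2" using s rho ab by (intro power_mono) auto
  then have s2: "9 / 16 * a\<^sup>2 \<le> s\<^sup>2" by (simp add: power2_eq_square)
  ultimately have "\<bar>\<epsilon> * ang u \<theta> s / s\<^sup>2\<bar> \<le> (\<omega> * a\<^sup>2 / 4) / (9 / 16 * a\<^sup>2)"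
    unfolding abs_divide using omega_pos ab by (intro frac_le) auto
  also have "\<dots> = 4 / 9 * \<omega>" using ab by simp
  finally have "\<epsilon> * ang u \<theta> s / s\<^sup>2 \<le> 4 / 9 * \<omega>" "- (4 / 9 * \<omega>) \<le> \<epsilon> * ang u \<theta> s / s\<^sup>2"
    unfolding abs_le_iff by linarith+
  then show "\<omega> / 2 \<le> speed u \<theta> s" "speed u \<theta> s \<le> 2 * \<omega>"
    unfolding speed_def using omega_pos by linarith+
qed

lemma slope_eq:
  assumes "s \<in> {a - 4 * \<rho>..b + 4 * \<rho>}"
  shows "slope u \<epsilon> \<theta> s * speed u \<theta> s = \<epsilon> * rad u \<theta> s / s"
proof -
  have s: "s > 0" and v: "speed u \<theta> s > 0" using real_bounds[OF assms] speed_bounds[OF assms, of u \<theta>] omega_pos by auto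
  have e: "\<omega> * s\<^sup>2 + \<epsilon> * ang u \<theta> s = speed u \<theta> s * s\<^sup>2" using s by (simp add: speed_def field_simps)
  show ?thesis unfolding slope_def of_real_eq_id id_apply e using s v by (simp add: power2_eq_square)
qed

text \<open>The flow in the stretched angle is read in the true angle by inverting the stretching; \<open>T\<close> is the time at
which the orbit reaches the angle. At the switching angles both functions are merely continuous.\<close>

lemma polar_orbit:
  assumes s0: "a - \<rho> < s0" "s0 < b + \<rho>"
  obtains \<sigma> T where "continuous_on {0..2 * pi} \<sigma>" "continuous_on {0..2 * pi} T"
    "\<sigma> 0 = s0" "\<sigma> (2 * pi) = poincare s0" "T 0 = 0"
    "\<And>\<theta>. \<theta> \<in> {0..2 * pi} \<Longrightarrow> \<bar>\<sigma> \<theta> - s0\<bar> \<le> \<rho>"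
    "\<And>\<theta>. \<theta> \<in> {0<..<2 * pi} - {pi / 2, 3 * pi / 2} \<Longrightarrow>
       (\<sigma> has_real_derivative slope (cos \<theta> > 0) \<epsilon> \<theta> (\<sigma> \<theta>)) (at \<theta>)"
    "\<And>\<theta>. \<theta> \<in> {0<..<2 * pi} - {pi / 2, 3 * pi / 2} \<Longrightarrow>
       (T has_real_derivative 1 / speed (cos \<theta> > 0) \<theta> (\<sigma> \<theta>)) (at \<theta>)"
proof -
  let ?I = "{0..2 * pi}"
  have z0: "of_real s0 \<in> open_rect" using s0 rho by (simp add: mem_open_rect)
  define S where "S \<tau> = Re (flow \<tau> (of_real s0))" for \<tau>
  have flow_S: "flow \<tau> (of_real s0) = of_real (S \<tau>)" if "\<tau> \<in> ?I" for \<tau>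
    using flow(5)[OF that z0] by (simp add: S_def complex_is_Real_iff complex_eq_iff)
  have near: "\<bar>S \<tau> - s0\<bar> \<le> \<rho>" if "\<tau> \<in> ?I" for \<tau>
    using flow(1)[OF that z0] unfolding flow_S[OF that] by (simp flip: of_real_diff)
  have S_in: "S \<tau> \<in> {a - 4 * \<rho>..b + 4 * \<rho>}" if "\<tau> \<in> ?I" for \<tau>
    using near[OF that] s0 rho by auto
  have S': "(S has_real_derivative stretched_slope \<epsilon> \<tau> (S \<tau>)) (at \<tau> within ?I)" if \<tau>: "\<tau> \<in> ?I" for \<tau>
  proof -
    have "((\<lambda>\<tau>. Re (flow \<tau> (of_real s0))) has_vector_derivative Re (stretched_slope \<epsilon> \<tau> (flow \<tau> (of_real s0)))) (at \<tau> within ?I)"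
      using bounded_linear.has_vector_derivative[OF bounded_linear_Re flow(3)[OF \<tau> z0]] .
    then show ?thesis
      unfolding flow_S[OF \<tau>] by (simp add: S_def [abs_def] has_real_derivative_iff_has_vector_derivative)
  qed
  have cS: "continuous_on ?I S"
    using S' by (meson DERIV_continuous continuous_on_eq_continuous_within)
  \<comment> \<open>The time per stretched angle.\<close>
  define q where "q \<tau> = 2 * (cos \<tau>)\<^sup>2 * (1 / speed (cos \<tau> \<ge> 0) (stretch \<tau>) (S \<tau>))" for \<tau>
  have cq: "continuous_on ?I q"
  proof -
    have "continuous_on ?I (\<lambda>\<tau>. 1 / speed u (stretch \<tau>) (S \<tau>))" for u
    proof -
      have "S \<tau> \<noteq> 0" "norm (S \<tau>) < 1" "speed u (stretch \<tau>) (S \<tau>) \<noteq> 0" if "\<tau> \<in> ?I" for \<tau>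
        using real_bounds[OF S_in[OF that]] speed_bounds[OF S_in[OF that], of u "stretch \<tau>"] omega_pos by auto
      then show ?thesis unfolding speed_def by (intro continuous_intros cS) auto
    qed
    from continuous_on_two_sided[OF continuous_on_id this] show ?thesis unfolding q_def by simp
  qed
  define Q where "Q \<tau> = integral {0..\<tau>} q" for \<tau>
  have Q': "(Q has_real_derivative q \<tau>) (at \<tau> within ?I)" if "\<tau> \<in> ?I" for \<tau>
    unfolding Q_def has_real_derivative_iff_has_vector_derivative
    by (rule integral_has_vector_derivative[OF cq that])
  have cQ: "continuous_on ?I Q"
    using Q' by (meson DERIV_continuous continuous_on_eq_continuous_within)
  have at: "at \<tau> within ?I = at \<tau>" if "\<tau> \<in> {0<..<2 * pi}" for \<tau> :: real
    using that by (intro at_within_interior) auto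
  let ?E = "{pi / 2, 3 * pi / 2}"
  have cos_ne: "cos \<tau> \<noteq> 0" if "\<tau> \<in> {0<..<2 * pi} - ?E" for \<tau>
    using cos_sign(2)[of \<tau>] that by auto
  obtain g where g: "continuous_on {stretch 0..stretch (2 * pi)} g"
    "\<And>y. y \<in> {stretch 0..stretch (2 * pi)} \<Longrightarrow> g y \<in> ?I \<and> stretch (g y) = y"
    "\<And>x. x \<in> ?I \<Longrightarrow> stretch x \<in> {stretch 0..stretch (2 * pi)} \<and> g (stretch x) = x"
    "\<And>y. y \<in> {stretch 0<..<stretch (2 * pi)} - stretch ` ?E \<Longrightarrow> (g has_real_derivative 1 / (2 * (cos (g y))\<^sup>2)) (at y)"
    "\<And>y. y \<in> {stretch 0<..<stretch (2 * pi)} \<Longrightarrow> g y \<in> {0<..<2 * pi}"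
  proof (rule inverse_off_finite[of 0 "2 * pi" stretch ?E "\<lambda>\<tau>. 2 * (cos \<tau>)\<^sup>2"])
    show "continuous_on ?I stretch" by (intro continuous_intros)
    show "(stretch has_real_derivative 2 * (cos t)\<^sup>2) (at t)" for t by (rule has_real_derivative_stretch)
    show "0 < 2 * (cos t)\<^sup>2" if "t \<in> {0<..<2 * pi} - ?E" for t using cos_ne[OF that] by simp
  qed auto
  note g = g[unfolded stretch_0 stretch_2pi image_insert image_empty stretch_pi_half stretch_3pi_half]
  have sgn: "cos (g \<theta>) \<ge> 0 \<longleftrightarrow> cos \<theta> > 0" and gE: "g \<theta> \<in> {0<..<2 * pi} - ?E" if \<theta>: "\<theta> \<in> {0<..<2 * pi} - ?E" for \<theta>
  proof -
    have gt: "g \<theta> \<in> {0<..<2 * pi}" "stretch (g \<theta>) = \<theta>" using g(2)[of \<theta>] g(5)[of \<theta>] \<theta> by auto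
    have less: "g \<theta> < x \<longleftrightarrow> \<theta> < stretch x" for x
      using stretch_strict_mono[of "g \<theta>" x] stretch_strict_mono[of x "g \<theta>"] gt(2) by (cases "g \<theta>" x rule: linorder_cases) auto
    have gr: "g \<theta> > x \<longleftrightarrow> \<theta> > stretch x" for x
      using stretch_strict_mono[of "g \<theta>" x] stretch_strict_mono[of x "g \<theta>"] gt(2) by (cases "g \<theta>" x rule: linorder_cases) auto
    have "g \<theta> \<noteq> pi / 2" "g \<theta> \<noteq> 3 * pi / 2" using gt(2) \<theta> stretch_pi_half stretch_3pi_half by fastforce+
    then show gE: "g \<theta> \<in> {0<..<2 * pi} - ?E" using gt(1) by simp
    have "cos (g \<theta>) \<ge> 0 \<longleftrightarrow> cos (g \<theta>) > 0" using cos_ne[OF gE] by linarith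
    also have "\<dots> \<longleftrightarrow> \<theta> < pi / 2 \<or> \<theta> > 3 * pi / 2"
      using cos_sign(1)[of "g \<theta>"] gt(1) less[of "pi / 2"] gr[of "3 * pi / 2"] by simp
    also have "\<dots> \<longleftrightarrow> cos \<theta> > 0" using cos_sign(1)[of \<theta>] \<theta> by simp
    finally show "cos (g \<theta>) \<ge> 0 \<longleftrightarrow> cos \<theta> > 0" .
  qed
  have comp: "((\<lambda>\<theta>. F (g \<theta>)) has_real_derivative F' / (2 * (cos (g \<theta>))\<^sup>2)) (at \<theta>)"
    if "\<theta> \<in> {0<..<2 * pi} - ?E" "(F has_real_derivative F') (at (g \<theta>) within ?I)" for F F' \<theta>
    using DERIV_chain2[of F F' "g" \<theta> "1 / (2 * (cos (g \<theta>))\<^sup>2)" UNIV] that g(4)[of \<theta>] at[of "g \<theta>"] gE[of \<theta>] by simp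
  have g0: "g 0 = 0" "g (2 * pi) = 2 * pi" using g(3)[of 0] g(3)[of "2 * pi"] by auto
  show thesis
  proof (rule that[of "\<lambda>\<theta>. S (g \<theta>)" "\<lambda>\<theta>. Q (g \<theta>)"])
    show "continuous_on ?I (\<lambda>\<theta>. S (g \<theta>))" "continuous_on ?I (\<lambda>\<theta>. Q (g \<theta>))"
      using g(2) by (auto intro!: continuous_on_compose2[OF cS g(1)] continuous_on_compose2[OF cQ g(1)])
    show "S (g 0) = s0" using flow(2)[OF z0] by (simp add: g0 S_def)
    show "S (g (2 * pi)) = poincare s0" by (simp add: g0 S_def poincare_def)
    show "Q (g 0) = 0" by (simp add: g0 Q_def)
    show "\<bar>S (g \<theta>) - s0\<bar> \<le> \<rho>" if "\<theta> \<in> ?I" for \<theta> using near g(2)[OF that] by blast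
    fix \<theta> assume \<theta>: "\<theta> \<in> {0<..<2 * pi} - ?E"
    have gI: "g \<theta> \<in> ?I" and st: "stretch (g \<theta>) = \<theta>" using g(2)[of \<theta>] \<theta> by auto
    have c2: "2 * (cos (g \<theta>))\<^sup>2 \<noteq> 0" using cos_ne[OF gE[OF \<theta>]] by simp
    show "((\<lambda>\<theta>. S (g \<theta>)) has_real_derivative slope (cos \<theta> > 0) \<epsilon> \<theta> (S (g \<theta>))) (at \<theta>)"
      using comp[OF \<theta> S'[OF gI]] c2 by (simp add: stretched_slope_def sgn[OF \<theta>] st)
    show "((\<lambda>\<theta>. Q (g \<theta>)) has_real_derivative 1 / speed (cos \<theta> > 0) \<theta> (S (g \<theta>))) (at \<theta>)"
      using comp[OF \<theta> Q'[OF gI]] c2 by (simp add: q_def sgn[OF \<theta>] st)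
  qed
qed

end

section \<open>Solutions in the plane and their polar lifts\<close>

lemma finite_sin_cos_zeros: "finite {x \<in> {A..B}. sin x = 0 \<or> cos x = (0::real)}"
proof (rule finite_subset)
  show "{x \<in> {A..B}. sin x = 0 \<or> cos x = 0} \<subseteq> (\<lambda>i. of_int i * (pi / 2)) ` {\<lfloor>A / (pi / 2)\<rfloor>..\<lceil>B / (pi / 2)\<rceil>}"
  proof
    fix x assume "x \<in> {x \<in> {A..B}. sin x = 0 \<or> cos x = 0}"
    then obtain i :: int where i: "x = of_int i * (pi / 2)" and x: "A \<le> x" "x \<le> B"
      using cos_zero_iff_int[of x] sin_zero_iff_int[of x] by auto
    have "A / (pi / 2) \<le> of_int i" "of_int i \<le> B / (pi / 2)"
      using x unfolding i by (simp_all add: divide_le_eq le_divide_eq)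
    then have "\<lfloor>A / (pi / 2)\<rfloor> \<le> i" "i \<le> \<lceil>B / (pi / 2)\<rceil>"
      by linarith+
    then show "x \<in> (\<lambda>i. of_int i * (pi / 2)) ` {\<lfloor>A / (pi / 2)\<rfloor>..\<lceil>B / (pi / 2)\<rceil>}"
      using i by auto
  qed
qed simp

text \<open>A continuous logarithm is locally a branch of \<open>Ln\<close>, hence differentiable wherever its exponential is.\<close>

lemma has_vector_derivative_continuous_log:
  fixes g z :: "real \<Rightarrow> complex"
  assumes cont: "continuous_on {t1..t2} g" and exp: "\<And>u. u \<in> {t1..t2} \<Longrightarrow> exp (g u) = z u"
    and t: "t \<in> {t1<..<t2}" and D: "(z has_vector_derivative D) (at t)"
  shows "(g has_vector_derivative D / z t) (at t)"
proof -
  have zt: "z t = exp (g t)" using exp[of t] t by auto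
  then have zt0: "z t \<noteq> 0" by simp
  define h where "h u = Ln (z u / z t) + g t" for u
  have "((\<lambda>u. z u / z t) has_vector_derivative D / z t) (at t)"
    using D by (rule has_vector_derivative_divide)
  moreover have "(Ln has_field_derivative inverse (z t / z t)) (at (z t / z t))"
    using zt0 by (intro has_field_derivative_Ln) auto
  ultimately have "((Ln \<circ> (\<lambda>u. z u / z t)) has_vector_derivative D / z t * inverse (z t / z t)) (at t)"
    by (rule field_vector_diff_chain_at)
  then have "(h has_vector_derivative D / z t + 0) (at t)"
    unfolding h_def using zt0 by (intro has_vector_derivative_add has_vector_derivative_const) (simp add: o_def)
  then have h': "(h has_vector_derivative D / z t) (at t)" by simp
  have "isCont g t" using cont t by (intro continuous_on_interior[OF cont]) auto
  then have "((\<lambda>u. Im (g u)) \<longlongrightarrow> Im (g t)) (at t)" unfolding isCont_def by (intro tendsto_intros)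
  then have "\<forall>\<^sub>F u in at t. dist (Im (g u)) (Im (g t)) < pi" by (rule tendstoD) simp
  then obtain \<delta> where \<delta>: "\<delta> > 0" "\<And>u. dist u t < \<delta> \<Longrightarrow> \<bar>Im (g u) - Im (g t)\<bar> < pi"
  proof -
    obtain \<delta> where "\<delta> > 0" "\<And>u. u \<noteq> t \<Longrightarrow> dist u t < \<delta> \<Longrightarrow> \<bar>Im (g u) - Im (g t)\<bar> < pi"
      using \<open>\<forall>\<^sub>F u in at t. dist (Im (g u)) (Im (g t)) < pi\<close> unfolding eventually_at dist_real_def by auto
    moreover from this(2) have "\<bar>Im (g u) - Im (g t)\<bar> < pi" if "dist u t < \<delta>" for u
      using that by (cases "u = t") auto
    ultimately show ?thesis using that by blast
  qed
  show ?thesis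
  proof (rule has_vector_derivative_transform_within_open[OF h', of "ball t \<delta> \<inter> {t1<..<t2}"])
    fix u assume u: "u \<in> ball t \<delta> \<inter> {t1<..<t2}"
    then have "exp (g u - g t) = z u / z t" using exp[of u] zt by (simp add: exp_diff)
    moreover have "Ln (exp (g u - g t)) = g u - g t"
      using \<delta>(2)[of u] u by (intro Ln_exp) (auto simp: dist_commute)
    ultimately show "h u = g u" by (simp add: h_def)
  qed (use t \<delta> in auto)
qed

locale perturbed_system = small_perturbation +
  fixes f g :: "nat \<Rightarrow> plane \<Rightarrow> real"
  assumes f_eq: "f 1 (x, y) = bipoly n c x y" "f 2 (x, y) = bipoly n c' x y"
    and g_eq: "g 1 (x, y) = bipoly n d x y" "g 2 (x, y) = bipoly n d' x y"
    and zones: "f 1 = f 4" "g 1 = g 4" "f 2 = f 3" "g 2 = g 3"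
begin

definition X :: "nat \<Rightarrow> plane \<Rightarrow> plane" where "X = perturbed_field \<eta> f g \<epsilon>"

text \<open>The linearizing coordinate: along unperturbed solutions \<open>\<zeta>' = \<i> \<omega> \<zeta>\<close>.\<close>

definition \<zeta> :: "plane \<Rightarrow> complex" where
  "\<zeta> p = Complex (1 - \<eta> / snd p) (\<omega> * fst p / snd p)"

text \<open>The inverse of \<open>\<zeta>\<close> in polar coordinates.\<close>

definition pt :: "real \<Rightarrow> real \<Rightarrow> plane" where
  "pt \<theta> s = (\<eta> / \<omega> * (s * sin \<theta>) / (1 - s * cos \<theta>), \<eta> / (1 - s * cos \<theta>))"

definition D\<zeta> :: "plane \<Rightarrow> plane \<Rightarrow> complex" where
  "D\<zeta> p v = Complex (\<eta> * snd v / (snd p)\<^sup>2) (\<omega> * (fst v * snd p - fst p * snd v) / (snd p)\<^sup>2)"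

lemma snd_pt_pos: "\<bar>s\<bar> < 1 \<Longrightarrow> snd (pt \<theta> s) > 0"
  using one_minus_mult_cos_pos[of s \<theta>] eta_pos by (simp add: pt_def)

lemma \<zeta>_pt: "\<bar>s\<bar> < 1 \<Longrightarrow> \<zeta> (pt \<theta> s) = of_real s * cis \<theta>"
  using one_minus_mult_cos_pos[of s \<theta>] eta_pos omega_pos by (simp add: \<zeta>_def pt_def complex_eq_iff)

lemma pt_\<zeta>:
  assumes "snd p > 0" "\<zeta> p = of_real s * cis \<theta>"
  shows "p = pt \<theta> s"
proof -
  have re: "1 - s * cos \<theta> = \<eta> / snd p" and im: "s * sin \<theta> = \<omega> * fst p / snd p"
    using assms(2) by (simp_all add: \<zeta>_def complex_eq_iff)
  show ?thesis unfolding pt_def re im using assms(1) eta_pos omega_pos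
    by (cases p) simp
qed

lemma snd_pt_compare:
  assumes "0 < s" "s < 1"
  shows "snd (pt \<theta> s) > \<eta> \<longleftrightarrow> cos \<theta> > 0" "snd (pt \<theta> s) < \<eta> \<longleftrightarrow> cos \<theta> < 0"
proof -
  have w: "1 - s * cos \<theta> > 0" using assms by (intro one_minus_mult_cos_pos) auto
  have "snd (pt \<theta> s) > \<eta> \<longleftrightarrow> \<eta> * (s * cos \<theta>) > 0"
    using w by (simp add: pt_def pos_less_divide_eq algebra_simps)
  also have "\<dots> \<longleftrightarrow> cos \<theta> > 0" using eta_pos assms by (simp add: zero_less_mult_iff)
  finally show "snd (pt \<theta> s) > \<eta> \<longleftrightarrow> cos \<theta> > 0" .
  have "snd (pt \<theta> s) < \<eta> \<longleftrightarrow> \<eta> * (s * cos \<theta>) < 0"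
    using w by (simp add: pt_def pos_divide_less_eq algebra_simps)
  also have "\<dots> \<longleftrightarrow> cos \<theta> < 0" using eta_pos assms by (simp add: mult_less_0_iff)
  finally show "snd (pt \<theta> s) < \<eta> \<longleftrightarrow> cos \<theta> < 0" .
qed

lemma fst_pt_sign:
  assumes "0 < s" "s < 1"
  shows "fst (pt \<theta> s) > 0 \<longleftrightarrow> sin \<theta> > 0" "fst (pt \<theta> s) < 0 \<longleftrightarrow> sin \<theta> < 0"
proof -
  have w: "1 - s * cos \<theta> > 0" using assms by (intro one_minus_mult_cos_pos) auto
  then have k: "\<eta> / \<omega> * s / (1 - s * cos \<theta>) > 0" using eta_pos omega_pos assms by simp
  have e: "fst (pt \<theta> s) = (\<eta> / \<omega> * s / (1 - s * cos \<theta>)) * sin \<theta>" by (simp add: pt_def)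
  show "fst (pt \<theta> s) > 0 \<longleftrightarrow> sin \<theta> > 0" "fst (pt \<theta> s) < 0 \<longleftrightarrow> sin \<theta> < 0"
    unfolding e using k by (metis zero_less_mult_pos mult_pos_pos, metis mult_less_0_iff less_asym)
qed

lemma has_vector_derivative_\<zeta>:
  assumes "(\<gamma> has_vector_derivative v) (at t within A)" "snd (\<gamma> t) > 0"
  shows "((\<lambda>t. \<zeta> (\<gamma> t)) has_vector_derivative D\<zeta> (\<gamma> t) v) (at t within A)"
proof -
  have 1: "((\<lambda>t. fst (\<gamma> t)) has_real_derivative fst v) (at t within A)"
    and 2: "((\<lambda>t. snd (\<gamma> t)) has_real_derivative snd v) (at t within A)"
    unfolding has_real_derivative_iff_has_vector_derivative
    using bounded_linear.has_vector_derivative[OF bounded_linear_fst assms(1)]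
      bounded_linear.has_vector_derivative[OF bounded_linear_snd assms(1)] by auto
  have r: "((\<lambda>t. 1 - \<eta> / snd (\<gamma> t)) has_real_derivative \<eta> * snd v / (snd (\<gamma> t))\<^sup>2) (at t within A)"
    by (rule derivative_eq_intros 2 refl | use assms(2) in \<open>simp add: power2_eq_square\<close>)+
  have i: "((\<lambda>t. \<omega> * fst (\<gamma> t) / snd (\<gamma> t)) has_real_derivative
      \<omega> * (fst v * snd (\<gamma> t) - fst (\<gamma> t) * snd v) / (snd (\<gamma> t))\<^sup>2) (at t within A)"
    by (rule derivative_eq_intros 1 2 refl | use assms(2) in \<open>simp add: power2_eq_square algebra_simps\<close>)+
  have "((\<lambda>t. of_real (1 - \<eta> / snd (\<gamma> t)) + \<i> * of_real (\<omega> * fst (\<gamma> t) / snd (\<gamma> t))) has_vector_derivative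
     of_real (\<eta> * snd v / (snd (\<gamma> t))\<^sup>2) + \<i> * of_real (\<omega> * (fst v * snd (\<gamma> t) - fst (\<gamma> t) * snd v) / (snd (\<gamma> t))\<^sup>2)) (at t within A)"
    by (intro has_vector_derivative_add has_vector_derivative_mult_right has_vector_derivative_of_real r i)
  then show ?thesis by (simp only: \<zeta>_def D\<zeta>_def Complex_eq)
qed

text \<open>In the direction from \<open>\<zeta>\<close> to the plane: the coordinates \<open>x\<close> and \<open>y\<close> are rational functions of \<open>\<zeta>\<close>.\<close>

lemma has_vector_derivative_\<zeta>_imp:
  assumes "(z has_vector_derivative D\<zeta> (\<gamma> t) v) (at t)" "\<And>u. snd (\<gamma> u) > 0 \<and> \<zeta> (\<gamma> u) = z u"
  shows "(\<gamma> has_vector_derivative v) (at t)"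
proof -
  define y where "y = snd (\<gamma> t)"
  have y: "y > 0" using assms(2) by (simp add: y_def)
  have 1: "((\<lambda>t. Re (z t)) has_real_derivative \<eta> * snd v / y\<^sup>2) (at t)"
    and 2: "((\<lambda>t. Im (z t)) has_real_derivative \<omega> * (fst v * y - fst (\<gamma> t) * snd v) / y\<^sup>2) (at t)"
    unfolding has_real_derivative_iff_has_vector_derivative
    using bounded_linear.has_vector_derivative[OF bounded_linear_Re assms(1)]
      bounded_linear.has_vector_derivative[OF bounded_linear_Im assms(1)] by (auto simp: D\<zeta>_def y_def)
  have snd_eq: "snd (\<gamma> u) = \<eta> / (1 - Re (z u))" and fst_eq: "fst (\<gamma> u) = snd (\<gamma> u) * Im (z u) / \<omega>" for u
  proof -
    have Y: "snd (\<gamma> u) > 0" using assms(2) by simp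
    have R: "1 - Re (z u) = \<eta> / snd (\<gamma> u)" and I: "Im (z u) = \<omega> * fst (\<gamma> u) / snd (\<gamma> u)"
      using assms(2)[of u] by (auto simp: \<zeta>_def complex_eq_iff)
    show "snd (\<gamma> u) = \<eta> / (1 - Re (z u))" unfolding R using Y eta_pos by simp
    show "fst (\<gamma> u) = snd (\<gamma> u) * Im (z u) / \<omega>" unfolding I using Y omega_pos by simp
  qed
  have R: "1 - Re (z t) = \<eta> / y" using assms(2)[of t] eta_pos by (simp add: y_def \<zeta>_def complex_eq_iff)
  have I: "Im (z t) = \<omega> * fst (\<gamma> t) / y" using assms(2)[of t] by (simp add: y_def \<zeta>_def complex_eq_iff)
  have Rne: "1 - Re (z t) \<noteq> 0" using R y eta_pos by simp
  have s': "((\<lambda>u. snd (\<gamma> u)) has_real_derivative snd v) (at t)"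
  proof -
    have "((\<lambda>u. \<eta> / (1 - Re (z u))) has_real_derivative \<eta> * (\<eta> * snd v / y\<^sup>2) / (1 - Re (z t))\<^sup>2) (at t)"
      by (rule derivative_eq_intros 1 refl Rne | simp add: power2_eq_square)+
    also have "\<eta> * (\<eta> * snd v / y\<^sup>2) / (1 - Re (z t))\<^sup>2 = snd v"
      unfolding R using y eta_pos by (simp add: power2_eq_square)
    finally show ?thesis by (simp add: snd_eq)
  qed
  have f': "((\<lambda>u. fst (\<gamma> u)) has_real_derivative fst v) (at t)"
  proof -
    have "((\<lambda>u. snd (\<gamma> u) * Im (z u) / \<omega>) has_real_derivative
       (snd v * Im (z t) + (\<omega> * (fst v * y - fst (\<gamma> t) * snd v) / y\<^sup>2) * snd (\<gamma> t)) / \<omega>) (at t)"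
      by (intro DERIV_cdivide DERIV_mult s' 2)
    also have "(snd v * Im (z t) + (\<omega> * (fst v * y - fst (\<gamma> t) * snd v) / y\<^sup>2) * snd (\<gamma> t)) / \<omega> = fst v"
      unfolding I y_def[symmetric] using y omega_pos by (simp add: field_simps power2_eq_square)
    finally show ?thesis using fst_eq by simp
  qed
  have "((\<lambda>u. (fst (\<gamma> u), snd (\<gamma> u))) has_vector_derivative (fst v, snd v)) (at t)"
    by (intro has_vector_derivative_Pair s'[unfolded has_real_derivative_iff_has_vector_derivative]
       f'[unfolded has_real_derivative_iff_has_vector_derivative])
  then show ?thesis by simp
qed

lemma X_zones: "X 4 = X 1" "X 3 = X 2"
  by (simp_all only: X_def perturbed_field_def zones)

text \<open>The field in the coordinate \<open>\<zeta>\<close>, split into the radial component \<open>\<epsilon> rad / s\<close> and the angular component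
\<open>s speed\<close>.\<close>

lemma D\<zeta>_X:
  assumes s: "0 < s" "s < 1"
  shows "D\<zeta> (pt \<theta> s) (X (if u then 1 else 2) (pt \<theta> s)) = cis \<theta> * Complex (\<epsilon> * rad u \<theta> s / s) (s * speed u \<theta> s)"
proof -
  define C where "C = s * cos \<theta>"
  define S where "S = s * sin \<theta>"
  define x where "x = \<eta> / \<omega> * S / (1 - C)"
  define y where "y = \<eta> / (1 - C)"
  define F where "F = bipoly n (if u then c else c') x y"
  define G where "G = bipoly n (if u then d else d') x y"
  have w: "1 - C > 0" unfolding C_def using s by (intro one_minus_mult_cos_pos) auto
  have y: "y > 0" using eta_pos w by (simp add: y_def)
  have p: "pt \<theta> s = (x, y)" by (simp add: pt_def x_def y_def C_def S_def)
  have Cy: "C * y = y - \<eta>" using w by (simp add: y_def field_simps)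
  have Sy: "S * y = \<omega> * x" using w omega_pos by (simp add: y_def x_def)
  have Xp: "X (if u then 1 else 2) (pt \<theta> s) = (y - 2 * x\<^sup>2 - \<eta> + \<epsilon> * F, - 2 * x * y + \<epsilon> * G)"
    unfolding X_def perturbed_field_def p F_def G_def using f_eq g_eq by (cases u) auto
  have rate: "rad u \<theta> s = (\<eta> * G * C + \<omega> * (F * y - x * G) * S) / y\<^sup>2"
    "ang u \<theta> s = (\<omega> * (F * y - x * G) * C - \<eta> * G * S) / y\<^sup>2"
    unfolding rad_def ang_def radial_rate_def angular_rate_def Let_def F_def G_def x_def y_def C_def S_def \<omega>_def
    by (auto split: if_splits)
  have CS: "C\<^sup>2 + S\<^sup>2 = s\<^sup>2"
  proof -
    have "C\<^sup>2 + S\<^sup>2 = s\<^sup>2 * ((sin \<theta>)\<^sup>2 + (cos \<theta>)\<^sup>2)"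
      unfolding C_def S_def power_mult_distrib by (simp only: algebra_simps)
    then show ?thesis by simp
  qed
  have c: "cos \<theta> = C / s" and sn: "sin \<theta> = S / s" using s by (simp_all add: C_def S_def)
  have sp: "\<omega> * s\<^sup>2 + \<epsilon> * ang u \<theta> s = speed u \<theta> s * s\<^sup>2"
    using s by (simp add: speed_def field_simps power2_eq_square)
  have E1: "\<eta> * (- 2 * x * y + \<epsilon> * G) / y\<^sup>2 = (C * (\<epsilon> * rad u \<theta> s) - S * (\<omega> * s\<^sup>2 + \<epsilon> * ang u \<theta> s)) / s\<^sup>2"
  proof -
    have h: "C * rad u \<theta> s - S * ang u \<theta> s = \<eta> * G * (C\<^sup>2 + S\<^sup>2) / y\<^sup>2"
      unfolding rate by (simp add: diff_divide_distrib[symmetric] algebra_simps power2_eq_square)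
    have "C * (\<epsilon> * rad u \<theta> s) - S * (\<omega> * s\<^sup>2 + \<epsilon> * ang u \<theta> s)
       = \<epsilon> * (C * rad u \<theta> s - S * ang u \<theta> s) - \<omega> * S * s\<^sup>2" by (simp add: algebra_simps)
    also have "\<dots> = (\<epsilon> * (\<eta> * G / y\<^sup>2) - \<omega> * S) * s\<^sup>2"
      unfolding h CS by (simp add: algebra_simps)
    finally have "C * (\<epsilon> * rad u \<theta> s) - S * (\<omega> * s\<^sup>2 + \<epsilon> * ang u \<theta> s)
       = (\<epsilon> * (\<eta> * G / y\<^sup>2) - \<omega> * S) * s\<^sup>2" .
    moreover have "\<eta> * (- 2 * x * y + \<epsilon> * G) / y\<^sup>2 = \<epsilon> * (\<eta> * G / y\<^sup>2) - \<omega> * S"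
    proof -
      have "\<eta> * (2 * x * y) = \<omega> * S * y\<^sup>2"
      proof -
        have "\<omega> * S * y\<^sup>2 = \<omega> * (S * y) * y" by (simp add: power2_eq_square)
        then show ?thesis unfolding Sy using omega_sq by (simp add: mult.assoc[symmetric])
      qed
      then have "\<eta> * (- 2 * x * y + \<epsilon> * G) / y\<^sup>2 = (\<epsilon> * \<eta> * G - \<omega> * S * y\<^sup>2) / y\<^sup>2"
        by (simp add: algebra_simps)
      then show ?thesis using y by (simp add: diff_divide_distrib)
    qed
    ultimately show ?thesis using s by simp
  qed
  have E2: "\<omega> * ((y - 2 * x\<^sup>2 - \<eta> + \<epsilon> * F) * y - x * (- 2 * x * y + \<epsilon> * G)) / y\<^sup>2
     = (C * (\<omega> * s\<^sup>2 + \<epsilon> * ang u \<theta> s) + S * (\<epsilon> * rad u \<theta> s)) / s\<^sup>2"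
  proof -
    have h: "C * ang u \<theta> s + S * rad u \<theta> s = \<omega> * (F * y - x * G) * (C\<^sup>2 + S\<^sup>2) / y\<^sup>2"
      unfolding rate by (simp add: add_divide_distrib[symmetric] algebra_simps power2_eq_square)
    have "C * (\<omega> * s\<^sup>2 + \<epsilon> * ang u \<theta> s) + S * (\<epsilon> * rad u \<theta> s)
       = \<epsilon> * (C * ang u \<theta> s + S * rad u \<theta> s) + \<omega> * C * s\<^sup>2" by (simp add: algebra_simps)
    also have "\<dots> = (\<epsilon> * (\<omega> * (F * y - x * G) / y\<^sup>2) + \<omega> * C) * s\<^sup>2"
    proof -
      have "\<epsilon> * (A * s\<^sup>2 / y\<^sup>2) + \<omega> * C * s\<^sup>2 = (\<epsilon> * (A / y\<^sup>2) + \<omega> * C) * s\<^sup>2" for A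
        by (simp add: distrib_right)
      then show ?thesis unfolding h CS .
    qed
    finally have "C * (\<omega> * s\<^sup>2 + \<epsilon> * ang u \<theta> s) + S * (\<epsilon> * rad u \<theta> s)
       = (\<epsilon> * (\<omega> * (F * y - x * G) / y\<^sup>2) + \<omega> * C) * s\<^sup>2" .
    moreover have "\<omega> * ((y - 2 * x\<^sup>2 - \<eta> + \<epsilon> * F) * y - x * (- 2 * x * y + \<epsilon> * G)) / y\<^sup>2
       = \<epsilon> * (\<omega> * (F * y - x * G) / y\<^sup>2) + \<omega> * C"
    proof -
      have "(y - 2 * x\<^sup>2 - \<eta> + \<epsilon> * F) * y - x * (- 2 * x * y + \<epsilon> * G) = (y - \<eta>) * y + \<epsilon> * (F * y - x * G)"
        by (simp add: algebra_simps power2_eq_square)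
      also have "(y - \<eta>) * y = C * y\<^sup>2" unfolding Cy[symmetric] by (simp add: power2_eq_square)
      finally show ?thesis using y by (simp add: distrib_left add_divide_distrib)
    qed
    ultimately show ?thesis using s by simp
  qed
  show ?thesis
    unfolding Xp unfolding D\<zeta>_def p fst_conv snd_conv E1 E2 sp
    using s by (simp add: complex_eq_iff c sn power2_eq_square diff_divide_distrib add_divide_distrib)
qed

lemma closure_Q:
  assumes "k \<in> {1..4}" "p \<in> closure (Q \<eta> k)"
  shows "snd p > \<eta> \<Longrightarrow> k = 1 \<or> k = 4" "snd p < \<eta> \<Longrightarrow> k = 2 \<or> k = 3"
proof -
  have up: "closure (Q \<eta> k) \<subseteq> {p. snd p \<ge> \<eta>}" if "k = 1 \<or> k = 4"
    by (rule closure_minimal) (use that in \<open>auto simp: Q_def intro!: closed_Collect_le continuous_intros\<close>)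
  have lo: "closure (Q \<eta> k) \<subseteq> {p. snd p \<le> \<eta>}" if "k = 2 \<or> k = 3"
    by (rule closure_minimal) (use that in \<open>auto simp: Q_def intro!: closed_Collect_le continuous_intros\<close>)
  have "k = 1 \<or> k = 2 \<or> k = 3 \<or> k = 4" using assms(1) by auto
  then show "snd p > \<eta> \<Longrightarrow> k = 1 \<or> k = 4" "snd p < \<eta> \<Longrightarrow> k = 2 \<or> k = 3"
    using up lo assms(2) by fastforce+
qed

lemma filippov_upper:
  assumes "v \<in> filippov_set \<eta> X p" "snd p > \<eta>"
  shows "v = X 1 p"
proof -
  have "{X k p | k. k \<in> {1..4} \<and> p \<in> closure (Q \<eta> k)} \<subseteq> {X 1 p}"
  proof clarsimp
    fix k assume "Suc 0 \<le> k" "k \<le> 4" "p \<in> closure (Q \<eta> k)"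
    then have "k = 1 \<or> k = 4" using closure_Q(1)[of k p] assms(2) by auto
    then show "X k p = X (Suc 0) p" using X_zones by auto
  qed
  then have "filippov_set \<eta> X p \<subseteq> convex hull {X 1 p}" unfolding filippov_set_def by (rule hull_mono)
  then show ?thesis using assms(1) by auto
qed

lemma filippov_lower:
  assumes "v \<in> filippov_set \<eta> X p" "snd p < \<eta>"
  shows "v = X 2 p"
proof -
  have "{X k p | k. k \<in> {1..4} \<and> p \<in> closure (Q \<eta> k)} \<subseteq> {X 2 p}"
  proof clarsimp
    fix k assume "Suc 0 \<le> k" "k \<le> 4" "p \<in> closure (Q \<eta> k)"
    then have "k = 2 \<or> k = 3" using closure_Q(2)[of k p] assms(2) by auto
    then show "X k p = X 2 p" using X_zones by auto
  qed
  then have "filippov_set \<eta> X p \<subseteq> convex hull {X 2 p}" unfolding filippov_set_def by (rule hull_mono)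
  then show ?thesis using assms(1) by auto
qed

text \<open>The angular velocity is a linear function of the velocity, so its lower bound for the two fields extends to
their convex hull. Hence even Filippov solutions cannot stay on the switching line.\<close>

lemma filippov_angular_speed:
  assumes v: "v \<in> filippov_set \<eta> X (pt \<theta> s)" and s: "s \<in> {a - 4 * \<rho>..b + 4 * \<rho>}"
  shows "Im (D\<zeta> (pt \<theta> s) v / (of_real s * cis \<theta>)) \<ge> \<omega> / 2"
proof -
  let ?p = "pt \<theta> s"
  have s01: "0 < s" "s < 1" using real_bounds[OF s] by auto
  define z where "z = of_real s * cis \<theta>"
  have z0: "z \<noteq> 0" using s01 by (simp add: z_def)
  define c1 where "c1 = D\<zeta> ?p (1, 0) / z"
  define c2 where "c2 = D\<zeta> ?p (0, 1) / z"
  have lin: "Im (D\<zeta> ?p v / z) = inner (Im c1, Im c2) v" for v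
  proof -
    have "D\<zeta> ?p v = of_real (fst v) * D\<zeta> ?p (1, 0) + of_real (snd v) * D\<zeta> ?p (0, 1)"
      by (simp add: D\<zeta>_def complex_eq_iff diff_divide_distrib add_divide_distrib algebra_simps)
    then have "D\<zeta> ?p v / z = of_real (fst v) * c1 + of_real (snd v) * c2"
      by (simp add: c1_def c2_def add_divide_distrib)
    then show ?thesis by (cases v) (simp add: inner_prod_def)
  qed
  have XX: "Im (D\<zeta> ?p (X (if u then 1 else 2) ?p) / z) \<ge> \<omega> / 2" for u
  proof -
    have "D\<zeta> ?p (X (if u then 1 else 2) ?p) / z = Complex (\<epsilon> * rad u \<theta> s / s) (s * speed u \<theta> s) / of_real s"
      unfolding D\<zeta>_X[OF s01] z_def by simp
    then have "Im (D\<zeta> ?p (X (if u then 1 else 2) ?p) / z) = speed u \<theta> s" using s01 by simp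
    then show ?thesis using speed_bounds(1)[OF s, of u \<theta>] by simp
  qed
  have "filippov_set \<eta> X ?p \<subseteq> {v. inner (Im c1, Im c2) v \<ge> \<omega> / 2}"
    unfolding filippov_set_def
  proof (rule hull_minimal)
    show "convex {v. inner (Im c1, Im c2) v \<ge> \<omega> / 2}" by (rule convex_halfspace_ge)
    show "{X k ?p | k. k \<in> {1..4} \<and> ?p \<in> closure (Q \<eta> k)} \<subseteq> {v. inner (Im c1, Im c2) v \<ge> \<omega> / 2}"
    proof
      fix w assume "w \<in> {X k ?p | k. k \<in> {1..4} \<and> ?p \<in> closure (Q \<eta> k)}"
      then obtain k where w: "w = X k ?p" and "k \<in> {1..4}" by blast
      then have "k = 1 \<or> k = 2 \<or> k = 3 \<or> k = 4" by auto
      then show "w \<in> {v. inner (Im c1, Im c2) v \<ge> \<omega> / 2}"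
        using XX[of True] XX[of False] X_zones unfolding lin w by auto
    qed
  qed
  then show ?thesis using v unfolding z_def[symmetric] lin by auto
qed

definition annular :: "plane set" where
  "annular = {p. snd p > 0 \<and> norm (\<zeta> p) \<in> {a - 3 * \<rho>..b + 3 * \<rho>}}"

lemma continuous_on_\<zeta>: "continuous_on {p. snd p > 0} \<zeta>"
  unfolding \<zeta>_def [abs_def] Complex_eq by (intro continuous_intros) auto

text \<open>A continuous logarithm of \<open>\<zeta>\<close> along the solution provides the angle. Since the angle increases strictly, the
axes of the \<open>\<zeta>\<close>-plane are met at finitely many times only; at all other times the Filippov set is a
single vector, and the angle and the radius satisfy the polar equations.\<close>

lemma polar_lift:
  assumes sol: "solution_on \<eta> X T \<gamma>" and t12: "0 \<le> t1" "t1 \<le> t2" "t2 \<le> T"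
    and ann: "\<And>t. t \<in> {t1..t2} \<Longrightarrow> \<gamma> t \<in> annular"
    and t0: "t0 \<in> {t1..t2}" and start: "\<zeta> (\<gamma> t0) = of_real (norm (\<zeta> (\<gamma> t0))) * cis \<theta>\<^sub>0"
  obtains \<theta> S where "continuous_on {t1..t2} \<theta>" "\<theta> t0 = \<theta>\<^sub>0"
    "continuous_on {t1..t2} (\<lambda>t. norm (\<zeta> (\<gamma> t)))"
    "\<And>t. t \<in> {t1..t2} \<Longrightarrow> \<gamma> t = pt (\<theta> t) (norm (\<zeta> (\<gamma> t)))"
    "\<And>t t'. t1 \<le> t \<Longrightarrow> t < t' \<Longrightarrow> t' \<le> t2 \<Longrightarrow> \<theta> t < \<theta> t'"
    "finite S"
    "\<And>t. t \<in> {t1<..<t2} - S \<Longrightarrow> sin (\<theta> t) \<noteq> 0 \<and> cos (\<theta> t) \<noteq> 0"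
    "\<And>t. t \<in> {t1<..<t2} - S \<Longrightarrow>
       (\<theta> has_real_derivative speed (cos (\<theta> t) > 0) (\<theta> t) (norm (\<zeta> (\<gamma> t)))) (at t)"
    "\<And>t. t \<in> {t1<..<t2} - S \<Longrightarrow>
       ((\<lambda>t. norm (\<zeta> (\<gamma> t))) has_real_derivative
          slope (cos (\<theta> t) > 0) \<epsilon> (\<theta> t) (norm (\<zeta> (\<gamma> t))) * speed (cos (\<theta> t) > 0) (\<theta> t) (norm (\<zeta> (\<gamma> t)))) (at t)"
proof -
  let ?I = "{t1..t2}"
  define s where "s t = norm (\<zeta> (\<gamma> t))" for t
  have s: "s t \<in> {a - 4 * \<rho>..b + 4 * \<rho>}" "0 < s t" "s t < 1" and y: "snd (\<gamma> t) > 0" if "t \<in> ?I" for t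
    using ann[OF that] rho ab by (auto simp: annular_def s_def)
  obtain S0 where c\<gamma>: "continuous_on {0..T} \<gamma>" and S0: "finite S0"
    "\<And>t. t \<in> {0..T} - S0 \<Longrightarrow> \<exists>v\<in>filippov_set \<eta> X (\<gamma> t). (\<gamma> has_vector_derivative v) (at t within {0..T})"
    using sol unfolding solution_on_def by blast
  have c\<zeta>: "continuous_on ?I (\<lambda>t. \<zeta> (\<gamma> t))"
    by (rule continuous_on_compose2[OF continuous_on_\<zeta> continuous_on_subset[OF c\<gamma>]]) (use y t12 in auto)
  have ne: "\<zeta> (\<gamma> t) \<noteq> 0" if "t \<in> ?I" for t using s(2)[OF that] by (auto simp: s_def)
  obtain l where l: "continuous_on ?I l" "\<And>t. t \<in> ?I \<Longrightarrow> \<zeta> (\<gamma> t) = exp (l t)"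
    using continuous_logarithm_on_contractible[OF c\<zeta> convex_imp_contractible ne] by auto
  have s_l: "s t = exp (Re (l t))" if "t \<in> ?I" for t by (simp add: s_def l(2)[OF that])
  define \<theta> where "\<theta> t = Im (l t) - Im (l t0) + \<theta>\<^sub>0" for t
  have cis0: "cis (Im (l t0)) = cis \<theta>\<^sub>0"
  proof -
    have "of_real (s t0) * cis (Im (l t0)) = of_real (s t0) * cis \<theta>\<^sub>0"
      using start l(2)[OF t0] s_l[OF t0] by (simp add: exp_eq_polar s_def)
    then show ?thesis using s(2)[OF t0] by simp
  qed
  have cis\<theta>: "cis (\<theta> t) = cis (Im (l t))" for t
  proof -
    have "cis (\<theta> t) = cis (Im (l t)) * (cis \<theta>\<^sub>0 / cis (Im (l t0)))"
    proof -
      have "\<theta> t = Im (l t) + (\<theta>\<^sub>0 - Im (l t0))" by (simp add: \<theta>_def)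
      then show ?thesis by (simp only: cis_mult cis_divide)
    qed
    then show ?thesis unfolding cis0 by simp
  qed
  have polar: "\<zeta> (\<gamma> t) = of_real (s t) * cis (\<theta> t)" if "t \<in> ?I" for t
    using l(2)[OF that] s_l[OF that] unfolding cis\<theta> by (simp add: exp_eq_polar)
  have pt: "\<gamma> t = pt (\<theta> t) (s t)" if "t \<in> ?I" for t by (rule pt_\<zeta>[OF y[OF that] polar[OF that]])
  have c\<theta>: "continuous_on ?I \<theta>" unfolding \<theta>_def by (intro continuous_intros l)
  have der: "\<exists>v\<in>filippov_set \<eta> X (\<gamma> t). (\<theta> has_real_derivative Im (D\<zeta> (\<gamma> t) v / \<zeta> (\<gamma> t))) (at t) \<and>
      (s has_real_derivative s t * Re (D\<zeta> (\<gamma> t) v / \<zeta> (\<gamma> t))) (at t)"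
    if t: "t \<in> {t1<..<t2} - S0" for t
  proof -
    have tI: "t \<in> ?I" using t by auto
    obtain v where v: "v \<in> filippov_set \<eta> X (\<gamma> t)" "(\<gamma> has_vector_derivative v) (at t within {0..T})"
      using S0(2)[of t] t t12 by auto
    have "at t within {0..T} = at t" using t t12 by (intro at_within_interior) auto
    then have "((\<lambda>t. \<zeta> (\<gamma> t)) has_vector_derivative D\<zeta> (\<gamma> t) v) (at t)"
      using has_vector_derivative_\<zeta>[OF v(2) y[OF tI]] by simp
    then have l': "(l has_vector_derivative D\<zeta> (\<gamma> t) v / \<zeta> (\<gamma> t)) (at t)"
      by (intro has_vector_derivative_continuous_log[OF l(1)]) (use l(2) t in auto)
    have re: "((\<lambda>t. Re (l t)) has_real_derivative Re (D\<zeta> (\<gamma> t) v / \<zeta> (\<gamma> t))) (at t)"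
      and im: "((\<lambda>t. Im (l t)) has_real_derivative Im (D\<zeta> (\<gamma> t) v / \<zeta> (\<gamma> t))) (at t)"
      unfolding has_real_derivative_iff_has_vector_derivative
      using bounded_linear.has_vector_derivative[OF bounded_linear_Re l']
        bounded_linear.has_vector_derivative[OF bounded_linear_Im l'] by auto
    have "(\<theta> has_real_derivative Im (D\<zeta> (\<gamma> t) v / \<zeta> (\<gamma> t))) (at t)"
      unfolding \<theta>_def [abs_def] using DERIV_add[OF DERIV_diff[OF im DERIV_const] DERIV_const] by simp
    moreover have "(s has_real_derivative s t * Re (D\<zeta> (\<gamma> t) v / \<zeta> (\<gamma> t))) (at t)"
    proof (rule has_field_derivative_transform_within_open[where S = "{t1<..<t2}"])
      show "((\<lambda>t. exp (Re (l t))) has_real_derivative s t * Re (D\<zeta> (\<gamma> t) v / \<zeta> (\<gamma> t))) (at t)"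
        unfolding s_l[OF tI] using DERIV_chain2[OF DERIV_exp re] .
    qed (use t s_l in auto)
    ultimately show ?thesis using v(1) by blast
  qed
  have mono: "\<theta> t < \<theta> t'" if "t1 \<le> t" "t < t'" "t' \<le> t2" for t t'
  proof (rule increment_pos_off_finite[OF that(2) continuous_on_subset[OF c\<theta>] S0(1)])
    fix u assume u: "u \<in> {t<..<t'} - S0"
    then have uI: "u \<in> ?I" and u': "u \<in> {t1<..<t2} - S0" using that by auto
    obtain v where v: "v \<in> filippov_set \<eta> X (\<gamma> u)" "(\<theta> has_real_derivative Im (D\<zeta> (\<gamma> u) v / \<zeta> (\<gamma> u))) (at u)"
      using der[OF u'] by blast
    have "Im (D\<zeta> (\<gamma> u) v / \<zeta> (\<gamma> u)) \<ge> \<omega> / 2"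
      unfolding polar[OF uI] using v(1) unfolding pt[OF uI] by (rule filippov_angular_speed[OF _ s(1)[OF uI]])
    then show "\<exists>v>0. (\<theta> has_real_derivative v) (at u)" using v(2) omega_pos by (intro exI conjI) auto
  qed (use that in auto)
  define Z where "Z = {t \<in> ?I. sin (\<theta> t) = 0 \<or> cos (\<theta> t) = 0}"
  have inj\<theta>: "inj_on \<theta> ?I"
    by (rule linorder_inj_onI) (use mono in \<open>auto simp: less_imp_neq\<close>)
  have injZ: "inj_on \<theta> Z" by (rule inj_on_subset[OF inj\<theta>]) (auto simp: Z_def)
  have subZ: "\<theta> ` Z \<subseteq> {x \<in> {\<theta> t1..\<theta> t2}. sin x = 0 \<or> cos x = 0}"
  proof clarsimp
    fix t assume t: "t \<in> Z"
    then have "\<theta> t1 \<le> \<theta> t" "\<theta> t \<le> \<theta> t2"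
      using mono[of t1 t] mono[of t t2] by (cases "t = t1"; cases "t = t2"; force simp: Z_def)+
    then show "\<theta> t1 \<le> \<theta> t \<and> \<theta> t \<le> \<theta> t2 \<and> (sin (\<theta> t) = 0 \<or> cos (\<theta> t) = 0)" using t by (simp add: Z_def)
  qed
  have finZ: "finite Z"
    by (rule finite_imageD[OF finite_subset[OF subZ finite_sin_cos_zeros] injZ])
  have main: "(sin (\<theta> t) \<noteq> 0 \<and> cos (\<theta> t) \<noteq> 0) \<and> (\<theta> has_real_derivative speed (cos (\<theta> t) > 0) (\<theta> t) (s t)) (at t) \<and>
     (s has_real_derivative slope (cos (\<theta> t) > 0) \<epsilon> (\<theta> t) (s t) * speed (cos (\<theta> t) > 0) (\<theta> t) (s t)) (at t)"
    if t: "t \<in> {t1<..<t2} - (S0 \<union> Z)" for t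
  proof -
    have tI: "t \<in> ?I" using t by auto
    define u where "u \<longleftrightarrow> cos (\<theta> t) > 0"
    have c0: "sin (\<theta> t) \<noteq> 0" "cos (\<theta> t) \<noteq> 0" using t tI by (auto simp: Z_def)
    obtain v where v: "v \<in> filippov_set \<eta> X (\<gamma> t)" "(\<theta> has_real_derivative Im (D\<zeta> (\<gamma> t) v / \<zeta> (\<gamma> t))) (at t)"
      "(s has_real_derivative s t * Re (D\<zeta> (\<gamma> t) v / \<zeta> (\<gamma> t))) (at t)"
      using der[of t] t by blast
    have "v = X (if u then 1 else 2) (\<gamma> t)"
    proof (cases u)
      case True
      then have "snd (\<gamma> t) > \<eta>" unfolding pt[OF tI] u_def using snd_pt_compare[OF s(2,3)[OF tI]] by simp
      then show ?thesis using filippov_upper[OF v(1)] True by simp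
    next
      case False
      then have "snd (\<gamma> t) < \<eta>" unfolding pt[OF tI] u_def using snd_pt_compare[OF s(2,3)[OF tI]] c0 by simp
      then show ?thesis using filippov_lower[OF v(1)] False by simp
    qed
    then have "D\<zeta> (\<gamma> t) v = cis (\<theta> t) * Complex (\<epsilon> * rad u (\<theta> t) (s t) / s t) (s t * speed u (\<theta> t) (s t))"
      using D\<zeta>_X[OF s(2,3)[OF tI], of "\<theta> t" u] pt[OF tI] by simp
    then have q: "D\<zeta> (\<gamma> t) v / \<zeta> (\<gamma> t) = Complex (\<epsilon> * rad u (\<theta> t) (s t) / s t) (s t * speed u (\<theta> t) (s t)) / of_real (s t)"
      unfolding polar[OF tI] by simp
    have "Im (D\<zeta> (\<gamma> t) v / \<zeta> (\<gamma> t)) = speed u (\<theta> t) (s t)" "s t * Re (D\<zeta> (\<gamma> t) v / \<zeta> (\<gamma> t)) = slope u \<epsilon> (\<theta> t) (s t) * speed u (\<theta> t) (s t)"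
      unfolding q slope_eq[OF s(1)[OF tI]] using s(2)[OF tI] by auto
    then show ?thesis using v(2,3) c0 by (simp add: u_def)
  qed
  show thesis
  proof (rule that[of \<theta> "S0 \<union> Z"])
    show "continuous_on ?I (\<lambda>t. norm (\<zeta> (\<gamma> t)))" by (intro continuous_intros c\<zeta>)
    show "\<theta> t0 = \<theta>\<^sub>0" by (simp add: \<theta>_def)
    show "finite (S0 \<union> Z)" using S0 finZ by simp
  qed (use c\<theta> pt mono main in \<open>auto simp: s_def[abs_def]\<close>)
qed

end

section \<open>Solutions follow the polar orbit\<close>

text \<open>The set of times outside \<open>U\<close> is closed, so it has a first element unless it is empty.\<close>

lemma first_exit:
  fixes \<gamma> :: "real \<Rightarrow> 'a::t2_space"
  assumes cont: "continuous_on {0..T} \<gamma>" and T: "T > 0" and U: "open U" and 0: "\<gamma> 0 \<in> U"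
  obtains \<tau> where "0 < \<tau>" "\<tau> \<le> T" "\<And>t. 0 \<le> t \<Longrightarrow> t < \<tau> \<Longrightarrow> \<gamma> t \<in> U" "\<tau> = T \<or> \<gamma> \<tau> \<notin> U"
proof (cases "\<forall>t\<in>{0..T}. \<gamma> t \<in> U")
  case True
  then show thesis using that[of T] T by auto
next
  case False
  define Bad where "Bad = {t \<in> {0..T}. \<gamma> t \<notin> U}"
  have "closed Bad"
  proof -
    have "closed ({0..T} \<inter> \<gamma> -` (- U))"
      by (rule continuous_closed_preimage[OF cont]) (use U in auto)
    moreover have "{0..T} \<inter> \<gamma> -` (- U) = Bad" by (auto simp: Bad_def)
    ultimately show ?thesis by simp
  qed
  moreover have ne: "Bad \<noteq> {}" and bdd: "bdd_below Bad" using False by (auto simp: Bad_def intro: bdd_belowI[of _ 0])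
  ultimately have inf: "Inf Bad \<in> Bad" by (intro closed_contains_Inf)
  then have "Inf Bad \<noteq> 0" using 0 by (auto simp: Bad_def)
  moreover have "\<gamma> t \<in> U" if "0 \<le> t" "t < Inf Bad" for t
  proof (rule ccontr)
    assume "\<gamma> t \<notin> U"
    then have "t \<in> Bad" using that inf by (auto simp: Bad_def)
    then show False using cInf_lower[OF _ bdd, of t] that by simp
  qed
  ultimately show thesis using that[of "Inf Bad"] inf by (auto simp: Bad_def)
qed

text \<open>Points outside \<open>P\<close> and \<open>N\<close> form a gate that can be passed only from \<open>N\<close> to \<open>P\<close>. A path that leaves the
gate is in \<open>P\<close>; to reach the gate again it would have to come from \<open>N\<close>, but the first point after leaving
\<open>P\<close> can be neither in the open set \<open>N\<close> nor on the gate.\<close>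

lemma no_loop_through_gate:
  fixes \<gamma> :: "real \<Rightarrow> 'a::t2_space"
  assumes cont: "continuous_on {0..T} \<gamma>" and T: "T > 0" and "open P" "open N" "P \<inter> N = {}"
    and ends: "\<gamma> 0 \<notin> P \<union> N" "\<gamma> T \<notin> P \<union> N"
    and gate: "\<And>t. t \<in> {0..T} \<Longrightarrow> \<gamma> t \<notin> P \<union> N \<Longrightarrow>
      \<exists>\<delta>>0. (\<forall>t'\<in>{0..T}. t < t' \<and> t' < t + \<delta> \<longrightarrow> \<gamma> t' \<in> P) \<and> (\<forall>t'\<in>{0..T}. t - \<delta> < t' \<and> t' < t \<longrightarrow> \<gamma> t' \<in> N)"
  shows False
proof -
  obtain \<delta>0 where d0: "\<delta>0 > 0" "\<And>t'. t' \<in> {0..T} \<Longrightarrow> 0 < t' \<and> t' < 0 + \<delta>0 \<Longrightarrow> \<gamma> t' \<in> P"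
    using gate[of 0] ends T by auto
  \<comment> \<open>A start shortly after time 0 lies in \<open>P\<close>.\<close>
  define \<epsilon> where "\<epsilon> = min (\<delta>0 / 2) (T / 2)"
  have e: "0 < \<epsilon>" "\<epsilon> < \<delta>0" "\<epsilon> < T" using d0(1) T by (auto simp: \<epsilon>_def)
  define \<gamma>' where "\<gamma>' t = \<gamma> (t + \<epsilon>)" for t
  have "continuous_on {0..T - \<epsilon>} \<gamma>'"
    unfolding \<gamma>'_def by (intro continuous_on_compose2[OF cont] continuous_intros) (use e in auto)
  moreover have "T - \<epsilon> > 0" using e by simp
  moreover have "\<gamma>' 0 \<in> P" using d0(2)[of \<epsilon>] e by (simp add: \<gamma>'_def)
  ultimately obtain \<tau> where \<tau>: "0 < \<tau>" "\<tau> \<le> T - \<epsilon>" "\<And>t. 0 \<le> t \<Longrightarrow> t < \<tau> \<Longrightarrow> \<gamma>' t \<in> P" "\<tau> = T - \<epsilon> \<or> \<gamma>' \<tau> \<notin> P"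
    using first_exit[of "T - \<epsilon>" \<gamma>' P] \<open>open P\<close> by metis
  define t where "t = \<tau> + \<epsilon>"
  have t: "0 < t" "t \<le> T" using \<tau> e by (auto simp: t_def)
  have inP: "\<gamma> t' \<in> P" if "\<epsilon> \<le> t'" "t' < t" for t'
    using \<tau>(3)[of "t' - \<epsilon>"] that by (simp add: \<gamma>'_def t_def)
  have notP: "\<gamma> t \<notin> P" using \<tau>(4) ends(2) e by (auto simp: \<gamma>'_def t_def)
  have "\<gamma> t \<notin> N"
  proof
    assume "\<gamma> t \<in> N"
    have "(\<gamma> \<longlongrightarrow> \<gamma> t) (at t within {0..T})" using cont t by (auto simp: continuous_on_def)
    then have "\<forall>\<^sub>F t' in at t within {0..T}. \<gamma> t' \<in> N" using \<open>open N\<close> \<open>\<gamma> t \<in> N\<close> by (rule topological_tendstoD)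
    then obtain d where d: "d > 0" "\<And>t'. t' \<in> {0..T} \<Longrightarrow> t' \<noteq> t \<Longrightarrow> dist t' t < d \<Longrightarrow> \<gamma> t' \<in> N"
      unfolding eventually_at by auto
    define t' where "t' = max \<epsilon> (t - d / 2)"
    have "\<epsilon> < t" using \<tau>(1) by (simp add: t_def)
    then have "\<epsilon> \<le> t'" "t' < t" "dist t' t < d" "t' \<in> {0..T}" using d(1) t e by (auto simp: t'_def dist_real_def)
    then have "\<gamma> t' \<in> N" "\<gamma> t' \<in> P" using d(2)[of t'] inP by auto
    then show False using \<open>P \<inter> N = {}\<close> by auto
  qed
  then obtain d where d: "d > 0" "\<And>t'. t' \<in> {0..T} \<Longrightarrow> t - d < t' \<and> t' < t \<Longrightarrow> \<gamma> t' \<in> N"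
    using gate[of t] notP t by auto
  define t' where "t' = max \<epsilon> (t - d / 2)"
  have "\<epsilon> < t" using \<tau>(1) by (simp add: t_def)
  then have "\<epsilon> \<le> t'" "t' < t" "t - d < t'" "t' \<in> {0..T}" using d(1) t e by (auto simp: t'_def)
  then have "\<gamma> t' \<in> N" "\<gamma> t' \<in> P" using d(2)[of t'] inP by auto
  then show False using \<open>P \<inter> N = {}\<close> by auto
qed

context perturbed_system begin

text \<open>The radius \<open>\<sigma>\<close> and the time \<open>T\<close> along one turn, as functions of the angle.\<close>

definition orbit :: "real \<Rightarrow> (real \<Rightarrow> real) \<Rightarrow> (real \<Rightarrow> real) \<Rightarrow> bool" where
  "orbit s\<^sub>0 \<sigma> T \<longleftrightarrow> continuous_on {0..2 * pi} \<sigma> \<and> continuous_on {0..2 * pi} T \<and>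
    \<sigma> 0 = s\<^sub>0 \<and> \<sigma> (2 * pi) = poincare s\<^sub>0 \<and> T 0 = 0 \<and>
    (\<forall>\<theta>\<in>{0..2 * pi}. \<bar>\<sigma> \<theta> - s\<^sub>0\<bar> \<le> \<rho>) \<and>
    (\<forall>\<theta>\<in>{0<..<2 * pi} - {pi / 2, 3 * pi / 2}.
       (\<sigma> has_real_derivative slope (cos \<theta> > 0) \<epsilon> \<theta> (\<sigma> \<theta>)) (at \<theta>) \<and>
       (T has_real_derivative 1 / speed (cos \<theta> > 0) \<theta> (\<sigma> \<theta>)) (at \<theta>))"

lemma orbit_exists:
  assumes "a - \<rho> < s0" "s0 < b + \<rho>"
  obtains \<sigma> T where "orbit s0 \<sigma> T"
  by (rule polar_orbit[OF assms]) (auto simp: orbit_def intro!: that)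

text \<open>The height of the section point with \<open>\<zeta> = s\<close>.\<close>

definition ordinate :: "real \<Rightarrow> real" where "ordinate s = \<eta> / (1 - s)"

lemma pt_0: "pt 0 s = (0, ordinate s)" and pt_2pi: "pt (2 * pi) s = (0, ordinate s)"
  by (simp_all add: pt_def ordinate_def)

lemma section_pt:
  assumes "0 < s" "s < 1" "0 < \<theta>" "\<theta> < 2 * pi"
  shows "pt \<theta> s \<notin> {0} \<times> {\<eta><..}"
proof
  assume "pt \<theta> s \<in> {0} \<times> {\<eta><..}"
  then have "fst (pt \<theta> s) = 0" "snd (pt \<theta> s) > \<eta>" by auto
  then have "sin \<theta> = 0" "cos \<theta> > 0"
    using fst_pt_sign[OF assms(1,2), of \<theta>] snd_pt_compare[OF assms(1,2), of \<theta>] by (auto simp: not_less_iff_gr_or_eq)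
  moreover have "\<theta> = pi"
    using \<open>sin \<theta> = 0\<close> assms(3,4) sin_gt_zero[of \<theta>] sin_lt_zero[of \<theta>] by (cases \<theta> pi rule: linorder_cases) auto
  ultimately show False by simp
qed

text \<open>Wide enough to contain all orbits that start over \<open>{a..b}\<close> and the barriers that are built from them.\<close>

definition open_annulus :: "plane set" where
  "open_annulus = {p. snd p > 0 \<and> norm (\<zeta> p) \<in> {a - 3 * \<rho><..<b + 3 * \<rho>}}"

lemma open_annulus: "open open_annulus"
proof -
  have "open {p :: plane. snd p > 0}" by (intro open_Collect_less continuous_intros)
  then have "open ({p. snd p > 0} \<inter> (\<lambda>p. norm (\<zeta> p)) -` {a - 3 * \<rho><..<b + 3 * \<rho>})"
    by (intro continuous_open_preimage continuous_on_norm continuous_on_\<zeta>) auto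
  moreover have "{p. snd p > 0} \<inter> (\<lambda>p. norm (\<zeta> p)) -` {a - 3 * \<rho><..<b + 3 * \<rho>} = open_annulus"
    by (auto simp: open_annulus_def)
  ultimately show ?thesis by simp
qed

text \<open>The bound on \<open>\<zeta>\<close> keeps \<open>y\<close> above \<open>\<eta> / 2\<close>, so the set does not reach the boundary \<open>y = 0\<close> of the domain
of \<open>\<zeta>\<close>.\<close>

lemma closed_disc:
  assumes "r < 1"
  shows "closed {p. snd p > 0 \<and> norm (\<zeta> p) \<le> r}"
proof -
  have "closed {p :: plane. snd p \<ge> \<eta> / 2}" by (intro closed_Collect_le continuous_intros)
  moreover have "continuous_on {p :: plane. snd p \<ge> \<eta> / 2} (\<lambda>p. norm (\<zeta> p))"
    by (rule continuous_on_subset[OF continuous_on_norm[OF continuous_on_\<zeta>]]) (use eta_pos in auto)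
  ultimately have "closed ({p. snd p \<ge> \<eta> / 2} \<inter> (\<lambda>p. norm (\<zeta> p)) -` {..r})"
    by (intro continuous_closed_preimage) auto
  moreover have "{p. snd p \<ge> \<eta> / 2} \<inter> (\<lambda>p. norm (\<zeta> p)) -` {..r} = {p. snd p > 0 \<and> norm (\<zeta> p) \<le> r}"
  proof -
    have "snd p \<ge> \<eta> / 2" if "snd p > 0" "norm (\<zeta> p) \<le> r" for p
    proof -
      have "\<bar>Re (\<zeta> p)\<bar> < 1" using abs_Re_le_cmod[of "\<zeta> p"] that assms by linarith
      then have "\<eta> / snd p < 2" by (simp add: \<zeta>_def)
      then show ?thesis using that(1) by (simp add: divide_less_eq)
    qed
    then show ?thesis using eta_pos by fastforce
  qed
  ultimately show ?thesis by simp
qed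

lemma closed_annular: "closed annular"
proof -
  have b1: "b + 3 * \<rho> < 1" using rho ab by linarith
  have op: "open {p. snd p > 0 \<and> norm (\<zeta> p) < a - 3 * \<rho>}"
  proof -
    have "open {p :: plane. snd p > 0}" by (intro open_Collect_less continuous_intros)
    then have "open ({p. snd p > 0} \<inter> (\<lambda>p. norm (\<zeta> p)) -` {..<a - 3 * \<rho>})"
      by (intro continuous_open_preimage continuous_on_norm continuous_on_\<zeta>) auto
    moreover have "{p. snd p > 0} \<inter> (\<lambda>p. norm (\<zeta> p)) -` {..<a - 3 * \<rho>} = {p. snd p > 0 \<and> norm (\<zeta> p) < a - 3 * \<rho>}"
      by auto
    ultimately show ?thesis by simp
  qed
  have "annular = {p. snd p > 0 \<and> norm (\<zeta> p) \<le> b + 3 * \<rho>} - {p. snd p > 0 \<and> norm (\<zeta> p) < a - 3 * \<rho>}"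
    by (auto simp: annular_def)
  then show ?thesis using closed_disc[OF b1] op by (simp add: closed_Diff)
qed

lemma norm_\<zeta>_pt: "0 \<le> s \<Longrightarrow> s < 1 \<Longrightarrow> norm (\<zeta> (pt \<theta> s)) = s"
  by (simp add: \<zeta>_pt norm_mult)

text \<open>As long as a solution stays in the annulus, its polar lift satisfies the orbit equation, and Gronwall's
argument identifies its radius with \<open>\<sigma>\<close>. The orbit stays in the interior of the annulus, so the solution
cannot leave the annulus before it completes the turn.\<close>

lemma orbit_follow:
  assumes orb: "orbit s0 \<sigma> \<tau>" and s0: "a - \<rho> < s0" "s0 < b + \<rho>"
    and sol: "solution_on \<eta> X T \<gamma>" and T: "T > 0" and start: "\<gamma> 0 = (0, ordinate s0)"
  obtains t1 \<theta> where "0 < t1" "t1 \<le> T" "continuous_on {0..t1} \<theta>" "\<theta> 0 = 0"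
    "\<And>t t'. 0 \<le> t \<Longrightarrow> t < t' \<Longrightarrow> t' \<le> t1 \<Longrightarrow> \<theta> t < \<theta> t'"
    "\<And>t. t \<in> {0..t1} \<Longrightarrow> \<gamma> t = pt (\<theta> t) (\<sigma> (\<theta> t))"
    "\<theta> t1 = 2 * pi \<or> t1 = T \<and> \<theta> t1 < 2 * pi"
proof -
  have s01: "0 < s0" "s0 < 1" using s0 rho ab by linarith+
  have c\<gamma>: "continuous_on {0..T} \<gamma>" using sol by (simp add: solution_on_def)
  have start': "\<gamma> 0 = pt 0 s0" using start by (simp add: pt_0)
  have z0: "\<zeta> (\<gamma> 0) = of_real s0" and n0: "norm (\<zeta> (\<gamma> 0)) = s0" and y0: "snd (\<gamma> 0) > 0"
    unfolding start' using s01 by (simp_all add: \<zeta>_pt norm_\<zeta>_pt snd_pt_pos)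
  have "\<gamma> 0 \<in> open_annulus" using n0 y0 s0 rho by (simp add: open_annulus_def)
  then obtain \<tau>1 where \<tau>1: "0 < \<tau>1" "\<tau>1 \<le> T" "\<And>t. 0 \<le> t \<Longrightarrow> t < \<tau>1 \<Longrightarrow> \<gamma> t \<in> open_annulus" "\<tau>1 = T \<or> \<gamma> \<tau>1 \<notin> open_annulus"
    using first_exit[OF c\<gamma> T open_annulus] by metis
  have ann: "\<gamma> t \<in> annular" if t: "t \<in> {0..\<tau>1}" for t
  proof (cases "t < \<tau>1")
    case True
    then show ?thesis using \<tau>1(3)[of t] t by (auto simp: open_annulus_def annular_def)
  next
    case False
    then have t: "t = \<tau>1" using t by simp
    have lim: "(\<gamma> \<longlongrightarrow> \<gamma> \<tau>1) (at \<tau>1 within {0..<\<tau>1})"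
    proof (rule tendsto_within_subset)
      show "(\<gamma> \<longlongrightarrow> \<gamma> \<tau>1) (at \<tau>1 within {0..T})" using c\<gamma> \<tau>1(1,2) by (auto simp: continuous_on_def)
    qed (use \<tau>1(2) in auto)
    show ?thesis unfolding t
    proof (rule Lim_in_closed_set[OF closed_annular _ _ lim])
      show "\<forall>\<^sub>F t in at \<tau>1 within {0..<\<tau>1}. \<gamma> t \<in> annular"
      proof -
        have "open_annulus \<subseteq> annular" by (auto simp: open_annulus_def annular_def)
        then have "\<gamma> t \<in> annular" if "t \<in> {0..<\<tau>1}" for t using \<tau>1(3)[of t] that by auto
        then show ?thesis unfolding eventually_at_filter by (intro always_eventually) auto
      qed
      show "\<not> trivial_limit (at \<tau>1 within {0..<\<tau>1})"
        using \<tau>1(1) by (simp add: trivial_limit_within islimpt_Ico)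
    qed
  qed
  have start0: "\<zeta> (\<gamma> 0) = of_real (norm (\<zeta> (\<gamma> 0))) * cis 0" using s01 by (simp add: z0)
  have zero_mem: "0 \<in> {0..\<tau>1}" using \<tau>1(1) by simp
  obtain \<theta> S where \<theta>: "continuous_on {0..\<tau>1} \<theta>" "\<theta> 0 = 0"
    "continuous_on {0..\<tau>1} (\<lambda>t. norm (\<zeta> (\<gamma> t)))"
    "\<And>t. t \<in> {0..\<tau>1} \<Longrightarrow> \<gamma> t = pt (\<theta> t) (norm (\<zeta> (\<gamma> t)))"
    "\<And>t t'. 0 \<le> t \<Longrightarrow> t < t' \<Longrightarrow> t' \<le> \<tau>1 \<Longrightarrow> \<theta> t < \<theta> t'"
    "finite S"
    "\<And>t. t \<in> {0<..<\<tau>1} - S \<Longrightarrow> sin (\<theta> t) \<noteq> 0 \<and> cos (\<theta> t) \<noteq> 0"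
    "\<And>t. t \<in> {0<..<\<tau>1} - S \<Longrightarrow>
       (\<theta> has_real_derivative speed (cos (\<theta> t) > 0) (\<theta> t) (norm (\<zeta> (\<gamma> t)))) (at t)"
    "\<And>t. t \<in> {0<..<\<tau>1} - S \<Longrightarrow>
       ((\<lambda>t. norm (\<zeta> (\<gamma> t))) has_real_derivative
          slope (cos (\<theta> t) > 0) \<epsilon> (\<theta> t) (norm (\<zeta> (\<gamma> t))) * speed (cos (\<theta> t) > 0) (\<theta> t) (norm (\<zeta> (\<gamma> t)))) (at t)"
  proof (rule polar_lift[OF sol order_refl less_imp_le[OF \<tau>1(1)] \<tau>1(2) ann zero_mem start0], goal_cases)
    case (1 t)
    then show ?case by simp
  next
    case (2 \<theta> S)
    show ?case by (rule 2(1)[OF 2(2-10)])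
  qed
  obtain t1 where t1: "0 < t1" "t1 \<le> \<tau>1" "\<theta> t1 = 2 * pi \<or> t1 = \<tau>1 \<and> \<theta> t1 < 2 * pi"
  proof (cases "\<theta> \<tau>1 < 2 * pi")
    case True
    then show thesis using that[of \<tau>1] \<tau>1(1) by simp
  next
    case False
    then obtain t where "0 \<le> t" "t \<le> \<tau>1" "\<theta> t = 2 * pi"
      using IVT'[of \<theta> 0 "2 * pi" \<tau>1] \<theta>(1,2) \<tau>1(1) by auto
    moreover from this have "t \<noteq> 0" using \<theta>(2) by auto
    ultimately show thesis using that[of t] by auto
  qed
  have \<theta>I: "\<theta> t \<in> {0..2 * pi}" if "t \<in> {0..t1}" for t
    using \<theta>(5)[of 0 t] \<theta>(5)[of t t1] that t1 \<theta>(2) by (cases "t = 0"; cases "t = t1") auto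
  have \<theta>Io: "\<theta> t \<in> {0<..<2 * pi}" if "t \<in> {0<..<t1}" for t
    using \<theta>(5)[of 0 t] \<theta>(5)[of t t1] that t1 \<theta>(2) by auto
  have \<sigma>: "continuous_on {0..2 * pi} \<sigma>" "\<sigma> 0 = s0" "\<And>\<theta>. \<theta> \<in> {0..2 * pi} \<Longrightarrow> \<bar>\<sigma> \<theta> - s0\<bar> \<le> \<rho>"
    "\<And>\<theta>. \<theta> \<in> {0<..<2 * pi} - {pi / 2, 3 * pi / 2} \<Longrightarrow> (\<sigma> has_real_derivative slope (cos \<theta> > 0) \<epsilon> \<theta> (\<sigma> \<theta>)) (at \<theta>)"
    using orb by (auto simp: orbit_def)
  have eq0: "norm (\<zeta> (\<gamma> t)) - \<sigma> (\<theta> t) = 0" if t: "t \<in> {0..t1}" for t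
  proof (rule gronwall_zero[where e = "\<lambda>t. norm (\<zeta> (\<gamma> t)) - \<sigma> (\<theta> t)" and M = "\<bar>\<epsilon>\<bar> * K / \<rho> * (2 * \<omega>)", OF _ \<theta>(6) _ _ t])
    show "continuous_on {0..t1} (\<lambda>t. norm (\<zeta> (\<gamma> t)) - \<sigma> (\<theta> t))"
      by (intro continuous_on_diff continuous_on_subset[OF \<theta>(3)] continuous_on_compose2[OF \<sigma>(1)] continuous_on_subset[OF \<theta>(1)])
         (use t1 \<theta>I in auto)
    show "norm (\<zeta> (\<gamma> 0)) - \<sigma> (\<theta> 0) = 0" by (simp add: n0 \<theta>(2) \<sigma>(2))
    fix t assume t: "t \<in> {0<..<t1} - S"
    then have tS: "t \<in> {0<..<\<tau>1} - S" and tI: "t \<in> {0<..<t1}" "t \<in> {0..\<tau>1}" "t \<in> {0..t1}" using t1 by auto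
    define s where "s = norm (\<zeta> (\<gamma> t))"
    define u where "u \<longleftrightarrow> cos (\<theta> t) > 0"
    have sI: "s \<in> {a - 3 * \<rho>..b + 3 * \<rho>}" using ann[OF tI(2)] by (simp add: s_def annular_def)
    have \<sigma>I: "\<sigma> (\<theta> t) \<in> {a - 3 * \<rho>..b + 3 * \<rho>}" using \<sigma>(3)[OF \<theta>I[OF tI(3)]] s0 rho by auto
    have "\<theta> t \<in> {0<..<2 * pi} - {pi / 2, 3 * pi / 2}"
      using \<theta>Io[OF tI(1)] \<theta>(7)[OF tS] cos_sign(2)[of "\<theta> t"] by auto
    from DERIV_chain2[OF \<sigma>(4)[OF this] \<theta>(8)[OF tS]]
    have "((\<lambda>t. norm (\<zeta> (\<gamma> t)) - \<sigma> (\<theta> t)) has_real_derivative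
        slope u \<epsilon> (\<theta> t) s * speed u (\<theta> t) s - slope u \<epsilon> (\<theta> t) (\<sigma> (\<theta> t)) * speed u (\<theta> t) s) (at t)"
      unfolding s_def u_def by (intro DERIV_diff \<theta>(9)[OF tS])
    moreover have "\<bar>slope u \<epsilon> (\<theta> t) s * speed u (\<theta> t) s - slope u \<epsilon> (\<theta> t) (\<sigma> (\<theta> t)) * speed u (\<theta> t) s\<bar>
       \<le> \<bar>\<epsilon>\<bar> * K / \<rho> * (2 * \<omega>) * \<bar>s - \<sigma> (\<theta> t)\<bar>"
    proof -
      have sI4: "s \<in> {a - 4 * \<rho>..b + 4 * \<rho>}" using sI rho by auto
      have "\<bar>slope u \<epsilon> (\<theta> t) s * speed u (\<theta> t) s - slope u \<epsilon> (\<theta> t) (\<sigma> (\<theta> t)) * speed u (\<theta> t) s\<bar>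
        = \<bar>slope u \<epsilon> (\<theta> t) s - slope u \<epsilon> (\<theta> t) (\<sigma> (\<theta> t))\<bar> * \<bar>speed u (\<theta> t) s\<bar>"
        by (simp add: abs_mult left_diff_distrib[symmetric])
      also have "\<dots> \<le> (\<bar>\<epsilon>\<bar> * K / \<rho> * \<bar>s - \<sigma> (\<theta> t)\<bar>) * (2 * \<omega>)"
        using real_slope_lipschitz[OF sI \<sigma>I, of u "\<theta> t"] speed_bounds[OF sI4, of u "\<theta> t"] omega_pos K_pos rho
        by (intro mult_mono) auto
      finally show ?thesis by (simp add: mult_ac)
    qed
    ultimately show "\<exists>v. ((\<lambda>t. norm (\<zeta> (\<gamma> t)) - \<sigma> (\<theta> t)) has_real_derivative v) (at t) \<and>
        \<bar>v\<bar> \<le> \<bar>\<epsilon>\<bar> * K / \<rho> * (2 * \<omega>) * \<bar>norm (\<zeta> (\<gamma> t)) - \<sigma> (\<theta> t)\<bar>"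
      unfolding s_def by blast
  qed
  show thesis
  proof (rule that[of t1 \<theta>])
    show "t1 \<le> T" using t1 \<tau>1 by simp
    show "continuous_on {0..t1} \<theta>" by (rule continuous_on_subset[OF \<theta>(1)]) (use t1 in auto)
    show "\<theta> t < \<theta> t'" if "0 \<le> t" "t < t'" "t' \<le> t1" for t t' using \<theta>(5)[of t t'] that t1 by simp
    show "\<gamma> t = pt (\<theta> t) (\<sigma> (\<theta> t))" if "t \<in> {0..t1}" for t
      using \<theta>(4)[of t] eq0[OF that] that t1 by simp
    show "\<theta> t1 = 2 * pi \<or> t1 = T \<and> \<theta> t1 < 2 * pi"
    proof (cases "\<theta> t1 = 2 * pi")
      case False
      then have t1': "t1 = \<tau>1" "\<theta> t1 < 2 * pi" using t1(3) by auto
      have t1I: "t1 \<in> {0..t1}" using t1 by simp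
      have "norm (\<zeta> (\<gamma> t1)) = \<sigma> (\<theta> t1)" using eq0[OF t1I] by simp
      moreover have "\<bar>\<sigma> (\<theta> t1) - s0\<bar> \<le> \<rho>" by (rule \<sigma>(3)[OF \<theta>I[OF t1I]])
      ultimately have "\<gamma> t1 \<in> open_annulus"
        using ann[of t1] t1' t1(1) s0 rho by (auto simp: open_annulus_def annular_def)
      then show ?thesis using \<tau>1(4) t1' by auto
    qed simp
  qed (use t1 \<theta> in auto)
qed

end

section \<open>First return and displacement\<close>

context perturbed_system begin

lemma X_in_filippov:
  assumes s: "0 < s" "s < 1" and ne: "sin \<theta> \<noteq> 0" "cos \<theta> \<noteq> 0"
  shows "X (if cos \<theta> > 0 then 1 else 2) (pt \<theta> s) \<in> filippov_set \<eta> X (pt \<theta> s)"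
proof -
  define k :: nat where "k = (if cos \<theta> > 0 then if sin \<theta> > 0 then 1 else 4 else if sin \<theta> > 0 then 2 else 3)"
  have "pt \<theta> s \<in> Q \<eta> k"
    using fst_pt_sign[OF s, of \<theta>] snd_pt_compare[OF s, of \<theta>] ne
    by (cases "pt \<theta> s") (auto simp: Q_def k_def not_less_iff_gr_or_eq)
  then have "pt \<theta> s \<in> closure (Q \<eta> k)" using closure_subset by blast
  moreover have "k \<in> {1..4}" by (simp add: k_def)
  ultimately have "X k (pt \<theta> s) \<in> filippov_set \<eta> X (pt \<theta> s)"
    unfolding filippov_set_def by (intro hull_inc) blast
  moreover have "X k = X (if cos \<theta> > 0 then 1 else 2)" using X_zones by (simp add: k_def)
  ultimately show ?thesis by simp
qed

text \<open>Inverting the time function of the polar orbit produces a Filippov solution in the plane.\<close>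

lemma first_return_exists:
  assumes s0: "a - \<rho> < s0" "s0 < b + \<rho>"
  shows "first_return \<eta> X (ordinate s0) (ordinate (poincare s0))"
proof -
  obtain \<sigma> \<tau> where orb: "orbit s0 \<sigma> \<tau>" using orbit_exists[OF s0] .
  let ?E = "{pi / 2, 3 * pi / 2}"
  have \<sigma>: "continuous_on {0..2 * pi} \<sigma>" "continuous_on {0..2 * pi} \<tau>" "\<sigma> 0 = s0" "\<sigma> (2 * pi) = poincare s0" "\<tau> 0 = 0"
    "\<And>\<theta>. \<theta> \<in> {0..2 * pi} \<Longrightarrow> \<bar>\<sigma> \<theta> - s0\<bar> \<le> \<rho>"
    "\<And>\<theta>. \<theta> \<in> {0<..<2 * pi} - ?E \<Longrightarrow> (\<sigma> has_real_derivative slope (cos \<theta> > 0) \<epsilon> \<theta> (\<sigma> \<theta>)) (at \<theta>)"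
    "\<And>\<theta>. \<theta> \<in> {0<..<2 * pi} - ?E \<Longrightarrow> (\<tau> has_real_derivative 1 / speed (cos \<theta> > 0) \<theta> (\<sigma> \<theta>)) (at \<theta>)"
    using orb by (auto simp: orbit_def)
  have \<sigma>I: "\<sigma> \<theta> \<in> {a - 4 * \<rho>..b + 4 * \<rho>}" "0 < \<sigma> \<theta>" "\<sigma> \<theta> < 1" if "\<theta> \<in> {0..2 * pi}" for \<theta>
    using \<sigma>(6)[OF that] s0 rho ab by auto
  have sp: "speed u \<theta> (\<sigma> \<theta>) > 0" if "\<theta> \<in> {0..2 * pi}" for u \<theta>
    using speed_bounds(1)[OF \<sigma>I(1)[OF that], of u \<theta>] omega_pos by linarith
  define T where "T = \<tau> (2 * pi)"
  obtain g where g: "continuous_on {\<tau> 0..\<tau> (2 * pi)} g" "\<tau> 0 < \<tau> (2 * pi)"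
    "\<And>y. y \<in> {\<tau> 0..\<tau> (2 * pi)} \<Longrightarrow> g y \<in> {0..2 * pi} \<and> \<tau> (g y) = y"
    "\<And>x. x \<in> {0..2 * pi} \<Longrightarrow> \<tau> x \<in> {\<tau> 0..\<tau> (2 * pi)} \<and> g (\<tau> x) = x"
    "\<And>y. y \<in> {\<tau> 0<..<\<tau> (2 * pi)} - \<tau> ` ?E \<Longrightarrow> (g has_real_derivative 1 / (1 / speed (cos (g y) > 0) (g y) (\<sigma> (g y)))) (at y)"
    "\<And>y. y \<in> {\<tau> 0<..<\<tau> (2 * pi)} \<Longrightarrow> g y \<in> {0<..<2 * pi}"
  proof (rule inverse_off_finite[of 0 "2 * pi" \<tau> ?E "\<lambda>\<theta>. 1 / speed (cos \<theta> > 0) \<theta> (\<sigma> \<theta>)"])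
    show "0 < 1 / speed (cos t > 0) t (\<sigma> t)" if "t \<in> {0<..<2 * pi} - ?E" for t
      using sp[of t] that by simp
  qed (use \<sigma> in auto)
  note g = g[unfolded \<sigma>(5), folded T_def]
  define G where "G t = g (max 0 (min T t))" for t
  have GI: "G t \<in> {0..2 * pi}" for t unfolding G_def using g(2,3) by simp
  have G_eq: "G t = g t" if "t \<in> {0..T}" for t using that by (simp add: G_def)
  define \<gamma> where "\<gamma> t = pt (G t) (\<sigma> (G t))" for t
  have cG: "continuous_on A G" for A
    unfolding G_def by (intro continuous_on_compose2[OF g(1)] continuous_intros) (use g(2) in auto)
  have c\<sigma>: "continuous_on A (\<lambda>t. \<sigma> (G t))" for A
    by (intro continuous_on_compose2[OF \<sigma>(1) cG]) (use GI in auto)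
  have w: "1 - \<sigma> (G t) * cos (G t) \<noteq> 0" for t
    using one_minus_mult_cos_pos[of "\<sigma> (G t)" "G t"] \<sigma>I[OF GI[of t]] by simp
  have c\<gamma>: "continuous_on {0..T} \<gamma>"
    unfolding \<gamma>_def pt_def by (intro continuous_intros cG c\<sigma>) (use w in auto)
  \<comment> \<open>The times on the axes \<open>x = 0\<close> and \<open>y = \<eta>\<close>.\<close>
  define Z where "Z = {0, T} \<union> \<tau> ` {pi / 2, pi, 3 * pi / 2}"
  have "solution_on \<eta> X T \<gamma>"
    unfolding solution_on_def
  proof (intro conjI exI[of _ Z] ballI c\<gamma>)
    show "finite Z" by (simp add: Z_def)
    fix t assume t: "t \<in> {0..T} - Z"
    then have tI: "t \<in> {0<..<T}" "t \<in> {0..T}" by (auto simp: Z_def)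
    define \<theta> where "\<theta> = g t"
    have \<theta>: "\<theta> \<in> {0<..<2 * pi}" "\<tau> \<theta> = t" "\<theta> \<in> {0..2 * pi}" using g(3)[OF tI(2)] g(6)[OF tI(1)] by (auto simp: \<theta>_def)
    have "t \<notin> \<tau> ` {pi / 2, pi, 3 * pi / 2}" using t unfolding Z_def by blast
    then have ne: "\<theta> \<noteq> pi / 2" "\<theta> \<noteq> pi" "\<theta> \<noteq> 3 * pi / 2" using \<theta>(2) by blast+
    have cne: "cos \<theta> \<noteq> 0" using cos_sign(2)[of \<theta>] \<theta> ne by auto
    have sne: "sin \<theta> \<noteq> 0"
      using ne(2) \<theta>(1) sin_gt_zero[of \<theta>] sin_lt_zero[of \<theta>] by (cases \<theta> pi rule: linorder_cases) auto
    define u where "u \<longleftrightarrow> cos \<theta> > 0"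
    define s where "s = \<sigma> \<theta>"
    have s: "s \<in> {a - 4 * \<rho>..b + 4 * \<rho>}" "0 < s" "s < 1" using \<sigma>I[OF \<theta>(3)] by (simp_all add: s_def)
    have "t \<notin> \<tau> ` ?E" using t by (auto simp: Z_def)
    then have g': "(g has_real_derivative speed u \<theta> s) (at t)"
      using g(5)[of t] tI by (simp add: \<theta>_def u_def s_def)
    have G': "(G has_real_derivative speed u \<theta> s) (at t)"
      by (rule has_field_derivative_transform_within_open[OF g', of "{0<..<T}"]) (use tI G_eq in auto)
    have Gt: "G t = \<theta>" using G_eq[OF tI(2)] by (simp add: \<theta>_def)
    have "\<theta> \<in> {0<..<2 * pi} - ?E" using \<theta> ne by simp
    from \<sigma>(7)[OF this] have "(\<sigma> has_real_derivative slope u \<epsilon> \<theta> s) (at (G t))" by (simp add: Gt u_def s_def)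
    from DERIV_chain2[OF this G'] have \<sigma>': "((\<lambda>t. \<sigma> (G t)) has_real_derivative \<epsilon> * rad u \<theta> s / s) (at t)"
      by (simp add: slope_eq[OF s(1)])
    have ps: "\<gamma> t = pt \<theta> s" by (simp add: \<gamma>_def Gt s_def)
    have "((\<lambda>t. of_real (\<sigma> (G t)) * cis (G t)) has_vector_derivative
       of_real s * (of_real (speed u \<theta> s) * (\<i> * cis \<theta>)) + of_real (\<epsilon> * rad u \<theta> s / s) * cis \<theta>) (at t)"
    proof -
      have c: "((\<lambda>t. cis (G t)) has_vector_derivative of_real (speed u \<theta> s) * (\<i> * cis \<theta>)) (at t)"
      proof -
        have "((\<lambda>t. of_real (cos (G t)) + \<i> * of_real (sin (G t))) has_vector_derivative
           of_real (- sin \<theta> * speed u \<theta> s) + \<i> * of_real (cos \<theta> * speed u \<theta> s)) (at t)"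
          using DERIV_chain2[OF DERIV_cos G'] DERIV_chain2[OF DERIV_sin G'] unfolding Gt
          by (intro has_vector_derivative_add has_vector_derivative_mult_right has_vector_derivative_of_real) auto
        moreover have "of_real (- sin \<theta> * speed u \<theta> s) + \<i> * of_real (cos \<theta> * speed u \<theta> s)
           = of_real (speed u \<theta> s) * (\<i> * cis \<theta>)" by (simp add: complex_eq_iff)
        moreover have "(\<lambda>t. of_real (cos (G t)) + \<i> * of_real (sin (G t))) = (\<lambda>t. cis (G t))"
          by (simp add: fun_eq_iff complex_eq_iff)
        ultimately show ?thesis by (simp only:)
      qed
      have "((\<lambda>t. complex_of_real (\<sigma> (G t))) has_vector_derivative of_real (\<epsilon> * rad u \<theta> s / s)) (at t)"
        by (rule has_vector_derivative_of_real[OF \<sigma>'])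
      from has_vector_derivative_mult[OF this c] show ?thesis by (simp add: Gt s_def)
    qed
    also have "of_real s * (of_real (speed u \<theta> s) * (\<i> * cis \<theta>)) + of_real (\<epsilon> * rad u \<theta> s / s) * cis \<theta>
       = cis \<theta> * Complex (\<epsilon> * rad u \<theta> s / s) (s * speed u \<theta> s)"
      by (simp add: Complex_eq algebra_simps)
    also have "\<dots> = D\<zeta> (\<gamma> t) (X (if u then 1 else 2) (pt \<theta> s))"
      unfolding ps D\<zeta>_X[OF s(2,3), of \<theta> u] ..
    finally have "(\<gamma> has_vector_derivative X (if u then 1 else 2) (pt \<theta> s)) (at t)"
    proof (rule has_vector_derivative_\<zeta>_imp)
      fix v
      have "\<bar>\<sigma> (G v)\<bar> < 1" using \<sigma>I[OF GI[of v]] by simp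
      then show "snd (\<gamma> v) > 0 \<and> \<zeta> (\<gamma> v) = of_real (\<sigma> (G v)) * cis (G v)"
        unfolding \<gamma>_def using snd_pt_pos \<zeta>_pt by blast
    qed
    then show "\<exists>v\<in>filippov_set \<eta> X (\<gamma> t). (\<gamma> has_vector_derivative v) (at t within {0..T})"
      using X_in_filippov[OF s(2,3) sne cne] unfolding ps u_def by (blast intro: has_vector_derivative_at_within)
  qed
  moreover have T: "T > 0" using g(2) .
  moreover have "\<gamma> 0 = (0, ordinate s0)" "\<gamma> T = (0, ordinate (poincare s0))"
  proof -
    have "G 0 = 0" "G T = 2 * pi" using g(4)[of 0] g(4)[of "2 * pi"] T \<sigma>(5) by (auto simp: G_def T_def)
    then show "\<gamma> 0 = (0, ordinate s0)" "\<gamma> T = (0, ordinate (poincare s0))"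
      by (simp_all add: \<gamma>_def \<sigma> pt_0 pt_2pi)
  qed
  moreover have "\<gamma> t \<notin> {0} \<times> {\<eta><..}" if t: "t \<in> {0<..<T}" for t
    unfolding \<gamma>_def using section_pt[of "\<sigma> (G t)" "G t"] g(6)[OF t] G_eq[of t] \<sigma>I[of "G t"] t by auto
  moreover have "ordinate (poincare s0) > \<eta>"
  proof -
    have "0 < poincare s0" "poincare s0 < 1" using \<sigma>I[of "2 * pi"] \<sigma>(4) by auto
    then show ?thesis using eta_pos by (simp add: ordinate_def pos_less_divide_eq)
  qed
  ultimately show ?thesis unfolding first_return_def by (intro conjI exI[of _ T] exI[of _ \<gamma>]) auto
qed

text \<open>The solution follows the polar orbit, which meets the section only after a full turn.\<close>

lemma first_return_unique:
  assumes s0: "a - \<rho> < s0" "s0 < b + \<rho>" and fr: "first_return \<eta> X (ordinate s0) y'"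
  shows "y' = ordinate (poincare s0)"
proof -
  have y': "y' > \<eta>" using fr by (simp add: first_return_def)
  obtain T \<gamma> where T: "T > 0" and sol: "solution_on \<eta> X T \<gamma>" and ends: "\<gamma> 0 = (0, ordinate s0)" "\<gamma> T = (0, y')"
    and miss: "\<forall>t\<in>{0<..<T}. \<gamma> t \<notin> {0} \<times> {\<eta><..}"
    using fr unfolding first_return_def by (elim conjE exE) (rule that; assumption)
  obtain \<sigma> \<tau> where orb: "orbit s0 \<sigma> \<tau>" using orbit_exists[OF s0] .
  obtain t1 \<theta> where f: "0 < t1" "t1 \<le> T" "continuous_on {0..t1} \<theta>" "\<theta> 0 = 0"
    "\<And>t t'. 0 \<le> t \<Longrightarrow> t < t' \<Longrightarrow> t' \<le> t1 \<Longrightarrow> \<theta> t < \<theta> t'"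
    "\<And>t. t \<in> {0..t1} \<Longrightarrow> \<gamma> t = pt (\<theta> t) (\<sigma> (\<theta> t))"
    "\<theta> t1 = 2 * pi \<or> t1 = T \<and> \<theta> t1 < 2 * pi"
  proof (rule orbit_follow[OF orb s0 sol T ends(1)], goal_cases)
    case (1 t1 \<theta>)
    show ?case by (rule 1(1)[OF 1(2-8)])
  qed
  have \<sigma>I: "0 < \<sigma> \<theta>" "\<sigma> \<theta> < 1" if "\<theta> \<in> {0..2 * pi}" for \<theta>
  proof -
    have "\<bar>\<sigma> \<theta> - s0\<bar> \<le> \<rho>" using orb that by (simp add: orbit_def)
    then show "0 < \<sigma> \<theta>" "\<sigma> \<theta> < 1" using s0 rho ab by linarith+
  qed
  have pos: "\<theta> t1 > 0" using f(5)[of 0 t1] f(1,4) by simp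
  have \<gamma>t1: "\<gamma> t1 = pt (\<theta> t1) (\<sigma> (\<theta> t1))" using f(6)[of t1] f(1) by simp
  have full: "\<theta> t1 = 2 * pi"
  proof (rule ccontr)
    assume "\<theta> t1 \<noteq> 2 * pi"
    then have "t1 = T" "\<theta> t1 < 2 * pi" using f(7) by auto
    then have "pt (\<theta> t1) (\<sigma> (\<theta> t1)) \<notin> {0} \<times> {\<eta><..}"
      using \<sigma>I[of "\<theta> t1"] pos by (intro section_pt) auto
    moreover have "pt (\<theta> t1) (\<sigma> (\<theta> t1)) = (0, y')" using \<gamma>t1 ends(2) \<open>t1 = T\<close> by metis
    ultimately have "(0, y') \<notin> {0} \<times> {\<eta><..}" by simp
    then show False using y' by simp
  qed
  have P: "\<sigma> (2 * pi) = poincare s0" using orb by (simp add: orbit_def)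
  have "\<gamma> t1 = (0, ordinate (poincare s0))" unfolding \<gamma>t1 full P by (rule pt_2pi)
  moreover have "ordinate (poincare s0) > \<eta>"
    using first_return_exists[OF s0] by (simp add: first_return_def)
  ultimately have "t1 = T" using bspec[OF miss, of t1] f(1,2) by fastforce
  then show ?thesis using ends(2) \<open>\<gamma> t1 = (0, ordinate (poincare s0))\<close> by simp
qed

lemma displacement_eq:
  assumes "a - \<rho> < s0" "s0 < b + \<rho>"
  shows "displacement \<eta> X (ordinate s0) = ordinate (poincare s0) - ordinate s0"
proof -
  have "(THE y'. first_return \<eta> X (ordinate s0) y') = ordinate (poincare s0)"
    using first_return_exists[OF assms] first_return_unique[OF assms] by (rule the_equality)
  then show ?thesis by (simp add: displacement_def)
qed

end

lemma closed_orbit_starting_at: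
  assumes "closed_orbit \<eta> X C" "p \<in> C"
  obtains T \<gamma> where "T > 0" "solution_on \<eta> X T \<gamma>" "\<gamma> 0 = p" "\<gamma> T = p" "inj_on \<gamma> {0..<T}" "C = \<gamma> ` {0..T}"
proof -
  obtain T \<gamma> where T: "T > 0" and sol: "solution_on \<eta> X T \<gamma>" and per: "\<gamma> T = \<gamma> 0"
    and inj: "inj_on \<gamma> {0..<T}" and C: "C = \<gamma> ` {0..T}"
    using assms(1) unfolding closed_orbit_def by blast
  have C': "C = \<gamma> ` {0..<T}"
  proof -
    have "{0..T} = insert T {0..<T}" using T by auto
    then show ?thesis using C per T by auto
  qed
  then obtain r where r: "0 \<le> r" "r < T" "\<gamma> r = p" using assms(2) by auto
  define \<phi> where "\<phi> t = (if t \<le> T - r then t + r else t + r - T)" for t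
  define \<gamma>' where "\<gamma>' t = \<gamma> (\<phi> t)" for t
  obtain S where c\<gamma>: "continuous_on {0..T} \<gamma>" and S: "finite S"
    "\<And>t. t \<in> {0..T} - S \<Longrightarrow> \<exists>v\<in>filippov_set \<eta> X (\<gamma> t). (\<gamma> has_vector_derivative v) (at t within {0..T})"
    using sol unfolding solution_on_def by blast
  have "continuous_on {0..T} \<gamma>'"
  proof -
    have "continuous_on {0..T} (\<lambda>t. if t \<le> T - r then \<gamma> (t + r) else \<gamma> (t + r - T))"
    proof (rule continuous_on_cases_le)
      show "continuous_on {t \<in> {0..T}. t \<le> T - r} (\<lambda>t. \<gamma> (t + r))"
        by (intro continuous_on_compose2[OF c\<gamma>] continuous_intros) (use r in auto)
      show "continuous_on {t \<in> {0..T}. T - r \<le> t} (\<lambda>t. \<gamma> (t + r - T))"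
        by (intro continuous_on_compose2[OF c\<gamma>] continuous_intros) (use r in auto)
      show "\<gamma> (t + r) = \<gamma> (t + r - T)" if "t \<in> {0..T}" "t = T - r" for t using that per by simp
    qed (intro continuous_intros)
    moreover have "(\<lambda>t. if t \<le> T - r then \<gamma> (t + r) else \<gamma> (t + r - T)) = \<gamma>'" by (auto simp: \<gamma>'_def \<phi>_def)
    ultimately show ?thesis by (simp only:)
  qed
  moreover have "\<exists>v\<in>filippov_set \<eta> X (\<gamma>' t). (\<gamma>' has_vector_derivative v) (at t within {0..T})"
    if t: "t \<in> {0..T} - ({0, T - r, T} \<union> (\<lambda>u. u - r) ` S \<union> (\<lambda>u. u - r + T) ` S)" for t
  proof -
    define k where "k = (if t \<le> T - r then r else r - T)"
    define U where "U = (if t \<le> T - r then {0<..<T - r} else {T - r<..<T})"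
    have tU: "t \<in> U" "open U" using t by (auto simp: U_def)
    have eq: "\<gamma>' x = \<gamma> (x + k)" if "x \<in> U" for x
      using that by (auto simp: U_def \<gamma>'_def \<phi>_def k_def add_diff_eq split: if_splits)
    have tk: "t + k \<in> {0<..<T}" using t r by (auto simp: k_def)
    moreover have "t + k \<notin> S" using t by (force simp: k_def)
    ultimately obtain v where v: "v \<in> filippov_set \<eta> X (\<gamma> (t + k))" "(\<gamma> has_vector_derivative v) (at (t + k) within {0..T})"
      using S(2)[of "t + k"] by auto
    have "at (t + k) within {0..T} = at (t + k)" using tk by (intro at_within_interior) auto
    then have v': "(\<gamma> has_vector_derivative v) (at (t + k))" using v(2) by simp
    have "((\<lambda>x. x + k) has_real_derivative 1) (at t)" by (auto intro!: derivative_eq_intros)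
    from vector_diff_chain_at[OF this[unfolded has_real_derivative_iff_has_vector_derivative] v']
    have "((\<lambda>x. \<gamma> (x + k)) has_vector_derivative v) (at t)" by (simp add: o_def)
    then have "(\<gamma>' has_vector_derivative v) (at t)"
      by (rule has_vector_derivative_transform_within_open[OF _ tU(2,1)]) (simp add: eq)
    then show ?thesis using v(1) eq[OF tU(1)] by (auto intro: has_vector_derivative_at_within)
  qed
  ultimately have sol': "solution_on \<eta> X T \<gamma>'"
    unfolding solution_on_def
    by (intro conjI exI[of _ "{0, T - r, T} \<union> (\<lambda>u. u - r) ` S \<union> (\<lambda>u. u - r + T) ` S"]) (use S(1) in auto)
  define \<psi> where "\<psi> t = (if t < T - r then t + r else t + r - T)" for t
  have \<gamma>\<psi>: "\<gamma>' t = \<gamma> (\<psi> t)" for t using per by (auto simp: \<gamma>'_def \<phi>_def \<psi>_def)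
  have \<psi>I: "\<psi> t \<in> {0..<T}" if "t \<in> {0..<T}" for t using that r by (auto simp: \<psi>_def)
  have "inj_on \<psi> {0..<T}" unfolding inj_on_def \<psi>_def using r by auto
  then have "inj_on (\<gamma> \<circ> \<psi>) {0..<T}"
    by (rule comp_inj_on) (rule inj_on_subset[OF inj], use \<psi>I in auto)
  then have inj': "inj_on \<gamma>' {0..<T}" by (simp add: inj_on_def \<gamma>\<psi>)
  have "\<psi> ` {0..<T} = {0..<T}"
  proof
    show "{0..<T} \<subseteq> \<psi> ` {0..<T}"
    proof
      fix x assume x: "x \<in> {0..<T}"
      have "x = \<psi> (if x \<ge> r then x - r else x - r + T)" using x r by (auto simp: \<psi>_def)
      moreover have "(if x \<ge> r then x - r else x - r + T) \<in> {0..<T}" using x r by auto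
      ultimately show "x \<in> \<psi> ` {0..<T}" by (rule image_eqI)
    qed
  qed (use \<psi>I in auto)
  then have "\<gamma>' ` {0..<T} = C" unfolding C' by (metis (no_types, lifting) \<gamma>\<psi> image_cong image_image)
  moreover have "\<gamma>' 0 = p" "\<gamma>' T = p" using r per by (auto simp: \<gamma>'_def \<phi>_def)
  moreover have "\<gamma>' ` {0..T} = \<gamma>' ` {0..<T}"
  proof -
    have "{0..T} = insert T {0..<T}" using T by auto
    moreover have "\<gamma>' T \<in> \<gamma>' ` {0..<T}" using \<open>\<gamma>' 0 = p\<close> \<open>\<gamma>' T = p\<close> T by (metis atLeastLessThan_iff image_eqI order_refl)
    ultimately show ?thesis by auto
  qed
  ultimately show thesis using that[OF T sol'] inj' by metis
qed

section \<open>Closed orbits close up after one turn\<close>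

text \<open>Here \<open>\<sigma>\<close> is the polar orbit of a section point, whose radius changes by \<open>2 pi \<kappa>\<close> during one turn.
Without its drift it becomes a closed curve \<open>s = \<beta> \<theta>\<close>. In the direction of \<open>\<theta>\<close> the curve has the slope of the
orbit minus \<open>\<kappa>\<close>, so if \<open>\<kappa> \<noteq> 0\<close> all solutions cross it towards the side of the sign of \<open>\<kappa>\<close>.\<close>

locale barrier = perturbed_system +
  fixes s\<^sub>0 :: real and \<sigma> \<tau> :: "real \<Rightarrow> real"
  assumes orb: "orbit s\<^sub>0 \<sigma> \<tau>" and s0: "a \<le> s\<^sub>0" "s\<^sub>0 \<le> b"
begin

definition \<kappa> :: real where "\<kappa> = (poincare s\<^sub>0 - s\<^sub>0) / (2 * pi)"

definition \<beta> :: "real \<Rightarrow> real" where "\<beta> \<theta> = \<sigma> \<theta> - \<kappa> * \<theta>"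

lemma \<sigma>:
  "continuous_on {0..2 * pi} \<sigma>" "\<sigma> 0 = s\<^sub>0" "\<sigma> (2 * pi) = poincare s\<^sub>0"
  "\<theta> \<in> {0..2 * pi} \<Longrightarrow> \<bar>\<sigma> \<theta> - s\<^sub>0\<bar> \<le> \<rho>"
  "\<theta> \<in> {0<..<2 * pi} - {pi / 2, 3 * pi / 2} \<Longrightarrow> (\<sigma> has_real_derivative slope (cos \<theta> > 0) \<epsilon> \<theta> (\<sigma> \<theta>)) (at \<theta>)"
  using orb by (auto simp: orbit_def)

lemma \<beta>_ends: "\<beta> 0 = s\<^sub>0" "\<beta> (2 * pi) = s\<^sub>0"
  by (simp_all add: \<beta>_def \<kappa>_def \<sigma>)

lemma continuous_on_\<beta>: "continuous_on {0..2 * pi} \<beta>"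
  unfolding \<beta>_def by (intro continuous_intros \<sigma>)

lemma \<kappa>_bound: "2 * pi * \<bar>\<kappa>\<bar> \<le> \<rho>"
  using \<sigma>(4)[of "2 * pi"] by (simp add: \<kappa>_def \<sigma>(3) abs_divide)

lemma \<kappa>_mult_bound: "\<theta> \<in> {0..2 * pi} \<Longrightarrow> \<bar>\<kappa> * \<theta>\<bar> \<le> 2 * pi * \<bar>\<kappa>\<bar>"
  by (simp add: abs_mult mult.commute mult_right_mono)

lemma \<beta>_bound:
  assumes "\<theta> \<in> {0..2 * pi}"
  shows "\<bar>\<beta> \<theta> - s\<^sub>0\<bar> \<le> 2 * \<rho>"
  using \<sigma>(4)[OF assms] \<kappa>_mult_bound[OF assms] \<kappa>_bound unfolding \<beta>_def by linarith

lemma \<beta>_range: "\<theta> \<in> {0..2 * pi} \<Longrightarrow> \<beta> \<theta> \<in> {a - 2 * \<rho>..b + 2 * \<rho>}"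
  using \<beta>_bound[of \<theta>] s0 by auto

lemma \<beta>_cis_cong:
  assumes "\<theta> \<in> {0..2 * pi}" "\<theta>' \<in> {0..2 * pi}" "cis \<theta> = cis \<theta>'"
  shows "\<beta> \<theta> = \<beta> \<theta>'"
proof -
  have sc: "sin \<theta> = sin \<theta>'" "cos \<theta> = cos \<theta>'" using assms(3) by (simp_all add: complex_eq_iff)
  then obtain k :: int where k: "\<theta> = \<theta>' + 2 * pi * of_int k" using sin_cos_eq_iff[of \<theta> \<theta>'] by auto
  have "k = 0 \<or> k = 1 \<or> k = - 1"
  proof -
    define x where "x = pi * of_int k"
    have "\<theta> = \<theta>' + 2 * x" using k by (simp add: x_def)
    then have x: "- pi \<le> x" "x \<le> pi" using assms(1,2) by auto
    have "\<not> 2 \<le> k"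
    proof
      assume "2 \<le> k"
      then have "pi * 2 \<le> x" unfolding x_def by (intro mult_left_mono) auto
      then show False using x pi_gt_zero by linarith
    qed
    moreover have "\<not> k \<le> - 2"
    proof
      assume "k \<le> - 2"
      then have "x \<le> pi * - 2" unfolding x_def by (intro mult_left_mono) auto
      then show False using x pi_gt_zero by linarith
    qed
    ultimately show ?thesis by presburger
  qed
  then show ?thesis
  proof (elim disjE)
    assume "k = 1"
    then have "\<theta> = 2 * pi" "\<theta>' = 0" using k assms(1,2) by auto
    then show ?thesis by (simp add: \<beta>_ends)
  next
    assume "k = - 1"
    then have "\<theta>' = 2 * pi" "\<theta> = 0" using k assms(1,2) by auto
    then show ?thesis by (simp add: \<beta>_ends)
  qed (use k in simp)
qed

text \<open>The derivative of \<open>s - \<beta> \<theta>\<close> per angle is \<open>\<kappa>\<close> plus the difference of the slopes at \<open>s\<close> and at \<open>\<sigma> \<theta>\<close>. Since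
\<open>\<bar>\<sigma> \<theta> - \<beta> \<theta>\<bar> \<le> 2 pi \<bar>\<kappa>\<bar>\<close> and the Lipschitz constant of the slope is at most \<open>1 / (8 pi)\<close>, this difference is
at most \<open>\<bar>\<kappa>\<bar> / 2\<close> near the curve.\<close>

lemma barrier_increment:
  fixes s \<theta> :: "real \<Rightarrow> real"
  assumes \<kappa>: "\<kappa> \<noteq> 0" and "t1 < t2" "finite S"
    and cont: "continuous_on {t1..t2} \<theta>" "continuous_on {t1..t2} s"
    and \<theta>I: "\<And>t. t \<in> {t1..t2} \<Longrightarrow> \<theta> t \<in> {0..2 * pi}"
    and sI: "\<And>t. t \<in> {t1..t2} \<Longrightarrow> s t \<in> {a - 3 * \<rho>..b + 3 * \<rho>}"
    and near: "\<And>t. t \<in> {t1..t2} \<Longrightarrow> \<bar>\<epsilon>\<bar> * K / \<rho> * \<bar>s t - \<beta> (\<theta> t)\<bar> \<le> \<bar>\<kappa>\<bar> / 4"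
    and axes: "\<And>t. t \<in> {t1<..<t2} - S \<Longrightarrow> sin (\<theta> t) \<noteq> 0 \<and> cos (\<theta> t) \<noteq> 0"
    and \<theta>': "\<And>t. t \<in> {t1<..<t2} - S \<Longrightarrow> (\<theta> has_real_derivative speed (cos (\<theta> t) > 0) (\<theta> t) (s t)) (at t)"
    and s': "\<And>t. t \<in> {t1<..<t2} - S \<Longrightarrow> (s has_real_derivative
          slope (cos (\<theta> t) > 0) \<epsilon> (\<theta> t) (s t) * speed (cos (\<theta> t) > 0) (\<theta> t) (s t)) (at t)"
  shows "\<kappa> * (s t1 - \<beta> (\<theta> t1)) < \<kappa> * (s t2 - \<beta> (\<theta> t2))"
proof (rule increment_pos_off_finite[OF assms(2) _ assms(3)])
  show "continuous_on {t1..t2} (\<lambda>t. \<kappa> * (s t - \<beta> (\<theta> t)))"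
    by (intro continuous_intros cont continuous_on_compose2[OF continuous_on_\<beta> cont(1)]) (use \<theta>I in auto)
  fix t assume t: "t \<in> {t1<..<t2} - S"
  then have tI: "t \<in> {t1..t2}" by auto
  define u where "u \<longleftrightarrow> cos (\<theta> t) > 0"
  define v where "v = speed u (\<theta> t) (s t)"
  define \<Delta> where "\<Delta> = slope u \<epsilon> (\<theta> t) (s t) - slope u \<epsilon> (\<theta> t) (\<sigma> (\<theta> t))"
  have "\<theta> t \<noteq> 0" "\<theta> t \<noteq> 2 * pi" using axes[OF t] by auto
  then have "\<theta> t \<in> {0<..<2 * pi} - {pi / 2, 3 * pi / 2}"
    using \<theta>I[OF tI] axes[OF t] cos_sign(2)[of "\<theta> t"] by auto
  from DERIV_chain2[OF \<sigma>(5)[OF this] \<theta>'[OF t]]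
  have "((\<lambda>t. \<sigma> (\<theta> t)) has_real_derivative slope u \<epsilon> (\<theta> t) (\<sigma> (\<theta> t)) * v) (at t)" by (simp add: u_def v_def)
  moreover have "((\<lambda>t. \<kappa> * \<theta> t) has_real_derivative \<kappa> * v) (at t)"
    using DERIV_cmult[OF \<theta>'[OF t], of \<kappa>] by (simp add: u_def v_def)
  moreover have "(s has_real_derivative slope u \<epsilon> (\<theta> t) (s t) * v) (at t)" using s'[OF t] by (simp add: u_def v_def)
  ultimately have "((\<lambda>t. s t - (\<sigma> (\<theta> t) - \<kappa> * \<theta> t)) has_real_derivative
      slope u \<epsilon> (\<theta> t) (s t) * v - (slope u \<epsilon> (\<theta> t) (\<sigma> (\<theta> t)) * v - \<kappa> * v)) (at t)"
    by (intro DERIV_diff)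
  from DERIV_cmult[OF this, of \<kappa>]
  have der: "((\<lambda>t. \<kappa> * (s t - \<beta> (\<theta> t))) has_real_derivative v * (\<kappa> * \<kappa> + \<kappa> * \<Delta>)) (at t)"
    by (simp add: \<beta>_def \<Delta>_def algebra_simps)
  have sI4: "s t \<in> {a - 4 * \<rho>..b + 4 * \<rho>}" using sI[OF tI] rho by auto
  have v: "v > 0" using speed_bounds(1)[OF sI4, of u "\<theta> t"] omega_pos by (simp add: v_def)
  have \<sigma>I: "\<sigma> (\<theta> t) \<in> {a - 3 * \<rho>..b + 3 * \<rho>}" using \<sigma>(4)[OF \<theta>I[OF tI]] s0 rho by auto
  have L0: "0 \<le> \<bar>\<epsilon>\<bar> * K / \<rho>" using K_pos rho by simp
  have "\<bar>\<Delta>\<bar> \<le> \<bar>\<epsilon>\<bar> * K / \<rho> * \<bar>s t - \<sigma> (\<theta> t)\<bar>"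
    unfolding \<Delta>_def by (rule real_slope_lipschitz[OF sI[OF tI] \<sigma>I])
  also have "\<dots> \<le> \<bar>\<epsilon>\<bar> * K / \<rho> * (\<bar>s t - \<beta> (\<theta> t)\<bar> + 2 * pi * \<bar>\<kappa>\<bar>)"
  proof (intro mult_left_mono L0)
    show "\<bar>s t - \<sigma> (\<theta> t)\<bar> \<le> \<bar>s t - \<beta> (\<theta> t)\<bar> + 2 * pi * \<bar>\<kappa>\<bar>"
      using \<kappa>_mult_bound[OF \<theta>I[OF tI]] unfolding \<beta>_def by linarith
  qed
  also have "\<dots> = \<bar>\<epsilon>\<bar> * K / \<rho> * \<bar>s t - \<beta> (\<theta> t)\<bar> + (8 * pi * (\<bar>\<epsilon>\<bar> * K)) / \<rho> * \<bar>\<kappa>\<bar> / 4"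
    by (simp add: distrib_left mult_ac)
  also have "\<dots> \<le> \<bar>\<kappa>\<bar> / 4 + 1 * \<bar>\<kappa>\<bar> / 4"
  proof (intro add_mono near[OF tI] divide_right_mono mult_right_mono)
    show "8 * pi * (\<bar>\<epsilon>\<bar> * K) / \<rho> \<le> 1" using eps_bound_slope rho by (simp add: pos_divide_le_eq)
  qed auto
  finally have "\<bar>\<Delta>\<bar> \<le> \<bar>\<kappa>\<bar> / 2" by simp
  then have "\<bar>\<kappa>\<bar> * \<bar>\<Delta>\<bar> \<le> \<bar>\<kappa>\<bar> * (\<bar>\<kappa>\<bar> / 2)" by (intro mult_left_mono) auto
  then have "\<bar>\<kappa> * \<Delta>\<bar> \<le> \<bar>\<kappa>\<bar> * \<bar>\<kappa>\<bar> / 2" by (simp add: abs_mult)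
  then have "- (\<kappa> * \<Delta>) \<le> \<kappa> * \<kappa> / 2" unfolding abs_mult_self_eq by linarith
  moreover have "\<kappa> * \<kappa> > 0" using \<kappa> by (cases "\<kappa> > 0") (auto simp: zero_less_mult_iff)
  ultimately have "\<kappa> * \<kappa> + \<kappa> * \<Delta> > 0" by linarith
  then show "\<exists>v>0. ((\<lambda>t. \<kappa> * (s t - \<beta> (\<theta> t))) has_real_derivative v) (at t)"
    using der v by (intro exI conjI) auto
qed

text \<open>The lift starts at an angle in \<open>{0..2 * pi}\<close> and has to stay there, since \<open>\<beta>\<close> is used on this interval only.
Therefore the two directions of time are treated separately, and an angle with room in the direction
considered is chosen among the representatives 0 and \<open>2 pi\<close>.\<close>

lemma gate_crossing_local:
  assumes sol: "solution_on \<eta> X T \<gamma>" and \<kappa>: "\<kappa> \<noteq> 0" and t12: "0 \<le> t1" "t1 \<le> t2" "t2 \<le> T"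
    and ann: "\<And>t. t \<in> {t1..t2} \<Longrightarrow> \<gamma> t \<in> annular"
    and \<theta>0: "\<theta>\<^sub>0 \<in> {0..2 * pi}" "\<gamma> t0 = pt \<theta>\<^sub>0 (\<beta> \<theta>\<^sub>0)"
    and side: "t0 = t1 \<and> \<theta>\<^sub>0 < 2 * pi \<or> t0 = t2 \<and> \<theta>\<^sub>0 > 0"
  shows "\<exists>\<delta>>0. \<forall>t\<in>{t1..t2}. \<bar>t - t0\<bar> < \<delta> \<and> t \<noteq> t0 \<longrightarrow>
    (\<exists>\<theta>\<in>{0..2 * pi}. \<exists>s\<in>{a - 3 * \<rho>..b + 3 * \<rho>}. \<gamma> t = pt \<theta> s \<and> (t - t0) * (\<kappa> * (s - \<beta> \<theta>)) > 0)"
proof -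
  have t0: "t0 \<in> {t1..t2}" using side t12 by auto
  have b0: "0 < \<beta> \<theta>\<^sub>0" "\<beta> \<theta>\<^sub>0 < 1" using \<beta>_range[OF \<theta>0(1)] rho ab by auto
  have n0: "norm (\<zeta> (\<gamma> t0)) = \<beta> \<theta>\<^sub>0" unfolding \<theta>0(2) using b0 by (simp add: norm_\<zeta>_pt)
  have start: "\<zeta> (\<gamma> t0) = of_real (norm (\<zeta> (\<gamma> t0))) * cis \<theta>\<^sub>0"
    unfolding n0 unfolding \<theta>0(2) using b0 by (simp add: \<zeta>_pt)
  define s where "s t = norm (\<zeta> (\<gamma> t))" for t
  obtain \<theta> S where \<theta>: "continuous_on {t1..t2} \<theta>" "\<theta> t0 = \<theta>\<^sub>0" "continuous_on {t1..t2} s"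
    "\<And>t. t \<in> {t1..t2} \<Longrightarrow> \<gamma> t = pt (\<theta> t) (s t)"
    "\<And>t t'. t1 \<le> t \<Longrightarrow> t < t' \<Longrightarrow> t' \<le> t2 \<Longrightarrow> \<theta> t < \<theta> t'"
    "finite S"
    "\<And>t. t \<in> {t1<..<t2} - S \<Longrightarrow> sin (\<theta> t) \<noteq> 0 \<and> cos (\<theta> t) \<noteq> 0"
    "\<And>t. t \<in> {t1<..<t2} - S \<Longrightarrow> (\<theta> has_real_derivative speed (cos (\<theta> t) > 0) (\<theta> t) (s t)) (at t)"
    "\<And>t. t \<in> {t1<..<t2} - S \<Longrightarrow> (s has_real_derivative
          slope (cos (\<theta> t) > 0) \<epsilon> (\<theta> t) (s t) * speed (cos (\<theta> t) > 0) (\<theta> t) (s t)) (at t)"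
  proof (rule polar_lift[OF sol t12 ann t0 start], goal_cases)
    case (1 t)
    then show ?case by simp
  next
    case (2 \<theta> S)
    show ?case by (rule 2(1)[OF 2(2-10)[folded s_def]])
  qed
  have lim\<theta>: "(\<theta> \<longlongrightarrow> \<theta>\<^sub>0) (at t0 within {t1..t2})" and lims: "(s \<longlongrightarrow> \<beta> \<theta>\<^sub>0) (at t0 within {t1..t2})"
    using \<theta>(1,3) t0 n0 \<theta>(2) s_def[of t0] unfolding continuous_on_def by metis+
  have in\<theta>: "\<forall>\<^sub>F t in at t0 within {t1..t2}. \<theta> t \<in> {0..2 * pi}"
    using side
  proof
    assume sd: "t0 = t1 \<and> \<theta>\<^sub>0 < 2 * pi"
    have "\<forall>\<^sub>F t in at t0 within {t1..t2}. \<theta> t < 2 * pi" using sd by (intro order_tendstoD(2)[OF lim\<theta>]) auto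
    moreover have "\<forall>\<^sub>F t in at t0 within {t1..t2}. t \<in> {t1..t2} \<and> t \<noteq> t0" by (simp add: eventually_at_filter)
    ultimately show ?thesis
    proof eventually_elim
      case (elim t)
      then have "\<theta> t0 < \<theta> t" using \<theta>(5)[of t0 t] sd by auto
      then show ?case using elim \<theta>(2) \<theta>0(1) by auto
    qed
  next
    assume sd: "t0 = t2 \<and> \<theta>\<^sub>0 > 0"
    have "\<forall>\<^sub>F t in at t0 within {t1..t2}. \<theta> t > 0" using sd by (intro order_tendstoD(1)[OF lim\<theta>]) auto
    moreover have "\<forall>\<^sub>F t in at t0 within {t1..t2}. t \<in> {t1..t2} \<and> t \<noteq> t0" by (simp add: eventually_at_filter)
    ultimately show ?thesis
    proof eventually_elim
      case (elim t)
      then have "\<theta> t < \<theta> t0" using \<theta>(5)[of t t0] sd by auto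
      then show ?case using elim \<theta>(2) \<theta>0(1) by auto
    qed
  qed
  have lim\<beta>: "((\<lambda>t. \<beta> (\<theta> t)) \<longlongrightarrow> \<beta> \<theta>\<^sub>0) (at t0 within {t1..t2})"
    by (rule continuous_on_tendsto_compose[OF continuous_on_\<beta> lim\<theta> \<theta>0(1) in\<theta>])
  have "((\<lambda>t. \<bar>\<epsilon>\<bar> * K / \<rho> * \<bar>s t - \<beta> (\<theta> t)\<bar>) \<longlongrightarrow> \<bar>\<epsilon>\<bar> * K / \<rho> * \<bar>\<beta> \<theta>\<^sub>0 - \<beta> \<theta>\<^sub>0\<bar>) (at t0 within {t1..t2})"
    by (intro tendsto_intros lims lim\<beta>)
  then have "\<forall>\<^sub>F t in at t0 within {t1..t2}. \<bar>\<epsilon>\<bar> * K / \<rho> * \<bar>s t - \<beta> (\<theta> t)\<bar> < \<bar>\<kappa>\<bar> / 4"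
    using \<kappa> by (intro order_tendstoD(2)) auto
  with in\<theta> have "\<forall>\<^sub>F t in at t0 within {t1..t2}. \<theta> t \<in> {0..2 * pi} \<and> \<bar>\<epsilon>\<bar> * K / \<rho> * \<bar>s t - \<beta> (\<theta> t)\<bar> \<le> \<bar>\<kappa>\<bar> / 4"
    by eventually_elim auto
  then obtain \<delta> where \<delta>: "\<delta> > 0" "\<And>t. t \<in> {t1..t2} \<Longrightarrow> t \<noteq> t0 \<Longrightarrow> \<bar>t - t0\<bar> < \<delta> \<Longrightarrow>
      \<theta> t \<in> {0..2 * pi} \<and> \<bar>\<epsilon>\<bar> * K / \<rho> * \<bar>s t - \<beta> (\<theta> t)\<bar> \<le> \<bar>\<kappa>\<bar> / 4"
    unfolding eventually_at by (auto simp: dist_real_def)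
  have s0eq: "s t0 = \<beta> (\<theta> t0)" using n0 \<theta>(2) by (simp add: s_def)
  have ok: "\<theta> t \<in> {0..2 * pi}" "\<bar>\<epsilon>\<bar> * K / \<rho> * \<bar>s t - \<beta> (\<theta> t)\<bar> \<le> \<bar>\<kappa>\<bar> / 4"
    if "t \<in> {t1..t2}" "\<bar>t - t0\<bar> < \<delta>" for t
    using \<delta>(2)[of t] that \<theta>(2) \<theta>0(1) s0eq by (cases "t = t0"; auto)+
  have sI: "s t \<in> {a - 3 * \<rho>..b + 3 * \<rho>}" if "t \<in> {t1..t2}" for t
    using ann[OF that] by (simp add: annular_def s_def)
  have inc: "\<kappa> * (s u - \<beta> (\<theta> u)) < \<kappa> * (s v - \<beta> (\<theta> v))"
    if "u < v" "u \<in> {t1..t2}" "v \<in> {t1..t2}" "\<bar>u - t0\<bar> < \<delta>" "\<bar>v - t0\<bar> < \<delta>" for u v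
  proof (rule barrier_increment[OF \<kappa> that(1) \<theta>(6)])
    fix t assume "t \<in> {u..v}"
    then have "t \<in> {t1..t2}" "\<bar>t - t0\<bar> < \<delta>" using that by auto
    then show "\<theta> t \<in> {0..2 * pi}" "\<bar>\<epsilon>\<bar> * K / \<rho> * \<bar>s t - \<beta> (\<theta> t)\<bar> \<le> \<bar>\<kappa>\<bar> / 4" "s t \<in> {a - 3 * \<rho>..b + 3 * \<rho>}"
      using ok sI by auto
  qed (use that in \<open>auto intro!: \<theta> continuous_on_subset[OF \<theta>(1)] continuous_on_subset[OF \<theta>(3)] dest: \<theta>(7)\<close>)
  show ?thesis
  proof (intro exI[of _ \<delta>] conjI ballI impI \<delta>(1))
    fix t assume t: "t \<in> {t1..t2}" and d: "\<bar>t - t0\<bar> < \<delta> \<and> t \<noteq> t0"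
    have "(t - t0) * (\<kappa> * (s t - \<beta> (\<theta> t))) > 0"
    proof (cases "t > t0")
      case True
      then show ?thesis using inc[of t0 t] t t0 d \<delta>(1) s0eq by simp
    next
      case False
      then show ?thesis using inc[of t t0] t t0 d \<delta>(1) s0eq by (intro mult_neg_neg) auto
    qed
    then show "\<exists>\<theta>\<in>{0..2 * pi}. \<exists>s\<in>{a - 3 * \<rho>..b + 3 * \<rho>}. \<gamma> t = pt \<theta> s \<and> (t - t0) * (\<kappa> * (s - \<beta> \<theta>)) > 0"
      using ok(1)[OF t] d sI[OF t] \<theta>(4)[OF t] by blast
  qed
qed

lemma polar_inject:
  assumes "0 \<le> s" "s < 1" "0 < s'" "s' < 1" "pt \<theta> s = pt \<theta>' s'"
  shows "s = s'" "cis \<theta> = cis \<theta>'"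
proof -
  show "s = s'" using norm_\<zeta>_pt[of s \<theta>] norm_\<zeta>_pt[of s' \<theta>'] assms by simp
  then show "cis \<theta> = cis \<theta>'" using \<zeta>_pt[of s \<theta>] \<zeta>_pt[of s' \<theta>'] assms by simp
qed

lemma polar_point:
  assumes "snd p > 0"
  obtains \<theta> where "\<theta> \<in> {0..2 * pi}" "p = pt \<theta> (norm (\<zeta> p))"
proof
  show "Arg2pi (\<zeta> p) \<in> {0..2 * pi}" using Arg2pi_ge_0[of "\<zeta> p"] Arg2pi_lt_2pi[of "\<zeta> p"] by auto
  show "p = pt (Arg2pi (\<zeta> p)) (norm (\<zeta> p))"
    by (rule pt_\<zeta>[OF assms]) (use Arg2pi_eq[of "\<zeta> p"] in \<open>simp add: cis_conv_exp mult_ac\<close>)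
qed

text \<open>The two sides of the curve are defined as complements of images of compact sets, from which openness
follows without any discussion of the argument function at its cut.\<close>

definition inside :: "plane set" where
  "inside = (\<lambda>(\<theta>, s). pt \<theta> s) ` {(\<theta>, s). \<theta> \<in> {0..2 * pi} \<and> 0 \<le> s \<and> s \<le> \<beta> \<theta>}"

definition beyond :: "plane set" where
  "beyond = (\<lambda>(\<theta>, s). pt \<theta> s) ` {(\<theta>, s). \<theta> \<in> {0..2 * pi} \<and> \<beta> \<theta> \<le> s \<and> s \<le> 1 - \<rho>}"

definition outer_side :: "plane set" where "outer_side = - inside"

definition inner_side :: "plane set" where "inner_side = {p. snd p > 0 \<and> norm (\<zeta> p) < 1 - \<rho>} - beyond"

lemma compact_image_pt:
  assumes "closed R" "R \<subseteq> {0..2 * pi} \<times> {0..1 - \<rho>}"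
  shows "compact ((\<lambda>(\<theta>, s). pt \<theta> s) ` R)"
proof (rule compact_continuous_image)
  have "compact (({0..2 * pi} \<times> {0..1 - \<rho>}) \<inter> R)"
    using assms(1) by (intro compact_Int_closed compact_Times compact_Icc)
  moreover have "({0..2 * pi} \<times> {0..1 - \<rho>}) \<inter> R = R" using assms(2) by blast
  ultimately show "compact R" by simp
  have "1 - s * cos \<theta> \<noteq> 0" if "(\<theta>, s) \<in> R" for \<theta> s
  proof -
    have "0 \<le> s" "s < 1" using assms(2) that rho by auto
    then show ?thesis using one_minus_mult_cos_pos[of s \<theta>] by simp
  qed
  then show "continuous_on R (\<lambda>(\<theta>, s). pt \<theta> s)"
    unfolding pt_def case_prod_unfold by (intro continuous_intros) auto
qed

lemma \<beta>_pos: "\<theta> \<in> {0..2 * pi} \<Longrightarrow> 0 < \<beta> \<theta>" and \<beta>_less: "\<theta> \<in> {0..2 * pi} \<Longrightarrow> \<beta> \<theta> < 1 - \<rho>"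
  using \<beta>_range[of \<theta>] rho ab by auto

lemma below_\<beta>: "0 \<le> \<theta> \<Longrightarrow> \<theta> \<le> 2 * pi \<Longrightarrow> s \<le> \<beta> \<theta> \<Longrightarrow> s \<le> 1 - \<rho>"
  and above_\<beta>: "0 \<le> \<theta> \<Longrightarrow> \<theta> \<le> 2 * pi \<Longrightarrow> \<beta> \<theta> \<le> s \<Longrightarrow> 0 \<le> s"
  using \<beta>_less[of \<theta>] \<beta>_pos[of \<theta>] by auto

lemma closed_graph_sides:
  "closed {(\<theta>, s). \<theta> \<in> {0..2 * pi} \<and> 0 \<le> s \<and> s \<le> \<beta> \<theta>}"
  "closed {(\<theta>, s). \<theta> \<in> {0..2 * pi} \<and> \<beta> \<theta> \<le> s \<and> s \<le> 1 - \<rho>}"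
proof -
  let ?A = "{0..2 * pi} \<times> {0..1 - \<rho>}"
  have c: "continuous_on ?A (\<lambda>p. \<beta> (fst p))" "continuous_on ?A snd" "closed ?A"
    by (auto intro!: continuous_on_compose2[OF continuous_on_\<beta>] continuous_intros closed_Times)
  have "closed {p \<in> ?A. snd p \<le> \<beta> (fst p)}" "closed {p \<in> ?A. \<beta> (fst p) \<le> snd p}"
    by (rule continuous_on_closed_Collect_le c)+
  moreover have "{p \<in> ?A. snd p \<le> \<beta> (fst p)} = {(\<theta>, s). \<theta> \<in> {0..2 * pi} \<and> 0 \<le> s \<and> s \<le> \<beta> \<theta>}"
    by (auto intro: below_\<beta>)
  moreover have "{p \<in> ?A. \<beta> (fst p) \<le> snd p} = {(\<theta>, s). \<theta> \<in> {0..2 * pi} \<and> \<beta> \<theta> \<le> s \<and> s \<le> 1 - \<rho>}"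
    by (auto intro: above_\<beta>)
  ultimately show "closed {(\<theta>, s). \<theta> \<in> {0..2 * pi} \<and> 0 \<le> s \<and> s \<le> \<beta> \<theta>}"
    "closed {(\<theta>, s). \<theta> \<in> {0..2 * pi} \<and> \<beta> \<theta> \<le> s \<and> s \<le> 1 - \<rho>}" by simp_all
qed

lemma open_outer_side: "open outer_side"
proof -
  have "compact inside"
    unfolding inside_def by (rule compact_image_pt[OF closed_graph_sides(1)]) (auto intro: below_\<beta>)
  then show ?thesis by (simp add: outer_side_def compact_imp_closed open_Compl)
qed

lemma open_inner_side: "open inner_side"
proof -
  have "compact beyond"
    unfolding beyond_def by (rule compact_image_pt[OF closed_graph_sides(2)]) (auto intro: above_\<beta>)
  moreover have "open {p. snd p > 0 \<and> norm (\<zeta> p) < 1 - \<rho>}"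
  proof -
    have "open {p :: plane. snd p > 0}" by (intro open_Collect_less continuous_intros)
    then have "open ({p. snd p > 0} \<inter> (\<lambda>p. norm (\<zeta> p)) -` {..<1 - \<rho>})"
      by (intro continuous_open_preimage continuous_on_norm continuous_on_\<zeta>) auto
    moreover have "{p. snd p > 0} \<inter> (\<lambda>p. norm (\<zeta> p)) -` {..<1 - \<rho>} = {p. snd p > 0 \<and> norm (\<zeta> p) < 1 - \<rho>}"
      by auto
    ultimately show ?thesis by simp
  qed
  ultimately show ?thesis unfolding inner_side_def by (intro open_Diff compact_imp_closed)
qed

lemma sides_disjoint: "outer_side \<inter> inner_side = {}"
proof -
  have "p \<in> inside" if p: "p \<in> inner_side" for p
  proof -
    have "snd p > 0" using p by (simp add: inner_side_def)
    then obtain \<theta> where \<theta>: "\<theta> \<in> {0..2 * pi}" "p = pt \<theta> (norm (\<zeta> p))" by (rule polar_point)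
    have "norm (\<zeta> p) \<le> \<beta> \<theta>"
    proof (rule ccontr)
      assume "\<not> norm (\<zeta> p) \<le> \<beta> \<theta>"
      then have "(\<theta>, norm (\<zeta> p)) \<in> {(\<theta>, s). \<theta> \<in> {0..2 * pi} \<and> \<beta> \<theta> \<le> s \<and> s \<le> 1 - \<rho>}"
        using \<theta>(1) p by (auto simp: inner_side_def)
      from imageI[OF this, of "\<lambda>(\<theta>, s). pt \<theta> s"] have "p \<in> beyond"
        using \<theta>(2) by (simp add: beyond_def)
      then show False using p by (simp add: inner_side_def)
    qed
    then have "(\<theta>, norm (\<zeta> p)) \<in> {(\<theta>, s). \<theta> \<in> {0..2 * pi} \<and> 0 \<le> s \<and> s \<le> \<beta> \<theta>}" using \<theta>(1) by auto
    from imageI[OF this, of "\<lambda>(\<theta>, s). pt \<theta> s"] show ?thesis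
      using \<theta>(2) by (simp add: inside_def)
  qed
  then show ?thesis by (auto simp: outer_side_def)
qed

text \<open>Such a point has a radius at most \<open>\<beta> \<theta>\<close> and at least \<open>\<beta> \<theta>'\<close> for angles \<open>\<theta>\<close>, \<open>\<theta>'\<close> that agree up to a turn.\<close>

lemma between_sides:
  assumes "p \<notin> outer_side \<union> inner_side"
  obtains \<theta> where "\<theta> \<in> {0..2 * pi}" "p = pt \<theta> (\<beta> \<theta>)"
proof -
  obtain \<theta> s where 1: "\<theta> \<in> {0..2 * pi}" "0 \<le> s" "s \<le> \<beta> \<theta>" "p = pt \<theta> s"
    using assms by (auto simp: outer_side_def inside_def)
  have s: "s < 1 - \<rho>" "s < 1" using 1 \<beta>_less[OF 1(1)] rho by auto
  have "snd p > 0" "norm (\<zeta> p) = s" using 1 s snd_pt_pos[of s \<theta>] norm_\<zeta>_pt[of s \<theta>] by auto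
  then have "p \<in> beyond" using assms s by (auto simp: inner_side_def)
  then obtain \<theta>' s' where 2: "\<theta>' \<in> {0..2 * pi}" "\<beta> \<theta>' \<le> s'" "s' \<le> 1 - \<rho>" "p = pt \<theta>' s'"
    by (auto simp: beyond_def)
  have s': "0 < s'" "s' < 1" using 2 \<beta>_pos[OF 2(1)] rho by auto
  have eq: "pt \<theta> s = pt \<theta>' s'" using 1(4) 2(4) by simp
  have "s = s'" "cis \<theta> = cis \<theta>'" by (rule polar_inject[OF 1(2) s(2) s' eq])+
  then have "\<beta> \<theta> = \<beta> \<theta>'" using \<beta>_cis_cong 1(1) 2(1) by blast
  then have "s = \<beta> \<theta>" using 1(3) 2(2) \<open>s = s'\<close> by simp
  then show thesis using that[OF 1(1)] 1(4) by simp
qed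

lemma mem_outer_side:
  assumes \<theta>: "\<theta> \<in> {0..2 * pi}" and s: "\<beta> \<theta> < s" "s < 1"
  shows "pt \<theta> s \<in> outer_side"
proof -
  have s0: "0 < s" using \<beta>_pos[OF \<theta>] s by simp
  have "pt \<theta> s \<noteq> pt \<theta>' s'" if "\<theta>' \<in> {0..2 * pi}" "0 \<le> s'" "s' \<le> \<beta> \<theta>'" for \<theta>' s'
  proof
    assume eq: "pt \<theta> s = pt \<theta>' s'"
    have s': "s' < 1" using that \<beta>_less[OF that(1)] rho by simp
    have "s' = s" "cis \<theta>' = cis \<theta>" by (rule polar_inject[OF that(2) s' s0 s(2) eq[symmetric]])+
    then show False using \<beta>_cis_cong[OF that(1) \<theta>] that(3) s(1) by simp
  qed
  then show ?thesis by (auto simp: outer_side_def inside_def)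
qed

lemma mem_inner_side:
  assumes \<theta>: "\<theta> \<in> {0..2 * pi}" and s: "0 \<le> s" "s < \<beta> \<theta>"
  shows "pt \<theta> s \<in> inner_side"
proof -
  have s1: "s < 1 - \<rho>" "s < 1" using \<beta>_less[OF \<theta>] s rho by simp_all
  have "pt \<theta> s \<noteq> pt \<theta>' s'" if "\<theta>' \<in> {0..2 * pi}" "\<beta> \<theta>' \<le> s'" "s' \<le> 1 - \<rho>" for \<theta>' s'
  proof
    assume eq: "pt \<theta> s = pt \<theta>' s'"
    have s': "0 < s'" "s' < 1" using that \<beta>_pos[OF that(1)] rho by simp_all
    have "s = s'" "cis \<theta> = cis \<theta>'" by (rule polar_inject[OF s(1) s1(2) s' eq])+
    then show False using \<beta>_cis_cong[OF \<theta> that(1)] that(2) s(2) by simp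
  qed
  then have "pt \<theta> s \<notin> beyond" by (auto simp: beyond_def)
  then show ?thesis using snd_pt_pos[of s \<theta>] norm_\<zeta>_pt[of s \<theta>] s s1 by (simp add: inner_side_def)
qed

text \<open>On the ray of angle 0 there is a choice between the representatives 0 and \<open>2 pi\<close>.\<close>

lemma \<beta>_graph_angle:
  assumes "p \<notin> outer_side \<union> inner_side"
  obtains \<theta> \<theta>' where "\<theta> \<in> {0..2 * pi}" "\<theta> < 2 * pi" "p = pt \<theta> (\<beta> \<theta>)"
    "\<theta>' \<in> {0..2 * pi}" "\<theta>' > 0" "p = pt \<theta>' (\<beta> \<theta>')"
proof -
  obtain \<theta> where \<theta>: "\<theta> \<in> {0..2 * pi}" "p = pt \<theta> (\<beta> \<theta>)" using between_sides[OF assms] .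
  have e: "pt 0 (\<beta> 0) = pt (2 * pi) (\<beta> (2 * pi))" by (simp add: \<beta>_ends pt_0 pt_2pi)
  consider "\<theta> = 0" | "\<theta> = 2 * pi" | "0 < \<theta>" "\<theta> < 2 * pi" using \<theta>(1) by fastforce
  then show thesis
  proof cases
    case 1
    then show thesis using that[of 0 "2 * pi"] \<theta> e by simp
  next
    case 2
    then show thesis using that[of 0 "2 * pi"] \<theta> e by simp
  qed (use that[of \<theta> \<theta>] \<theta> in auto)
qed

text \<open>The starting point lies on the curve \<open>s = \<beta> \<theta>\<close>, which for \<open>\<kappa> \<noteq> 0\<close> is a gate in the sense of
\<open>no_loop_through_gate\<close>. The argument only looks at the
solution near the curve.\<close>

lemma loop_through_section_fixed:
  assumes sol: "solution_on \<eta> X T \<gamma>" and T: "T > 0" and ends: "\<gamma> 0 = (0, ordinate s\<^sub>0)" "\<gamma> T = (0, ordinate s\<^sub>0)"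
  shows "poincare s\<^sub>0 = s\<^sub>0"
proof (rule ccontr)
  assume "poincare s\<^sub>0 \<noteq> s\<^sub>0"
  then have \<kappa>: "\<kappa> \<noteq> 0" by (simp add: \<kappa>_def)
  define P where "P = (if \<kappa> > 0 then outer_side else inner_side)"
  define N where "N = (if \<kappa> > 0 then inner_side else outer_side)"
  have PN: "open P" "open N" "P \<inter> N = {}" "P \<union> N = outer_side \<union> inner_side"
    using open_outer_side open_inner_side sides_disjoint by (auto simp: P_def N_def)
  have c\<gamma>: "continuous_on {0..T} \<gamma>" using sol by (simp add: solution_on_def)
  have start: "(0, ordinate s\<^sub>0) \<notin> outer_side \<union> inner_side"
  proof -
    have p: "(0, ordinate s\<^sub>0) = pt 0 (\<beta> 0)" by (simp add: \<beta>_ends pt_0)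
    have b0: "0 \<le> \<beta> 0" "\<beta> 0 \<le> 1 - \<rho>" using \<beta>_pos[of 0] \<beta>_less[of 0] by auto
    have "(0, ordinate s\<^sub>0) \<in> inside" "(0, ordinate s\<^sub>0) \<in> beyond"
      unfolding inside_def beyond_def p by (rule rev_image_eqI[of "(0, \<beta> 0)"]; use b0 in simp)+
    then show ?thesis by (simp add: outer_side_def inner_side_def)
  qed
  have side: "\<gamma> t' \<in> (if t' > t then P else N)"
    if "\<theta> \<in> {0..2 * pi}" "s \<in> {a - 3 * \<rho>..b + 3 * \<rho>}" "\<gamma> t' = pt \<theta> s" "(t' - t) * (\<kappa> * (s - \<beta> \<theta>)) > 0" for t t' \<theta> s
  proof -
    have s: "0 < s" "s < 1" using that(2) rho ab by auto
    have "\<beta> \<theta> < s \<Longrightarrow> pt \<theta> s \<in> outer_side" "s < \<beta> \<theta> \<Longrightarrow> pt \<theta> s \<in> inner_side" using mem_outer_side[OF that(1)] mem_inner_side[OF that(1)] s by auto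
    moreover have "if t' > t then \<kappa> > 0 \<and> \<beta> \<theta> < s \<or> \<kappa> < 0 \<and> s < \<beta> \<theta> else \<kappa> > 0 \<and> s < \<beta> \<theta> \<or> \<kappa> < 0 \<and> \<beta> \<theta> < s"
      using that(4) by (auto simp: zero_less_mult_iff mult_less_0_iff)
    ultimately show ?thesis unfolding that(3) by (auto simp: P_def N_def split: if_splits)
  qed
  show False
  proof (rule no_loop_through_gate[OF c\<gamma> T PN(1-3)])
    show "\<gamma> 0 \<notin> P \<union> N" "\<gamma> T \<notin> P \<union> N" using start by (simp_all add: PN(4) ends)
    fix t assume t: "t \<in> {0..T}" and off: "\<gamma> t \<notin> P \<union> N"
    then have "\<gamma> t \<notin> outer_side \<union> inner_side" by (simp add: PN(4))
    then obtain \<theta> \<theta>' where \<theta>: "\<theta> \<in> {0..2 * pi}" "\<theta> < 2 * pi" "\<gamma> t = pt \<theta> (\<beta> \<theta>)"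
      "\<theta>' \<in> {0..2 * pi}" "\<theta>' > 0" "\<gamma> t = pt \<theta>' (\<beta> \<theta>')"
      by (rule \<beta>_graph_angle)
    have bI: "\<beta> \<theta> \<in> {a - 2 * \<rho>..b + 2 * \<rho>}" by (rule \<beta>_range[OF \<theta>(1)])
    have "\<gamma> t \<in> open_annulus"
      unfolding \<theta>(3) open_annulus_def using bI rho ab snd_pt_pos[of "\<beta> \<theta>" \<theta>] norm_\<zeta>_pt[of "\<beta> \<theta>" \<theta>] by auto
    moreover have "(\<gamma> \<longlongrightarrow> \<gamma> t) (at t within {0..T})" using c\<gamma> t by (auto simp: continuous_on_def)
    ultimately have "\<forall>\<^sub>F t' in at t within {0..T}. \<gamma> t' \<in> open_annulus"
      by (intro topological_tendstoD[OF _ open_annulus])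
    then obtain r where r: "r > 0" "\<And>t'. t' \<in> {0..T} \<Longrightarrow> t' \<noteq> t \<Longrightarrow> \<bar>t' - t\<bar> < r \<Longrightarrow> \<gamma> t' \<in> open_annulus"
      unfolding eventually_at by (auto simp: dist_real_def)
    have ann: "\<gamma> t' \<in> annular" if "t' \<in> {0..T}" "\<bar>t' - t\<bar> < r" for t'
    proof -
      have "\<gamma> t' \<in> open_annulus" using r(2)[OF that(1)] that(2) \<open>\<gamma> t \<in> open_annulus\<close> by (cases "t' = t") auto
      then show ?thesis by (auto simp: open_annulus_def annular_def)
    qed
    define t1 where "t1 = max 0 (t - r / 2)"
    define t2 where "t2 = min T (t + r / 2)"
    have tt: "0 \<le> t1" "t1 \<le> t" "t \<le> t2" "t2 \<le> T" "0 \<le> t" "t \<le> T" using t r(1) by (auto simp: t1_def t2_def)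
    have inI: "t' \<in> {0..T} \<and> \<bar>t' - t\<bar> < r" if "t' \<in> {t1..t2}" for t'
      using that r(1) by (auto simp: t1_def t2_def)
    have ann': "\<gamma> t' \<in> annular" if "t' \<in> {t1..t2}" for t' using ann inI[OF that] by blast
    have "\<exists>\<delta>>0. \<forall>t'\<in>{t..t2}. \<bar>t' - t\<bar> < \<delta> \<and> t' \<noteq> t \<longrightarrow>
      (\<exists>\<theta>\<in>{0..2 * pi}. \<exists>s\<in>{a - 3 * \<rho>..b + 3 * \<rho>}. \<gamma> t' = pt \<theta> s \<and> (t' - t) * (\<kappa> * (s - \<beta> \<theta>)) > 0)"
      by (rule gate_crossing_local[OF sol \<kappa> tt(5,3,4) _ \<theta>(1,3)]) (use ann' \<theta>(2) tt in auto)
    then obtain d1 where d1: "d1 > 0" "\<And>t'. t' \<in> {t..t2} \<Longrightarrow> \<bar>t' - t\<bar> < d1 \<Longrightarrow> t' \<noteq> t \<Longrightarrow>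
      \<exists>\<theta>\<in>{0..2 * pi}. \<exists>s\<in>{a - 3 * \<rho>..b + 3 * \<rho>}. \<gamma> t' = pt \<theta> s \<and> (t' - t) * (\<kappa> * (s - \<beta> \<theta>)) > 0"
      by blast
    have "\<exists>\<delta>>0. \<forall>t'\<in>{t1..t}. \<bar>t' - t\<bar> < \<delta> \<and> t' \<noteq> t \<longrightarrow>
      (\<exists>\<theta>\<in>{0..2 * pi}. \<exists>s\<in>{a - 3 * \<rho>..b + 3 * \<rho>}. \<gamma> t' = pt \<theta> s \<and> (t' - t) * (\<kappa> * (s - \<beta> \<theta>)) > 0)"
      by (rule gate_crossing_local[OF sol \<kappa> tt(1,2,6) _ \<theta>(4,6)]) (use ann' \<theta>(5) tt in auto)
    then obtain d2 where d2: "d2 > 0" "\<And>t'. t' \<in> {t1..t} \<Longrightarrow> \<bar>t' - t\<bar> < d2 \<Longrightarrow> t' \<noteq> t \<Longrightarrow>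
      \<exists>\<theta>\<in>{0..2 * pi}. \<exists>s\<in>{a - 3 * \<rho>..b + 3 * \<rho>}. \<gamma> t' = pt \<theta> s \<and> (t' - t) * (\<kappa> * (s - \<beta> \<theta>)) > 0"
      by blast
    define \<delta> where "\<delta> = min (r / 2) (min d1 d2)"
    have "\<gamma> t' \<in> P" if "t' \<in> {0..T}" "t < t' \<and> t' < t + \<delta>" for t'
    proof -
      have "t' \<in> {t..t2}" "\<bar>t' - t\<bar> < d1" "t' \<noteq> t" using that by (auto simp: \<delta>_def t2_def)
      from d1(2)[OF this] show ?thesis using side[of _ _ t' t] that by fastforce
    qed
    moreover have "\<gamma> t' \<in> N" if "t' \<in> {0..T}" "t - \<delta> < t' \<and> t' < t" for t'
    proof -
      have "t' \<in> {t1..t}" "\<bar>t' - t\<bar> < d2" "t' \<noteq> t" using that by (auto simp: \<delta>_def t1_def)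
      from d2(2)[OF this] show ?thesis using side[of _ _ t' t] that by fastforce
    qed
    moreover have "\<delta> > 0" using r(1) d1(1) d2(1) by (simp add: \<delta>_def)
    ultimately show "\<exists>\<delta>>0. (\<forall>t'\<in>{0..T}. t < t' \<and> t' < t + \<delta> \<longrightarrow> \<gamma> t' \<in> P) \<and> (\<forall>t'\<in>{0..T}. t - \<delta> < t' \<and> t' < t \<longrightarrow> \<gamma> t' \<in> N)"
      by blast
  qed
qed

text \<open>Knowing that the polar orbit closes up, injectivity of the closed orbit on its period shows that its period
is exactly one turn.\<close>

lemma closed_orbit_is_graph:
  assumes C: "closed_orbit \<eta> X C" and mem: "(0, ordinate s\<^sub>0) \<in> C"
  shows "poincare s\<^sub>0 = s\<^sub>0" "C = (\<lambda>\<theta>. pt \<theta> (\<sigma> \<theta>)) ` {0..2 * pi}"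
proof -
  obtain T \<gamma> where T: "T > 0" and sol: "solution_on \<eta> X T \<gamma>"
    and ends: "\<gamma> 0 = (0, ordinate s\<^sub>0)" "\<gamma> T = (0, ordinate s\<^sub>0)"
    and inj: "inj_on \<gamma> {0..<T}" and img: "C = \<gamma> ` {0..T}"
    using closed_orbit_starting_at[OF C mem] .
  show fixed: "poincare s\<^sub>0 = s\<^sub>0" by (rule loop_through_section_fixed[OF sol T ends])
  have s0': "a - \<rho> < s\<^sub>0" "s\<^sub>0 < b + \<rho>" using s0 rho by auto
  obtain t1 \<theta> where f: "0 < t1" "t1 \<le> T" "continuous_on {0..t1} \<theta>" "\<theta> 0 = 0"
    "\<And>t t'. 0 \<le> t \<Longrightarrow> t < t' \<Longrightarrow> t' \<le> t1 \<Longrightarrow> \<theta> t < \<theta> t'"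
    "\<And>t. t \<in> {0..t1} \<Longrightarrow> \<gamma> t = pt (\<theta> t) (\<sigma> (\<theta> t))"
    "\<theta> t1 = 2 * pi \<or> t1 = T \<and> \<theta> t1 < 2 * pi"
  proof (rule orbit_follow[OF orb s0' sol T ends(1)], goal_cases)
    case (1 t1 \<theta>)
    show ?case by (rule 1(1)[OF 1(2-8)])
  qed
  have \<sigma>I: "0 < \<sigma> \<theta>" "\<sigma> \<theta> < 1" if "\<theta> \<in> {0..2 * pi}" for \<theta>
    using \<sigma>(4)[OF that] s0 rho ab by linarith+
  have pos: "\<theta> t1 > 0" using f(5)[of 0 t1] f(1,4) by simp
  have \<gamma>t1: "\<gamma> t1 = pt (\<theta> t1) (\<sigma> (\<theta> t1))" using f(6)[of t1] f(1) by simp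
  have top: "(0, ordinate s\<^sub>0) \<in> {0} \<times> {\<eta><..}"
    using s0 ab eta_pos by (simp add: ordinate_def pos_less_divide_eq)
  have full: "\<theta> t1 = 2 * pi"
  proof (rule ccontr)
    assume "\<theta> t1 \<noteq> 2 * pi"
    then have "t1 = T" "\<theta> t1 < 2 * pi" using f(7) by auto
    then have "pt (\<theta> t1) (\<sigma> (\<theta> t1)) \<notin> {0} \<times> {\<eta><..}"
      using \<sigma>I[of "\<theta> t1"] pos by (intro section_pt) auto
    moreover have "pt (\<theta> t1) (\<sigma> (\<theta> t1)) = (0, ordinate s\<^sub>0)" using \<gamma>t1 ends(2) \<open>t1 = T\<close> by metis
    ultimately show False using top by simp
  qed
  have "\<gamma> t1 = \<gamma> 0" unfolding \<gamma>t1 full ends by (simp add: \<sigma> fixed pt_2pi)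
  then have t1T: "t1 = T" using inj_onD[OF inj, of t1 0] f(1,2) T by (cases "t1 = T") auto
  have "\<theta> ` {0..T} = {0..2 * pi}"
  proof
    show "\<theta> ` {0..T} \<subseteq> {0..2 * pi}"
    proof clarify
      fix t assume "t \<in> {0..T}"
      then show "\<theta> t \<in> {0..2 * pi}"
        using f(5)[of 0 t] f(5)[of t t1] f(4) full t1T by (cases "t = 0"; cases "t = T") auto
    qed
    show "{0..2 * pi} \<subseteq> \<theta> ` {0..T}"
      using IVT'[of \<theta> 0 _ T] f(3,4) full t1T T by fastforce
  qed
  then have "(\<lambda>\<theta>. pt \<theta> (\<sigma> \<theta>)) ` {0..2 * pi} = (\<lambda>\<theta>. pt \<theta> (\<sigma> \<theta>)) ` \<theta> ` {0..T}" by (rule arg_cong[OF sym])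
  also have "\<dots> = (\<lambda>t. pt (\<theta> t) (\<sigma> (\<theta> t))) ` {0..T}" by (rule image_image)
  also have "\<dots> = C" unfolding img using f(6) t1T by (intro image_cong) auto
  finally show "C = (\<lambda>\<theta>. pt \<theta> (\<sigma> \<theta>)) ` {0..2 * pi}" ..
qed

lemma closed_orbit_section:
  assumes C: "closed_orbit \<eta> X C" and mem: "(0, ordinate s\<^sub>0) \<in> C" and y: "y > \<eta>" "(0, y) \<in> C"
  shows "y = ordinate s\<^sub>0"
proof -
  obtain \<theta> where \<theta>: "\<theta> \<in> {0..2 * pi}" "(0, y) = pt \<theta> (\<sigma> \<theta>)"
    using y(2) closed_orbit_is_graph(2)[OF C mem] by auto
  have "0 < \<sigma> \<theta>" "\<sigma> \<theta> < 1" using \<sigma>(4)[OF \<theta>(1)] s0 rho ab by linarith+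
  then have "\<theta> = 0 \<or> \<theta> = 2 * pi"
    using section_pt[of "\<sigma> \<theta>" \<theta>, folded \<theta>(2)] \<theta>(1) y(1) by (cases "\<theta> = 0"; cases "\<theta> = 2 * pi") auto
  then show ?thesis
    using \<theta>(2) closed_orbit_is_graph(1)[OF C mem] by (auto simp: pt_0 pt_2pi \<sigma>)
qed

end

context perturbed_system begin

lemma closed_orbit_through:
  assumes s0: "a \<le> s\<^sub>0" "s\<^sub>0 \<le> b" and C: "closed_orbit \<eta> X C" "(0, ordinate s\<^sub>0) \<in> C"
  shows "poincare s\<^sub>0 = s\<^sub>0"
    "cycle_multiplicity \<eta> X C = zero_multiplicity (displacement \<eta> X) (ordinate s\<^sub>0)"
    "closed_orbit \<eta> X C' \<Longrightarrow> (0, ordinate s\<^sub>0) \<in> C' \<Longrightarrow> C' = C"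
proof -
  have s0': "a - \<rho> < s\<^sub>0" "s\<^sub>0 < b + \<rho>" using s0 rho by auto
  obtain \<sigma> \<tau> where orb: "orbit s\<^sub>0 \<sigma> \<tau>" using orbit_exists[OF s0'] .
  interpret barrier \<eta> n c d c' d' a b \<epsilon> f g s\<^sub>0 \<sigma> \<tau>
    by unfold_locales (use orb s0 in auto)
  show "poincare s\<^sub>0 = s\<^sub>0" by (rule closed_orbit_is_graph(1)[OF C])
  have "(THE y. y > \<eta> \<and> (0, y) \<in> C) = ordinate s\<^sub>0"
  proof (rule the_equality)
    show "ordinate s\<^sub>0 > \<eta> \<and> (0, ordinate s\<^sub>0) \<in> C"
      using s0 ab eta_pos C(2) by (simp add: ordinate_def pos_less_divide_eq)
  qed (use closed_orbit_section[OF C] in blast)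
  then show "cycle_multiplicity \<eta> X C = zero_multiplicity (displacement \<eta> X) (ordinate s\<^sub>0)"
    by (simp add: cycle_multiplicity_def)
  show "C' = C" if "closed_orbit \<eta> X C'" "(0, ordinate s\<^sub>0) \<in> C'"
    using closed_orbit_is_graph(2)[OF C] closed_orbit_is_graph(2)[OF that] by simp
qed

end

section \<open>Stability of the zero count under perturbation\<close>

lemma tower_Re_holomorphic:
  assumes "f holomorphic_on U" "open U"
  shows "tower (\<lambda>j t. Re ((deriv ^^ j) f (of_real t))) {t. of_real t \<in> U}"
  unfolding tower_def
proof (intro allI ballI)
  fix j and t :: real
  assume t: "t \<in> {t. of_real t \<in> U}"
  have "(deriv ^^ j) f holomorphic_on U" by (rule holomorphic_higher_deriv[OF assms])
  then have "((deriv ^^ j) f has_field_derivative (deriv ^^ Suc j) f (of_real t)) (at (of_real t))"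
    using holomorphic_derivI[OF _ assms(2), of "(deriv ^^ j) f" "of_real t"] t by simp
  then have "((\<lambda>t. (deriv ^^ j) f (of_real t)) has_vector_derivative (deriv ^^ Suc j) f (of_real t)) (at t)"
    by (rule has_vector_derivative_real_field)
  from bounded_linear.has_vector_derivative[OF bounded_linear_Re this]
  show "((\<lambda>t. Re ((deriv ^^ j) f (of_real t))) has_real_derivative Re ((deriv ^^ Suc j) f (of_real t))) (at t)"
    by (simp add: has_real_derivative_iff_has_vector_derivative)
qed

lemma open_real_trace:
  assumes "open U"
  shows "open {t. complex_of_real t \<in> U}"
proof -
  have "continuous_on UNIV complex_of_real" by (intro continuous_intros)
  with assms have "open (complex_of_real -` U)" by (rule open_vimage)
  then show ?thesis by (simp add: vimage_def)
qed

text \<open>If the derivative of order \<open>m\<close> is the first that does not vanish at \<open>x\<close>, then by Cauchy's estimate it stays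
away from zero near \<open>x\<close> under small perturbations, and Rolle's theorem leaves at most \<open>m\<close> zeros there.\<close>

lemma zeros_le_near_point:
  fixes F :: "complex \<Rightarrow> complex" and G :: "real \<Rightarrow> complex \<Rightarrow> complex"
  assumes U: "open U" "of_real x \<in> U" and F: "F holomorphic_on U"
    and G: "\<And>\<epsilon>. 0 < \<bar>\<epsilon>\<bar> \<Longrightarrow> \<bar>\<epsilon>\<bar> < e\<^sub>1 \<Longrightarrow> G \<epsilon> holomorphic_on U"
    and near: "\<And>\<epsilon> z. 0 < \<bar>\<epsilon>\<bar> \<Longrightarrow> \<bar>\<epsilon>\<bar> < e\<^sub>1 \<Longrightarrow> z \<in> U \<Longrightarrow> norm (G \<epsilon> z - F z) \<le> C * \<bar>\<epsilon>\<bar>"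
    and C: "C > 0" "e\<^sub>1 > 0" and fin: "\<not> vanishes_to (\<lambda>t. Re (F (of_real t))) x M"
  obtains r e m where "r > 0" "e > 0" "vanishes_to (\<lambda>t. Re (F (of_real t))) x m"
    "\<And>\<epsilon>. 0 < \<bar>\<epsilon>\<bar> \<Longrightarrow> \<bar>\<epsilon>\<bar> < e \<Longrightarrow> zeros_le (\<lambda>t. Re (G \<epsilon> (of_real t))) {x - r<..<x + r} m"
proof -
  define D where "D j t = Re ((deriv ^^ j) F (of_real t))" for j t
  let ?I = "{t. complex_of_real t \<in> U}"
  have tow: "tower D ?I" unfolding D_def [abs_def] by (rule tower_Re_holomorphic[OF F U(1)])
  have opI: "open ?I" by (rule open_real_trace[OF U(1)])
  have xI: "x \<in> ?I" using U(2) by simp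
  have D0: "D 0 = (\<lambda>t. Re (F (of_real t)))" by (simp add: D_def fun_eq_iff)
  have ex: "\<exists>k. D k x \<noteq> 0"
    using tower_vanishes_to[OF tow opI xI, of M] fin unfolding D0 by blast
  define m where "m = (LEAST k. D k x \<noteq> 0)"
  have m1: "D m x \<noteq> 0" unfolding m_def by (rule LeastI_ex[OF ex])
  have m2: "\<forall>j<m. D j x = 0" unfolding m_def using not_less_Least[of _ "\<lambda>k. D k x \<noteq> 0"] by blast
  note m = m1 m2
  have van: "vanishes_to (D 0) x m" by (rule tower_vanishes_to[OF tow opI xI m(2)])
  obtain r1 where r1: "r1 > 0" "cball (of_real x) r1 \<subseteq> U" using U open_contains_cball by blast
  have "isCont (D m) x" using tow xI by (auto simp: tower_def intro: DERIV_isCont)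
  then have "((\<lambda>t. \<bar>D m t\<bar>) \<longlongrightarrow> \<bar>D m x\<bar>) (at x)" unfolding isCont_def by (rule tendsto_rabs)
  then have "\<forall>\<^sub>F t in at x. \<bar>D m t\<bar> > \<bar>D m x\<bar> / 2" using m(1) by (intro order_tendstoD(1)) auto
  then obtain r2 where r2: "r2 > 0" "\<And>t. t \<noteq> x \<Longrightarrow> \<bar>t - x\<bar> < r2 \<Longrightarrow> \<bar>D m t\<bar> > \<bar>D m x\<bar> / 2"
    unfolding eventually_at by (auto simp: dist_real_def)
  define r where "r = min (r1 / 2) r2"
  have r: "r > 0" "2 * r \<le> r1" "r \<le> r2" using r1(1) r2(1) by (auto simp: r_def)
  define e where "e = min e\<^sub>1 (\<bar>D m x\<bar> * r ^ m / (2 * fact m * C))"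
  have e: "e > 0" using C m(1) r(1) by (simp add: e_def)
  have zeros: "zeros_le (\<lambda>t. Re (G \<epsilon> (of_real t))) {x - r<..<x + r} m" if \<epsilon>: "0 < \<bar>\<epsilon>\<bar>" "\<bar>\<epsilon>\<bar> < e" for \<epsilon>
  proof -
    have e1: "\<bar>\<epsilon>\<bar> < e\<^sub>1" using \<epsilon>(2) by (simp add: e_def)
    define E where "E j t = Re ((deriv ^^ j) (G \<epsilon>) (of_real t))" for j t
    have hG: "G \<epsilon> holomorphic_on U" by (rule G[OF \<epsilon>(1) e1])
    have towE: "tower E ?I" unfolding E_def [abs_def] by (rule tower_Re_holomorphic[OF hG U(1)])
    have sub: "{x - r<..<x + r} \<subseteq> ?I"
    proof
      fix t assume t: "t \<in> {x - r<..<x + r}"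
      have "\<bar>x - t\<bar> \<le> r1" using t r(1,2) unfolding abs_le_iff by auto
      then have "complex_of_real t \<in> cball (of_real x) r1"
        by (simp add: dist_norm flip: of_real_diff)
      then show "t \<in> ?I" using r1(2) by auto
    qed
    have towE': "tower E {x - r<..<x + r}" using towE sub by (auto simp: tower_def)
    have nz: "E m t \<noteq> 0" if t: "t \<in> {x - r<..<x + r}" for t
    proof -
      have tU: "complex_of_real t \<in> U" using sub t by auto
      have cb: "cball (complex_of_real t) r \<subseteq> U"
      proof
        fix z assume "z \<in> cball (complex_of_real t) r"
        moreover have "dist (complex_of_real x) (complex_of_real t) < r"
          using t by (simp add: dist_norm abs_less_iff flip: of_real_diff)
        ultimately have "z \<in> cball (of_real x) r1"
          using dist_triangle[of "complex_of_real x" z "complex_of_real t"] r(2) by simp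
        then show "z \<in> U" using r1(2) by auto
      qed
      have h: "(\<lambda>z. G \<epsilon> z - F z) holomorphic_on cball (of_real t) r"
        by (intro holomorphic_intros holomorphic_on_subset[OF hG cb] holomorphic_on_subset[OF F cb])
      have c1: "norm ((deriv ^^ m) (\<lambda>z. G \<epsilon> z - F z) (of_real t)) \<le> fact m * (C * \<bar>\<epsilon>\<bar>) / r ^ m"
      proof (rule Cauchy_inequality)
        show "(\<lambda>z. G \<epsilon> z - F z) holomorphic_on ball (of_real t) r"
          by (rule holomorphic_on_subset[OF h]) auto
        show "continuous_on (cball (of_real t) r) (\<lambda>z. G \<epsilon> z - F z)"
          by (rule holomorphic_on_imp_continuous_on[OF h])
        fix z assume "norm (complex_of_real t - z) = r"
        then have "z \<in> U" using cb by (auto simp: dist_norm subset_eq)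
        then show "norm (G \<epsilon> z - F z) \<le> C * \<bar>\<epsilon>\<bar>" by (rule near[OF \<epsilon>(1) e1])
      qed (rule r(1))
      have c2: "(deriv ^^ m) (\<lambda>z. G \<epsilon> z - F z) (of_real t) = (deriv ^^ m) (G \<epsilon>) (of_real t) - (deriv ^^ m) F (of_real t)"
        by (rule higher_deriv_diff[OF hG F U(1) tU])
      have c3: "fact m * (C * \<bar>\<epsilon>\<bar>) / r ^ m < \<bar>D m x\<bar> / 2"
      proof -
        have "\<bar>\<epsilon>\<bar> < \<bar>D m x\<bar> * r ^ m / (2 * fact m * C)" using \<epsilon>(2) by (simp add: e_def)
        then have "\<bar>\<epsilon>\<bar> * (2 * fact m * C) < \<bar>D m x\<bar> * r ^ m" using C(1) by (subst (asm) pos_less_divide_eq) auto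
        then have "fact m * (C * \<bar>\<epsilon>\<bar>) < \<bar>D m x\<bar> / 2 * r ^ m" by (simp add: mult_ac)
        then show ?thesis using r(1) by (subst pos_divide_less_eq) auto
      qed
      have c4: "\<bar>E m t - D m t\<bar> \<le> norm ((deriv ^^ m) (G \<epsilon>) (of_real t) - (deriv ^^ m) F (of_real t))"
        unfolding E_def D_def by (metis abs_Re_le_cmod minus_complex.simps(1))
      have "\<bar>t - x\<bar> < r2" using t r(3) by (auto simp: abs_less_iff)
      then have c5: "\<bar>D m x\<bar> / 2 \<le> \<bar>D m t\<bar>" using r2(2)[of t] by (cases "t = x") auto
      have "\<bar>E m t - D m t\<bar> < \<bar>D m t\<bar>"
        using order_trans[OF c4 c1[unfolded c2]] c3 c5 by linarith
      then show ?thesis by auto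
    qed
    have "zeros_le (E m) {x - r<..<x + r} 0"
    proof (intro zeros_le_0 conjI)
      fix t assume t: "t \<in> {x - r<..<x + r}"
      then have "(E m has_real_derivative E (Suc m) t) (at t)" using towE' by (simp add: tower_def)
      then show "isCont (E m) t" by (rule DERIV_isCont)
      show "E m t \<noteq> 0" by (rule nz[OF t])
    qed
    then have "zeros_le (E 0) {x - r<..<x + r} (0 + m) \<or> (\<forall>t\<in>{x - r<..<x + r}. E 0 t = 0)"
      by (intro tower_Rolle[OF towE'] disjI1)
    moreover have "\<not> (\<forall>t\<in>{x - r<..<x + r}. E 0 t = 0)"
    proof
      assume z: "\<forall>t\<in>{x - r<..<x + r}. E 0 t = 0"
      have xr: "x \<in> {x - r<..<x + r}" using r(1) by simp
      have "\<forall>\<^sub>F t in nhds x. t \<in> {x - r<..<x + r}" by (rule eventually_nhds_in_open[OF _ xr]) simp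
      then have "\<forall>\<^sub>F t in nhds x. \<bar>E 0 t\<bar> \<le> 0 * \<bar>t - x\<bar> ^ Suc m" by eventually_elim (use z in auto)
      then have "vanishes_to (E 0) x (Suc m)" unfolding vanishes_to_def by blast
      from tower_vanishes_to_imp[OF towE' _ xr this, of m] show False using nz[OF xr] by simp
    qed
    ultimately have "zeros_le (E 0) {x - r<..<x + r} m" by auto
    moreover have "E 0 = (\<lambda>t. Re (G \<epsilon> (of_real t)))" by (simp add: E_def fun_eq_iff)
    ultimately show ?thesis by (simp only:)
  qed
  show thesis by (rule that[OF r(1) e van[unfolded D0] zeros])
qed

text \<open>Finitely many of the neighbourhoods just found cover the interval, and the multiplicities at their centres
add up to at most \<open>N\<close>.\<close>

lemma zeros_le_perturbation:
  fixes F :: "complex \<Rightarrow> complex" and G :: "real \<Rightarrow> complex \<Rightarrow> complex"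
  assumes U: "open U" "of_real ` {a..b} \<subseteq> U" and F: "F holomorphic_on U"
    and G: "\<And>\<epsilon>. 0 < \<bar>\<epsilon>\<bar> \<Longrightarrow> \<bar>\<epsilon>\<bar> < e\<^sub>1 \<Longrightarrow> G \<epsilon> holomorphic_on U"
    and near: "\<And>\<epsilon> z. 0 < \<bar>\<epsilon>\<bar> \<Longrightarrow> \<bar>\<epsilon>\<bar> < e\<^sub>1 \<Longrightarrow> z \<in> U \<Longrightarrow> norm (G \<epsilon> z - F z) \<le> C * \<bar>\<epsilon>\<bar>"
    and C: "C > 0" "e\<^sub>1 > 0" and zF: "zeros_le (\<lambda>t. Re (F (of_real t))) {a..b} N"
  shows "\<exists>e>0. \<forall>\<epsilon>. 0 < \<bar>\<epsilon>\<bar> \<and> \<bar>\<epsilon>\<bar> < e \<longrightarrow> zeros_le (\<lambda>t. Re (G \<epsilon> (of_real t))) {a..b} N"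
proof -
  have "\<exists>r e m. r > 0 \<and> e > 0 \<and> vanishes_to (\<lambda>t. Re (F (of_real t))) x m \<and>
      (\<forall>\<epsilon>. 0 < \<bar>\<epsilon>\<bar> \<longrightarrow> \<bar>\<epsilon>\<bar> < e \<longrightarrow> zeros_le (\<lambda>t. Re (G \<epsilon> (of_real t))) {x - r<..<x + r} m)"
    if x: "x \<in> {a..b}" for x
  proof -
    have xU: "of_real x \<in> U" using U(2) x by auto
    have "\<not> vanishes_to (\<lambda>t. Re (F (of_real t))) x (Suc N)"
    proof
      assume "vanishes_to (\<lambda>t. Re (F (of_real t))) x (Suc N)"
      then have "sum (\<lambda>_. Suc N) {x} \<le> N"
        using zF[unfolded zeros_le_def, rule_format, of "{x}" "\<lambda>_. Suc N"] x by simp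
      then show False by simp
    qed
    show ?thesis
    proof (rule zeros_le_near_point[of U x F e\<^sub>1 G C "Suc N"])
      fix r e m
      assume "r > 0" "e > 0" "vanishes_to (\<lambda>t. Re (F (of_real t))) x m"
        and "\<And>\<epsilon>. 0 < \<bar>\<epsilon>\<bar> \<Longrightarrow> \<bar>\<epsilon>\<bar> < e \<Longrightarrow> zeros_le (\<lambda>t. Re (G \<epsilon> (of_real t))) {x - r<..<x + r} m"
      then show ?thesis by blast
    qed (use U(1) xU F G near C \<open>\<not> vanishes_to _ x (Suc N)\<close> in auto)
  qed
  then obtain r e m where *: "\<And>x. x \<in> {a..b} \<Longrightarrow> r x > 0" "\<And>x. x \<in> {a..b} \<Longrightarrow> e x > 0"
    "\<And>x. x \<in> {a..b} \<Longrightarrow> vanishes_to (\<lambda>t. Re (F (of_real t))) x (m x)"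
    "\<And>x \<epsilon>. x \<in> {a..b} \<Longrightarrow> 0 < \<bar>\<epsilon>\<bar> \<Longrightarrow> \<bar>\<epsilon>\<bar> < e x \<Longrightarrow>
       zeros_le (\<lambda>t. Re (G \<epsilon> (of_real t))) {x - r x<..<x + r x} (m x)"
    by metis
  obtain X where X: "X \<subseteq> {a..b}" "finite X" "{a..b} \<subseteq> (\<Union>x\<in>X. {x - r x<..<x + r x})"
  proof (rule compactE_image[of "{a..b}" "{a..b}" "\<lambda>x. {x - r x<..<x + r x}"])
    show "{a..b} \<subseteq> (\<Union>x\<in>{a..b}. {x - r x<..<x + r x})" using *(1) by force
  qed auto
  have mX: "sum m X \<le> N" using zF X *(3) unfolding zeros_le_def by blast
  define e\<^sub>0 where "e\<^sub>0 = Min (insert 1 (e ` X))"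
  have e0: "e\<^sub>0 > 0" "\<And>x. x \<in> X \<Longrightarrow> e\<^sub>0 \<le> e x"
    using X *(2) by (auto simp: e\<^sub>0_def Min_gr_iff)
  have "zeros_le (\<lambda>t. Re (G \<epsilon> (of_real t))) {a..b} N" if \<epsilon>: "0 < \<bar>\<epsilon>\<bar>" "\<bar>\<epsilon>\<bar> < e\<^sub>0" for \<epsilon>
    unfolding zeros_le_def
  proof (intro allI impI)
    fix S and k :: "real \<Rightarrow> nat"
    assume S: "finite S \<and> S \<subseteq> {a..b} \<and> (\<forall>x\<in>S. vanishes_to (\<lambda>t. Re (G \<epsilon> (of_real t))) x (k x))"
    have "\<exists>x\<in>X. t \<in> {x - r x<..<x + r x}" if "t \<in> S" for t using S X(3) that by blast
    then obtain p where p: "\<And>t. t \<in> S \<Longrightarrow> p t \<in> X \<and> t \<in> {p t - r (p t)<..<p t + r (p t)}" by metis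
    have "sum k S = (\<Sum>x\<in>X. sum k {t \<in> S. p t = x})"
      by (rule sum.group[symmetric]) (use S X p in auto)
    also have "\<dots> \<le> sum m X"
    proof (rule sum_mono)
      fix x assume x: "x \<in> X"
      have "zeros_le (\<lambda>t. Re (G \<epsilon> (of_real t))) {x - r x<..<x + r x} (m x)"
        using *(4)[of x \<epsilon>] x X(1) \<epsilon> e0(2)[OF x] by auto
      moreover have "finite {t \<in> S. p t = x} \<and> {t \<in> S. p t = x} \<subseteq> {x - r x<..<x + r x} \<and>
          (\<forall>t\<in>{t \<in> S. p t = x}. vanishes_to (\<lambda>t. Re (G \<epsilon> (of_real t))) t (k t))"
        using S p by fastforce
      ultimately show "sum k {t \<in> S. p t = x} \<le> m x" unfolding zeros_le_def by blast
    qed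
    also have "\<dots> \<le> N" by (rule mX)
    finally show "sum k S \<le> N" .
  qed
  then show ?thesis using e0(1) by blast
qed

lemma tower_higher_deriv:
  assumes "tower D J" "open J" "\<And>t. t \<in> J \<Longrightarrow> d t = D 0 t" "t \<in> J"
  shows "(deriv ^^ j) d t = D j t"
  using assms(4)
proof (induction j arbitrary: t)
  case 0
  then show ?case using assms(3) by simp
next
  case (Suc j)
  have "(D j has_real_derivative D (Suc j) t) (at t)" using assms(1) Suc.prems by (simp add: tower_def)
  then have "((deriv ^^ j) d has_real_derivative D (Suc j) t) (at t)"
    by (rule has_field_derivative_transform_within_open[OF _ assms(2) Suc.prems]) (simp add: Suc.IH)
  then show ?case by (simp add: DERIV_imp_deriv)
qed

lemma zero_multiplicity_ge:
  assumes "enat k \<le> zero_multiplicity d y" "j < k"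
  shows "(deriv ^^ j) d y = 0"
proof (rule ccontr)
  assume nz: "(deriv ^^ j) d y \<noteq> 0"
  have "zero_multiplicity d y \<le> enat j"
    unfolding zero_multiplicity_def
  proof (rule Sup_least)
    fix v assume "v \<in> {enat m | m. \<forall>j<m. (deriv ^^ j) d y = 0}"
    then obtain m where m: "v = enat m" "\<forall>j<m. (deriv ^^ j) d y = 0" by blast
    then have "m \<le> j" using nz not_le_imp_less by blast
    then show "v \<le> enat j" using m by simp
  qed
  then have "enat k \<le> enat j" using assms(1) by (rule order_trans[rotated])
  then show False using assms(2) by simp
qed

text \<open>Any choice of finite lower bounds for the multiplicities on finitely many members is bounded by \<open>N\<close>; this
excludes infinite families and infinite multiplicities.\<close>

lemma zeros_le_sum_zero_multiplicity:
  assumes z: "zeros_le \<phi> I N" and s: "\<And>C. C \<in> \<C> \<Longrightarrow> s C \<in> I" "inj_on s \<C>"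
    and one: "\<And>C. C \<in> \<C> \<Longrightarrow> vanishes_to \<phi> (s C) 1"
    and van: "\<And>C k. C \<in> \<C> \<Longrightarrow> enat k \<le> \<mu> C \<Longrightarrow> vanishes_to \<phi> (s C) k"
  shows "finite \<C> \<and> sum \<mu> \<C> \<le> enat N"
proof -
  have bound: "sum k F \<le> N" if "finite F" "F \<subseteq> \<C>" "\<And>C. C \<in> F \<Longrightarrow> vanishes_to \<phi> (s C) (k C)" for F k
  proof -
    have inj: "inj_on s F" using s(2) that(2) by (rule inj_on_subset)
    define k' where "k' x = k (the_inv_into F s x)" for x
    have k': "k' (s C) = k C" if "C \<in> F" for C by (simp add: k'_def the_inv_into_f_f[OF inj that])
    have "sum k' (s ` F) = sum (k' \<circ> s) F" by (rule sum.reindex[OF inj])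
    also have "\<dots> = sum k F" by (rule sum.cong) (simp_all add: k')
    finally have "sum k F = sum k' (s ` F)" ..
    also have "\<dots> \<le> N"
      using z[unfolded zeros_le_def, rule_format, of "s ` F" k'] that s(1) k' by auto
    finally show ?thesis .
  qed
  have fin: "finite \<C>"
  proof (rule finite_if_finite_subsets_card_bdd[of _ N, THEN conjunct1])
    fix F assume F: "F \<subseteq> \<C>" "finite F"
    show "card F \<le> N" using bound[OF F(2,1), of "\<lambda>_. 1"] one F(1) by auto
  qed
  have small: "\<mu> C \<le> enat N" if C: "C \<in> \<C>" for C
  proof (rule ccontr)
    assume "\<not> \<mu> C \<le> enat N"
    then have "enat (Suc N) \<le> \<mu> C" by (simp add: not_le ileI1 flip: eSuc_enat)
    then have "vanishes_to \<phi> (s C) (Suc N)" by (rule van[OF C])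
    then have "sum (\<lambda>_. Suc N) {C} \<le> N" by (intro bound) (use C in auto)
    then show False by simp
  qed
  then have \<mu>: "\<mu> C = enat (the_enat (\<mu> C))" if "C \<in> \<C>" for C
    using small[OF that] by (cases "\<mu> C") auto
  have "sum \<mu> \<C> = (\<Sum>C\<in>\<C>. enat (the_enat (\<mu> C)))" by (rule sum.cong) (use \<mu> in auto)
  also have "\<dots> = enat (\<Sum>C\<in>\<C>. the_enat (\<mu> C))" by (simp add: of_nat_sum flip: of_nat_eq_enat)
  also have "\<dots> \<le> enat N"
    using bound[OF fin order_refl, of "\<lambda>C. the_enat (\<mu> C)"] van \<mu> by (simp add: order_eq_refl[OF sym])
  finally show ?thesis using fin by simp
qed

section \<open>Limit cycles near the period annulus\<close>

context annulus begin

text \<open>The stretched angle fixes the switching angles, so the half turns are unchanged by the substitution.\<close>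

lemma integral_stretch:
  assumes R: "continuous_on {p..q} R" and pq: "p \<le> q" "stretch p = p" "stretch q = q"
    and l: "\<And>\<tau>. \<tau> \<in> {p..q} \<Longrightarrow> l \<tau> = 2 * (cos \<tau>)\<^sup>2 * R (stretch \<tau>)"
  shows "(l has_integral integral {p..q} R) {p..q}"
proof -
  have sub: "stretch \<tau> \<in> {p..q}" if "\<tau> \<in> {p..q}" for \<tau>
    using stretch_strict_mono[of p \<tau>] stretch_strict_mono[of \<tau> q] that pq(2,3)
    by (cases "\<tau> = p"; cases "\<tau> = q") auto
  have sub': "stretch ` {p..q} \<subseteq> {p..q}" using sub by blast
  have "((\<lambda>\<tau>. (2 * (cos \<tau>)\<^sup>2) *\<^sub>R R (stretch \<tau>)) has_integral integral {stretch p..stretch q} R) {p..q}"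
  proof (rule has_integral_substitution[of p q stretch p q])
    show "(stretch has_real_derivative 2 * (cos x)\<^sup>2) (at x within {p..q})" for x
      using has_real_derivative_stretch by (rule has_field_derivative_at_within)
    show "stretch p \<le> stretch q" unfolding pq by (rule pq(1))
  qed (rule pq(1) sub' R)+
  then have *: "((\<lambda>\<tau>. (2 * (cos \<tau>)\<^sup>2) *\<^sub>R R (stretch \<tau>)) has_integral integral {p..q} R) {p..q}"
    by (simp only: pq(2,3))
  show ?thesis by (rule has_integral_eq[OF _ *]) (simp only: l real_scaleR_def)
qed

lemma melnikov_fun_real:
  assumes s: "a - \<rho> < s" "s < b + \<rho>"
  shows "melnikov_fun (of_real s) = of_real ((half_int \<eta> n c d s + half_int \<eta> n c' d' (- s)) / (\<omega> * s))"
proof -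
  have s1: "\<bar>s\<bar> < 1" "s > 0" using s ab rho by auto
  define R where "R u \<theta> = rad u \<theta> s / (\<omega> * s)" for u \<theta>
  have cR: "continuous_on A (R u)" for A u
    unfolding R_def [abs_def] by (intro continuous_intros) (use s1 omega_pos in auto)
  have sgn: "linear_slope \<tau> s = 2 * (cos \<tau>)\<^sup>2 * R u (stretch \<tau>)"
    if "if u then cos \<tau> \<ge> 0 else cos \<tau> \<le> 0" for u \<tau>
    using that by (cases "cos \<tau> = 0"; cases u) (auto simp: linear_slope_def R_def)
  have pos: "cos \<tau> \<ge> 0" if "\<tau> \<in> {0..pi / 2} \<union> {3 * pi / 2..2 * pi}" for \<tau>
    using cos_sign[of \<tau>] that pi_gt_zero by (force simp: less_eq_real_def)
  have neg: "cos \<tau> \<le> 0" if "\<tau> \<in> {pi / 2..3 * pi / 2}" for \<tau>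
    using cos_sign(1)[of \<tau>] that pi_gt_zero by auto
  have 1: "(linear_slope' has_integral integral {0..pi / 2} (R True)) {0..pi / 2}"
    and 3: "(linear_slope' has_integral integral {3 * pi / 2..2 * pi} (R True)) {3 * pi / 2..2 * pi}"
    and 2: "(linear_slope' has_integral integral {pi / 2..3 * pi / 2} (R False)) {pi / 2..3 * pi / 2}"
    if "linear_slope' = (\<lambda>\<tau>. linear_slope \<tau> s)" for linear_slope'
    unfolding that by (rule integral_stretch[OF cR]; (rule sgn)?; use pos neg pi_gt_zero in simp)+
  have "((\<lambda>\<tau>. linear_slope \<tau> s) has_integral
      integral {0..pi / 2} (R True) + integral {pi / 2..3 * pi / 2} (R False) + integral {3 * pi / 2..2 * pi} (R True)) {0..2 * pi}"
    using has_integral_combine[OF _ _ has_integral_combine[OF _ _ 1[OF refl] 2[OF refl]] 3[OF refl]] pi_gt_zero by simp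
  moreover have "integral A (R True) = integral A (\<lambda>t. radial_rate \<eta> n c d (s * cos t) (s * sin t)) / (\<omega> * s)"
    "integral A (R False) = integral A (\<lambda>t. radial_rate \<eta> n c' d' (s * cos t) (s * sin t)) / (\<omega> * s)" for A
    by (simp_all add: R_def [abs_def] rad_def divide_inverse)
  ultimately have "((\<lambda>\<tau>. linear_slope \<tau> s) has_integral
      (half_int \<eta> n c d s + half_int \<eta> n c' d' (- s)) / (\<omega> * s)) {0..2 * pi}"
    unfolding half_int_upper[OF s1(1) eta_pos] half_int_lower[OF s1(1) eta_pos]
    by (simp add: add_divide_distrib add_ac)
  then have "(complex_of_real \<circ> (\<lambda>\<tau>. linear_slope \<tau> s) has_integral
      complex_of_real ((half_int \<eta> n c d s + half_int \<eta> n c' d' (- s)) / (\<omega> * s))) {0..2 * pi}"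
    by (rule has_integral_linear[OF _ bounded_linear_of_real])
  then have "((\<lambda>\<tau>. linear_slope \<tau> (complex_of_real s)) has_integral
      of_real ((half_int \<eta> n c d s + half_int \<eta> n c' d' (- s)) / (\<omega> * s))) {0..2 * pi}"
    by (simp only: o_def of_real_linear_slope)
  then show ?thesis unfolding melnikov_fun_def by (rule integral_unique)
qed

text \<open>The divided displacement \<open>(P z - z) / \<epsilon>\<close> converges to the first order coefficient uniformly on a complex
neighbourhood of \<open>{a..b}\<close>.\<close>

lemma poincare_zeros_le:
  assumes z: "zeros_le (\<lambda>s. half_int \<eta> n c d s + half_int \<eta> n c' d' (- s)) {0<..<1} N"
  shows "\<exists>e>0. \<forall>\<epsilon>. 0 < \<bar>\<epsilon>\<bar> \<and> \<bar>\<epsilon>\<bar> < e \<longrightarrow> \<bar>\<epsilon>\<bar> < \<epsilon>\<^sub>0 \<and>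
    zeros_le (\<lambda>s. small_perturbation.poincare \<eta> n c d c' d' a b \<epsilon> s - s) {a..b} N"
proof -
  define flow where "flow \<epsilon> = small_perturbation.flow \<eta> n c d c' d' a b \<epsilon> (2 * pi)" for \<epsilon>
  define G where "G \<epsilon> z = (flow \<epsilon> z - z) / of_real \<epsilon>" for \<epsilon> z
  define C where "C = 16 * pi\<^sup>2 * K\<^sup>2 / \<rho> + 4 * pi * B * K / (\<omega> * (a\<^sup>2 / 2))"
  have sp: "small_perturbation \<eta> n c d c' d' a b \<epsilon>" if "\<bar>\<epsilon>\<bar> < \<epsilon>\<^sub>0" for \<epsilon>
    by unfold_locales (rule that)
  have C: "C > 0" using K_pos rho omega_pos ab B(1) by (simp add: C_def add_pos_nonneg)
  have near: "norm (G \<epsilon> z - melnikov_fun z) \<le> C * \<bar>\<epsilon>\<bar>"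
    if \<epsilon>: "0 < \<bar>\<epsilon>\<bar>" "\<bar>\<epsilon>\<bar> < \<epsilon>\<^sub>0" and zU: "z \<in> open_rect" for \<epsilon> z
  proof -
    have e0: "\<epsilon> \<noteq> 0" using \<epsilon>(1) by auto
    have "norm (flow \<epsilon> z - z - of_real \<epsilon> * melnikov_fun z) \<le> C * \<epsilon>\<^sup>2"
      unfolding flow_def C_def by (rule small_perturbation.flow(6)[OF sp[OF \<epsilon>(2)] zU])
    moreover have "flow \<epsilon> z - z - of_real \<epsilon> * melnikov_fun z = of_real \<epsilon> * (G \<epsilon> z - melnikov_fun z)"
      using e0 by (simp add: G_def field_simps)
    ultimately have "\<bar>\<epsilon>\<bar> * norm (G \<epsilon> z - melnikov_fun z) \<le> \<bar>\<epsilon>\<bar> * (C * \<bar>\<epsilon>\<bar>)"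
      by (simp add: norm_mult power2_eq_square mult_ac)
    then show ?thesis using \<epsilon>(1) by simp
  qed
  have hG: "G \<epsilon> holomorphic_on open_rect" if \<epsilon>: "0 < \<bar>\<epsilon>\<bar>" "\<bar>\<epsilon>\<bar> < \<epsilon>\<^sub>0" for \<epsilon>
    unfolding G_def [abs_def] flow_def
    by (intro holomorphic_intros small_perturbation.flow(4)[OF sp[OF \<epsilon>(2)]]) (use \<epsilon>(1) in auto)
  have sub: "of_real ` {a..b} \<subseteq> open_rect" using rho by (auto simp: mem_open_rect)
  have van: "vanishes_to (\<lambda>s. half_int \<eta> n c d s + half_int \<eta> n c' d' (- s)) x m"
    if x: "x \<in> {a..b}" and v: "vanishes_to (\<lambda>t. Re (melnikov_fun (of_real t))) x m" for x m
  proof (rule vanishes_to_cong)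
    show "vanishes_to (\<lambda>t. (\<omega> * t) * Re (melnikov_fun (of_real t))) x m"
      by (rule vanishes_to_mult_left[OF v]) (intro continuous_intros)
    have "\<forall>\<^sub>F t in nhds x. t \<in> {a - \<rho><..<b + \<rho>}"
      by (rule eventually_nhds_in_open) (use x rho in auto)
    then show "\<forall>\<^sub>F t in nhds x. (\<omega> * t) * Re (melnikov_fun (of_real t)) = half_int \<eta> n c d t + half_int \<eta> n c' d' (- t)"
    proof eventually_elim
      case (elim t)
      then have "t > 0" using rho ab by simp
      then show ?case using elim omega_pos melnikov_fun_real[of t] by simp
    qed
  qed
  have zM: "zeros_le (\<lambda>t. Re (melnikov_fun (of_real t))) {a..b} N"
    unfolding zeros_le_def
  proof (intro allI impI)
    fix S and m :: "real \<Rightarrow> nat"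
    assume S: "finite S \<and> S \<subseteq> {a..b} \<and> (\<forall>x\<in>S. vanishes_to (\<lambda>t. Re (melnikov_fun (of_real t))) x (m x))"
    have "{a..b} \<subseteq> {0<..<1}" using ab by auto
    then show "sum m S \<le> N" using z S van unfolding zeros_le_def by (meson order_trans subset_iff)
  qed
  obtain e where e: "e > 0" "\<And>\<epsilon>. 0 < \<bar>\<epsilon>\<bar> \<Longrightarrow> \<bar>\<epsilon>\<bar> < e \<Longrightarrow> zeros_le (\<lambda>t. Re (G \<epsilon> (of_real t))) {a..b} N"
    using zeros_le_perturbation[OF open_open_rect sub holomorphic_melnikov_fun, of \<epsilon>\<^sub>0 G C N] hG near C eps0_pos zM
    by auto
  have "zeros_le (\<lambda>s. small_perturbation.poincare \<eta> n c d c' d' a b \<epsilon> s - s) {a..b} N"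
    if \<epsilon>: "0 < \<bar>\<epsilon>\<bar>" "\<bar>\<epsilon>\<bar> < min e \<epsilon>\<^sub>0" for \<epsilon>
    unfolding zeros_le_def
  proof (intro allI impI)
    let ?P = "\<lambda>s. small_perturbation.poincare \<eta> n c d c' d' a b \<epsilon> s - s"
    have e0: "\<bar>\<epsilon>\<bar> < \<epsilon>\<^sub>0" using \<epsilon> by simp
    have eq: "Re (G \<epsilon> (of_real s)) = 1 / \<epsilon> * ?P s" for s
      using \<epsilon>(1) by (simp add: G_def flow_def small_perturbation.poincare_def[OF sp[OF e0]] flip: of_real_inverse)
    have "vanishes_to (\<lambda>s. Re (G \<epsilon> (of_real s))) x m" if "vanishes_to ?P x m" for x m
      unfolding eq by (rule vanishes_to_mult_left[OF that]) simp
    then show "sum m S \<le> N" if "finite S \<and> S \<subseteq> {a..b} \<and> (\<forall>x\<in>S. vanishes_to ?P x (m x))" for S and m :: "real \<Rightarrow> nat"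
      using e(2)[of \<epsilon>] \<epsilon> that unfolding zeros_le_def by simp
  qed
  then show ?thesis using e(1) eps0_pos by (intro exI[of _ "min e \<epsilon>\<^sub>0"]) auto
qed

end

context perturbed_system begin

text \<open>The displacement in the coordinate \<open>y\<close> is the restriction of a holomorphic function, so vanishing
derivatives mean a zero of that order; and \<open>ordinate (P s) - ordinate s\<close> is \<open>P s - s\<close> times the nonzero
factor \<open>\<eta> / ((1 - P s) (1 - s))\<close>.\<close>

lemma fixed_point_multiplicity:
  assumes s0: "s\<^sub>0 \<in> {a..b}" and k: "enat k \<le> zero_multiplicity (displacement \<eta> X) (ordinate s\<^sub>0)"
  shows "vanishes_to (\<lambda>s. poincare s - s) s\<^sub>0 k"
proof -
  define U where "U = {z. z \<noteq> 0 \<and> 1 - of_real \<eta> / z \<in> open_rect}"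
  define W where "W z = of_real \<eta> / (1 - flow (2 * pi) (1 - of_real \<eta> / z)) - z" for z
  have "open ((- {0}) \<inter> (\<lambda>z :: complex. 1 - of_real \<eta> / z) -` open_rect)"
    by (rule continuous_open_preimage) (auto intro!: continuous_intros open_open_rect)
  moreover have "(- {0}) \<inter> (\<lambda>z :: complex. 1 - of_real \<eta> / z) -` open_rect = U" by (auto simp: U_def)
  ultimately have opU: "open U" by simp
  have ne: "flow (2 * pi) w \<noteq> 1" if "w \<in> open_rect" for w
  proof
    assume "flow (2 * pi) w = 1"
    then have "norm (1 - w) \<le> \<rho>" using flow(1)[of "2 * pi" w] that by simp
    then have "1 - Re w \<le> \<rho>" using complex_Re_le_cmod[of "1 - w"] by simp
    then show False using that rho ab by (simp add: mem_open_rect)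
  qed
  have hW: "W holomorphic_on U"
    unfolding W_def [abs_def]
    by (intro holomorphic_intros holomorphic_on_compose_gen[OF _ flow(4), unfolded o_def])
       (auto simp: U_def intro!: holomorphic_intros dest: ne)
  let ?J = "{t. complex_of_real t \<in> U}"
  have opJ: "open ?J" by (rule open_real_trace[OF opU])
  note tow = tower_Re_holomorphic[OF hW opU]
  have real_flow: "flow (2 * pi) (of_real s) = of_real (poincare s)" if "of_real s \<in> open_rect" for s
    using flow(5)[OF _ that] by (simp add: poincare_def complex_eq_iff complex_is_Real_iff)
  have rectI: "complex_of_real s \<in> open_rect \<longleftrightarrow> a - \<rho> < s \<and> s < b + \<rho>" for s
    using rho by (simp add: mem_open_rect)
  have d_eq: "displacement \<eta> X t = Re (W (of_real t))" if t: "t \<in> ?J" for t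
  proof -
    define s where "s = 1 - \<eta> / t"
    have t0: "t \<noteq> 0" using t by (simp add: U_def)
    have cs: "1 - complex_of_real \<eta> / of_real t = of_real s" by (simp add: s_def)
    have sU: "complex_of_real s \<in> open_rect" using t by (simp add: U_def cs)
    have ts: "t = ordinate s" using t0 eta_pos by (simp add: ordinate_def s_def)
    have "displacement \<eta> X t = ordinate (poincare s) - ordinate s"
      unfolding ts by (rule displacement_eq) (use sU rectI in auto)
    moreover have "W (of_real t) = of_real (ordinate (poincare s) - t)"
      unfolding W_def cs real_flow[OF sU] by (simp add: ordinate_def)
    ultimately show ?thesis using ts by simp
  qed
  have s01: "s\<^sub>0 < 1" "0 < s\<^sub>0" using s0 ab by auto
  have inv: "1 - \<eta> / ordinate s = s" if "s < 1" for s using that eta_pos by (simp add: ordinate_def)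
  have ordJ: "ordinate s \<in> ?J" if "a - \<rho> < s" "s < b + \<rho>" for s
  proof -
    have "s < 1" using that rho ab by simp
    have "1 - complex_of_real \<eta> / of_real (ordinate s) = of_real (1 - \<eta> / ordinate s)" by simp
    then have "1 - complex_of_real \<eta> / of_real (ordinate s) = of_real s" unfolding inv[OF \<open>s < 1\<close>] .
    moreover have "ordinate s \<noteq> 0" using eta_pos \<open>s < 1\<close> by (simp add: ordinate_def)
    ultimately show ?thesis using rectI that by (simp add: U_def)
  qed
  have s0J: "ordinate s\<^sub>0 \<in> ?J" using s0 rho by (intro ordJ) auto
  have "vanishes_to (\<lambda>t. Re ((deriv ^^ 0) W (of_real t))) (ordinate s\<^sub>0) k"
  proof (rule tower_vanishes_to[OF tow opJ s0J], intro allI impI)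
    fix j assume "j < k"
    have "(deriv ^^ j) (displacement \<eta> X) (ordinate s\<^sub>0) = Re ((deriv ^^ j) W (of_real (ordinate s\<^sub>0)))"
      by (rule tower_higher_deriv[OF tow opJ _ s0J]) (simp add: d_eq)
    then show "Re ((deriv ^^ j) W (of_real (ordinate s\<^sub>0))) = 0" using zero_multiplicity_ge[OF k \<open>j < k\<close>] by simp
  qed
  then have v1: "vanishes_to (\<lambda>t. Re (W (of_real t))) (ordinate s\<^sub>0) k" by simp
  have "(ordinate has_real_derivative \<eta> / (1 - s\<^sub>0)\<^sup>2) (at s\<^sub>0)"
    unfolding ordinate_def [abs_def] using s01
    by (auto intro!: derivative_eq_intros simp: power2_eq_square)
  from vanishes_to_compose[OF v1 this]
  have v2: "vanishes_to (\<lambda>s. Re (W (of_real (ordinate s)))) s\<^sub>0 k" .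
  have z0: "of_real s\<^sub>0 \<in> open_rect" using s0 rho by (simp add: rectI)
  have cP: "isCont poincare s\<^sub>0"
  proof -
    have "isCont (flow (2 * pi)) (of_real s\<^sub>0)"
      using holomorphic_on_imp_continuous_on[OF flow(4)] z0 open_open_rect by (simp add: continuous_on_eq_continuous_at)
    then have "isCont (\<lambda>s. flow (2 * pi) (of_real s)) s\<^sub>0"
      by (intro isCont_o2[where f = complex_of_real and g = "flow (2 * pi)"] continuous_intros)
    then show ?thesis unfolding poincare_def [abs_def] by (rule bounded_linear.continuous[OF bounded_linear_Re])
  qed
  define u where "u s = (1 - poincare s) * (1 - s) / \<eta>" for s
  have "vanishes_to (\<lambda>s. u s * Re (W (of_real (ordinate s)))) s\<^sub>0 k"
    by (rule vanishes_to_mult_left[OF v2]) (unfold u_def, intro continuous_intros cP, use eta_pos in simp)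
  then show ?thesis
  proof (rule vanishes_to_cong[rotated])
    have "\<forall>\<^sub>F s in nhds s\<^sub>0. s \<in> {a - \<rho><..<b + \<rho>}"
      by (rule eventually_nhds_in_open) (use s0 rho in auto)
    then show "\<forall>\<^sub>F s in nhds s\<^sub>0. u s * Re (W (of_real (ordinate s))) = poincare s - s"
    proof eventually_elim
      case (elim s)
      then have sr: "complex_of_real s \<in> open_rect" by (simp add: rectI)
      have s1: "s < 1" using elim rho ab by simp
      have p1: "1 - poincare s \<noteq> 0"
        using ne[OF sr] real_flow[OF sr] by auto
      have "Re (W (of_real (ordinate s))) = ordinate (poincare s) - ordinate s"
        using d_eq[OF ordJ, of s] displacement_eq[of s] elim by simp
      moreover have "p * q / \<eta> * (\<eta> / p - \<eta> / q) = q - p" if "p \<noteq> 0" "q \<noteq> 0" for p q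
        using that eta_pos by (simp add: right_diff_distrib)
      from this[OF p1, of "1 - s"] have "u s * (ordinate (poincare s) - ordinate s) = poincare s - s"
        using s1 by (simp add: u_def ordinate_def)
      ultimately show ?case by simp
    qed
  qed
qed

lemma cycles_le:
  assumes z: "zeros_le (\<lambda>s. poincare s - s) {a..b} N"
    and K: "\<And>y. y > \<eta> \<Longrightarrow> H \<eta> (0, y) \<in> K' \<Longrightarrow> \<exists>s\<in>{a..b}. y = ordinate s"
  defines "\<C> \<equiv> {C. limit_cycle \<eta> X C \<and> (\<exists>y>\<eta>. (0, y) \<in> C \<and> H \<eta> (0, y) \<in> K')}"
  shows "finite \<C> \<and> (\<Sum>C\<in>\<C>. cycle_multiplicity \<eta> X C) \<le> enat N"
proof -
  have "\<exists>s\<in>{a..b}. closed_orbit \<eta> X C \<and> (0, ordinate s) \<in> C" if "C \<in> \<C>" for C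
    using that K unfolding \<C>_def limit_cycle_def by blast
  then obtain s where s: "\<And>C. C \<in> \<C> \<Longrightarrow> s C \<in> {a..b} \<and> closed_orbit \<eta> X C \<and> (0, ordinate (s C)) \<in> C"
    by metis
  have sI: "a \<le> s C" "s C \<le> b" if "C \<in> \<C>" for C using s[OF that] by auto
  show ?thesis
  proof (rule zeros_le_sum_zero_multiplicity[OF z, of \<C> s])
    show "s C \<in> {a..b}" if "C \<in> \<C>" for C using s[OF that] by simp
    show "inj_on s \<C>"
    proof (rule inj_onI)
      fix C C' assume C: "C \<in> \<C>" "C' \<in> \<C>" "s C = s C'"
      then show "C = C'"
        using closed_orbit_through(3)[OF sI[OF C(2)], of C' C] s[OF C(1)] s[OF C(2)] by simp
    qed
    show "vanishes_to (\<lambda>s. poincare s - s) (s C) 1" if C: "C \<in> \<C>" for C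
    proof -
      have "poincare (s C) = s C" using closed_orbit_through(1)[OF sI[OF C]] s[OF C] by blast
      have hol: "(\<lambda>z. flow (2 * pi) z - z) holomorphic_on open_rect" by (intro holomorphic_intros flow)
      have "vanishes_to (\<lambda>t. Re ((deriv ^^ 0) (\<lambda>z. flow (2 * pi) z - z) (of_real t))) (s C) 1"
        using sI[OF C] rho \<open>poincare (s C) = s C\<close>
        by (intro tower_vanishes_to[OF tower_Re_holomorphic[OF hol open_open_rect] open_real_trace[OF open_open_rect]])
           (auto simp: mem_open_rect poincare_def)
      then show ?thesis by (simp add: poincare_def)
    qed
    show "vanishes_to (\<lambda>s. poincare s - s) (s C) k" if C: "C \<in> \<C>" and k: "enat k \<le> cycle_multiplicity \<eta> X C" for C k
    proof (rule fixed_point_multiplicity)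
      show "s C \<in> {a..b}" using s[OF C] by simp
      show "enat k \<le> zero_multiplicity (displacement \<eta> X) (ordinate (s C))"
        using k closed_orbit_through(2)[OF sI[OF C]] s[OF C] by simp
    qed
  qed
qed

end

lemma level_range:
  fixes \<eta> h :: real
  assumes "\<eta> > 0" "- 1 / (2 * \<eta>) < h" "h < 0"
  shows "0 < 1 + 2 * \<eta> * h" "1 + 2 * \<eta> * h < 1"
proof -
  have "2 * \<eta> * (- 1 / (2 * \<eta>)) < 2 * \<eta> * h" using assms by (intro mult_strict_left_mono) auto
  then show "0 < 1 + 2 * \<eta> * h" using assms(1) by simp
  show "1 + 2 * \<eta> * h < 1" using assms(1,3) by (simp add: mult_pos_neg)
qed

text \<open>A point of the section at level \<open>h\<close> has \<open>s\<^sup>2 = 1 + 2 \<eta> h\<close>.\<close>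

lemma compact_levels_ordinates:
  assumes \<eta>: "\<eta> > 0" and K: "compact K" "K \<subseteq> {- 1 / (2 * \<eta>)<..<0}"
  obtains a b where "0 < a" "a \<le> b" "b < 1"
    "\<And>y. y > \<eta> \<Longrightarrow> H \<eta> (0, y) \<in> K \<Longrightarrow> \<exists>s\<in>{a..b}. y = \<eta> / (1 - s)"
proof (cases "K = {}")
  case True
  then show thesis using that[of "1 / 2" "1 / 2"] by simp
next
  case False
  define h where "h = Inf K"
  define h' where "h' = Sup K"
  have bd: "bdd_below K" "bdd_above K" "closed K"
    using K(1) by (auto simp: compact_imp_closed compact_imp_bounded bounded_imp_bdd_below bounded_imp_bdd_above)
  have hK: "h \<in> K" "h' \<in> K" using closed_contains_Inf[of K] closed_contains_Sup[of K] bd False by (auto simp: h_def h'_def)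
  have range: "0 < 1 + 2 * \<eta> * t" "1 + 2 * \<eta> * t < 1" if "t \<in> K" for t
  proof -
    have "- 1 / (2 * \<eta>) < t" "t < 0" using K(2) that by auto
    then show "0 < 1 + 2 * \<eta> * t" "1 + 2 * \<eta> * t < 1" by (rule level_range[OF \<eta>])+
  qed
  have le: "h \<le> t" "t \<le> h'" if "t \<in> K" for t
    using cInf_lower[OF that bd(1)] cSup_upper[OF that bd(2)] by (simp_all add: h_def h'_def)
  show thesis
  proof (rule that[of "sqrt (1 + 2 * \<eta> * h)" "sqrt (1 + 2 * \<eta> * h')"])
    show "0 < sqrt (1 + 2 * \<eta> * h)" using range[OF hK(1)] by simp
    show "sqrt (1 + 2 * \<eta> * h) \<le> sqrt (1 + 2 * \<eta> * h')" using le(1)[OF hK(2)] \<eta> by simp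
    show "sqrt (1 + 2 * \<eta> * h') < 1" using range(2)[OF hK(2)] by simp
    fix y assume y: "y > \<eta>" and HK: "H \<eta> (0, y) \<in> K"
    define s where "s = 1 - \<eta> / y"
    have y0: "y > 0" using y \<eta> by simp
    have s: "0 \<le> s" using y y0 by (simp add: s_def)
    have s2: "s\<^sup>2 = 1 + 2 * \<eta> * H \<eta> (0, y)" using y0 by (simp add: s_def H_def field_simps power2_eq_square)
    then have "s = sqrt (1 + 2 * \<eta> * H \<eta> (0, y))" using s by (metis real_sqrt_unique)
    then have "s \<in> {sqrt (1 + 2 * \<eta> * h)..sqrt (1 + 2 * \<eta> * h')}" using le[OF HK] \<eta> by simp
    moreover have "y = \<eta> / (1 - s)" using y0 \<eta> by (simp add: s_def)
    ultimately show "\<exists>s\<in>{sqrt (1 + 2 * \<eta> * h)..sqrt (1 + 2 * \<eta> * h')}. y = \<eta> / (1 - s)" by blast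
  qed
qed

theorem theorem1p3:
  fixes \<eta> :: real and n :: nat and f g :: "nat \<Rightarrow> plane \<Rightarrow> real"
  assumes "\<eta> > 0" and "n \<ge> 1"
    and "\<And>k. k \<in> {1..4} \<Longrightarrow> bivariate_poly_le n (f k)"
    and "\<And>k. k \<in> {1..4} \<Longrightarrow> bivariate_poly_le n (g k)"
    and "\<exists>h\<in>{- 1 / (2 * \<eta>)<..<0}. melnikov \<eta> f g h \<noteq> 0"
    and "f 1 = f 4" and "g 1 = g 4" and "f 2 = f 3" and "g 2 = g 3"
  shows "bifurcating_limit_cycles_le \<eta> f g (9 * n - 6)"
proof -
  have "\<exists>c. \<forall>x y. q (x, y) = bipoly n c x y" if "bivariate_poly_le n q" for q
    using that by (simp add: bivariate_poly_le_def bipoly_def)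
  then have ex: "\<exists>c. \<forall>x y. f k (x, y) = bipoly n c x y" "\<exists>c. \<forall>x y. g k (x, y) = bipoly n c x y" if "k \<in> {1..4}" for k
    using assms(3,4)[OF that] by blast+
  obtain c where f1: "\<And>x y. f 1 (x, y) = bipoly n c x y" using ex(1)[of 1] by auto
  obtain c' where f2: "\<And>x y. f 2 (x, y) = bipoly n c' x y" using ex(1)[of 2] by auto
  obtain d where g1: "\<And>x y. g 1 (x, y) = bipoly n d x y" using ex(2)[of 1] by auto
  obtain d' where g2: "\<And>x y. g 2 (x, y) = bipoly n d' x y" using ex(2)[of 2] by auto
  note f = f1 f2 and g = g1 g2
  define F where "F s = half_int \<eta> n c d s + half_int \<eta> n c' d' (- s)" for s
  have "melnikov_space n (half_int \<eta> n c d)" "melnikov_space n (half_int \<eta> n c' d')"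
    using melnikov_space_radial_rate[OF assms(1,2)] unfolding half_int_def [abs_def] by blast+
  from melnikov_space_zeros_le[OF assms(2) this]
  have dich: "zeros_le F {0<..<1} (9 * n - 6) \<or> (\<forall>s\<in>{0<..<1}. F s = 0)" by (simp add: F_def [abs_def])
  obtain h where h: "- 1 / (2 * \<eta>) < h" "h < 0" "melnikov \<eta> f g h \<noteq> 0" using assms(5) by auto
  define s where "s = sqrt (1 + 2 * \<eta> * h)"
  have "0 < 1 + 2 * \<eta> * h" "1 + 2 * \<eta> * h < 1" by (rule level_range[OF assms(1) h(1,2)])+
  then have s: "0 < s" "s < 1" "h = (s\<^sup>2 - 1) / (2 * \<eta>)" using assms(1) by (simp_all add: s_def)
  have "melnikov \<eta> f g h = F s / (\<eta> * sqrt (2 * \<eta>))"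
    unfolding F_def by (rule melnikov_eq_half_int[OF assms(1) s f g assms(6-9)])
  then have "F s \<noteq> 0" using h(3) by auto
  then have zF: "zeros_le F {0<..<1} (9 * n - 6)" using dich s by auto
  show ?thesis
    unfolding bifurcating_limit_cycles_le_def
  proof (intro allI impI)
    fix K :: "real set" assume "compact K \<and> K \<subseteq> {- 1 / (2 * \<eta>)<..<0}"
    then obtain a b where ab: "0 < a" "a \<le> b" "b < 1"
      and sec: "\<And>y. y > \<eta> \<Longrightarrow> H \<eta> (0, y) \<in> K \<Longrightarrow> \<exists>s\<in>{a..b}. y = \<eta> / (1 - s)"
      using compact_levels_ordinates[OF assms(1)] by metis
    interpret annulus \<eta> n c d c' d' a b
      by unfold_locales (use assms(1) ab in auto)
    obtain e where e: "e > 0" "\<And>\<epsilon>. 0 < \<bar>\<epsilon>\<bar> \<Longrightarrow> \<bar>\<epsilon>\<bar> < e \<Longrightarrow> \<bar>\<epsilon>\<bar> < \<epsilon>\<^sub>0 \<and>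
        zeros_le (\<lambda>s. small_perturbation.poincare \<eta> n c d c' d' a b \<epsilon> s - s) {a..b} (9 * n - 6)"
      using poincare_zeros_le[OF zF[unfolded F_def [abs_def]]] by blast
    show "\<exists>\<epsilon>\<^sub>0>0. \<forall>\<epsilon>. 0 < \<bar>\<epsilon>\<bar> \<and> \<bar>\<epsilon>\<bar> < \<epsilon>\<^sub>0 \<longrightarrow>
         (let X = perturbed_field \<eta> f g \<epsilon>;
              \<C> = {C. limit_cycle \<eta> X C \<and> (\<exists>y>\<eta>. (0, y) \<in> C \<and> H \<eta> (0, y) \<in> K)}
          in finite \<C> \<and> (\<Sum>C\<in>\<C>. cycle_multiplicity \<eta> X C) \<le> enat (9 * n - 6))"
    proof (intro exI[of _ e] conjI allI impI e(1))
      fix \<epsilon> :: real assume \<epsilon>: "0 < \<bar>\<epsilon>\<bar> \<and> \<bar>\<epsilon>\<bar> < e"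
      interpret sys: perturbed_system \<eta> n c d c' d' a b \<epsilon> f g
        by unfold_locales (use e(2)[of \<epsilon>] \<epsilon> f g assms(6-9) in auto)
      have "finite {C. limit_cycle \<eta> sys.X C \<and> (\<exists>y>\<eta>. (0, y) \<in> C \<and> H \<eta> (0, y) \<in> K)} \<and>
        (\<Sum>C | limit_cycle \<eta> sys.X C \<and> (\<exists>y>\<eta>. (0, y) \<in> C \<and> H \<eta> (0, y) \<in> K). cycle_multiplicity \<eta> sys.X C) \<le> enat (9 * n - 6)"
        by (rule sys.cycles_le) (use e(2)[of \<epsilon>] \<epsilon> sec in \<open>auto simp: sys.ordinate_def\<close>)
      then show "let X = perturbed_field \<eta> f g \<epsilon>;
              \<C> = {C. limit_cycle \<eta> X C \<and> (\<exists>y>\<eta>. (0, y) \<in> C \<and> H \<eta> (0, y) \<in> K)}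
          in finite \<C> \<and> (\<Sum>C\<in>\<C>. cycle_multiplicity \<eta> X C) \<le> enat (9 * n - 6)"
        by (simp add: Let_def sys.X_def)
    qed
  qed
qed

end
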